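(* Let $M$ be an $A$-line bundle with $c_1=\mathcal{O}_Y(-2,-2)$ and $c_2=2$. Then for any $0\ne\varphi\in\mathrm{Hom}_A(M,A)$ there exists an exact sequence of $A$-modules $$0\longrightarrow M\stackrel{\varphi}{\longrightarrow}A\longrightarrow Q\longrightarrow0$$ where: 1. if $M\simeq A\otimes_Y\mathcal{O}_Y(-1,0)$ (respectively $M\simeq A\otimes_Y\mathcal{O}_Y(0,-1)$) as $A$-modules, then $Q\simeq A\otimes_Y\mathcal{O}_F$, where $F$ is a $(1,0)$-divisor (respectively a $(0,1)$-divisor); 2. if $M\simeq\mathcal{O}_Y(-1,-1)\oplus\mathcal{O}_Y(-1,-1)$ as an $\mathcal{O}_Y$-module, then $Q\simeq\mathcal{O}_C$ as an $\mathcal{O}_Y$-module, where $C$ is a $(1,1)$-divisor.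
   Context: Work over an algebraically closed field $k$ of characteristic $0$. Let $Z=\mathbb{P}^2$ and let $\pi:Y\to Z$ be the double cover ramified on a smooth conic $E\subset Z$, with covering involution $\sigma$. Then $Y\simeq\mathbb{P}^1\times\mathbb{P}^1$, $\mathrm{Pic}\,Y=\mathbb{Z}\oplus\mathbb{Z}$ and $\sigma^*\mathcal{O}_Y(n,m)=\mathcal{O}_Y(m,n)$. Let $E'\subset Z$ be a second smooth conic meeting $E$ in $4$ distinct points, let $D=\pi^*E'$ (a smooth $(2,2)$-divisor), and let $L=\mathcal{O}_Y(-1,-1)$. Let $L_\sigma$ be the $\mathcal{O}_Y$-bimodule which is $L$ as a left module and $\sigma^*L$ as a right module, so $L_\sigma\otimes_Y M\simeq L\otimes_Y\sigma^*M$ for an $\mathcal{O}_Y$-module $M$. Fix an isomorphism of bimodules $\phi:L_\sigma^{\otimes 2}\to\mathcal{O}_Y(-D)\subset\mathcal{O}_Y$; it satisfies $1\otimes\phi=\phi\otimes1$ on $L_\sigma^{\otimes 3}$. Then $A=\mathcal{O}_Y\oplus L_\sigma$ is a sheaf of algebras, with multiplication $L_\sigma\otimes_Y L_\sigma\to\mathcal{O}_Y$ given by $\phi$ and the other products the obvious ones. Viewed on $Z$ via $\pi_*$, $A$ is a maximal order on $Z$ in a division ring $k(A)=A\otimes_Z k(Z)$, ramified on $E\cup E'$. An $A$-module is a left $A$-module; it is in particular an $\mathcal{O}_Y$-module, and its Chern classes are those of this $\mathcal{O}_Y$-module. An $A$-line bundle is a locally projective left $A$-module $M$ with $\dim_{k(A)}k(A)\otimes_A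 M=1$. For an $\mathcal{O}_Y$-module $N$, $A\otimes_Y N$ is a left $A$-module via left multiplication on $A$. An $(a,b)$-divisor is an effective divisor $F$ on $Y$ with $\mathcal{O}_Y(F)\simeq\mathcal{O}_Y(a,b)$. *)

theory Defs
  imports
    "HOL-Analysis.Finite_Cartesian_Product"
    "HOL-Computational_Algebra.Polynomial"
    "HOL-Algebra.Module"
    "HOL-Algebra.AbelCoset"
    "HOL-Algebra.Free_Abelian_Groups"
begin

section \<open>The surface \<open>Y = P1 \<times> P1\<close>\<close>

text \<open>
  \<open>Y\<close> is treated as a classical variety (closed points only); its sheaves are those of the
  corresponding scheme, since both have the same lattice of open sets.  A point is given by a
  pair of nonzero vectors of \<open>k^2\<close>, and a Zariski open subset of \<open>Y\<close> by its preimage in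
  \<open>(k^2 - 0) \<times> (k^2 - 0)\<close>.  The isomorphism of \<open>Y\<close> with \<open>P1 \<times> P1\<close> is chosen such that
  the covering involution \<open>\<sigma>\<close> is the exchange of the two factors.
\<close>

type_synonym 'k pt = "('k^2) \<times> ('k^2)"
type_synonym 'k fn = "'k pt \<Rightarrow> 'k"

definition ycone :: "'k::field pt set" where
  "ycone = {(x, y). x \<noteq> 0 \<and> y \<noteq> 0}"

definition same_pt :: "'k::field pt \<Rightarrow> 'k pt \<Rightarrow> bool" where
  "same_pt v w \<longleftrightarrow> (\<exists>s t. s \<noteq> 0 \<and> t \<noteq> 0 \<and> fst w = s *s fst v \<and> snd w = t *s snd v)"

text \<open>Bihomogeneous polynomials are identified with the functions they define (\<open>k\<close> is infinite).\<close>

definition bihom :: "nat \<Rightarrow> nat \<Rightarrow> 'k::field fn \<Rightarrow> bool" where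
  "bihom m n F \<longleftrightarrow> (\<exists>c :: nat \<Rightarrow> nat \<Rightarrow> 'k. \<forall>x y. F (x, y) =
     (\<Sum>i\<le>m. \<Sum>j\<le>n. c i j * (x$1)^i * (x$2)^(m - i) * (y$1)^j * (y$2)^(n - j)))"

definition zopen :: "'k::field pt set \<Rightarrow> bool" where
  "zopen U \<longleftrightarrow> (\<exists>S. (\<forall>F\<in>S. \<exists>m n. bihom m n F) \<and> U = {v \<in> ycone. \<exists>F\<in>S. F v \<noteq> 0})"

text \<open>\<open>\<sigma>\<close> on points is \<^const>\<open>prod.swap\<close>; on functions it acts by composition.\<close>

abbreviation sig :: "'k::field pt set \<Rightarrow> 'k pt set" where
  "sig U \<equiv> prod.swap ` U"

abbreviation sigf :: "'k::field fn \<Rightarrow> 'k fn" where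
  "sigf f \<equiv> f \<circ> prod.swap"

text \<open>The open sets below are exactly the preimages of the open subsets of \<open>Z\<close> under \<open>\<pi>\<close>.\<close>

definition zopen_stable :: "'k::field pt set \<Rightarrow> bool" where
  "zopen_stable U \<longleftrightarrow> zopen U \<and> sig U = U"

definition rst :: "'k::field pt set \<Rightarrow> 'k fn \<Rightarrow> 'k fn" where
  "rst U f = (\<lambda>v. if v \<in> U then f v else 0)"

text \<open>Sections of \<open>O(a, b)\<close> over \<open>U\<close>: functions on the cone over \<open>U\<close> (extended by \<open>0\<close>) that are
  locally quotients of bihomogeneous polynomials, of bidegree \<open>(a, b)\<close>.\<close>

definition regular :: "int \<Rightarrow> int \<Rightarrow> 'k::field pt set \<Rightarrow> 'k fn set" where
  "regular a b U = {f. (\<forall>v. v \<notin> U \<longrightarrow> f v = 0) \<and>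
     (\<forall>v\<in>U. \<exists>W m n m' n' F G. zopen W \<and> v \<in> W \<and> W \<subseteq> U \<and> bihom m n F \<and> bihom m' n' G \<and>
        int m - int m' = a \<and> int n - int n' = b \<and> (\<forall>w\<in>W. G w \<noteq> 0 \<and> f w = F w / G w))}"

definition oring :: "'k::field pt set \<Rightarrow> 'k fn ring" where
  "oring U = \<lparr>carrier = regular 0 0 U, mult = (\<lambda>f g v. f v * g v), monoid.one = rst U (\<lambda>_. 1),
              ring.zero = (\<lambda>_. 0), ring.add = (\<lambda>f g v. f v + g v)\<rparr>"


section \<open>\<open>O_Y\<close>-modules\<close>

record ('k, 'm) osheaf =
  sec :: "'k pt set \<Rightarrow> ('k fn, 'm) module"
  res :: "'k pt set \<Rightarrow> 'k pt set \<Rightarrow> 'm \<Rightarrow> 'm"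

abbreviation secs :: "('k, 'm, 'z) osheaf_scheme \<Rightarrow> 'k pt set \<Rightarrow> 'm set" where
  "secs M U \<equiv> carrier (sec M U)"

locale O_module =
  fixes M :: "('k::field, 'm, 'z) osheaf_scheme"
  assumes sec_module: "zopen U \<Longrightarrow> module (oring U) (sec M U)"
    and res_closed: "\<lbrakk>zopen U; zopen W; W \<subseteq> U; x \<in> secs M U\<rbrakk> \<Longrightarrow> res M U W x \<in> secs M W"
    and res_add: "\<lbrakk>zopen U; zopen W; W \<subseteq> U; x \<in> secs M U; y \<in> secs M U\<rbrakk> \<Longrightarrow>
       res M U W (x \<oplus>\<^bsub>sec M U\<^esub> y) = res M U W x \<oplus>\<^bsub>sec M W\<^esub> res M U W y"
    and res_smult: "\<lbrakk>zopen U; zopen W; W \<subseteq> U; x \<in> secs M U; f \<in> regular 0 0 U\<rbrakk> \<Longrightarrow>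
       res M U W (f \<odot>\<^bsub>sec M U\<^esub> x) = rst W f \<odot>\<^bsub>sec M W\<^esub> res M U W x"
    and res_id: "\<lbrakk>zopen U; x \<in> secs M U\<rbrakk> \<Longrightarrow> res M U U x = x"
    and res_res: "\<lbrakk>zopen U; zopen W; zopen T; T \<subseteq> W; W \<subseteq> U; x \<in> secs M U\<rbrakk> \<Longrightarrow>
       res M W T (res M U W x) = res M U T x"
    and locality: "\<lbrakk>\<And>W. W \<in> \<W> \<Longrightarrow> zopen W; zopen (\<Union>\<W>); x \<in> secs M (\<Union>\<W>); y \<in> secs M (\<Union>\<W>);
       \<And>W. W \<in> \<W> \<Longrightarrow> res M (\<Union>\<W>) W x = res M (\<Union>\<W>) W y\<rbrakk> \<Longrightarrow> x = y"
    and gluing: "\<lbrakk>\<And>W. W \<in> \<W> \<Longrightarrow> zopen W; zopen (\<Union>\<W>); \<And>W. W \<in> \<W> \<Longrightarrow> s W \<in> secs M W;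
       \<And>W T. \<lbrakk>W \<in> \<W>; T \<in> \<W>\<rbrakk> \<Longrightarrow> res M W (W \<inter> T) (s W) = res M T (W \<inter> T) (s T)\<rbrakk> \<Longrightarrow>
       \<exists>x\<in>secs M (\<Union>\<W>). \<forall>W\<in>\<W>. res M (\<Union>\<W>) W x = s W"

text \<open>Morphisms over the open set \<open>X\<close>, i.e. from \<open>M|X\<close> to \<open>N|X\<close>.\<close>

definition o_hom_on ::
  "'k::field pt set \<Rightarrow> ('k, 'm, 'y) osheaf_scheme \<Rightarrow> ('k, 'n, 'z) osheaf_scheme \<Rightarrow>
   ('k pt set \<Rightarrow> 'm \<Rightarrow> 'n) \<Rightarrow> bool" where
  "o_hom_on X M N F \<longleftrightarrow> (\<forall>U. zopen U \<and> U \<subseteq> X \<longrightarrow>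
     F U \<in> secs M U \<rightarrow> secs N U \<and>
     (\<forall>x\<in>secs M U. \<forall>y\<in>secs M U. F U (x \<oplus>\<^bsub>sec M U\<^esub> y) = F U x \<oplus>\<^bsub>sec N U\<^esub> F U y) \<and>
     (\<forall>f\<in>regular 0 0 U. \<forall>x\<in>secs M U. F U (f \<odot>\<^bsub>sec M U\<^esub> x) = f \<odot>\<^bsub>sec N U\<^esub> F U x) \<and>
     (\<forall>W. zopen W \<and> W \<subseteq> U \<longrightarrow> (\<forall>x\<in>secs M U. F W (res M U W x) = res N U W (F U x))))"

abbreviation "o_hom \<equiv> o_hom_on ycone"

definition bij_on_sections ::
  "('k::field, 'm, 'y) osheaf_scheme \<Rightarrow> ('k, 'n, 'z) osheaf_scheme \<Rightarrow>
   ('k pt set \<Rightarrow> 'm \<Rightarrow> 'n) \<Rightarrow> bool" where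
  "bij_on_sections M N F \<longleftrightarrow> (\<forall>U. zopen U \<longrightarrow> bij_betw (F U) (secs M U) (secs N U))"

definition o_iso (infix \<open>\<cong>\<^sub>O\<close> 50) where
  "M \<cong>\<^sub>O N \<longleftrightarrow> (\<exists>F. o_hom M N F \<and> bij_on_sections M N F)"

definition in_image ::
  "('k::field, 'm, 'y) osheaf_scheme \<Rightarrow> ('k pt set \<Rightarrow> 'm \<Rightarrow> 'n) \<Rightarrow> ('k, 'n, 'z) osheaf_scheme \<Rightarrow>
   'k pt set \<Rightarrow> 'n \<Rightarrow> bool" where
  "in_image M F N U y \<longleftrightarrow>
     (\<forall>v\<in>U. \<exists>W. zopen W \<and> v \<in> W \<and> W \<subseteq> U \<and> res N U W y \<in> F W ` secs M W)"

text \<open>\<open>0 \<rightarrow> M \<rightarrow> N \<rightarrow> Q \<rightarrow> 0\<close> is an exact sequence of sheaves.\<close>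

definition short_exact where
  "short_exact M F N G Q \<longleftrightarrow> o_hom M N F \<and> o_hom N Q G \<and>
     (\<forall>U. zopen U \<longrightarrow> inj_on (F U) (secs M U) \<and>
       (\<forall>y\<in>secs N U. G U y = \<zero>\<^bsub>sec Q U\<^esub> \<longleftrightarrow> in_image M F N U y) \<and>
       (\<forall>z\<in>secs Q U. in_image N G Q U z))"

definition osum ::
  "('k::field, 'm, 'y) osheaf_scheme \<Rightarrow> ('k, 'n, 'z) osheaf_scheme \<Rightarrow> ('k, 'm \<times> 'n) osheaf" where
  "osum M N = \<lparr>
     sec = (\<lambda>U. \<lparr>carrier = secs M U \<times> secs N U, mult = undefined, monoid.one = undefined,
        ring.zero = (\<zero>\<^bsub>sec M U\<^esub>, \<zero>\<^bsub>sec N U\<^esub>),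
        ring.add = (\<lambda>(x, y) (x', y'). (x \<oplus>\<^bsub>sec M U\<^esub> x', y \<oplus>\<^bsub>sec N U\<^esub> y')),
        smult = (\<lambda>f (x, y). (f \<odot>\<^bsub>sec M U\<^esub> x, f \<odot>\<^bsub>sec N U\<^esub> y))\<rparr>),
     res = (\<lambda>U W (x, y). (res M U W x, res N U W y))\<rparr>"

text \<open>The pullback \<open>\<sigma>\<^sup>*M\<close>.\<close>

definition sig_pull :: "('k::field, 'm, 'z) osheaf_scheme \<Rightarrow> ('k, 'm) osheaf" where
  "sig_pull M = \<lparr>
     sec = (\<lambda>U. (sec M (sig U))\<lparr>smult := \<lambda>f m. sigf f \<odot>\<^bsub>sec M (sig U)\<^esub> m\<rparr>),
     res = (\<lambda>U W. res M (sig U) (sig W))\<rparr>"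


subsection \<open>Sheafification\<close>

text \<open>The presheaf of modules \<open>P\<close> is given by the same kind of record; the sections of the
  associated sheaf are the functions from points to germs that are locally induced by \<open>P\<close>.\<close>

definition germ ::
  "('k::field, 'm, 'z) osheaf_scheme \<Rightarrow> 'k pt \<Rightarrow> 'k pt set \<Rightarrow> 'm \<Rightarrow> ('k pt set \<times> 'm) set" where
  "germ P v U x = {(W, y). zopen W \<and> v \<in> W \<and> y \<in> secs P W \<and>
     (\<exists>T. zopen T \<and> v \<in> T \<and> T \<subseteq> U \<inter> W \<and> res P U T x = res P W T y)}"

type_synonym ('k, 'm) shf = "'k pt \<Rightarrow> ('k pt set \<times> 'm) set"

definition to_shf :: "('k::field, 'm, 'z) osheaf_scheme \<Rightarrow> 'k pt set \<Rightarrow> 'm \<Rightarrow> ('k, 'm) shf" where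
  "to_shf P U x = (\<lambda>v. if v \<in> U then germ P v U x else {})"

text \<open>In the operations below all members of the unions are the same germ.\<close>

definition sheafify :: "('k::field, 'm, 'z) osheaf_scheme \<Rightarrow> ('k, ('k, 'm) shf) osheaf" where
  "sheafify P = \<lparr>
     sec = (\<lambda>U. \<lparr>
        carrier = {s. (\<forall>v. v \<notin> U \<longrightarrow> s v = {}) \<and>
          (\<forall>v\<in>U. \<exists>W x. zopen W \<and> v \<in> W \<and> W \<subseteq> U \<and> x \<in> secs P W \<and> (\<forall>w\<in>W. s w = germ P w W x))},
        mult = undefined, monoid.one = undefined,
        ring.zero = to_shf P U \<zero>\<^bsub>sec P U\<^esub>,
        ring.add = (\<lambda>s t v. \<Union>{germ P v W (x \<oplus>\<^bsub>sec P W\<^esub> y) | W x y. (W, x) \<in> s v \<and> (W, y) \<in> t v}),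
        smult = (\<lambda>f s v. \<Union>{germ P v W (rst W f \<odot>\<^bsub>sec P W\<^esub> x) | W x. (W, x) \<in> s v \<and> W \<subseteq> U})\<rparr>),
     res = (\<lambda>U W s v. if v \<in> W then s v else {})\<rparr>"


subsection \<open>Tensor products and quotients\<close>

text \<open>Bilinear relations in the free abelian group on \<open>M \<times> N\<close>.\<close>

definition tensor_rels ::
  "'r ring \<Rightarrow> ('r, 'm) module \<Rightarrow> ('r, 'n) module \<Rightarrow> (('m \<times> 'n) \<Rightarrow>\<^sub>0 int) set" where
  "tensor_rels R M N = generate (free_Abelian_group (carrier M \<times> carrier N))
    ({frag_of (m \<oplus>\<^bsub>M\<^esub> m', n) - frag_of (m, n) - frag_of (m', n) | m m' n.
        m \<in> carrier M \<and> m' \<in> carrier M \<and> n \<in> carrier N} \<union>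
     {frag_of (m, n \<oplus>\<^bsub>N\<^esub> n') - frag_of (m, n) - frag_of (m, n') | m n n'.
        m \<in> carrier M \<and> n \<in> carrier N \<and> n' \<in> carrier N} \<union>
     {frag_of (r \<odot>\<^bsub>M\<^esub> m, n) - frag_of (m, r \<odot>\<^bsub>N\<^esub> n) | r m n.
        r \<in> carrier R \<and> m \<in> carrier M \<and> n \<in> carrier N})"

type_synonym ('m, 'n) tens = "(('m \<times> 'n) \<Rightarrow>\<^sub>0 int) set"

definition tensor_coset ::
  "'r ring \<Rightarrow> ('r, 'm) module \<Rightarrow> ('r, 'n) module \<Rightarrow> (('m \<times> 'n) \<Rightarrow>\<^sub>0 int) \<Rightarrow> ('m, 'n) tens" where
  "tensor_coset R M N a =
     tensor_rels R M N #>\<^bsub>free_Abelian_group (carrier M \<times> carrier N)\<^esub> a"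

definition tensor_module ::
  "'r ring \<Rightarrow> ('r, 'm) module \<Rightarrow> ('r, 'n) module \<Rightarrow> ('r, ('m, 'n) tens) module" where
  "tensor_module R M N =
    (let T = free_Abelian_group (carrier M \<times> carrier N) Mod tensor_rels R M N in
     \<lparr>carrier = carrier T, mult = undefined, monoid.one = undefined,
      ring.zero = one T, ring.add = mult T,
      smult = (\<lambda>r X. \<Union>a\<in>X. tensor_coset R M N (frag_extend (\<lambda>(m, n). frag_of (r \<odot>\<^bsub>M\<^esub> m, n)) a))\<rparr>)"

definition tensor_presheaf ::
  "('k::field, 'm, 'y) osheaf_scheme \<Rightarrow> ('k, 'n, 'z) osheaf_scheme \<Rightarrow> ('k, ('m, 'n) tens) osheaf" where
  "tensor_presheaf M N = \<lparr>
     sec = (\<lambda>U. tensor_module (oring U) (sec M U) (sec N U)),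
     res = (\<lambda>U W X. \<Union>a\<in>X. tensor_coset (oring W) (sec M W) (sec N W)
              (frag_extend (\<lambda>(m, n). frag_of (res M U W m, res N U W n)) a))\<rparr>"

definition otensor where
  "otensor M N = sheafify (tensor_presheaf M N)"

definition pure_tensor where
  "pure_tensor M N U m n =
     to_shf (tensor_presheaf M N) U (tensor_coset (oring U) (sec M U) (sec N U) (frag_of (m, n)))"

definition oquotient ::
  "('k::field, 'm, 'y) osheaf_scheme \<Rightarrow> ('k, 'm, 'z) osheaf_scheme \<Rightarrow> ('k, ('k, 'm set) shf) osheaf" where
  "oquotient M N = sheafify \<lparr>
     sec = (\<lambda>U. \<lparr>carrier = a_rcosets\<^bsub>sec M U\<^esub> (secs N U), mult = undefined, monoid.one = undefined,
        ring.zero = secs N U, ring.add = set_add (sec M U),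
        smult = (\<lambda>f X. \<Union>x\<in>X. secs N U +>\<^bsub>sec M U\<^esub> (f \<odot>\<^bsub>sec M U\<^esub> x))\<rparr>),
     res = (\<lambda>U W X. \<Union>x\<in>X. secs N W +>\<^bsub>sec M W\<^esub> res M U W x)\<rparr>"


subsection \<open>Line bundles, divisors and Chern classes\<close>

definition Osh :: "int \<Rightarrow> int \<Rightarrow> ('k::field, 'k fn) osheaf" where
  "Osh a b = \<lparr>
     sec = (\<lambda>U. \<lparr>carrier = regular a b U, mult = undefined, monoid.one = undefined,
        ring.zero = (\<lambda>_. 0), ring.add = (\<lambda>f g v. f v + g v), smult = (\<lambda>f g v. f v * g v)\<rparr>),
     res = (\<lambda>U W. rst W)\<rparr>"

text \<open>An effective (Cartier) divisor \<open>F\<close> is given by its ideal sheaf \<open>O(-F) \<subseteq> O\<close>.\<close>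

type_synonym 'k divisor = "'k pt set \<Rightarrow> 'k fn set"

definition ideal_sheaf :: "'k::field divisor \<Rightarrow> ('k, 'k fn) osheaf" where
  "ideal_sheaf I = (Osh 0 0)\<lparr>sec := \<lambda>U. (sec (Osh 0 0) U)\<lparr>carrier := I U\<rparr>\<rparr>"

definition effective_divisor :: "'k::field divisor \<Rightarrow> bool" where
  "effective_divisor I \<longleftrightarrow> (\<forall>U. zopen U \<longrightarrow> I U \<subseteq> regular 0 0 U) \<and> O_module (ideal_sheaf I) \<and>
     (\<forall>v\<in>ycone. \<exists>W g. zopen W \<and> v \<in> W \<and> g \<in> regular 0 0 W \<and> g \<noteq> (\<lambda>_. 0) \<and>
        (\<forall>T. zopen T \<and> T \<subseteq> W \<longrightarrow> I T = {\<lambda>v. f v * g v | f. f \<in> regular 0 0 T}))"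

text \<open>\<open>O(F) \<cong> O(a, b)\<close>, stated for the dual \<open>O(-F)\<close>, the ideal sheaf of \<open>F\<close>.\<close>

definition is_divisor :: "int \<Rightarrow> int \<Rightarrow> 'k::field divisor \<Rightarrow> bool" where
  "is_divisor a b I \<longleftrightarrow> effective_divisor I \<and> ideal_sheaf I \<cong>\<^sub>O (Osh (-a) (-b) :: ('k, 'k fn) osheaf)"

definition structure_sheaf :: "'k::field divisor \<Rightarrow> ('k, ('k, 'k fn set) shf) osheaf" where
  "structure_sheaf I = oquotient (Osh 0 0) (ideal_sheaf I)"

text \<open>The divisor of zeros of the form \<open>h\<close> of bidegree \<open>(a, b)\<close>.\<close>

definition zero_divisor :: "int \<Rightarrow> int \<Rightarrow> 'k::field fn \<Rightarrow> 'k divisor" where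
  "zero_divisor a b h U = {\<lambda>v. h v * g v | g. g \<in> regular (-a) (-b) U}"

text \<open>
  Chern classes, with \<open>c_1 = O(a, b)\<close> recorded as \<open>(a, b)\<close> and \<open>c_2\<close> as an integer, by the
  Whitney formula \<open>c(N) = c(N') c(N'')\<close> and \<open>c(O(a, b)) = 1 + (a, b)\<close>; the intersection
  pairing is \<open>(a, b).(a', b') = a b' + a' b\<close>.  As every coherent sheaf on \<open>P1 \<times> P1\<close> has a finite
  resolution by direct sums of sheaves \<open>O(a, b)\<close>, this determines the classes of all coherent
  sheaves.  The sheaves in a derivation have sections in the fixed type \<open>'m\<close>; this is no
  restriction for the classes of a vector bundle of positive rank with sections in \<open>'m\<close>, because
  then \<open>'m\<close> has at least the cardinality of \<open>k\<close>, which bounds that of the set of sections of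
  any coherent sheaf.
\<close>

inductive has_chern :: "('k::field, 'm) osheaf \<Rightarrow> int \<times> int \<Rightarrow> int \<Rightarrow> bool" where
  line_bundle: "\<lbrakk>O_module N; N \<cong>\<^sub>O (Osh a b :: ('k, 'k fn) osheaf)\<rbrakk> \<Longrightarrow> has_chern N (a, b) 0"
| middle: "\<lbrakk>O_module N'; O_module N; O_module N''; short_exact N' F N G N'';
     has_chern N' (a', b') c'; has_chern N'' (a'', b'') c''\<rbrakk> \<Longrightarrow>
     has_chern N (a' + a'', b' + b'') (c' + c'' + (a' * b'' + a'' * b'))"
| left: "\<lbrakk>O_module N'; O_module N; O_module N''; short_exact N' F N G N'';
     has_chern N (a' + a'', b' + b'') (c' + c'' + (a' * b'' + a'' * b'));
     has_chern N'' (a'', b'') c''\<rbrakk> \<Longrightarrow> has_chern N' (a', b') c'"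
| right: "\<lbrakk>O_module N'; O_module N; O_module N''; short_exact N' F N G N'';
     has_chern N (a' + a'', b' + b'') (c' + c'' + (a' * b'' + a'' * b'));
     has_chern N' (a', b') c'\<rbrakk> \<Longrightarrow> has_chern N'' (a'', b'') c''"


section \<open>The double cover\<close>

text \<open>Over a field, \<open>q (z + w) - q z - q w\<close> is the derivative of the quadratic form \<open>q\<close> at \<open>z\<close> in
  direction \<open>w\<close>.\<close>

definition smooth_conic :: "('k::field^3 \<Rightarrow> 'k) \<Rightarrow> bool" where
  "smooth_conic q \<longleftrightarrow>
     (\<exists>a :: 'k^3^3. \<forall>z. q z = (\<Sum>i\<in>UNIV. \<Sum>j\<in>UNIV. a$i$j * z$i * z$j)) \<and>
     (\<forall>z. z \<noteq> 0 \<and> q z = 0 \<longrightarrow> (\<exists>w. q (z + w) - q z - q w \<noteq> 0))"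

definition point_P2 :: "'k::field^3 \<Rightarrow> ('k^3) set" where
  "point_P2 z = {c *s z | c. c \<noteq> 0}"

definition meet_in :: "nat \<Rightarrow> ('k::field^3 \<Rightarrow> 'k) \<Rightarrow> ('k^3 \<Rightarrow> 'k) \<Rightarrow> bool" where
  "meet_in n q q' \<longleftrightarrow> finite (point_P2 ` {z. z \<noteq> 0 \<and> q z = 0 \<and> q' z = 0}) \<and>
     card (point_P2 ` {z. z \<noteq> 0 \<and> q z = 0 \<and> q' z = 0}) = n"

text \<open>\<open>p\<close> represents in homogeneous coordinates a double cover \<open>\<pi>: Y \<rightarrow> Z = P2\<close> with covering
  involution \<open>\<sigma>\<close>, ramified on the conic \<open>q = 0\<close>.  The coordinates of \<open>p\<close> have bidegree \<open>(1, 1)\<close>,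
  i.e. \<open>\<pi>\<^sup>*O_Z(1) = O_Y(1, 1)\<close>.\<close>

definition double_cover :: "('k::field pt \<Rightarrow> 'k^3) \<Rightarrow> ('k^3 \<Rightarrow> 'k) \<Rightarrow> bool" where
  "double_cover p q \<longleftrightarrow> (\<forall>i. bihom 1 1 (\<lambda>v. p v $ i)) \<and> (\<forall>v\<in>ycone. p v \<noteq> 0) \<and>
     (\<forall>z. z \<noteq> 0 \<longrightarrow> (\<exists>v\<in>ycone. point_P2 (p v) = point_P2 z)) \<and>
     (\<forall>v\<in>ycone. \<forall>w\<in>ycone. point_P2 (p v) = point_P2 (p w) \<longleftrightarrow>
        same_pt v w \<or> same_pt (prod.swap v) w) \<and>
     (\<forall>v\<in>ycone. q (p v) = 0 \<longleftrightarrow> same_pt v (prod.swap v))"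


section \<open>The order \<open>A\<close> and its modules\<close>

abbreviation Lbd :: "('k::field, 'k fn) osheaf" where
  "Lbd \<equiv> Osh (-1) (-1)"

abbreviation Lsec :: "'k::field pt set \<Rightarrow> 'k fn set" where
  "Lsec U \<equiv> regular (-1) (-1) U"

text \<open>\<open>L_\<sigma> \<otimes>_Y N = L \<otimes> \<sigma>\<^sup>*N\<close>.\<close>

definition Lsig_tensor where
  "Lsig_tensor N = otensor Lbd (sig_pull N)"

definition Lsig_pure where
  "Lsig_pure N U l n = pure_tensor Lbd (sig_pull N) U l n"

type_synonym ('k, 'n) Lsig = "('k, ('k fn, 'n) tens) shf"
type_synonym 'k phi_map = "'k pt set \<Rightarrow> ('k, 'k fn) Lsig \<Rightarrow> 'k fn"

text \<open>\<open>\<phi>: L_\<sigma> \<otimes> L_\<sigma> \<rightarrow> O_Y(-D)\<close> is an isomorphism of bimodules.  On both sides right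
  multiplication by \<open>g\<close> coincides with left multiplication by \<open>g\<close> (for \<open>L_\<sigma> \<otimes> L_\<sigma>\<close> because
  \<open>\<sigma>\<^sup>2 = 1\<close>), so left linearity suffices.\<close>

definition phi_iso :: "'k::field divisor \<Rightarrow> 'k phi_map \<Rightarrow> bool" where
  "phi_iso D \<phi> \<longleftrightarrow> o_hom (Lsig_tensor Lbd) (ideal_sheaf D) \<phi> \<and>
     bij_on_sections (Lsig_tensor Lbd) (ideal_sheaf D) \<phi>"

text \<open>
  A left \<open>A\<close>-module, \<open>A = O_Y \<oplus> L_\<sigma>\<close>, is an \<open>O_Y\<close>-module \<open>M\<close> with an action of \<open>L_\<sigma>\<close>, that is
  a morphism \<open>L_\<sigma> \<otimes>_Y M = L \<otimes> \<sigma>\<^sup>*M \<rightarrow> M\<close>, given here by the balanced biadditive maps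
  \<open>lact U: L(U) \<times> M(\<sigma> U) \<rightarrow> M(U)\<close>, which is associative with respect to the product \<open>\<phi>\<close>.  Over
  a \<open>\<sigma>\<close>-stable \<open>U\<close>, \<open>M(U)\<close> becomes a left module over \<open>A(U) = O(U) \<oplus> L(U)\<close>.
\<close>

record ('k, 'm) amod = "('k, 'm) osheaf" +
  lact :: "'k pt set \<Rightarrow> 'k fn \<Rightarrow> 'm \<Rightarrow> 'm"

locale A_module = O_module M for M :: "('k::field, 'm) amod" +
  fixes \<phi> :: "'k phi_map"
  assumes lact_closed: "\<lbrakk>zopen U; l \<in> Lsec U; m \<in> secs M (sig U)\<rbrakk> \<Longrightarrow> lact M U l m \<in> secs M U"
    and lact_add_left: "\<lbrakk>zopen U; l \<in> Lsec U; l' \<in> Lsec U; m \<in> secs M (sig U)\<rbrakk> \<Longrightarrow>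
       lact M U (\<lambda>v. l v + l' v) m = lact M U l m \<oplus>\<^bsub>sec M U\<^esub> lact M U l' m"
    and lact_add_right: "\<lbrakk>zopen U; l \<in> Lsec U; m \<in> secs M (sig U); m' \<in> secs M (sig U)\<rbrakk> \<Longrightarrow>
       lact M U l (m \<oplus>\<^bsub>sec M (sig U)\<^esub> m') = lact M U l m \<oplus>\<^bsub>sec M U\<^esub> lact M U l m'"
    and lact_left: "\<lbrakk>zopen U; f \<in> regular 0 0 U; l \<in> Lsec U; m \<in> secs M (sig U)\<rbrakk> \<Longrightarrow>
       lact M U (\<lambda>v. f v * l v) m = f \<odot>\<^bsub>sec M U\<^esub> lact M U l m"
    and lact_balanced: "\<lbrakk>zopen U; f \<in> regular 0 0 (sig U); l \<in> Lsec U; m \<in> secs M (sig U)\<rbrakk> \<Longrightarrow>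
       lact M U l (f \<odot>\<^bsub>sec M (sig U)\<^esub> m) = lact M U (\<lambda>v. sigf f v * l v) m"
    and lact_res: "\<lbrakk>zopen U; zopen W; W \<subseteq> U; l \<in> Lsec U; m \<in> secs M (sig U)\<rbrakk> \<Longrightarrow>
       res M U W (lact M U l m) = lact M W (rst W l) (res M (sig U) (sig W) m)"
    and lact_assoc: "\<lbrakk>zopen U; l \<in> Lsec U; l' \<in> Lsec (sig U); m \<in> secs M U\<rbrakk> \<Longrightarrow>
       lact M U l (lact M (sig U) l' m) = \<phi> U (Lsig_pure Lbd U l l') \<odot>\<^bsub>sec M U\<^esub> m"

text \<open>\<open>A\<close> as a left module over itself.\<close>

definition Aalg :: "'k::field phi_map \<Rightarrow> ('k, 'k fn \<times> 'k fn) amod" where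
  "Aalg \<phi> = osheaf.extend (osum (Osh 0 0) Lbd)
     (amod.fields (\<lambda>U l (f, l'). (\<phi> U (Lsig_pure Lbd U l l'), \<lambda>v. l v * sigf f v)))"

definition a_hom_on ::
  "'k::field pt set \<Rightarrow> ('k, 'm) amod \<Rightarrow> ('k, 'n) amod \<Rightarrow> ('k pt set \<Rightarrow> 'm \<Rightarrow> 'n) \<Rightarrow> bool" where
  "a_hom_on X M N F \<longleftrightarrow> o_hom_on X M N F \<and>
     (\<forall>U. zopen U \<and> U \<subseteq> X \<longrightarrow> (\<forall>l\<in>Lsec U. \<forall>m\<in>secs M (sig U).
        F U (lact M U l m) = lact N U l (F (sig U) m)))"

abbreviation "a_hom \<equiv> a_hom_on ycone"

definition a_iso (infix \<open>\<cong>\<^sub>A\<close> 50) where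
  "M \<cong>\<^sub>A N \<longleftrightarrow> (\<exists>F. a_hom M N F \<and> bij_on_sections M N F)"

text \<open>
  \<open>A \<otimes>_Y N = N \<oplus> (L_\<sigma> \<otimes>_Y N)\<close>, with \<open>L_\<sigma>\<close> acting by
  \<open>l \<cdot> (n, l' \<otimes> n') = (\<phi>(l \<otimes> l') n', l \<otimes> n)\<close>.  For a section \<open>x\<close> of \<open>L_\<sigma> \<otimes>_Y N\<close> over \<open>\<sigma> U\<close>,
  \<open>contract \<phi> N U l x\<close> is the section of \<open>N\<close> over \<open>U\<close> that equals \<open>\<Sum>i. \<phi>(l \<otimes> l_i) n_i\<close>
  wherever \<open>x = \<Sum>i. l_i \<otimes> n_i\<close>.
\<close>

definition contract ::
  "'k::field phi_map \<Rightarrow> ('k, 'n) osheaf \<Rightarrow> 'k pt set \<Rightarrow> 'k fn \<Rightarrow> ('k, 'n) Lsig \<Rightarrow> 'n" where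
  "contract \<phi> N U l x = (THE y. y \<in> secs N U \<and>
     (\<forall>v\<in>U. \<exists>W r ls ns. zopen W \<and> v \<in> W \<and> W \<subseteq> U \<and>
        ls \<in> {..<r::nat} \<rightarrow> Lsec (sig W) \<and> ns \<in> {..<r} \<rightarrow> secs N W \<and>
        res (Lsig_tensor N) (sig U) (sig W) x =
          (\<Oplus>\<^bsub>sec (Lsig_tensor N) (sig W)\<^esub>i\<in>{..<r}. Lsig_pure N (sig W) (ls i) (ns i)) \<and>
        res N U W y =
          (\<Oplus>\<^bsub>sec N W\<^esub>i\<in>{..<r}. \<phi> W (Lsig_pure Lbd W (rst W l) (ls i)) \<odot>\<^bsub>sec N W\<^esub> ns i)))"

definition A_tensor :: "'k::field phi_map \<Rightarrow> ('k, 'n) osheaf \<Rightarrow> ('k, 'n \<times> ('k, 'n) Lsig) amod" where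
  "A_tensor \<phi> N = osheaf.extend (osum N (Lsig_tensor N))
     (amod.fields (\<lambda>U l (n, x). (contract \<phi> N U l x, Lsig_pure N U l n)))"


subsection \<open>Line bundles over \<open>A\<close>\<close>

definition A_power :: "nat \<Rightarrow> ('k::field, 'm) amod \<Rightarrow> ('k, nat \<Rightarrow> 'm) amod" where
  "A_power n M = \<lparr>
     sec = (\<lambda>U. \<lparr>carrier = {..<n} \<rightarrow>\<^sub>E secs M U, mult = undefined, monoid.one = undefined,
        ring.zero = (\<lambda>i\<in>{..<n}. \<zero>\<^bsub>sec M U\<^esub>),
        ring.add = (\<lambda>x y. \<lambda>i\<in>{..<n}. x i \<oplus>\<^bsub>sec M U\<^esub> y i),
        smult = (\<lambda>f x. \<lambda>i\<in>{..<n}. f \<odot>\<^bsub>sec M U\<^esub> x i)\<rparr>),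
     res = (\<lambda>U W x. \<lambda>i\<in>{..<n}. res M U W (x i)),
     lact = (\<lambda>U l x. \<lambda>i\<in>{..<n}. lact M U l (x i))\<rparr>"

text \<open>Locally on \<open>Z\<close>, \<open>M\<close> is a direct summand of a free \<open>A\<close>-module of finite rank.\<close>

definition locally_projective :: "'k::field phi_map \<Rightarrow> ('k, 'm) amod \<Rightarrow> bool" where
  "locally_projective \<phi> M \<longleftrightarrow> (\<forall>v\<in>ycone. \<exists>U n F G. zopen_stable U \<and> v \<in> U \<and>
     a_hom_on U M (A_power n (Aalg \<phi>)) F \<and> a_hom_on U (A_power n (Aalg \<phi>)) M G \<and>
     (\<forall>W. zopen W \<and> W \<subseteq> U \<longrightarrow> (\<forall>x\<in>secs M W. G W (F W x) = x)))"

definition a_act :: "('k, 'm) amod \<Rightarrow> 'k pt set \<Rightarrow> 'k fn \<times> 'k fn \<Rightarrow> 'm \<Rightarrow> 'm" where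
  "a_act M U a m = (fst a \<odot>\<^bsub>sec M U\<^esub> m) \<oplus>\<^bsub>sec M U\<^esub> lact M U (snd a) m"

text \<open>
  \<open>k(A) \<otimes>_A M = k(Z) \<otimes>_Z M\<close> is the stalk of \<open>M\<close> at the generic point of \<open>Z\<close>, the direct limit
  of the \<open>M(W)\<close> over the nonempty \<open>\<sigma>\<close>-stable open sets \<open>W\<close>; in particular \<open>k(A)\<close> is the
  generic stalk of \<open>A\<close>.  The following says that the germ of some section \<open>m\<close> is a basis of this
  left vector space over \<open>k(A)\<close>: every germ is a multiple of it, and it is not annihilated by any
  nonzero germ of \<open>A\<close>.
\<close>

definition generic_dim_one :: "'k::field phi_map \<Rightarrow> ('k, 'm) amod \<Rightarrow> bool" where
  "generic_dim_one \<phi> M \<longleftrightarrow> (\<exists>U m. zopen_stable U \<and> U \<noteq> {} \<and> m \<in> secs M U \<and>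
     (\<forall>W x. zopen_stable W \<and> W \<noteq> {} \<and> x \<in> secs M W \<longrightarrow>
        (\<exists>T a. zopen_stable T \<and> T \<noteq> {} \<and> T \<subseteq> U \<inter> W \<and> a \<in> secs (Aalg \<phi>) T \<and>
           res M W T x = a_act M T a (res M U T m))) \<and>
     (\<forall>T a. zopen_stable T \<and> T \<noteq> {} \<and> T \<subseteq> U \<and> a \<in> secs (Aalg \<phi>) T \<and>
        a_act M T a (res M U T m) = \<zero>\<^bsub>sec M T\<^esub> \<longrightarrow> a = \<zero>\<^bsub>sec (Aalg \<phi>) T\<^esub>))"

definition A_line_bundle :: "'k::field phi_map \<Rightarrow> ('k, 'm) amod \<Rightarrow> bool" where
  "A_line_bundle \<phi> M \<longleftrightarrow> A_module M \<phi> \<and> locally_projective \<phi> M \<and> generic_dim_one \<phi> M"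

end

theory Submission
  imports Defs "HOL-Analysis.Cartesian_Space"
begin

text \<open>
  The surface \<open>Y\<close> is described by its homogeneous coordinates, so a regular function, a form and a
  section of \<open>O(a, b)\<close> are all functions on the cone, and the geometry becomes computation with such
  functions.  The covering involution exchanges the two factors.

  \<^emph>\<open>The multiplication.\<close>  Where \<open>L\<close> is generated by one section, so is \<open>L_\<sigma> \<otimes> L_\<sigma>\<close>.  Hence \<open>\<phi>\<close> has the form
  \<open>l \<otimes> l' \<mapsto> r l \<sigma>(l')\<close>, and because \<open>\<phi>\<close> is onto \<open>O(-D)\<close>, the form \<open>r\<close> is a constant multiple of the
  equation \<open>E' \<circ> p\<close> of \<open>D\<close> (\<open>phi_form\<close>).  The coordinates of \<open>p\<close> are symmetric in the two factors
  (\<open>double_cover_symmetric\<close>), so \<open>r\<close> is symmetric, which is the associativity of \<open>A\<close>.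

  \<^emph>\<open>Injectivity.\<close>  An element \<open>f + l\<close> of \<open>A\<close> with a nonzero right annihilator has norm
  \<open>f \<sigma>(f) - r l \<sigma>(l) = 0\<close>.  On the diagonal \<open>r\<close> restricts to a form of degree \<open>4\<close> that vanishes at the
  four points of \<open>E \<inter> E'\<close>, so it has a zero of odd order (\<open>odd_zero_on_diagonal\<close>), while the lowest
  terms of \<open>f \<sigma>(f)\<close> and \<open>l \<sigma>(l)\<close> transversally to the diagonal are squares up to sign.  Therefore
  \<open>f = l = 0\<close>, and \<open>A\<close> is a domain (\<open>order_is_domain\<close>).  A homomorphism from a line bundle to \<open>A\<close> is
  generically right multiplication by an element of \<open>A\<close>; it is injective if it is nonzero, since
  line bundles are torsion-free (\<open>line_bundle_hom_injective\<close>).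

  \<^emph>\<open>The cokernel.\<close>  The quotient \<open>Q\<close> of \<open>A\<close> by the image inherits the action of \<open>A\<close>, as the action
  preserves the image (\<open>cokernel\<close>).  In order to identify \<open>Q\<close> it suffices to find a surjection from
  \<open>A\<close> to the expected module with the same kernel (\<open>quotients_iso\<close>, \<open>quotients_A_iso\<close>).

  If \<open>M = A \<otimes> O(-1, 0)\<close>, then the homomorphism is determined by its restriction to \<open>O(-1, 0)\<close>, a pair of sections of
  \<open>O(1, 0)\<close> and of \<open>O(0, -1)\<close>.  The latter is zero, and the former is the equation of the divisor \<open>F\<close>
  (\<open>cokernel_of_induced\<close>).  If \<open>M = O(-1, -1)\<^sup>2\<close> as a sheaf of \<open>O_Y\<close>-modules, then the homomorphism is a
  matrix of two forms of bidegree \<open>(1, 1)\<close> and two constants.  The constants do not both vanish,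
  because two forms have a syzygy and the homomorphism is injective; elimination with a nonzero
  constant leaves one form, the equation of \<open>C\<close> (\<open>cokernel_of_split\<close>).
\<close>

section \<open>Bihomogeneous forms and open sets\<close>

lemma bihom_0: "bihom m n (\<lambda>_. 0)"
  unfolding bihom_def by (rule exI[of _ "\<lambda>_ _. 0"]) simp

lemma bihom_cmult: "bihom m n F \<Longrightarrow> bihom m n (\<lambda>v. c * F v)"
  unfolding bihom_def
  by (elim exE, rule_tac x="\<lambda>i j. c * ca i j" in exI) (simp add: sum_distrib_left mult.assoc)

lemma bihom_add: "bihom m n F \<Longrightarrow> bihom m n G \<Longrightarrow> bihom m n (\<lambda>v. F v + G v)"
  unfolding bihom_def
  by (elim exE, rule_tac x="\<lambda>i j. c i j + ca i j" in exI) (simp add: sum.distrib algebra_simps)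

lemma bihom_sum: "(\<And>i. i \<in> I \<Longrightarrow> bihom m n (F i)) \<Longrightarrow> bihom m n (\<lambda>v. \<Sum>i\<in>I. F i v)"
  by (induction I rule: infinite_finite_induct) (auto intro: bihom_0 bihom_add)

lemma bihom_monom:
  assumes "i \<le> m" "j \<le> n"
  shows "bihom m n (\<lambda>(x, y). x$1^i * x$2^(m - i) * y$1^j * y$2^(n - j))"
  unfolding bihom_def
proof (rule exI[of _ "\<lambda>i' j'. if j' = j then (if i' = i then 1 else 0) else 0"], intro allI)
  fix x y :: "'a^2"
  have *: "(if b then (if a then 1 else 0) else 0) * A * B * C * D =
      (if a then (if b then A * B * C * D else 0) else (0::'a))" for a b A B C D by simp
  show "(case (x, y) of (x, y) \<Rightarrow> x$1^i * x$2^(m - i) * y$1^j * y$2^(n - j)) =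
     (\<Sum>i'\<le>m. \<Sum>j'\<le>n. (if j' = j then (if i' = i then 1 else 0) else 0) * x$1^i' * x$2^(m - i') *
        y$1^j' * y$2^(n - j'))"
    using assms unfolding * by (subst sum.mono_neutral_right[of "{..m}" "{i}"]) (auto simp: sum.delta)
qed

lemma bihom_mult:
  assumes "bihom m n F" "bihom m' n' G"
  shows "bihom (m + m') (n + n') (\<lambda>v. F v * G v)"
proof -
  obtain c where c: "\<And>x y. F (x, y) =
     (\<Sum>i\<le>m. \<Sum>j\<le>n. c i j * (x$1)^i * (x$2)^(m - i) * (y$1)^j * (y$2)^(n - j))"
    using assms(1) unfolding bihom_def by blast
  obtain d where d: "\<And>x y. G (x, y) =
     (\<Sum>i\<le>m'. \<Sum>j\<le>n'. d i j * (x$1)^i * (x$2)^(m' - i) * (y$1)^j * (y$2)^(n' - j))"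
    using assms(2) unfolding bihom_def by blast
  let ?H = "\<lambda>v. \<Sum>i\<le>m. \<Sum>j\<le>n. \<Sum>k\<le>m'. \<Sum>l\<le>n'. (c i j * d k l) * (case v of (x, y) \<Rightarrow>
     x$1^(i + k) * x$2^((m + m') - (i + k)) * y$1^(j + l) * y$2^((n + n') - (j + l)))"
  have "F v * G v = ?H v" for v
  proof -
    obtain x y where v: "v = (x, y)" by (cases v)
    show ?thesis
      unfolding v c d prod.case sum_distrib_right
      unfolding sum_distrib_left
    proof (intro sum.cong refl, goal_cases)
      case (1 i j k l)
      then have "(m + m') - (i + k) = (m - i) + (m' - k)" "(n + n') - (j + l) = (n - j) + (n' - l)"
        by auto
      then show ?case by (simp add: power_add mult_ac)
    qed
  qed
  moreover have "bihom (m + m') (n + n') ?H"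
    by (intro bihom_sum bihom_cmult bihom_monom) auto
  ultimately show ?thesis by simp
qed

lemma bihom_swap: "bihom m n F \<Longrightarrow> bihom n m (F \<circ> prod.swap)"
  unfolding bihom_def
proof (elim exE)
  fix c assume "\<forall>x y. F (x, y) =
     (\<Sum>i\<le>m. \<Sum>j\<le>n. c i j * (x$1)^i * (x$2)^(m - i) * (y$1)^j * (y$2)^(n - j))"
  then show "\<exists>c. \<forall>x y. (F \<circ> prod.swap) (x, y) =
     (\<Sum>i\<le>n. \<Sum>j\<le>m. c i j * (x$1)^i * (x$2)^(n - i) * (y$1)^j * (y$2)^(m - j))"
    by (intro exI[of _ "\<lambda>i j. c j i"]) (simp add: sum.swap[of _ "{..n}"] mult_ac)
qed

lemma bihom_const: "bihom 0 0 (\<lambda>_. c)"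
  unfolding bihom_def by (rule exI[of _ "\<lambda>_ _. c"]) simp

lemma bihom_fst: "bihom 1 0 (\<lambda>v. fst v $ i)"
  using bihom_monom[of 1 1 0 0] bihom_monom[of 0 1 0 0] exhaust_2[of i]
  by (auto simp: case_prod_unfold)

lemma bihom_snd: "bihom 0 1 (\<lambda>v. snd v $ i)"
  using bihom_monom[of 0 0 1 1] bihom_monom[of 0 0 0 1] exhaust_2[of i]
  by (auto simp: case_prod_unfold)

lemma bihom_fst_snd: "bihom 1 1 (\<lambda>v. fst v $ i * snd v $ j)"
  using bihom_mult[OF bihom_fst bihom_snd] by simp

lemma bihom_power: "bihom m n F \<Longrightarrow> bihom (k * m) (k * n) (\<lambda>v. F v ^ k)"
  by (induction k) (auto intro: bihom_const bihom_mult)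

text \<open>
  An induction principle for forms: a class of functions of a parameter \<open>t\<close> that contains the
  constants and is closed under sums and products contains \<open>F \<circ> \<gamma>\<close> if it contains the coordinates
  of \<open>\<gamma>\<close>.
\<close>

lemma bihom_closure:
  assumes F: "bihom m n F"
    and const: "\<And>c. S (\<lambda>_. c)"
    and add: "\<And>f g. S f \<Longrightarrow> S g \<Longrightarrow> S (\<lambda>t. f t + g t)"
    and mult: "\<And>f g. S f \<Longrightarrow> S g \<Longrightarrow> S (\<lambda>t. f t * g t)"
    and x: "\<And>i. S (\<lambda>t. fst (\<gamma> t) $ i)" and y: "\<And>i. S (\<lambda>t. snd (\<gamma> t) $ i)"
  shows "S (\<lambda>t. F (\<gamma> t))"
proof -
  obtain c where c: "\<And>x y. F (x, y) =
     (\<Sum>i\<le>m. \<Sum>j\<le>n. c i j * (x$1)^i * (x$2)^(m - i) * (y$1)^j * (y$2)^(n - j))"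
    using F unfolding bihom_def by blast
  have sum: "S (\<lambda>t. \<Sum>i\<in>I. f i t)" if "\<And>i. S (f i)" for I :: "nat set" and f
    by (induction I rule: infinite_finite_induct) (auto intro: const add that)
  have pow: "S (\<lambda>t. f t ^ k)" if "S f" for f k
    by (induction k) (auto intro: const mult that)
  have eq: "F v = (\<Sum>i\<le>m. \<Sum>j\<le>n. c i j * (fst v$1)^i * (fst v$2)^(m - i) * (snd v$1)^j * (snd v$2)^(n - j))" for v
    using c[of "fst v" "snd v"] by simp
  show ?thesis unfolding eq by (intro sum mult pow const x y)
qed

lemma zopen_subset: "zopen U \<Longrightarrow> U \<subseteq> ycone"
  unfolding zopen_def by auto

lemma zopen_ycone: "zopen ycone"
  unfolding zopen_def using bihom_const[of 1] by (intro exI[of _ "{\<lambda>_. 1}"]) auto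

lemma zopen_nonzero: "bihom m n F \<Longrightarrow> zopen {v \<in> ycone. F v \<noteq> 0}"
  unfolding zopen_def by (intro exI[of _ "{F}"]) auto

lemma zopen_Int:
  assumes "zopen U" "zopen W" shows "zopen (U \<inter> W)"
proof -
  obtain S where S: "\<forall>F\<in>S. \<exists>m n. bihom m n F" "U = {v \<in> ycone. \<exists>F\<in>S. F v \<noteq> 0}"
    using assms(1) unfolding zopen_def by blast
  obtain T where T: "\<forall>F\<in>T. \<exists>m n. bihom m n F" "W = {v \<in> ycone. \<exists>F\<in>T. F v \<noteq> 0}"
    using assms(2) unfolding zopen_def by blast
  let ?R = "{\<lambda>v. F v * G v | F G. F \<in> S \<and> G \<in> T}"
  have "\<exists>m n. bihom m n H" if R: "H \<in> ?R" for H
  proof -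
    obtain F G where "F \<in> S" "G \<in> T" and H: "H = (\<lambda>v. F v * G v)"
      using R by auto
    then obtain m n m' n' where "bihom m n F" "bihom m' n' G" using S(1) T(1) by blast
    then show ?thesis unfolding H using bihom_mult by blast
  qed
  moreover have "U \<inter> W = {v \<in> ycone. \<exists>H\<in>?R. H v \<noteq> 0}"
  proof (intro equalityI subsetI)
    fix v assume "v \<in> U \<inter> W"
    then obtain F G where "v \<in> ycone" "F \<in> S" "F v \<noteq> 0" "G \<in> T" "G v \<noteq> 0" unfolding S(2) T(2) by blast
    moreover from this have "(\<lambda>v. F v * G v) \<in> ?R" "F v * G v \<noteq> 0" by auto
    ultimately have "\<exists>H\<in>?R. H v \<noteq> 0" by (intro bexI[of _ "\<lambda>v. F v * G v"])
    then show "v \<in> {v \<in> ycone. \<exists>H\<in>?R. H v \<noteq> 0}" using \<open>v \<in> ycone\<close> by simp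
  next
    fix v assume "v \<in> {v \<in> ycone. \<exists>H\<in>?R. H v \<noteq> 0}"
    then obtain F G where "v \<in> ycone" "F \<in> S" "G \<in> T" "F v * G v \<noteq> 0" by auto
    moreover from this have "F v \<noteq> 0" "G v \<noteq> 0" by auto
    ultimately show "v \<in> U \<inter> W" unfolding S(2) T(2) by blast
  qed
  ultimately show ?thesis unfolding zopen_def by blast
qed

lemma sig_sig [simp]: "sig (sig U) = U"
  by (simp add: image_image)

lemma mem_sig [simp]: "v \<in> sig U \<longleftrightarrow> prod.swap v \<in> U"
  by (metis image_iff swap_swap)

lemma sig_Int: "sig (U \<inter> W) = sig U \<inter> sig W"
  by auto

lemma sig_ycone [simp]: "sig ycone = ycone"
  by (auto simp: ycone_def)

lemma zopen_sig: assumes "zopen U" shows "zopen (sig U)"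
proof -
  obtain S where S: "\<forall>F\<in>S. \<exists>m n. bihom m n F" "U = {v \<in> ycone. \<exists>F\<in>S. F v \<noteq> 0}"
    using assms unfolding zopen_def by blast
  have "sig U = {v \<in> ycone. \<exists>F\<in>(\<lambda>F. F \<circ> prod.swap) ` S. F v \<noteq> 0}"
    unfolding S(2) by (auto simp: ycone_def)
  moreover have "\<forall>F\<in>(\<lambda>F. F \<circ> prod.swap) ` S. \<exists>m n. bihom m n F"
    using S(1) by (auto dest!: bspec intro: bihom_swap)
  ultimately show ?thesis unfolding zopen_def by blast
qed

lemma zopen_sig_iff [simp]: "zopen (sig U) \<longleftrightarrow> zopen U"
  by (metis zopen_sig sig_sig)

definition polyfun :: "('k::comm_ring_1 \<Rightarrow> 'k) \<Rightarrow> bool" where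
  "polyfun f \<longleftrightarrow> (\<exists>p. \<forall>t. f t = poly p t)"

lemma bihom_polyfun:
  assumes "bihom m n F" "\<And>i. polyfun (\<lambda>t. fst (\<gamma> t) $ i)" "\<And>i. polyfun (\<lambda>t. snd (\<gamma> t) $ i)"
  shows "polyfun (\<lambda>t. F (\<gamma> t))"
proof (rule bihom_closure[OF assms(1)])
  show "polyfun (\<lambda>_. c)" for c :: 'a unfolding polyfun_def by (rule exI[of _ "[:c:]"]) simp
  show "polyfun (\<lambda>t. f t + g t)" if "polyfun f" "polyfun g" for f g :: "'a \<Rightarrow> 'a"
    using that unfolding polyfun_def by (metis poly_add)
  show "polyfun (\<lambda>t. f t * g t)" if "polyfun f" "polyfun g" for f g :: "'a \<Rightarrow> 'a"
    using that unfolding polyfun_def by (metis poly_mult)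
qed (use assms in auto)

lemma nonzero_coord: "x \<noteq> 0 \<Longrightarrow> \<exists>i. (x::'k::zero^2) $ i \<noteq> 0"
  by (metis vec_eq_iff zero_index)

lemma ycone_coords:
  assumes "v \<in> ycone" obtains i j where "fst v $ i \<noteq> 0" "snd v $ j \<noteq> 0"
  using assms nonzero_coord[of "fst v"] nonzero_coord[of "snd v"] by (auto simp: ycone_def)

text \<open>
  The surface is irreducible: a parametrised line through a point of each set meets both of them
  in all but finitely many of its points, as the two forms restrict to nonzero polynomials.
\<close>

lemma zopen_dense:
  fixes U W :: "'k::field_char_0 pt set"
  assumes "zopen U" "zopen W" "U \<noteq> {}" "W \<noteq> {}"
  shows "U \<inter> W \<noteq> {}"
proof -
  obtain S where S: "\<forall>F\<in>S. \<exists>m n. bihom m n F" "U = {v \<in> ycone. \<exists>F\<in>S. F v \<noteq> 0}"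
    using assms(1) unfolding zopen_def by blast
  obtain T where T: "\<forall>F\<in>T. \<exists>m n. bihom m n F" "W = {v \<in> ycone. \<exists>F\<in>T. F v \<noteq> 0}"
    using assms(2) unfolding zopen_def by blast
  obtain x y F where F: "(x, y) \<in> ycone" "F \<in> S" "F (x, y) \<noteq> 0" using assms(3) S(2) by auto
  obtain x' y' G where G: "(x', y') \<in> ycone" "G \<in> T" "G (x', y') \<noteq> 0" using assms(4) T(2) by auto
  let ?\<gamma> = "\<lambda>t. (x + t *s (x' - x), y + t *s (y' - y))"
  have lin: "polyfun (\<lambda>t. a + t * b)" for a b :: 'k
    unfolding polyfun_def by (rule exI[of _ "[:a, b:]"]) simp
  obtain i j where ij: "x $ i \<noteq> 0" "y $ j \<noteq> 0"
    using F(1) nonzero_coord unfolding ycone_def by blast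
  obtain p where p: "\<And>t. F (?\<gamma> t) = poly p t"
    using bihom_polyfun[of _ _ F ?\<gamma>] S(1) F(2) lin by (force simp: polyfun_def)
  obtain q where q: "\<And>t. G (?\<gamma> t) = poly q t"
    using bihom_polyfun[of _ _ G ?\<gamma>] T(1) G(2) lin by (force simp: polyfun_def)
  have "p \<noteq> 0" using p[of 0] F(3) by auto
  moreover have "q \<noteq> 0" using q[of 1] G(3) by auto
  \<comment> \<open>The parameters where one of these two polynomials vanishes are excluded, so that the point
      lies in the cone: neither of its two vectors may be zero.\<close>
  moreover have "[:x $ i, x' $ i - x $ i:] \<noteq> 0" "[:y $ j, y' $ j - y $ j:] \<noteq> 0" using ij by auto
  ultimately have "p * q * [:x $ i, x' $ i - x $ i:] * [:y $ j, y' $ j - y $ j:] \<noteq> 0"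
    by (simp only: mult_eq_0_iff) blast
  then obtain t where t: "poly (p * q * [:x $ i, x' $ i - x $ i:] * [:y $ j, y' $ j - y $ j:]) t \<noteq> 0"
    using poly_all_0_iff_0 by blast
  have "poly [:x $ i, x' $ i - x $ i:] t \<noteq> 0" "poly [:y $ j, y' $ j - y $ j:] t \<noteq> 0"
    using t by (simp_all only: poly_mult) auto
  then have "(x + t *s (x' - x)) $ i \<noteq> 0" "(y + t *s (y' - y)) $ j \<noteq> 0" by simp_all
  then have "?\<gamma> t \<in> ycone" unfolding ycone_def by (auto simp: vec_eq_iff)
  moreover have "F (?\<gamma> t) \<noteq> 0" "G (?\<gamma> t) \<noteq> 0" using t unfolding p q by auto
  ultimately have "?\<gamma> t \<in> U \<inter> W" using F(2) G(2) unfolding S(2) T(2) by blast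
  then show ?thesis by blast
qed

section \<open>Regular functions\<close>

text \<open>
  The local condition in the definition of \<open>regular\<close>, isolated because the algebra of fractions of
  forms takes place over a single open set.
\<close>

definition quot_on :: "int \<Rightarrow> int \<Rightarrow> 'k::field pt set \<Rightarrow> 'k fn \<Rightarrow> bool" where
  "quot_on a b W f \<longleftrightarrow> (\<exists>m n m' n' F G. bihom m n F \<and> bihom m' n' G \<and>
     int m - int m' = a \<and> int n - int n' = b \<and> (\<forall>w\<in>W. G w \<noteq> 0 \<and> f w = F w / G w))"

lemma regular_iff: "f \<in> regular a b U \<longleftrightarrow> (\<forall>v. v \<notin> U \<longrightarrow> f v = 0) \<and>
    (\<forall>v\<in>U. \<exists>W. zopen W \<and> v \<in> W \<and> W \<subseteq> U \<and> quot_on a b W f)"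
  unfolding regular_def quot_on_def by blast

lemma regular_outside: "f \<in> regular a b U \<Longrightarrow> v \<notin> U \<Longrightarrow> f v = 0"
  unfolding regular_iff by blast

lemma regularE:
  assumes "f \<in> regular a b U" "v \<in> U"
  obtains W where "zopen W" "v \<in> W" "W \<subseteq> U" "quot_on a b W f"
  using assms by (auto simp: regular_iff)

lemma quot_onI: "\<lbrakk>bihom m n F; bihom m' n' G; int m - int m' = a; int n - int n' = b;
    \<And>w. w \<in> W \<Longrightarrow> G w \<noteq> 0 \<and> f w = F w / G w\<rbrakk> \<Longrightarrow> quot_on a b W f"
  unfolding quot_on_def by blast

lemma quot_on_mono: "quot_on a b W f \<Longrightarrow> T \<subseteq> W \<Longrightarrow> quot_on a b T f"
  unfolding quot_on_def[of a b W] by (auto intro: quot_onI)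

lemma quot_on_cong: "quot_on a b W f \<Longrightarrow> (\<And>w. w \<in> W \<Longrightarrow> g w = f w) \<Longrightarrow> quot_on a b W g"
  unfolding quot_on_def[of a b W f] by (auto intro: quot_onI)

lemma quot_on_bihom: "bihom m n F \<Longrightarrow> quot_on (int m) (int n) W F"
  by (rule quot_onI[OF _ bihom_const[of 1]]) auto

lemma quot_on_mult:
  assumes "quot_on a b W f" "quot_on c d W g" shows "quot_on (a + c) (b + d) W (\<lambda>v. f v * g v)"
proof -
  obtain m n m' n' F G where 1: "bihom m n F" "bihom m' n' G" "int m - int m' = a" "int n - int n' = b"
     "\<And>w. w \<in> W \<Longrightarrow> G w \<noteq> 0 \<and> f w = F w / G w" using assms(1) unfolding quot_on_def by blast
  obtain k l k' l' H K where 2: "bihom k l H" "bihom k' l' K" "int k - int k' = c" "int l - int l' = d"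
     "\<And>w. w \<in> W \<Longrightarrow> K w \<noteq> 0 \<and> g w = H w / K w" using assms(2) unfolding quot_on_def by blast
  show ?thesis
    by (rule quot_onI[OF bihom_mult[OF 1(1) 2(1)] bihom_mult[OF 1(2) 2(2)]])
      (use 1(3-) 2(3-) in auto)
qed

lemma quot_on_add:
  assumes "quot_on a b W f" "quot_on a b W g" shows "quot_on a b W (\<lambda>v. f v + g v)"
proof -
  obtain m n m' n' F G where 1: "bihom m n F" "bihom m' n' G" "int m - int m' = a" "int n - int n' = b"
     "\<And>w. w \<in> W \<Longrightarrow> G w \<noteq> 0 \<and> f w = F w / G w" using assms(1) unfolding quot_on_def by blast
  obtain k l k' l' H K where 2: "bihom k l H" "bihom k' l' K" "int k - int k' = a" "int l - int l' = b"
     "\<And>w. w \<in> W \<Longrightarrow> K w \<noteq> 0 \<and> g w = H w / K w" using assms(2) unfolding quot_on_def by blast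
  have e: "m + k' = m' + k" "n + l' = n' + l" using 1(3,4) 2(3,4) by linarith+
  have "bihom (m + k') (n + l') (\<lambda>v. F v * K v + G v * H v)"
    using bihom_add[OF bihom_mult[OF 1(1) 2(2)]] bihom_mult[OF 1(2) 2(1)] unfolding e by blast
  from quot_onI[OF this bihom_mult[OF 1(2) 2(2)]] show ?thesis
    using 1(3-) 2(3-) by (auto simp: field_simps)
qed

lemma quot_on_inverse:
  assumes "quot_on a b W f" "\<And>w. w \<in> W \<Longrightarrow> f w \<noteq> 0" shows "quot_on (-a) (-b) W (\<lambda>v. inverse (f v))"
proof -
  obtain m n m' n' F G where 1: "bihom m n F" "bihom m' n' G" "int m - int m' = a" "int n - int n' = b"
     "\<And>w. w \<in> W \<Longrightarrow> G w \<noteq> 0 \<and> f w = F w / G w" using assms(1) unfolding quot_on_def by blast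
  from quot_onI[OF 1(2,1)] show ?thesis
    using 1(3-) assms(2) by (auto simp: field_simps)
qed

lemma quot_on_swap: "quot_on a b W f \<Longrightarrow> quot_on b a (sig W) (f \<circ> prod.swap)"
proof -
  assume "quot_on a b W f"
  then obtain m n m' n' F G where 1: "bihom m n F" "bihom m' n' G" "int m - int m' = a" "int n - int n' = b"
     "\<And>w. w \<in> W \<Longrightarrow> G w \<noteq> 0 \<and> f w = F w / G w" unfolding quot_on_def by blast
  show ?thesis
    by (rule quot_onI[OF bihom_swap[OF 1(1)] bihom_swap[OF 1(2)]]) (use 1(3-) in auto)
qed

lemma regular_mult:
  assumes f: "f \<in> regular a b U" and g: "g \<in> regular c d U" and e: "e = a + c" "e' = b + d"
  shows "(\<lambda>v. f v * g v) \<in> regular e e' U"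
  unfolding regular_iff
proof (intro conjI allI impI ballI)
  fix v assume "v \<notin> U" then show "f v * g v = 0" using regular_outside[OF f] by simp
next
  fix v assume v: "v \<in> U"
  obtain W where W: "zopen W" "v \<in> W" "W \<subseteq> U" "quot_on a b W f" using regularE[OF f v] .
  obtain T where T: "zopen T" "v \<in> T" "T \<subseteq> U" "quot_on c d T g" using regularE[OF g v] .
  have "quot_on e e' (W \<inter> T) (\<lambda>v. f v * g v)"
    unfolding e by (rule quot_on_mult[OF quot_on_mono[OF W(4)] quot_on_mono[OF T(4)]]) auto
  then show "\<exists>W. zopen W \<and> v \<in> W \<and> W \<subseteq> U \<and> quot_on e e' W (\<lambda>v. f v * g v)"
    using W T zopen_Int by (intro exI[of _ "W \<inter> T"]) auto
qed

lemma regular_add: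
  assumes f: "f \<in> regular a b U" and g: "g \<in> regular a b U"
  shows "(\<lambda>v. f v + g v) \<in> regular a b U"
  unfolding regular_iff
proof (intro conjI allI impI ballI)
  fix v assume "v \<notin> U" then show "f v + g v = 0" using regular_outside[OF f] regular_outside[OF g] by simp
next
  fix v assume v: "v \<in> U"
  obtain W where W: "zopen W" "v \<in> W" "W \<subseteq> U" "quot_on a b W f" using regularE[OF f v] .
  obtain T where T: "zopen T" "v \<in> T" "T \<subseteq> U" "quot_on a b T g" using regularE[OF g v] .
  have "quot_on a b (W \<inter> T) (\<lambda>v. f v + g v)"
    by (rule quot_on_add[OF quot_on_mono[OF W(4)] quot_on_mono[OF T(4)]]) auto
  then show "\<exists>W. zopen W \<and> v \<in> W \<and> W \<subseteq> U \<and> quot_on a b W (\<lambda>v. f v + g v)"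
    using W T zopen_Int by (intro exI[of _ "W \<inter> T"]) auto
qed

lemma regular_inverse:
  assumes f: "f \<in> regular a b U" and nz: "\<And>v. v \<in> U \<Longrightarrow> f v \<noteq> 0"
  shows "(\<lambda>v. inverse (f v)) \<in> regular (-a) (-b) U"
  unfolding regular_iff
proof (intro conjI allI impI ballI)
  fix v assume "v \<notin> U" then show "inverse (f v) = 0" using regular_outside[OF f] by simp
next
  fix v assume v: "v \<in> U"
  obtain W where W: "zopen W" "v \<in> W" "W \<subseteq> U" "quot_on a b W f" using regularE[OF f v] .
  have "quot_on (-a) (-b) W (\<lambda>v. inverse (f v))"
    by (rule quot_on_inverse[OF W(4)]) (use nz W(3) in blast)
  then show "\<exists>W. zopen W \<and> v \<in> W \<and> W \<subseteq> U \<and> quot_on (-a) (-b) W (\<lambda>v. inverse (f v))"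
    using W by blast
qed

lemma regular_swap: 
  assumes f: "f \<in> regular a b U" shows "f \<circ> prod.swap \<in> regular b a (sig U)"
  unfolding regular_iff
proof (intro conjI allI impI ballI)
  fix v assume "v \<notin> sig U" then show "(f \<circ> prod.swap) v = 0" using regular_outside[OF f] by simp
next
  fix v assume "v \<in> sig U"
  then have v: "prod.swap v \<in> U" by simp
  obtain W where W: "zopen W" "prod.swap v \<in> W" "W \<subseteq> U" "quot_on a b W f" using regularE[OF f v] .
  then have "zopen (sig W)" "v \<in> sig W" "sig W \<subseteq> sig U" "quot_on b a (sig W) (f \<circ> prod.swap)"
    by (auto intro: zopen_sig quot_on_swap simp del: zopen_sig_iff)
  then show "\<exists>W. zopen W \<and> v \<in> W \<and> W \<subseteq> sig U \<and> quot_on b a W (f \<circ> prod.swap)" by blast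
qed

lemma regular_rst:
  assumes f: "f \<in> regular a b U" and W: "zopen W" "W \<subseteq> U" shows "rst W f \<in> regular a b W"
  unfolding regular_iff
proof (intro conjI allI impI ballI)
  fix v assume "v \<in> W"
  then obtain T where T: "zopen T" "v \<in> T" "T \<subseteq> U" "quot_on a b T f" using regularE[OF f] W(2) by blast
  have "quot_on a b (T \<inter> W) f" by (rule quot_on_mono[OF T(4)]) blast
  then have "quot_on a b (T \<inter> W) (rst W f)" by (rule quot_on_cong) (auto simp: rst_def)
  then show "\<exists>T. zopen T \<and> v \<in> T \<and> T \<subseteq> W \<and> quot_on a b T (rst W f)"
    using T W \<open>v \<in> W\<close> by (intro exI[of _ "T \<inter> W"]) (auto intro: zopen_Int)
qed (simp add: rst_def)

lemma regular_bihom: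
  assumes "bihom m n F" "zopen U" "a = int m" "b = int n" shows "rst U F \<in> regular a b U"
  unfolding regular_iff assms(3,4)
  using assms(2) quot_on_cong[OF quot_on_bihom[OF assms(1)]] by (auto simp: rst_def)

lemma regular_0: "zopen U \<Longrightarrow> (\<lambda>_. 0) \<in> regular a b U"
proof (unfold regular_iff, intro conjI ballI allI impI)
  fix v assume U: "zopen U" "v \<in> U"
  have "quot_on a b W (\<lambda>_. 0)" if "W = {w \<in> U. fst w $ i \<noteq> 0 \<and> snd w $ j \<noteq> 0}" for W :: "'a pt set" and i j
  proof (rule quot_onI)
    show "bihom (nat a) (nat b) (\<lambda>_. 0 :: 'a)" by (rule bihom_0)
    \<comment> \<open>\<open>0 = 0 / G\<close> needs a denominator of the right bidegree, which a monomial in nonvanishing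
        coordinates provides, even for negative \<open>a\<close> or \<open>b\<close>.\<close>
    show "bihom (nat (-a) * 1 + nat (-b) * 0) (nat (-a) * 0 + nat (-b) * 1) (\<lambda>v. (fst v $ i :: 'a) ^ nat (-a) * snd v $ j ^ nat (-b))"
      by (intro bihom_mult bihom_power bihom_fst bihom_snd)
    show "int (nat a) - int (nat (-a) * 1 + nat (-b) * 0) = a" "int (nat b) - int (nat (-a) * 0 + nat (-b) * 1) = b"
      by simp_all
  qed (use that in auto)
  then have q: "quot_on a b {w \<in> U. fst w $ i \<noteq> 0 \<and> snd w $ j \<noteq> 0} (\<lambda>_. 0)" for i j by blast
  obtain i j where ij: "fst v $ i \<noteq> 0" "snd v $ j \<noteq> 0"
    using U zopen_subset[OF U(1)] ycone_coords by blast
  let ?W = "{w \<in> U. fst w $ i \<noteq> 0 \<and> snd w $ j \<noteq> 0}"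
  have "?W = U \<inter> {w \<in> ycone. fst w $ i * snd w $ j \<noteq> 0}"
    using zopen_subset[OF U(1)] by auto
  then have "zopen ?W" using zopen_Int[OF U(1) zopen_nonzero[OF bihom_fst_snd]] by (simp only:)
  moreover have "v \<in> ?W" "?W \<subseteq> U" using ij U(2) by auto
  ultimately show "\<exists>W. zopen W \<and> v \<in> W \<and> W \<subseteq> U \<and> quot_on a b W (\<lambda>_. 0)"
    using q[of i j] by blast
qed simp

lemma regular_const: "zopen U \<Longrightarrow> rst U (\<lambda>_. c) \<in> regular 0 0 U"
  by (rule regular_bihom[OF bihom_const]) auto

lemma regular_cmult:
  assumes f: "f \<in> regular a b U" and U: "zopen U" shows "(\<lambda>v. c * f v) \<in> regular a b U"
proof -
  have "(\<lambda>v. rst U (\<lambda>_. c) v * f v) \<in> regular a b U"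
    by (rule regular_mult[OF regular_const[OF U] f]) auto
  moreover have "(\<lambda>v. rst U (\<lambda>_. c) v * f v) = (\<lambda>v. c * f v)"
    using regular_outside[OF f] by (auto simp: rst_def fun_eq_iff)
  ultimately show ?thesis by simp
qed

lemma regular_uminus: "f \<in> regular a b U \<Longrightarrow> zopen U \<Longrightarrow> (\<lambda>v. - f v) \<in> regular a b U"
  using regular_cmult[of f a b U "-1"] by simp

lemma regular_diff: "f \<in> regular a b U \<Longrightarrow> g \<in> regular a b U \<Longrightarrow> zopen U \<Longrightarrow> (\<lambda>v. f v - g v) \<in> regular a b U"
  using regular_add[OF _ regular_uminus, of f a b U g] by simp

lemma regular_locally:
  assumes "\<And>v. v \<notin> U \<Longrightarrow> f v = 0"
    and "\<And>v. v \<in> U \<Longrightarrow> \<exists>W. zopen W \<and> v \<in> W \<and> W \<subseteq> U \<and> rst W f \<in> regular a b W"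
  shows "f \<in> regular a b U"
  unfolding regular_iff
proof (intro conjI allI impI ballI assms(1))
  fix v assume "v \<in> U"
  then obtain W where W: "zopen W" "v \<in> W" "W \<subseteq> U" "rst W f \<in> regular a b W" using assms(2) by blast
  obtain T where T: "zopen T" "v \<in> T" "T \<subseteq> W" "quot_on a b T (rst W f)" using regularE[OF W(4,2)] .
  have "quot_on a b T f"
    by (rule quot_on_cong[OF T(4)]) (use T(3) in \<open>auto simp: rst_def\<close>)
  then show "\<exists>W. zopen W \<and> v \<in> W \<and> W \<subseteq> U \<and> quot_on a b W f" using T W by blast
qed

lemma rst_self: "f \<in> regular a b U \<Longrightarrow> rst U f = f"
  using regular_outside by (auto simp: rst_def fun_eq_iff)

lemma rst_rst [simp]: "W \<subseteq> U \<Longrightarrow> rst W (rst U f) = rst W f"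
  by (auto simp: rst_def fun_eq_iff)

text \<open>
  Every \<open>O(a, b)\<close> is locally free of rank one: where a coordinate of each factor does not vanish,
  a monomial in these two is a generator \<open>e\<close>.
\<close>

lemma local_unit:
  assumes U: "zopen U" "v \<in> U"
  obtains W e where "zopen W" "v \<in> W" "W \<subseteq> U" "e \<in> regular a b W" "\<And>w. w \<in> W \<Longrightarrow> e w \<noteq> 0"
proof -
  obtain i j where ij: "fst v $ i \<noteq> 0" "snd v $ j \<noteq> 0"
    using U zopen_subset[OF U(1)] ycone_coords by blast
  define W where "W = U \<inter> {w \<in> ycone. fst w $ i * snd w $ j \<noteq> 0}"
  have W: "zopen W" unfolding W_def by (intro zopen_Int U zopen_nonzero[OF bihom_fst_snd])
  have unit: "\<exists>e\<in>regular (int m) (int n) W. \<forall>w\<in>W. e w \<noteq> 0" for m n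
  proof (intro bexI ballI)
    let ?e = "\<lambda>v. fst v $ i ^ m * snd v $ j ^ n"
    have "bihom (m * 1 + n * 0) (m * 0 + n * 1) ?e"
      by (intro bihom_mult bihom_power bihom_fst bihom_snd)
    then show "rst W ?e \<in> regular (int m) (int n) W"
      using W by (intro regular_bihom[of m n]) auto
    show "rst W ?e w \<noteq> 0" if "w \<in> W" for w using that by (auto simp: rst_def W_def)
  qed
  obtain e1 where e1: "e1 \<in> regular (int (nat a)) (int (nat b)) W" "\<forall>w\<in>W. e1 w \<noteq> 0" using unit by blast
  obtain e2 where e2: "e2 \<in> regular (int (nat (-a))) (int (nat (-b))) W" "\<forall>w\<in>W. e2 w \<noteq> 0" using unit by blast
  have "(\<lambda>v. e1 v * inverse (e2 v)) \<in> regular a b W"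
    by (rule regular_mult[OF e1(1) regular_inverse[OF e2(1)]]) (use e2 in auto)
  with W U e1(2) e2(2) ij show ?thesis
    using zopen_subset[OF U(1)]
    by (intro that[of W "\<lambda>v. e1 v * inverse (e2 v)"]) (auto simp: W_def)
qed

lemma regular_nonzero_open:
  fixes f :: "'k::field_char_0 fn"
  assumes f: "f \<in> regular a b U" and U: "zopen U" and nz: "f v \<noteq> 0"
  obtains W where "zopen W" "v \<in> W" "W \<subseteq> U" "\<And>w. w \<in> W \<Longrightarrow> f w \<noteq> 0" "quot_on a b W f"
proof -
  have v: "v \<in> U" using regular_outside[OF f] nz by blast
  obtain W where W: "zopen W" "v \<in> W" "W \<subseteq> U" "quot_on a b W f" using regularE[OF f v] .
  then obtain m n m' n' F G where FG: "bihom m n F" "bihom m' n' G"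
     "\<And>w. w \<in> W \<Longrightarrow> G w \<noteq> 0 \<and> f w = F w / G w" unfolding quot_on_def by blast
  let ?T = "W \<inter> {w \<in> ycone. F w \<noteq> 0}"
  have "quot_on a b ?T f" by (rule quot_on_mono[OF W(4)]) blast
  moreover have "zopen ?T" by (intro zopen_Int W zopen_nonzero[OF FG(1)])
  moreover have "F v \<noteq> 0" using FG(3)[OF W(2)] nz by auto
  ultimately show ?thesis
    using that[of ?T] FG(3) W v zopen_subset[OF U] by auto
qed

text \<open>
  The identity principle: the set where \<open>f\<close> does not vanish is open, so it would meet \<open>W\<close> if it
  were not empty.
\<close>

lemma regular_density:
  fixes f :: "'k::field_char_0 fn"
  assumes "f \<in> regular a b U" "zopen U" "zopen W" "W \<noteq> {}" "\<And>w. w \<in> W \<Longrightarrow> f w = 0"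
  shows "f v = 0"
proof (rule ccontr)
  assume nz: "f v \<noteq> 0"
  obtain T where T: "zopen T" "v \<in> T" "T \<subseteq> U" "\<And>w. w \<in> T \<Longrightarrow> f w \<noteq> 0"
    using regular_nonzero_open[OF assms(1,2) nz] by metis
  then have "T \<inter> W \<noteq> {}" using zopen_dense assms by blast
  then show False using T(4) assms(5) by blast
qed

declare split_paired_All [simp del] split_paired_Ex [simp del]

section \<open>Sheaves of modules\<close>

lemma oring_simps [simp]:
  "carrier (oring U) = regular 0 0 U" "f \<otimes>\<^bsub>oring U\<^esub> g = (\<lambda>v. f v * g v)"
  "\<one>\<^bsub>oring U\<^esub> = rst U (\<lambda>_. 1)" "\<zero>\<^bsub>oring U\<^esub> = (\<lambda>_. 0)" "f \<oplus>\<^bsub>oring U\<^esub> g = (\<lambda>v. f v + g v)"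
  by (simp_all add: oring_def)

lemma Osh_simps [simp]:
  "secs (Osh a b) U = regular a b U" "\<zero>\<^bsub>sec (Osh a b) U\<^esub> = (\<lambda>_. 0)"
  "f \<oplus>\<^bsub>sec (Osh a b) U\<^esub> g = (\<lambda>v. f v + g v)" "f \<odot>\<^bsub>sec (Osh a b) U\<^esub> g = (\<lambda>v. f v * g v)"
  "res (Osh a b) U W = rst W"
  by (simp_all add: Osh_def)

lemma rst_one_mult: "f \<in> regular a b U \<Longrightarrow> (\<lambda>v. rst U (\<lambda>_. 1) v * f v) = f"
  using regular_outside[of f a b U] by (auto simp: rst_def fun_eq_iff)

lemma rst_add: "rst W (\<lambda>v. f v + g v) = (\<lambda>v. rst W f v + rst W g v)"
  by (auto simp: rst_def)

lemma rst_mult: "rst W (\<lambda>v. f v * g v) = (\<lambda>v. rst W f v * rst W g v)"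
  by (auto simp: rst_def)

lemma mult_rst_one: "f \<in> regular a b U \<Longrightarrow> (\<lambda>v. f v * rst U (\<lambda>_. 1) v) = f"
  using rst_one_mult[of f a b U] by (simp add: mult.commute)

lemma oring_cring: "zopen U \<Longrightarrow> cring (oring U)"
proof (rule cringI)
  assume U: "zopen U"
  show "abelian_group (oring U)"
  proof (rule abelian_groupI)
    show "\<exists>y\<in>carrier (oring U). y \<oplus>\<^bsub>oring U\<^esub> x = \<zero>\<^bsub>oring U\<^esub>" if "x \<in> carrier (oring U)" for x
      using regular_uminus[of x 0 0 U] that U by (intro bexI[of _ "\<lambda>v. - x v"]) auto
  qed (use U in \<open>auto intro: regular_add regular_0 simp: algebra_simps\<close>)
  show "Group.comm_monoid (oring U)"
    by (rule Group.comm_monoidI)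
      (use U in \<open>auto intro: regular_mult regular_const rst_one_mult mult_rst_one simp: mult_ac\<close>)
qed (auto simp: algebra_simps)

lemma Osh_module: "zopen U \<Longrightarrow> module (oring U) (sec (Osh a b) U)"
proof (rule moduleI)
  assume U: "zopen U"
  then show "cring (oring U)" by (rule oring_cring)
  show "abelian_group (sec (Osh a b) U)"
  proof (rule abelian_groupI)
    show "\<exists>y\<in>secs (Osh a b) U. y \<oplus>\<^bsub>sec (Osh a b) U\<^esub> x = \<zero>\<^bsub>sec (Osh a b) U\<^esub>" if "x \<in> secs (Osh a b) U" for x
      using regular_uminus[of x a b U] that U by (intro bexI[of _ "\<lambda>v. - x v"]) auto
  qed (use U in \<open>auto intro: regular_add regular_0 simp: algebra_simps\<close>)
qed (auto intro: regular_mult rst_one_mult mult_rst_one simp: algebra_simps)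

text \<open>
  The axioms of a sheaf of modules without locality and gluing; they hold for the presheaf tensor
  products and quotients that are sheafified below.
\<close>

locale presheaf =
  fixes P :: "('k::field, 'm, 'z) osheaf_scheme"
  assumes sec_module: "zopen U \<Longrightarrow> module (oring U) (sec P U)"
    and res_closed: "\<lbrakk>zopen U; zopen W; W \<subseteq> U; x \<in> secs P U\<rbrakk> \<Longrightarrow> res P U W x \<in> secs P W"
    and res_add: "\<lbrakk>zopen U; zopen W; W \<subseteq> U; x \<in> secs P U; y \<in> secs P U\<rbrakk> \<Longrightarrow>
       res P U W (x \<oplus>\<^bsub>sec P U\<^esub> y) = res P U W x \<oplus>\<^bsub>sec P W\<^esub> res P U W y"
    and res_smult: "\<lbrakk>zopen U; zopen W; W \<subseteq> U; x \<in> secs P U; f \<in> regular 0 0 U\<rbrakk> \<Longrightarrow>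
       res P U W (f \<odot>\<^bsub>sec P U\<^esub> x) = rst W f \<odot>\<^bsub>sec P W\<^esub> res P U W x"
    and res_id: "\<lbrakk>zopen U; x \<in> secs P U\<rbrakk> \<Longrightarrow> res P U U x = x"
    and res_res: "\<lbrakk>zopen U; zopen W; zopen T; T \<subseteq> W; W \<subseteq> U; x \<in> secs P U\<rbrakk> \<Longrightarrow>
       res P W T (res P U W x) = res P U T x"
begin

lemma ab: "zopen U \<Longrightarrow> abelian_group (sec P U)"
  using sec_module module_def by blast

lemma add_closed: "\<lbrakk>zopen U; x \<in> secs P U; y \<in> secs P U\<rbrakk> \<Longrightarrow> x \<oplus>\<^bsub>sec P U\<^esub> y \<in> secs P U"
  by (rule abelian_monoid.a_closed[OF abelian_group.axioms(1)[OF ab]])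

lemma zero_closed: "zopen U \<Longrightarrow> \<zero>\<^bsub>sec P U\<^esub> \<in> secs P U"
  by (rule abelian_monoid.zero_closed[OF abelian_group.axioms(1)[OF ab]])

lemma smult_closed: "\<lbrakk>zopen U; f \<in> regular 0 0 U; x \<in> secs P U\<rbrakk> \<Longrightarrow> f \<odot>\<^bsub>sec P U\<^esub> x \<in> secs P U"
  using module.smult_closed[OF sec_module] by simp

lemma minus_closed: "\<lbrakk>zopen U; x \<in> secs P U\<rbrakk> \<Longrightarrow> \<ominus>\<^bsub>sec P U\<^esub> x \<in> secs P U"
  using abelian_group.a_inv_closed[OF ab] by blast

lemma res_zero:
  assumes "zopen U" "zopen W" "W \<subseteq> U" shows "res P U W \<zero>\<^bsub>sec P U\<^esub> = \<zero>\<^bsub>sec P W\<^esub>"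
proof -
  have z: "\<zero>\<^bsub>sec P U\<^esub> \<in> secs P U" using assms zero_closed by blast
  have "res P U W \<zero>\<^bsub>sec P U\<^esub> = res P U W ((\<lambda>_. 0) \<odot>\<^bsub>sec P U\<^esub> \<zero>\<^bsub>sec P U\<^esub>)"
    using module.smult_r_null[OF sec_module] assms(1) regular_0 by (metis oring_simps(1))
  also have "\<dots> = (\<lambda>_. 0) \<odot>\<^bsub>sec P W\<^esub> res P U W \<zero>\<^bsub>sec P U\<^esub>"
    using res_smult[OF assms z regular_0[OF assms(1)]] by (simp add: rst_def)
  also have "\<dots> = \<zero>\<^bsub>sec P W\<^esub>"
    using module.smult_l_null[OF sec_module[OF assms(2)] res_closed[OF assms z]] by simp
  finally show ?thesis .
qed

lemma res_minus:
  assumes "zopen U" "zopen W" "W \<subseteq> U" "x \<in> secs P U"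
  shows "res P U W (\<ominus>\<^bsub>sec P U\<^esub> x) = \<ominus>\<^bsub>sec P W\<^esub> res P U W x"
proof -
  have m: "\<ominus>\<^bsub>sec P U\<^esub> x \<in> secs P U" using assms minus_closed by blast
  have "res P U W (\<ominus>\<^bsub>sec P U\<^esub> x) \<oplus>\<^bsub>sec P W\<^esub> res P U W x = \<zero>\<^bsub>sec P W\<^esub>"
    using res_add[OF assms(1-3) m assms(4)] abelian_group.l_neg[OF ab assms(4)] res_zero[OF assms(1-3)] assms(1)
    by simp
  then show ?thesis
    using abelian_group.minus_equality[OF ab] res_closed[OF assms(1-3)] assms m by metis
qed

lemma res_diff:
  assumes "zopen U" "zopen W" "W \<subseteq> U" "x \<in> secs P U" "y \<in> secs P U"
  shows "res P U W (x \<ominus>\<^bsub>sec P U\<^esub> y) = res P U W x \<ominus>\<^bsub>sec P W\<^esub> res P U W y"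
  unfolding a_minus_def using res_add res_minus minus_closed assms by metis

lemma diff_closed: "\<lbrakk>zopen U; x \<in> secs P U; y \<in> secs P U\<rbrakk> \<Longrightarrow> x \<ominus>\<^bsub>sec P U\<^esub> y \<in> secs P U"
  using abelian_group.minus_closed[OF ab] by blast

lemma diff_zero_iff:
  assumes "zopen U" "x \<in> secs P U" "y \<in> secs P U"
  shows "x \<ominus>\<^bsub>sec P U\<^esub> y = \<zero>\<^bsub>sec P U\<^esub> \<longleftrightarrow> x = y"
proof -
  interpret A: abelian_group "sec P U" using ab[OF assms(1)] .
  show ?thesis
    using assms A.r_neg A.minus_equality A.minus_minus unfolding a_minus_def by (metis A.a_inv_closed)
qed

lemma neg_one_smult:
  assumes "zopen U" "x \<in> secs P U"
  shows "rst U (\<lambda>_. -1) \<odot>\<^bsub>sec P U\<^esub> x \<oplus>\<^bsub>sec P U\<^esub> x = \<zero>\<^bsub>sec P U\<^esub>"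
proof -
  interpret M: module "oring U" "sec P U" using sec_module[OF assms(1)] .
  have "rst U (\<lambda>_. -1) \<odot>\<^bsub>sec P U\<^esub> x \<oplus>\<^bsub>sec P U\<^esub> rst U (\<lambda>_. 1) \<odot>\<^bsub>sec P U\<^esub> x =
      (\<lambda>v. rst U (\<lambda>_. -1) v + rst U (\<lambda>_. 1) v) \<odot>\<^bsub>sec P U\<^esub> x"
    using M.smult_l_distr[of "rst U (\<lambda>_. -1)" "rst U (\<lambda>_. 1)" x] assms regular_const[OF assms(1)] by simp
  also have "(\<lambda>v. rst U (\<lambda>_. -1) v + rst U (\<lambda>_. 1) v) = (\<lambda>_. 0)" by (auto simp: rst_def)
  finally show ?thesis using M.smult_one[OF assms(2)] M.smult_l_null[OF assms(2)] by simp
qed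

end

lemma (in O_module) presheaf: "presheaf M"
  by (rule presheaf.intro) (fact sec_module res_closed res_add res_smult res_id res_res)+

context O_module
begin
sublocale pre: presheaf M
  using presheaf .
end

lemma O_module_Osh: "O_module (Osh a b)"
proof (rule O_module.intro)
  show "module (oring U) (sec (Osh a b) U)" if "zopen U" for U :: "'a pt set"
    using that by (rule Osh_module)
next
  fix \<W> :: "'a pt set set" and x y
  assume "zopen (\<Union>\<W>)" "x \<in> secs (Osh a b) (\<Union>\<W>)" "y \<in> secs (Osh a b) (\<Union>\<W>)"
    and *: "\<And>W. W \<in> \<W> \<Longrightarrow> res (Osh a b) (\<Union>\<W>) W x = res (Osh a b) (\<Union>\<W>) W y"
  then have xy: "x \<in> regular a b (\<Union>\<W>)" "y \<in> regular a b (\<Union>\<W>)" by auto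
  show "x = y"
  proof
    fix v show "x v = y v"
    proof (cases "v \<in> \<Union>\<W>")
      case True
      then obtain W where "W \<in> \<W>" "v \<in> W" by blast
      then show ?thesis using fun_cong[OF *[of W], of v] by (simp add: rst_def)
    qed (use xy regular_outside in metis)
  qed
next
  fix \<W> :: "'a pt set set" and s
  assume W: "\<And>W. W \<in> \<W> \<Longrightarrow> zopen W" and U: "zopen (\<Union>\<W>)"
    and s: "\<And>W. W \<in> \<W> \<Longrightarrow> s W \<in> secs (Osh a b) W"
    and c: "\<And>W T. \<lbrakk>W \<in> \<W>; T \<in> \<W>\<rbrakk> \<Longrightarrow> res (Osh a b) W (W \<inter> T) (s W) = res (Osh a b) T (W \<inter> T) (s T)"
  define x where "x v = (if v \<in> \<Union>\<W> then s (SOME W. W \<in> \<W> \<and> v \<in> W) v else 0)" for v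
  have x: "x v = s W v" if "W \<in> \<W>" "v \<in> W" for v W
  proof -
    let ?T = "SOME W. W \<in> \<W> \<and> v \<in> W"
    have T: "?T \<in> \<W>" "v \<in> ?T" using someI[of "\<lambda>W. W \<in> \<W> \<and> v \<in> W" W] that by auto
    show ?thesis using that T fun_cong[OF c[OF that(1) T(1)], of v] by (auto simp: x_def rst_def)
  qed
  have r: "rst W x = s W" if "W \<in> \<W>" for W
    using x[OF that] s[OF that] regular_outside[of "s W" a b W] by (auto simp: rst_def fun_eq_iff)
  show "\<exists>x\<in>secs (Osh a b) (\<Union>\<W>). \<forall>W\<in>\<W>. res (Osh a b) (\<Union>\<W>) W x = s W"
  proof (intro bexI ballI)
    show "x \<in> secs (Osh a b) (\<Union>\<W>)" unfolding Osh_simps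
    proof (rule regular_locally)
      fix v assume "v \<in> \<Union>\<W>"
      then obtain T where T: "T \<in> \<W>" "v \<in> T" by blast
      then show "\<exists>W. zopen W \<and> v \<in> W \<and> W \<subseteq> \<Union>\<W> \<and> rst W x \<in> regular a b W"
        using W s r by (intro exI[of _ T]) auto
    qed (auto simp: x_def)
  qed (simp add: r)
qed (auto simp: rst_add rst_mult rst_self intro: regular_rst)

context O_module
begin

lemma eq_locally:
  assumes U: "zopen U" "x \<in> secs M U" "y \<in> secs M U"
    and loc: "\<And>v. v \<in> U \<Longrightarrow> \<exists>W. zopen W \<and> v \<in> W \<and> W \<subseteq> U \<and> res M U W x = res M U W y"
  shows "x = y"
proof -
  let ?\<W> = "{W. zopen W \<and> W \<subseteq> U \<and> res M U W x = res M U W y}"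
  have "\<Union>?\<W> = U" using loc by blast
  then show ?thesis using locality[of ?\<W> x y] U by auto
qed

text \<open>
  Local solutions \<open>y\<close> of a condition \<open>R\<close> that is stable under restriction and has at most one
  solution over each open set agree on overlaps, hence glue. Homomorphisms that are given by local
  choices (factorisations through a quotient, contractions, divisions by a form) are constructed
  in this way.
\<close>

lemma glue_unique:
  assumes U: "zopen U"
    and rest: "\<And>W T y. \<lbrakk>zopen W; W \<subseteq> U; zopen T; T \<subseteq> W; y \<in> secs M W; R W y\<rbrakk> \<Longrightarrow> R T (res M W T y)"
    and uniq: "\<And>W y y'. \<lbrakk>zopen W; W \<subseteq> U; y \<in> secs M W; y' \<in> secs M W; R W y; R W y'\<rbrakk> \<Longrightarrow> y = y'"
    and ex: "\<And>v. v \<in> U \<Longrightarrow> \<exists>W y. zopen W \<and> v \<in> W \<and> W \<subseteq> U \<and> y \<in> secs M W \<and> R W y"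
  shows "\<exists>!y. y \<in> secs M U \<and> (\<forall>v\<in>U. \<exists>W. zopen W \<and> v \<in> W \<and> W \<subseteq> U \<and> R W (res M U W y))"
proof -
  let ?\<W> = "{W. zopen W \<and> W \<subseteq> U \<and> (\<exists>y\<in>secs M W. R W y)}"
  have cover: "\<Union>?\<W> = U" using ex by blast
  define s where "s W = (SOME y. y \<in> secs M W \<and> R W y)" for W
  have s: "s W \<in> secs M W \<and> R W (s W)" if "W \<in> ?\<W>" for W
    unfolding s_def by (rule someI_ex) (use that in blast)
  have "\<exists>x\<in>secs M (\<Union>?\<W>). \<forall>W\<in>?\<W>. res M (\<Union>?\<W>) W x = s W"
  proof (rule gluing)
    fix W T assume W: "W \<in> ?\<W>" and T: "T \<in> ?\<W>"
    have WT: "zopen (W \<inter> T)" using W T zopen_Int by blast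
    have "R (W \<inter> T) (res M W (W \<inter> T) (s W))" "R (W \<inter> T) (res M T (W \<inter> T) (s T))"
      using rest[of W "W \<inter> T" "s W"] rest[of T "W \<inter> T" "s T"] s[OF W] s[OF T] W T WT by auto
    then show "res M W (W \<inter> T) (s W) = res M T (W \<inter> T) (s T)"
      using uniq[of "W \<inter> T"] res_closed[of W "W \<inter> T" "s W"] res_closed[of T "W \<inter> T" "s T"] s[OF W] s[OF T] W T WT
      by auto
  qed (use s cover U in auto)
  then obtain x where x: "x \<in> secs M U" "\<And>W. W \<in> ?\<W> \<Longrightarrow> res M U W x = s W"
    unfolding cover by blast
  have xR: "\<forall>v\<in>U. \<exists>W. zopen W \<and> v \<in> W \<and> W \<subseteq> U \<and> R W (res M U W x)"
  proof
    fix v assume "v \<in> U"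
    then obtain W where W: "W \<in> ?\<W>" "v \<in> W" using cover by blast
    then show "\<exists>W. zopen W \<and> v \<in> W \<and> W \<subseteq> U \<and> R W (res M U W x)"
      using x(2)[OF W(1)] s[OF W(1)] by (intro exI[of _ W]) auto
  qed
  have uni: "y = y'" if y: "y \<in> secs M U" "\<forall>v\<in>U. \<exists>W. zopen W \<and> v \<in> W \<and> W \<subseteq> U \<and> R W (res M U W y)"
    and y': "y' \<in> secs M U" "\<forall>v\<in>U. \<exists>W. zopen W \<and> v \<in> W \<and> W \<subseteq> U \<and> R W (res M U W y')" for y y'
  proof (rule eq_locally[OF U y(1) y'(1)])
    fix v assume v: "v \<in> U"
    obtain W where W: "zopen W" "v \<in> W" "W \<subseteq> U" "R W (res M U W y)" using y(2) v by blast
    obtain T where T: "zopen T" "v \<in> T" "T \<subseteq> U" "R T (res M U T y')" using y'(2) v by blast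
    have WT: "zopen (W \<inter> T)" using W T zopen_Int by blast
    have "R (W \<inter> T) (res M U (W \<inter> T) y)"
      using rest[OF W(1,3) WT _ res_closed[OF U W(1,3) y(1)] W(4)] res_res[OF U W(1) WT _ W(3) y(1)] by simp
    moreover have "R (W \<inter> T) (res M U (W \<inter> T) y')"
      using rest[OF T(1,3) WT _ res_closed[OF U T(1,3) y'(1)] T(4)] res_res[OF U T(1) WT _ T(3) y'(1)] by simp
    ultimately have "res M U (W \<inter> T) y = res M U (W \<inter> T) y'"
      using uniq[OF WT] res_closed[OF U WT] W T y y' by (meson le_infI1)
    then show "\<exists>W. zopen W \<and> v \<in> W \<and> W \<subseteq> U \<and> res M U W y = res M U W y'"
      using WT W T by (intro exI[of _ "W \<inter> T"]) auto
  qed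
  show ?thesis by (rule ex1I[of _ x]) (use x(1) xR uni in blast)+
qed

end

section \<open>Sheafification\<close>

text \<open>
  Over \<open>W\<close>, the section \<open>s\<close> of the sheafification is induced by the section \<open>x\<close> of the presheaf.
  The operations of the sheafification, which are defined by germs, are all computed on such
  representatives.
\<close>

definition repr :: "('k::field, 'm, 'z) osheaf_scheme \<Rightarrow> ('k, 'm) shf \<Rightarrow> 'k pt set \<Rightarrow> 'm \<Rightarrow> bool" where
  "repr P s W x \<longleftrightarrow> zopen W \<and> x \<in> secs P W \<and> (\<forall>w\<in>W. s w = germ P w W x)"

lemma Union_const: "A \<noteq> {} \<Longrightarrow> (\<And>a. a \<in> A \<Longrightarrow> a = g) \<Longrightarrow> \<Union>A = g"
  by auto

lemma mem_sheafify: "s \<in> secs (sheafify P) U \<longleftrightarrow> (\<forall>v. v \<notin> U \<longrightarrow> s v = {}) \<and>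
    (\<forall>v\<in>U. \<exists>W x. v \<in> W \<and> W \<subseteq> U \<and> repr P s W x)"
  unfolding sheafify_def repr_def by (simp, meson)

lemma sheafify_simps:
  "\<zero>\<^bsub>sec (sheafify P) U\<^esub> = to_shf P U \<zero>\<^bsub>sec P U\<^esub>"
  "s \<oplus>\<^bsub>sec (sheafify P) U\<^esub> t =
     (\<lambda>v. \<Union>{germ P v W (x \<oplus>\<^bsub>sec P W\<^esub> y) | W x y. (W, x) \<in> s v \<and> (W, y) \<in> t v})"
  "f \<odot>\<^bsub>sec (sheafify P) U\<^esub> s =
     (\<lambda>v. \<Union>{germ P v W (rst W f \<odot>\<^bsub>sec P W\<^esub> x) | W x. (W, x) \<in> s v \<and> W \<subseteq> U})"
  "res (sheafify P) U W s = (\<lambda>v. if v \<in> W then s v else {})"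
  unfolding sheafify_def by simp_all

context presheaf
begin

lemma mem_germ_self: "\<lbrakk>zopen U; v \<in> U; x \<in> secs P U\<rbrakk> \<Longrightarrow> (U, x) \<in> germ P v U x"
  unfolding germ_def by blast

lemma germ_subset:
  assumes "zopen U" "zopen W" "x \<in> secs P U" "y \<in> secs P W"
    and T: "zopen T" "v \<in> T" "T \<subseteq> U \<inter> W" "res P U T x = res P W T y"
  shows "germ P v U x \<subseteq> germ P v W y"
proof
  fix p assume p: "p \<in> germ P v U x"
  obtain V z where [simp]: "p = (V, z)" by (cases p)
  from p obtain S where S: "zopen V" "v \<in> V" "z \<in> secs P V" "zopen S" "v \<in> S" "S \<subseteq> U \<inter> V"
    "res P U S x = res P V S z" unfolding germ_def by auto
  have TS: "zopen (T \<inter> S)" using T S zopen_Int by blast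
  have "res P W (T \<inter> S) y = res P T (T \<inter> S) (res P W T y)"
    using res_res[OF assms(2) T(1) TS] T assms(4) by auto
  also have "\<dots> = res P U (T \<inter> S) x"
    unfolding T(4)[symmetric] using res_res[OF assms(1) T(1) TS _ _ assms(3)] T(3) by auto
  also have "\<dots> = res P S (T \<inter> S) (res P U S x)"
    using res_res[OF assms(1) S(4) TS _ _ assms(3)] S(6) by auto
  also have "\<dots> = res P V (T \<inter> S) z"
    unfolding S(7) using res_res[OF S(1) S(4) TS _ _ S(3)] S(6) by auto
  finally show "p \<in> germ P v W y"
    unfolding germ_def using S T TS by (auto intro!: exI[of _ "T \<inter> S"])
qed

lemma germ_eq_iff:
  assumes "zopen U" "zopen W" "v \<in> U" "v \<in> W" "x \<in> secs P U" "y \<in> secs P W"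
  shows "germ P v U x = germ P v W y \<longleftrightarrow>
    (\<exists>T. zopen T \<and> v \<in> T \<and> T \<subseteq> U \<inter> W \<and> res P U T x = res P W T y)"
proof
  assume "germ P v U x = germ P v W y"
  then have "(W, y) \<in> germ P v U x" using mem_germ_self[OF assms(2,4,6)] by simp
  then show "\<exists>T. zopen T \<and> v \<in> T \<and> T \<subseteq> U \<inter> W \<and> res P U T x = res P W T y"
    unfolding germ_def by auto
next
  assume "\<exists>T. zopen T \<and> v \<in> T \<and> T \<subseteq> U \<inter> W \<and> res P U T x = res P W T y"
  then obtain T where T: "zopen T" "v \<in> T" "T \<subseteq> U \<inter> W" "res P U T x = res P W T y" by blast
  then have T': "T \<subseteq> W \<inter> U" "res P W T y = res P U T x" by auto
  show "germ P v U x = germ P v W y"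
    using germ_subset[OF assms(1,2,5,6) T] germ_subset[OF assms(2,1,6,5) T(1,2) T'] by blast
qed

lemma germ_res:
  assumes "zopen U" "zopen W" "W \<subseteq> U" "v \<in> W" "x \<in> secs P U"
  shows "germ P v W (res P U W x) = germ P v U x"
proof -
  have "res P W W (res P U W x) = res P U W x" using res_res[OF assms(1,2,2)] assms by auto
  then show ?thesis using germ_eq_iff[OF assms(2,1,4) _ res_closed assms(5)] assms by blast
qed

lemma repr_res:
  assumes "repr P s W x" "zopen T" "T \<subseteq> W" shows "repr P s T (res P W T x)"
  using assms germ_res[of W T _ x] res_closed[of W T x] unfolding repr_def by auto

lemma repr_common:
  assumes "s \<in> secs (sheafify P) U" "t \<in> secs (sheafify P) U" "v \<in> U"
  obtains W x y where "zopen W" "v \<in> W" "W \<subseteq> U" "repr P s W x" "repr P t W y"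
proof -
  obtain W x where W: "v \<in> W" "W \<subseteq> U" "repr P s W x" using assms(1,3) unfolding mem_sheafify by blast
  obtain T y where T: "v \<in> T" "T \<subseteq> U" "repr P t T y" using assms(2,3) unfolding mem_sheafify by blast
  have "zopen (W \<inter> T)" using W T zopen_Int unfolding repr_def by blast
  then show ?thesis
    using that[of "W \<inter> T"] repr_res[OF W(3), of "W \<inter> T"] repr_res[OF T(3), of "W \<inter> T"] W T by auto
qed

lemma repr_common3:
  assumes "s \<in> secs (sheafify P) U" "t \<in> secs (sheafify P) U" "u \<in> secs (sheafify P) U" "v \<in> U"
  obtains W x y z where "zopen W" "v \<in> W" "W \<subseteq> U" "repr P s W x" "repr P t W y" "repr P u W z"
proof -
  obtain W x y where W: "zopen W" "v \<in> W" "W \<subseteq> U" "repr P s W x" "repr P t W y"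
    using repr_common[OF assms(1,2,4)] .
  obtain T z where T: "v \<in> T" "T \<subseteq> U" "repr P u T z" using assms(3,4) unfolding mem_sheafify by blast
  have "zopen (W \<inter> T)" using W T zopen_Int unfolding repr_def by blast
  then show ?thesis
    using that[of "W \<inter> T"] repr_res[OF W(4), of "W \<inter> T"] repr_res[OF W(5), of "W \<inter> T"]
      repr_res[OF T(3), of "W \<inter> T"] W T by auto
qed

lemma shf_eqI:
  assumes "s \<in> secs (sheafify P) U" "t \<in> secs (sheafify P) U"
    and "\<And>v. v \<in> U \<Longrightarrow> \<exists>W x. v \<in> W \<and> repr P s W x \<and> repr P t W x"
  shows "s = t"
proof
  fix v show "s v = t v"
  proof (cases "v \<in> U")
    case True
    then show ?thesis using assms(3)[OF True] unfolding repr_def by auto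
  qed (use assms(1,2) in \<open>auto simp: mem_sheafify\<close>)
qed

lemma repr_add:
  assumes s: "repr P s W x" and t: "repr P t W y"
  shows "repr P (s \<oplus>\<^bsub>sec (sheafify P) U\<^esub> t) W (x \<oplus>\<^bsub>sec P W\<^esub> y)"
proof -
  have W: "zopen W" and xy: "x \<in> secs P W" "y \<in> secs P W" using s t unfolding repr_def by auto
  have "(s \<oplus>\<^bsub>sec (sheafify P) U\<^esub> t) w = germ P w W (x \<oplus>\<^bsub>sec P W\<^esub> y)" if w: "w \<in> W" for w
    unfolding sheafify_simps
  proof (rule Union_const)
    show "{germ P w W (x \<oplus>\<^bsub>sec P W\<^esub> y) |W x y. (W, x) \<in> s w \<and> (W, y) \<in> t w} \<noteq> {}"
      using mem_germ_self[OF W w xy(1)] mem_germ_self[OF W w xy(2)] s t w unfolding repr_def by auto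
    fix a assume "a \<in> {germ P w W (x \<oplus>\<^bsub>sec P W\<^esub> y) |W x y. (W, x) \<in> s w \<and> (W, y) \<in> t w}"
    then obtain W' x' y' where a: "a = germ P w W' (x' \<oplus>\<^bsub>sec P W'\<^esub> y')"
      and m: "(W', x') \<in> germ P w W x" "(W', y') \<in> germ P w W y"
      using s t w unfolding repr_def by auto
    have W': "zopen W'" "w \<in> W'" "x' \<in> secs P W'" "y' \<in> secs P W'" using m unfolding germ_def by auto
    obtain T where T: "zopen T" "w \<in> T" "T \<subseteq> W \<inter> W'" "res P W T x = res P W' T x'"
      using m(1) unfolding germ_def by auto
    obtain S where S: "zopen S" "w \<in> S" "S \<subseteq> W \<inter> W'" "res P W S y = res P W' S y'"
      using m(2) unfolding germ_def by auto
    let ?V = "T \<inter> S"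
    have V: "zopen ?V" "?V \<subseteq> W" "?V \<subseteq> W'" "w \<in> ?V" "?V \<subseteq> W' \<inter> W" using T S zopen_Int by auto
    have "res P W ?V x = res P W' ?V x'"
      using res_res[OF W T(1) V(1) _ _ xy(1)] res_res[OF W'(1) T(1) V(1) _ _ W'(3)] T by (metis Int_lower1 le_inf_iff)
    moreover have "res P W ?V y = res P W' ?V y'"
      using res_res[OF W S(1) V(1) _ _ xy(2)] res_res[OF W'(1) S(1) V(1) _ _ W'(4)] S by (metis Int_lower2 le_inf_iff)
    ultimately have "res P W' ?V (x' \<oplus>\<^bsub>sec P W'\<^esub> y') = res P W ?V (x \<oplus>\<^bsub>sec P W\<^esub> y)"
      using res_add[OF W V(1,2) xy] res_add[OF W'(1) V(1,3) W'(3,4)] by simp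
    then show "a = germ P w W (x \<oplus>\<^bsub>sec P W\<^esub> y)"
      unfolding a using germ_eq_iff[OF W'(1) W W'(2) w add_closed[OF W'(1,3,4)] add_closed[OF W xy]] V by blast
  qed
  then show ?thesis unfolding repr_def using W add_closed[OF W xy] by blast
qed

lemma repr_smult:
  assumes s: "repr P s W x" and U: "zopen U" "W \<subseteq> U" and f: "f \<in> regular 0 0 U"
  shows "repr P (f \<odot>\<^bsub>sec (sheafify P) U\<^esub> s) W (rst W f \<odot>\<^bsub>sec P W\<^esub> x)"
proof -
  have W: "zopen W" and x: "x \<in> secs P W" using s unfolding repr_def by auto
  have fT: "rst T f \<in> regular 0 0 T" if "zopen T" "T \<subseteq> U" for T using regular_rst[OF f that] .
  have "(f \<odot>\<^bsub>sec (sheafify P) U\<^esub> s) w = germ P w W (rst W f \<odot>\<^bsub>sec P W\<^esub> x)" if w: "w \<in> W" for w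
    unfolding sheafify_simps
  proof (rule Union_const)
    show "{germ P w W (rst W f \<odot>\<^bsub>sec P W\<^esub> x) |W x. (W, x) \<in> s w \<and> W \<subseteq> U} \<noteq> {}"
      using mem_germ_self[OF W w x] s w U unfolding repr_def by auto
    fix a assume "a \<in> {germ P w W (rst W f \<odot>\<^bsub>sec P W\<^esub> x) |W x. (W, x) \<in> s w \<and> W \<subseteq> U}"
    then obtain W' x' where a: "a = germ P w W' (rst W' f \<odot>\<^bsub>sec P W'\<^esub> x')"
      and m: "(W', x') \<in> germ P w W x" "W' \<subseteq> U"
      using s w unfolding repr_def by auto
    have W': "zopen W'" "w \<in> W'" "x' \<in> secs P W'" using m unfolding germ_def by auto
    obtain T where T: "zopen T" "w \<in> T" "T \<subseteq> W \<inter> W'" "res P W T x = res P W' T x'"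
      using m(1) unfolding germ_def by auto
    have TW: "T \<subseteq> W" "T \<subseteq> W'" "T \<subseteq> W' \<inter> W" using T by auto
    have "res P W' T (rst W' f \<odot>\<^bsub>sec P W'\<^esub> x') = res P W T (rst W f \<odot>\<^bsub>sec P W\<^esub> x)"
      using res_smult[OF W T(1) TW(1) x fT[OF W U(2)]] res_smult[OF W'(1) T(1) TW(2) W'(3) fT[OF W'(1) m(2)]] T(4) TW
      by simp
    then show "a = germ P w W (rst W f \<odot>\<^bsub>sec P W\<^esub> x)"
      unfolding a using germ_eq_iff[OF W'(1) W W'(2) w smult_closed[OF W'(1) fT W'(3)] smult_closed[OF W fT x]] 
        T TW W' W m(2) U(2) by blast
  qed
  then show ?thesis unfolding repr_def using W smult_closed[OF W fT x] U by blast
qed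

lemma repr_to_shf:
  assumes "zopen U" "zopen W" "W \<subseteq> U" "x \<in> secs P U"
  shows "repr P (to_shf P U x) W (res P U W x)"
  using assms germ_res[OF assms(1,2,3) _ assms(4)] res_closed[OF assms]
  unfolding repr_def to_shf_def by auto

lemma to_shf_closed:
  assumes "zopen U" "x \<in> secs P U" shows "to_shf P U x \<in> secs (sheafify P) U"
  unfolding mem_sheafify
  using repr_to_shf[OF assms(1,1) _ assms(2)] by (auto simp: to_shf_def)

lemma shf_add_closed:
  assumes U: "zopen U" and s: "s \<in> secs (sheafify P) U" and t: "t \<in> secs (sheafify P) U"
  shows "s \<oplus>\<^bsub>sec (sheafify P) U\<^esub> t \<in> secs (sheafify P) U"
  unfolding mem_sheafify
proof (intro conjI allI impI ballI)
  fix v assume "v \<notin> U" then show "(s \<oplus>\<^bsub>sec (sheafify P) U\<^esub> t) v = {}"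
    using s unfolding mem_sheafify sheafify_simps by auto
next
  fix v assume v: "v \<in> U"
  obtain W x y where W: "zopen W" "v \<in> W" "W \<subseteq> U" "repr P s W x" "repr P t W y" using repr_common[OF s t v] .
  show "\<exists>W x. v \<in> W \<and> W \<subseteq> U \<and> repr P (s \<oplus>\<^bsub>sec (sheafify P) U\<^esub> t) W x"
    using W repr_add[OF W(4,5)] by blast
qed

lemma shf_smult_closed:
  assumes U: "zopen U" and f: "f \<in> regular 0 0 U" and s: "s \<in> secs (sheafify P) U"
  shows "f \<odot>\<^bsub>sec (sheafify P) U\<^esub> s \<in> secs (sheafify P) U"
  unfolding mem_sheafify
proof (intro conjI allI impI ballI)
  fix v assume "v \<notin> U" then show "(f \<odot>\<^bsub>sec (sheafify P) U\<^esub> s) v = {}"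
    using s unfolding mem_sheafify sheafify_simps by auto
next
  fix v assume v: "v \<in> U"
  obtain W x y where W: "zopen W" "v \<in> W" "W \<subseteq> U" "repr P s W x" "repr P s W y" using repr_common[OF s s v] .
  show "\<exists>W x. v \<in> W \<and> W \<subseteq> U \<and> repr P (f \<odot>\<^bsub>sec (sheafify P) U\<^esub> s) W x"
    using W repr_smult[OF W(4) U W(3) f] by blast
qed

lemma repr_zero:
  assumes "zopen U" "zopen W" "W \<subseteq> U"
  shows "repr P \<zero>\<^bsub>sec (sheafify P) U\<^esub> W \<zero>\<^bsub>sec P W\<^esub>"
  using repr_to_shf[OF assms zero_closed[OF assms(1)]] res_zero[OF assms] by (simp add: sheafify_simps)

lemma sheafify_ab:
  assumes U: "zopen U" shows "abelian_group (sec (sheafify P) U)"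
proof (rule abelian_groupI)
  let ?S = "sec (sheafify P) U"
  show zc: "\<zero>\<^bsub>?S\<^esub> \<in> carrier ?S" using to_shf_closed[OF U zero_closed[OF U]] by (simp add: sheafify_simps)
  fix s assume s: "s \<in> carrier ?S"
  show "\<zero>\<^bsub>?S\<^esub> \<oplus>\<^bsub>?S\<^esub> s = s"
  proof (rule shf_eqI[OF shf_add_closed[OF U zc s] s])
    fix v assume v: "v \<in> U"
    obtain W x y where W: "zopen W" "v \<in> W" "W \<subseteq> U" "repr P s W x" "repr P s W y" using repr_common[OF s s v] .
    then have x: "x \<in> secs P W" unfolding repr_def by auto
    have "\<zero>\<^bsub>sec P W\<^esub> \<oplus>\<^bsub>sec P W\<^esub> x = x"
      using abelian_monoid.l_zero[OF abelian_group.axioms(1)[OF ab[OF W(1)]] x] .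
    then show "\<exists>W x. v \<in> W \<and> repr P (\<zero>\<^bsub>?S\<^esub> \<oplus>\<^bsub>?S\<^esub> s) W x \<and> repr P s W x"
      using repr_add[OF repr_zero[OF U W(1,3)] W(4), of U] W by auto
  qed
  let ?m = "rst U (\<lambda>_. -1)"
  have m: "?m \<in> regular 0 0 U" using regular_const[OF U] .
  have "?m \<odot>\<^bsub>?S\<^esub> s \<oplus>\<^bsub>?S\<^esub> s = \<zero>\<^bsub>?S\<^esub>"
  proof (rule shf_eqI[OF shf_add_closed[OF U shf_smult_closed[OF U m s] s] zc])
    fix v assume v: "v \<in> U"
    obtain W x y where W: "zopen W" "v \<in> W" "W \<subseteq> U" "repr P s W x" "repr P s W y" using repr_common[OF s s v] .
    then have x: "x \<in> secs P W" unfolding repr_def by auto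
    show "\<exists>W x. v \<in> W \<and> repr P (?m \<odot>\<^bsub>?S\<^esub> s \<oplus>\<^bsub>?S\<^esub> s) W x \<and> repr P \<zero>\<^bsub>?S\<^esub> W x"
      using repr_add[OF repr_smult[OF W(4) U W(3) m] W(4), of U] repr_zero[OF U W(1,3)] W 
        neg_one_smult[OF W(1) x] by auto
  qed
  then show "\<exists>y\<in>carrier ?S. y \<oplus>\<^bsub>?S\<^esub> s = \<zero>\<^bsub>?S\<^esub>" using shf_smult_closed[OF U m s] by blast
  fix t assume t: "t \<in> carrier ?S"
  show "s \<oplus>\<^bsub>?S\<^esub> t \<in> carrier ?S" by (rule shf_add_closed[OF U s t])
  show "s \<oplus>\<^bsub>?S\<^esub> t = t \<oplus>\<^bsub>?S\<^esub> s"
  proof (rule shf_eqI[OF shf_add_closed[OF U s t] shf_add_closed[OF U t s]])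
    fix v assume v: "v \<in> U"
    obtain W x y where W: "zopen W" "v \<in> W" "W \<subseteq> U" "repr P s W x" "repr P t W y" using repr_common[OF s t v] .
    then have x: "x \<in> secs P W" "y \<in> secs P W" unfolding repr_def by auto
    have "x \<oplus>\<^bsub>sec P W\<^esub> y = y \<oplus>\<^bsub>sec P W\<^esub> x"
      using abelian_monoid.a_comm[OF abelian_group.axioms(1)[OF ab[OF W(1)]] x] .
    then show "\<exists>W x. v \<in> W \<and> repr P (s \<oplus>\<^bsub>?S\<^esub> t) W x \<and> repr P (t \<oplus>\<^bsub>?S\<^esub> s) W x"
      using repr_add[OF W(4,5), of U] repr_add[OF W(5,4), of U] W by auto
  qed
  fix u assume u: "u \<in> carrier ?S"
  show "s \<oplus>\<^bsub>?S\<^esub> t \<oplus>\<^bsub>?S\<^esub> u = s \<oplus>\<^bsub>?S\<^esub> (t \<oplus>\<^bsub>?S\<^esub> u)"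
  proof (rule shf_eqI[OF shf_add_closed[OF U shf_add_closed[OF U s t] u] shf_add_closed[OF U s shf_add_closed[OF U t u]]])
    fix v assume v: "v \<in> U"
    obtain W x y z where W: "zopen W" "v \<in> W" "W \<subseteq> U" "repr P s W x" "repr P t W y" "repr P u W z"
      using repr_common3[OF s t u v] .
    then have x: "x \<in> secs P W" "y \<in> secs P W" "z \<in> secs P W" unfolding repr_def by auto
    have "(x \<oplus>\<^bsub>sec P W\<^esub> y) \<oplus>\<^bsub>sec P W\<^esub> z = x \<oplus>\<^bsub>sec P W\<^esub> (y \<oplus>\<^bsub>sec P W\<^esub> z)"
      using abelian_monoid.a_assoc[OF abelian_group.axioms(1)[OF ab[OF W(1)]] x] .
    then show "\<exists>W x. v \<in> W \<and> repr P (s \<oplus>\<^bsub>?S\<^esub> t \<oplus>\<^bsub>?S\<^esub> u) W x \<and> repr P (s \<oplus>\<^bsub>?S\<^esub> (t \<oplus>\<^bsub>?S\<^esub> u)) W x"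
      using repr_add[OF repr_add[OF W(4,5), of U] W(6), of U] repr_add[OF W(4) repr_add[OF W(5,6), of U], of U] W by auto
  qed
qed

lemma sheafify_module:
  assumes U: "zopen U" shows "module (oring U) (sec (sheafify P) U)"
proof (rule moduleI)
  let ?S = "sec (sheafify P) U"
  show "cring (oring U)" "abelian_group ?S" using oring_cring sheafify_ab U by auto
  fix f s assume "f \<in> carrier (oring U)" and s: "s \<in> carrier ?S"
  then have f: "f \<in> regular 0 0 U" by simp
  show "f \<odot>\<^bsub>?S\<^esub> s \<in> carrier ?S" by (rule shf_smult_closed[OF U f s])
  have R: "rst W f \<in> carrier (oring W)" if "zopen W" "W \<subseteq> U" "f \<in> regular 0 0 U" for f W
    using regular_rst[OF that(3,1,2)] by simp
  {
    fix g assume "g \<in> carrier (oring U)"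
    then have g: "g \<in> regular 0 0 U" by simp
    have fg: "(\<lambda>v. f v + g v) \<in> regular 0 0 U" "(\<lambda>v. f v * g v) \<in> regular 0 0 U"
      using f g by (auto intro: regular_add regular_mult)
    have rfg: "rst W (\<lambda>v. f v + g v) = (\<lambda>v. rst W f v + rst W g v)"
      "rst W (\<lambda>v. f v * g v) = (\<lambda>v. rst W f v * rst W g v)" for W by (auto simp: rst_def)
    have "(\<lambda>v. f v + g v) \<odot>\<^bsub>?S\<^esub> s = f \<odot>\<^bsub>?S\<^esub> s \<oplus>\<^bsub>?S\<^esub> g \<odot>\<^bsub>?S\<^esub> s"
    proof (rule shf_eqI[OF shf_smult_closed[OF U fg(1) s] shf_add_closed[OF U shf_smult_closed[OF U f s] shf_smult_closed[OF U g s]]])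
      fix v assume v: "v \<in> U"
      obtain W x y where W: "zopen W" "v \<in> W" "W \<subseteq> U" "repr P s W x" "repr P s W y" using repr_common[OF s s v] .
      then have x: "x \<in> secs P W" unfolding repr_def by auto
      show "\<exists>W x. v \<in> W \<and> repr P ((\<lambda>v. f v + g v) \<odot>\<^bsub>?S\<^esub> s) W x \<and> repr P (f \<odot>\<^bsub>?S\<^esub> s \<oplus>\<^bsub>?S\<^esub> g \<odot>\<^bsub>?S\<^esub> s) W x"
        using repr_smult[OF W(4) U W(3) fg(1)] W(2) repr_add[OF repr_smult[OF W(4) U W(3) f] repr_smult[OF W(4) U W(3) g], of U]
          module.smult_l_distr[OF sec_module[OF W(1)] R[OF W(1,3) f] R[OF W(1,3) g] x] by (auto simp: rfg)
    qed
    then show "(f \<oplus>\<^bsub>oring U\<^esub> g) \<odot>\<^bsub>?S\<^esub> s = f \<odot>\<^bsub>?S\<^esub> s \<oplus>\<^bsub>?S\<^esub> g \<odot>\<^bsub>?S\<^esub> s" by simp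
    have "(\<lambda>v. f v * g v) \<odot>\<^bsub>?S\<^esub> s = f \<odot>\<^bsub>?S\<^esub> (g \<odot>\<^bsub>?S\<^esub> s)"
    proof (rule shf_eqI[OF shf_smult_closed[OF U fg(2) s] shf_smult_closed[OF U f shf_smult_closed[OF U g s]]])
      fix v assume v: "v \<in> U"
      obtain W x y where W: "zopen W" "v \<in> W" "W \<subseteq> U" "repr P s W x" "repr P s W y" using repr_common[OF s s v] .
      then have x: "x \<in> secs P W" unfolding repr_def by auto
      show "\<exists>W x. v \<in> W \<and> repr P ((\<lambda>v. f v * g v) \<odot>\<^bsub>?S\<^esub> s) W x \<and> repr P (f \<odot>\<^bsub>?S\<^esub> (g \<odot>\<^bsub>?S\<^esub> s)) W x"
        using repr_smult[OF W(4) U W(3) fg(2)] W(2) repr_smult[OF repr_smult[OF W(4) U W(3) g] U W(3) f]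
          module.smult_assoc1[OF sec_module[OF W(1)] R[OF W(1,3) f] R[OF W(1,3) g] x] by (auto simp: rfg)
    qed
    then show "(f \<otimes>\<^bsub>oring U\<^esub> g) \<odot>\<^bsub>?S\<^esub> s = f \<odot>\<^bsub>?S\<^esub> (g \<odot>\<^bsub>?S\<^esub> s)" by simp
  next
    fix t assume t: "t \<in> carrier ?S"
    show "f \<odot>\<^bsub>?S\<^esub> (s \<oplus>\<^bsub>?S\<^esub> t) = f \<odot>\<^bsub>?S\<^esub> s \<oplus>\<^bsub>?S\<^esub> f \<odot>\<^bsub>?S\<^esub> t"
    proof (rule shf_eqI[OF shf_smult_closed[OF U f shf_add_closed[OF U s t]] shf_add_closed[OF U shf_smult_closed[OF U f s] shf_smult_closed[OF U f t]]])
      fix v assume v: "v \<in> U"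
      obtain W x y where W: "zopen W" "v \<in> W" "W \<subseteq> U" "repr P s W x" "repr P t W y" using repr_common[OF s t v] .
      then have x: "x \<in> secs P W" "y \<in> secs P W" unfolding repr_def by auto
      show "\<exists>W x. v \<in> W \<and> repr P (f \<odot>\<^bsub>?S\<^esub> (s \<oplus>\<^bsub>?S\<^esub> t)) W x \<and> repr P (f \<odot>\<^bsub>?S\<^esub> s \<oplus>\<^bsub>?S\<^esub> f \<odot>\<^bsub>?S\<^esub> t) W x"
        using repr_smult[OF repr_add[OF W(4,5)] U W(3) f, of U] W(2)
          repr_add[OF repr_smult[OF W(4) U W(3) f] repr_smult[OF W(5) U W(3) f], of U]
          module.smult_r_distr[OF sec_module[OF W(1)] R[OF W(1,3) f] x] by auto
    qed
  }
next
  let ?S = "sec (sheafify P) U"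
  fix s assume s: "s \<in> carrier ?S"
  have o: "rst U (\<lambda>_. 1) \<in> regular 0 0 U" using regular_const[OF U] .
  have "rst U (\<lambda>_. 1) \<odot>\<^bsub>?S\<^esub> s = s"
  proof (rule shf_eqI[OF shf_smult_closed[OF U o s] s])
    fix v assume v: "v \<in> U"
    obtain W x y where W: "zopen W" "v \<in> W" "W \<subseteq> U" "repr P s W x" "repr P s W y" using repr_common[OF s s v] .
    then have x: "x \<in> secs P W" unfolding repr_def by auto
    show "\<exists>W x. v \<in> W \<and> repr P (rst U (\<lambda>_. 1) \<odot>\<^bsub>?S\<^esub> s) W x \<and> repr P s W x"
      using repr_smult[OF W(4) U W(3) o] W(2,3,4) module.smult_one[OF sec_module[OF W(1)] x] by auto
  qed
  then show "\<one>\<^bsub>oring U\<^esub> \<odot>\<^bsub>?S\<^esub> s = s" by simp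
qed

lemma repr_res_shf: "repr P s W x \<Longrightarrow> W \<subseteq> T \<Longrightarrow> repr P (res (sheafify P) U T s) W x"
  unfolding repr_def sheafify_simps by auto

lemma repr_res_shf_iff: "W \<subseteq> T \<Longrightarrow> repr P (res (sheafify P) U T s) W x \<longleftrightarrow> repr P s W x"
  unfolding repr_def sheafify_simps by auto

lemma shf_res_closed:
  assumes "zopen U" "zopen T" "T \<subseteq> U" "s \<in> secs (sheafify P) U"
  shows "res (sheafify P) U T s \<in> secs (sheafify P) T"
  unfolding mem_sheafify
proof (intro conjI allI impI ballI)
  fix v assume v: "v \<in> T"
  then obtain W x where W: "v \<in> W" "W \<subseteq> U" "repr P s W x" using assms unfolding mem_sheafify by blast
  have "zopen (W \<inter> T)" using W assms zopen_Int unfolding repr_def by blast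
  then show "\<exists>W x. v \<in> W \<and> W \<subseteq> T \<and> repr P (res (sheafify P) U T s) W x"
    using repr_res_shf[OF repr_res[OF W(3)], of "W \<inter> T" T U] W v by auto
qed (simp add: sheafify_simps)

text \<open>
  Sections of the sheafification are functions on points that are locally induced by the presheaf,
  so locality and gluing are those of functions; the identities hold because they hold for
  representatives.
\<close>

lemma O_module_sheafify: "O_module (sheafify P)"
proof (rule O_module.intro)
  let ?S = "sheafify P"
  fix U :: "'k pt set" assume U: "zopen U"
  show "module (oring U) (sec ?S U)" by (rule sheafify_module[OF U])
  fix T assume T: "zopen T" "T \<subseteq> U"
  fix s assume s: "s \<in> secs ?S U"
  show rs: "res ?S U T s \<in> secs ?S T" by (rule shf_res_closed[OF U T s])
  {
    fix t assume t: "t \<in> secs ?S U"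
    have rt: "res ?S U T t \<in> secs ?S T" by (rule shf_res_closed[OF U T t])
    show "res ?S U T (s \<oplus>\<^bsub>sec ?S U\<^esub> t) = res ?S U T s \<oplus>\<^bsub>sec ?S T\<^esub> res ?S U T t"
    proof (rule shf_eqI[OF shf_res_closed[OF U T shf_add_closed[OF U s t]] shf_add_closed[OF T(1) rs rt]])
      fix v assume v: "v \<in> T"
      obtain W x y where W: "zopen W" "v \<in> W" "W \<subseteq> T" "repr P (res ?S U T s) W x" "repr P (res ?S U T t) W y"
        using repr_common[OF rs rt v] .
      have st: "repr P s W x" "repr P t W y" using W(4,5) by (simp_all add: repr_res_shf_iff[OF W(3)])
      show "\<exists>W x. v \<in> W \<and> repr P (res ?S U T (s \<oplus>\<^bsub>sec ?S U\<^esub> t)) W x \<and>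
          repr P (res ?S U T s \<oplus>\<^bsub>sec ?S T\<^esub> res ?S U T t) W x"
        using repr_add[OF W(4,5), of T] W(2) repr_res_shf[OF repr_add[OF st, of U] W(3), of U] by blast
    qed
  next
    fix f assume f: "f \<in> regular 0 0 U"
    have fT: "rst T f \<in> regular 0 0 T" by (rule regular_rst[OF f T])
    show "res ?S U T (f \<odot>\<^bsub>sec ?S U\<^esub> s) = rst T f \<odot>\<^bsub>sec ?S T\<^esub> res ?S U T s"
    proof (rule shf_eqI[OF shf_res_closed[OF U T shf_smult_closed[OF U f s]] shf_smult_closed[OF T(1) fT rs]])
      fix v assume v: "v \<in> T"
      obtain W x y where W: "zopen W" "v \<in> W" "W \<subseteq> T" "repr P (res ?S U T s) W x" "repr P (res ?S U T s) W y"
        using repr_common[OF rs rs v] .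
      have sW: "repr P s W x" using W(4) by (simp add: repr_res_shf_iff[OF W(3)])
      have WU: "W \<subseteq> U" using W(3) T(2) by blast
      show "\<exists>W x. v \<in> W \<and> repr P (res ?S U T (f \<odot>\<^bsub>sec ?S U\<^esub> s)) W x \<and>
          repr P (rst T f \<odot>\<^bsub>sec ?S T\<^esub> res ?S U T s) W x"
        using repr_smult[OF W(4) T(1) W(3) fT] repr_res_shf[OF repr_smult[OF sW U WU f] W(3), of U] W(2,3) by auto
    qed
  }
next
  let ?S = "sheafify P"
  fix U :: "'k pt set" and s assume "zopen U" "s \<in> secs ?S U"
  then show "res ?S U U s = s" by (intro ext) (simp add: mem_sheafify sheafify_simps)
next
  let ?S = "sheafify P"
  fix U W T :: "'k pt set" and s assume "zopen U" "zopen W" "zopen T" "T \<subseteq> W" "W \<subseteq> U" "s \<in> secs ?S U"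
  then show "res ?S W T (res ?S U W s) = res ?S U T s" by (intro ext) (auto simp only: sheafify_simps split: if_splits)
next
  let ?S = "sheafify P"
  fix \<W> :: "'k pt set set" and s t assume "\<And>W. W \<in> \<W> \<Longrightarrow> zopen W" and U: "zopen (\<Union>\<W>)" and st: "s \<in> secs ?S (\<Union>\<W>)" "t \<in> secs ?S (\<Union>\<W>)"
    and c: "\<And>W. W \<in> \<W> \<Longrightarrow> res ?S (\<Union>\<W>) W s = res ?S (\<Union>\<W>) W t"
  show "s = t"
  proof
    fix v show "s v = t v"
    proof (cases "v \<in> \<Union>\<W>")
      case True
      then obtain W where W: "W \<in> \<W>" "v \<in> W" by blast
      then show ?thesis using fun_cong[OF c[OF W(1)], of v] by (simp add: sheafify_simps)
    next
      case False
      then show ?thesis using st by (simp add: mem_sheafify)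
    qed
  qed
next
  let ?S = "sheafify P"
  fix \<W> :: "'k pt set set" and s assume WW: "\<And>W. W \<in> \<W> \<Longrightarrow> zopen W" and U: "zopen (\<Union>\<W>)" and s: "\<And>W. W \<in> \<W> \<Longrightarrow> s W \<in> secs ?S W"
    and c: "\<And>W T. \<lbrakk>W \<in> \<W>; T \<in> \<W>\<rbrakk> \<Longrightarrow> res ?S W (W \<inter> T) (s W) = res ?S T (W \<inter> T) (s T)"
  define x where "x v = (if v \<in> \<Union>\<W> then s (SOME W. W \<in> \<W> \<and> v \<in> W) v else {})" for v
  have x: "x v = s W v" if "W \<in> \<W>" "v \<in> W" for v W
  proof -
    let ?T = "SOME W. W \<in> \<W> \<and> v \<in> W"
    have T: "?T \<in> \<W>" "v \<in> ?T" using someI[of "\<lambda>W. W \<in> \<W> \<and> v \<in> W" W] that by auto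
    show ?thesis using that T fun_cong[OF c[OF that(1) T(1)], of v] by (auto simp: x_def sheafify_simps)
  qed
  show "\<exists>x\<in>secs ?S (\<Union>\<W>). \<forall>W\<in>\<W>. res ?S (\<Union>\<W>) W x = s W"
  proof (intro bexI ballI)
    fix W assume W: "W \<in> \<W>"
    have "s W v = {}" if "v \<notin> W" for v using s[OF W] that by (auto simp: mem_sheafify)
    then show "res ?S (\<Union>\<W>) W x = s W" using x[OF W] by (auto simp: sheafify_simps fun_eq_iff)
  next
    show "x \<in> secs ?S (\<Union>\<W>)"
      unfolding mem_sheafify
    proof (intro conjI allI impI ballI)
      fix v assume "v \<in> \<Union>\<W>"
      then obtain T where T: "T \<in> \<W>" "v \<in> T" by blast
      obtain W y where W: "v \<in> W" "W \<subseteq> T" "repr P (s T) W y"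
        using s[OF T(1)] T(2) unfolding mem_sheafify by blast
      then have "repr P x W y" using x[OF T(1)] unfolding repr_def by auto
      then show "\<exists>W y. v \<in> W \<and> W \<subseteq> \<Union>\<W> \<and> repr P x W y" using W T by blast
    qed (simp add: x_def)
  qed
qed

lemma to_shf_add:
  assumes U: "zopen U" "x \<in> secs P U" "y \<in> secs P U"
  shows "to_shf P U (x \<oplus>\<^bsub>sec P U\<^esub> y) = to_shf P U x \<oplus>\<^bsub>sec (sheafify P) U\<^esub> to_shf P U y"
proof (rule shf_eqI[OF to_shf_closed[OF U(1) add_closed[OF U]]
      shf_add_closed[OF U(1) to_shf_closed[OF U(1,2)] to_shf_closed[OF U(1,3)]]])
  fix v assume "v \<in> U"
  then show "\<exists>W z. v \<in> W \<and> repr P (to_shf P U (x \<oplus>\<^bsub>sec P U\<^esub> y)) W z \<and>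
      repr P (to_shf P U x \<oplus>\<^bsub>sec (sheafify P) U\<^esub> to_shf P U y) W z"
    using repr_to_shf[OF U(1,1) _ add_closed[OF U]] repr_add[OF repr_to_shf[OF U(1,1) _ U(2)] repr_to_shf[OF U(1,1) _ U(3)], of U]
      res_id[OF U(1)] U(2,3) add_closed[OF U] by (intro exI[of _ U] exI[of _ "x \<oplus>\<^bsub>sec P U\<^esub> y"]) auto
qed

lemma to_shf_smult:
  assumes U: "zopen U" "f \<in> regular 0 0 U" "x \<in> secs P U"
  shows "to_shf P U (f \<odot>\<^bsub>sec P U\<^esub> x) = f \<odot>\<^bsub>sec (sheafify P) U\<^esub> to_shf P U x"
proof (rule shf_eqI[OF to_shf_closed[OF U(1) smult_closed[OF U]]
      shf_smult_closed[OF U(1,2) to_shf_closed[OF U(1,3)]]])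
  fix v assume "v \<in> U"
  then show "\<exists>W z. v \<in> W \<and> repr P (to_shf P U (f \<odot>\<^bsub>sec P U\<^esub> x)) W z \<and>
      repr P (f \<odot>\<^bsub>sec (sheafify P) U\<^esub> to_shf P U x) W z"
    using repr_to_shf[OF U(1,1) _ smult_closed[OF U]] repr_smult[OF repr_to_shf[OF U(1,1) _ U(3)] U(1) _ U(2)]
      res_id[OF U(1)] U(3) smult_closed[OF U] rst_self[OF U(2)]
    by (intro exI[of _ U] exI[of _ "f \<odot>\<^bsub>sec P U\<^esub> x"]) auto
qed

lemma to_shf_res:
  assumes "zopen U" "zopen W" "W \<subseteq> U" "x \<in> secs P U"
  shows "res (sheafify P) U W (to_shf P U x) = to_shf P W (res P U W x)"
  using assms germ_res[OF assms(1,2,3) _ assms(4)] by (auto simp: to_shf_def sheafify_simps fun_eq_iff)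

text \<open>
  The kernel of sheafification: two sections of the presheaf become equal iff they agree locally.
\<close>

lemma to_shf_eq_iff:
  assumes U: "zopen U" "x \<in> secs P U" "y \<in> secs P U"
  shows "to_shf P U x = to_shf P U y \<longleftrightarrow>
    (\<forall>v\<in>U. \<exists>W. zopen W \<and> v \<in> W \<and> W \<subseteq> U \<and> res P U W x = res P U W y)"
proof -
  have "to_shf P U x = to_shf P U y \<longleftrightarrow> (\<forall>v\<in>U. germ P v U x = germ P v U y)"
    by (auto simp: to_shf_def fun_eq_iff)
  then show ?thesis using germ_eq_iff[OF U(1,1) _ _ U(2,3)] by simp
qed

lemma to_shf_locally_surj:
  assumes U: "zopen U" and s: "s \<in> secs (sheafify P) U" and v: "v \<in> U"
  obtains W x where "zopen W" "v \<in> W" "W \<subseteq> U" "x \<in> secs P W" "res (sheafify P) U W s = to_shf P W x"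
proof -
  obtain W x where W: "v \<in> W" "W \<subseteq> U" "repr P s W x" using s v unfolding mem_sheafify by blast
  then have "res (sheafify P) U W s w = to_shf P W x w" for w
    unfolding repr_def sheafify_simps to_shf_def by simp
  then have "res (sheafify P) U W s = to_shf P W x" by (rule ext)
  then show ?thesis using that W unfolding repr_def by blast
qed

end

section \<open>Homomorphisms and quotients\<close>

lemma regular_mult0: "f \<in> regular 0 0 U \<Longrightarrow> g \<in> regular a b U \<Longrightarrow> (\<lambda>v. f v * g v) \<in> regular a b U"
  by (rule regular_mult) auto

lemma o_hom_onD:
  assumes "o_hom_on X M N F" "zopen U" "U \<subseteq> X"
  shows o_hom_on_closed: "x \<in> secs M U \<Longrightarrow> F U x \<in> secs N U"
    and o_hom_on_add: "x \<in> secs M U \<Longrightarrow> y \<in> secs M U \<Longrightarrow>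
      F U (x \<oplus>\<^bsub>sec M U\<^esub> y) = F U x \<oplus>\<^bsub>sec N U\<^esub> F U y"
    and o_hom_on_smult: "f \<in> regular 0 0 U \<Longrightarrow> x \<in> secs M U \<Longrightarrow>
      F U (f \<odot>\<^bsub>sec M U\<^esub> x) = f \<odot>\<^bsub>sec N U\<^esub> F U x"
    and o_hom_on_res: "zopen W \<Longrightarrow> W \<subseteq> U \<Longrightarrow> x \<in> secs M U \<Longrightarrow> F W (res M U W x) = res N U W (F U x)"
  using assms unfolding o_hom_on_def by blast+

lemma o_homD:
  assumes "o_hom M N F" "zopen U"
  shows o_hom_closed: "x \<in> secs M U \<Longrightarrow> F U x \<in> secs N U"
    and o_hom_add: "x \<in> secs M U \<Longrightarrow> y \<in> secs M U \<Longrightarrow>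
      F U (x \<oplus>\<^bsub>sec M U\<^esub> y) = F U x \<oplus>\<^bsub>sec N U\<^esub> F U y"
    and o_hom_smult: "f \<in> regular 0 0 U \<Longrightarrow> x \<in> secs M U \<Longrightarrow>
      F U (f \<odot>\<^bsub>sec M U\<^esub> x) = f \<odot>\<^bsub>sec N U\<^esub> F U x"
    and o_hom_res: "zopen W \<Longrightarrow> W \<subseteq> U \<Longrightarrow> x \<in> secs M U \<Longrightarrow> F W (res M U W x) = res N U W (F U x)"
  using o_hom_onD[OF assms zopen_subset[OF assms(2)]] by blast+

lemma o_hom_onI:
  assumes "\<And>U x. \<lbrakk>zopen U; U \<subseteq> X; x \<in> secs M U\<rbrakk> \<Longrightarrow> F U x \<in> secs N U"
    and "\<And>U x y. \<lbrakk>zopen U; U \<subseteq> X; x \<in> secs M U; y \<in> secs M U\<rbrakk> \<Longrightarrow>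
      F U (x \<oplus>\<^bsub>sec M U\<^esub> y) = F U x \<oplus>\<^bsub>sec N U\<^esub> F U y"
    and "\<And>U f x. \<lbrakk>zopen U; U \<subseteq> X; f \<in> regular 0 0 U; x \<in> secs M U\<rbrakk> \<Longrightarrow>
      F U (f \<odot>\<^bsub>sec M U\<^esub> x) = f \<odot>\<^bsub>sec N U\<^esub> F U x"
    and "\<And>U W x. \<lbrakk>zopen U; U \<subseteq> X; zopen W; W \<subseteq> U; x \<in> secs M U\<rbrakk> \<Longrightarrow> F W (res M U W x) = res N U W (F U x)"
  shows "o_hom_on X M N F"
  unfolding o_hom_on_def using assms by (auto simp: Pi_iff)

lemma o_hom_on_zero:
  assumes "o_hom_on X M N F" "presheaf M" "presheaf N" "zopen U" "U \<subseteq> X"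
  shows "F U \<zero>\<^bsub>sec M U\<^esub> = \<zero>\<^bsub>sec N U\<^esub>"
proof -
  have z: "\<zero>\<^bsub>sec M U\<^esub> \<in> secs M U" by (rule presheaf.zero_closed[OF assms(2,4)])
  have "F U \<zero>\<^bsub>sec M U\<^esub> = F U ((\<lambda>_. 0) \<odot>\<^bsub>sec M U\<^esub> \<zero>\<^bsub>sec M U\<^esub>)"
    using module.smult_l_null[OF presheaf.sec_module[OF assms(2,4)] z] by simp
  also have "\<dots> = (\<lambda>_. 0) \<odot>\<^bsub>sec N U\<^esub> F U \<zero>\<^bsub>sec M U\<^esub>"
    by (rule o_hom_on_smult[OF assms(1,4,5) regular_0[OF assms(4)] z])
  also have "\<dots> = \<zero>\<^bsub>sec N U\<^esub>"
    using module.smult_l_null[OF presheaf.sec_module[OF assms(3,4)] o_hom_on_closed[OF assms(1,4,5) z]] by simp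
  finally show ?thesis .
qed

lemma o_hom_on_diff:
  assumes "o_hom_on X M N F" "presheaf M" "presheaf N" "zopen U" "U \<subseteq> X" "x \<in> secs M U" "y \<in> secs M U"
  shows "F U (x \<ominus>\<^bsub>sec M U\<^esub> y) = F U x \<ominus>\<^bsub>sec N U\<^esub> F U y"
proof -
  interpret A: abelian_group "sec M U" using presheaf.ab[OF assms(2,4)] .
  interpret B: abelian_group "sec N U" using presheaf.ab[OF assms(3,4)] .
  note c = o_hom_on_closed[OF assms(1,4,5)]
  have my: "\<ominus>\<^bsub>sec M U\<^esub> y \<in> secs M U" using assms(7) by simp
  have "F U (\<ominus>\<^bsub>sec M U\<^esub> y) \<oplus>\<^bsub>sec N U\<^esub> F U y = \<zero>\<^bsub>sec N U\<^esub>"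
    using o_hom_on_add[OF assms(1,4,5) my assms(7)] A.l_neg[OF assms(7)] o_hom_on_zero[OF assms(1-5)] by simp
  then have "F U (\<ominus>\<^bsub>sec M U\<^esub> y) = \<ominus>\<^bsub>sec N U\<^esub> F U y"
    using B.minus_equality c[OF my] c[OF assms(7)] by simp
  then show ?thesis unfolding a_minus_def using o_hom_on_add[OF assms(1,4,5,6) my] by simp
qed

lemmas o_hom_zero = o_hom_on_zero[OF _ _ _ _ zopen_subset]
lemma o_hom_on_eq_iff:
  assumes "o_hom_on X M N F" "presheaf M" "presheaf N" "zopen U" "U \<subseteq> X" "x \<in> secs M U" "y \<in> secs M U"
  shows "F U x = F U y \<longleftrightarrow> F U (x \<ominus>\<^bsub>sec M U\<^esub> y) = \<zero>\<^bsub>sec N U\<^esub>"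
  unfolding o_hom_on_diff[OF assms]
  using presheaf.diff_zero_iff[OF assms(3,4)] o_hom_on_closed[OF assms(1,4,5)] assms(6,7) by simp

lemma in_imageE:
  assumes "in_image M F N U y" "v \<in> U"
  obtains W x where "zopen W" "v \<in> W" "W \<subseteq> U" "x \<in> secs M W" "res N U W y = F W x"
  using assms unfolding in_image_def by blast

text \<open>
  A homomorphism that kills the kernel of a surjective homomorphism \<open>\<rho>\<close> of sheaves factors through
  it: the values on local preimages under \<open>\<rho>\<close> do not depend on the preimages, and therefore glue.
\<close>

lemma hom_factor:
  fixes N :: "('k::field, 'n, 'z) osheaf_scheme" and Q :: "('k, 'q, 'y) osheaf_scheme"
    and Q' :: "('k, 'r, 'x) osheaf_scheme"
  assumes N: "presheaf N" and Q: "presheaf Q" and Q': "O_module Q'"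
    and \<rho>: "o_hom_on X N Q \<rho>" and \<rho>': "o_hom_on X N Q' \<rho>'"
    and surj: "\<And>U z. zopen U \<Longrightarrow> U \<subseteq> X \<Longrightarrow> z \<in> secs Q U \<Longrightarrow> in_image N \<rho> Q U z"
    and ker: "\<And>U y. zopen U \<Longrightarrow> U \<subseteq> X \<Longrightarrow> y \<in> secs N U \<Longrightarrow> \<rho> U y = \<zero>\<^bsub>sec Q U\<^esub> \<Longrightarrow> \<rho>' U y = \<zero>\<^bsub>sec Q' U\<^esub>"
  obtains F where "o_hom_on X Q Q' F" "\<And>U y. zopen U \<Longrightarrow> U \<subseteq> X \<Longrightarrow> y \<in> secs N U \<Longrightarrow> F U (\<rho> U y) = \<rho>' U y"
proof -
  interpret N: presheaf N by (rule N)
  interpret Q: presheaf Q by (rule Q)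
  interpret Q': O_module Q' by (rule Q')
  have ker': "\<rho>' W y = \<rho>' W y'" if "zopen W" "W \<subseteq> X" "y \<in> secs N W" "y' \<in> secs N W" "\<rho> W y = \<rho> W y'" for W y y'
    using that ker[OF that(1,2), of "y \<ominus>\<^bsub>sec N W\<^esub> y'"] N.diff_closed[OF that(1,3,4)]
      o_hom_on_eq_iff[OF \<rho> N Q that(1-4)] o_hom_on_eq_iff[OF \<rho>' N Q'.presheaf that(1-4)] by simp
  \<comment> \<open>\<open>z\<close> is the value at \<open>q\<close> that is computed from some preimage of \<open>q\<close> over \<open>W\<close>.\<close>
  define R where "R U q W z \<longleftrightarrow> (\<exists>y\<in>secs N W. res Q U W q = \<rho> W y \<and> z = \<rho>' W y)" for U q W z
  define F where "F U q = (THE z. z \<in> secs Q' U \<and> (\<forall>v\<in>U. \<exists>W. zopen W \<and> v \<in> W \<and> W \<subseteq> U \<and> R U q W (res Q' U W z)))" for U q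
  have restR: "R U q T (res Q' W T z)"
    if "zopen U" "U \<subseteq> X" "q \<in> secs Q U" "zopen W" "W \<subseteq> U" "zopen T" "T \<subseteq> W" and Rz: "R U q W z" for U q W T z
  proof -
    obtain y where y: "y \<in> secs N W" "res Q U W q = \<rho> W y" "z = \<rho>' W y" using Rz unfolding R_def by blast
    have "res Q U T q = \<rho> T (res N W T y)"
      using Q.res_res[OF that(1,4,6,7,5,3)] y o_hom_on_res[OF \<rho> that(4) _ that(6,7) y(1)] that by auto
    moreover have "res Q' W T z = \<rho>' T (res N W T y)"
      using y o_hom_on_res[OF \<rho>' that(4) _ that(6,7) y(1)] that by auto
    ultimately show ?thesis unfolding R_def using N.res_closed[OF that(4,6,7) y(1)] by blast
  qed
  have ex1: "\<exists>!z. z \<in> secs Q' U \<and> (\<forall>v\<in>U. \<exists>W. zopen W \<and> v \<in> W \<and> W \<subseteq> U \<and> R U q W (res Q' U W z))"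
    if U: "zopen U" "U \<subseteq> X" and q: "q \<in> secs Q U" for U q
  proof (rule Q'.glue_unique[OF U(1)])
    show "R U q T (res Q' W T z)" if "zopen W" "W \<subseteq> U" "zopen T" "T \<subseteq> W" "z \<in> secs Q' W" "R U q W z" for W T z
      using restR[OF U q that(1-4,6)] .
    show "z = z'" if "zopen W" "W \<subseteq> U" "z \<in> secs Q' W" "z' \<in> secs Q' W" "R U q W z" "R U q W z'" for W z z'
      using that(5,6) ker'[OF that(1)] that(2) U(2) unfolding R_def by (metis order.trans)
    show "\<exists>W z. zopen W \<and> v \<in> W \<and> W \<subseteq> U \<and> z \<in> secs Q' W \<and> R U q W z" if v: "v \<in> U" for v
    proof -
      obtain W y where W: "zopen W" "v \<in> W" "W \<subseteq> U" "y \<in> secs N W" "res Q U W q = \<rho> W y"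
        using in_imageE[OF surj[OF U q] v] .
      then have "\<rho>' W y \<in> secs Q' W" "R U q W (\<rho>' W y)"
        using o_hom_on_closed[OF \<rho>'] U unfolding R_def by auto
      then show ?thesis using W by blast
    qed
  qed
  have F: "F U q \<in> secs Q' U" "\<And>v. v \<in> U \<Longrightarrow> \<exists>W. zopen W \<and> v \<in> W \<and> W \<subseteq> U \<and> R U q W (res Q' U W (F U q))"
    if "zopen U" "U \<subseteq> X" "q \<in> secs Q U" for U q
    using theI'[OF ex1[OF that]] unfolding F_def[symmetric] by auto
  have Fy: "res Q' U W (F U q) = \<rho>' W y"
    if U: "zopen U" "U \<subseteq> X" "q \<in> secs Q U" and W: "zopen W" "W \<subseteq> U" "y \<in> secs N W" "res Q U W q = \<rho> W y" for U q W y
  proof (rule Q'.eq_locally[OF W(1) Q'.res_closed[OF U(1) W(1,2) F(1)[OF U]]])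
    have WX: "W \<subseteq> X" using W U by blast
    show "\<rho>' W y \<in> secs Q' W" using o_hom_on_closed[OF \<rho>' W(1) WX W(3)] .
    fix v assume v: "v \<in> W"
    then obtain T where T: "zopen T" "v \<in> T" "T \<subseteq> U" "R U q T (res Q' U T (F U q))" using F(2)[OF U] W by blast
    have S: "zopen (T \<inter> W)" "T \<inter> W \<subseteq> X" using T W zopen_Int WX by blast+
    have "R U q (T \<inter> W) (res Q' U (T \<inter> W) (F U q))"
      using restR[OF U T(1,3) S(1) _ T(4)] Q'.res_res[OF U(1) T(1) S(1) _ T(3) F(1)[OF U]] by simp
    moreover have "R U q (T \<inter> W) (\<rho>' (T \<inter> W) (res N W (T \<inter> W) y))"
      using restR[OF U W(1,2) S(1), of "\<rho>' W y"] W o_hom_on_res[OF \<rho>' W(1) WX S(1) _ W(3)] unfolding R_def by auto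
    ultimately have "res Q' U (T \<inter> W) (F U q) = \<rho>' (T \<inter> W) (res N W (T \<inter> W) y)"
      unfolding R_def using ker'[OF S] by metis
    then have "res Q' W (T \<inter> W) (res Q' U W (F U q)) = res Q' W (T \<inter> W) (\<rho>' W y)"
      using Q'.res_res[OF U(1) W(1) S(1) _ W(2) F(1)[OF U]] o_hom_on_res[OF \<rho>' W(1) WX S(1) _ W(3)] by simp
    then show "\<exists>T. zopen T \<and> v \<in> T \<and> T \<subseteq> W \<and> res Q' W T (res Q' U W (F U q)) = res Q' W T (\<rho>' W y)"
      using S T v by (intro exI[of _ "T \<inter> W"]) auto
  qed
  have F\<rho>: "F U (\<rho> U y) = \<rho>' U y" if U: "zopen U" "U \<subseteq> X" and y: "y \<in> secs N U" for U y
  proof -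
    have q: "\<rho> U y \<in> secs Q U" using o_hom_on_closed[OF \<rho> U y] .
    show ?thesis using Fy[OF U q U(1) _ y Q.res_id[OF U(1) q]] Q'.res_id[OF U(1) F(1)[OF U q]] by simp
  qed
  have "o_hom_on X Q Q' F"
  proof (rule o_hom_onI)
    fix U q assume U: "zopen U" "U \<subseteq> X" and q: "q \<in> secs Q U"
    show Fc: "F U q \<in> secs Q' U" using F(1)[OF U q] .
    {
      fix q' assume q': "q' \<in> secs Q U"
      note qq = Q.add_closed[OF U(1) q q']
      show "F U (q \<oplus>\<^bsub>sec Q U\<^esub> q') = F U q \<oplus>\<^bsub>sec Q' U\<^esub> F U q'"
      proof (rule Q'.eq_locally[OF U(1) F(1)[OF U qq] Q'.pre.add_closed[OF U(1) F(1)[OF U q] F(1)[OF U q']]])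
        fix v assume v: "v \<in> U"
        obtain W y where W: "zopen W" "v \<in> W" "W \<subseteq> U" "y \<in> secs N W" "res Q U W q = \<rho> W y"
          using in_imageE[OF surj[OF U q] v] .
        obtain T y' where T: "zopen T" "v \<in> T" "T \<subseteq> U" "y' \<in> secs N T" "res Q U T q' = \<rho> T y'"
          using in_imageE[OF surj[OF U q'] v] .
        let ?S = "W \<inter> T"
        have S: "zopen ?S" "?S \<subseteq> U" "?S \<subseteq> X" "?S \<subseteq> W" "?S \<subseteq> T" using W T U zopen_Int by auto
        have WX: "W \<subseteq> X" "T \<subseteq> X" using W T U by auto
        let ?y = "res N W ?S y" and ?y' = "res N T ?S y'"
        have y: "?y \<in> secs N ?S" "?y' \<in> secs N ?S" using N.res_closed S W T by auto
        have r: "res Q U ?S q = \<rho> ?S ?y" "res Q U ?S q' = \<rho> ?S ?y'"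
          using o_hom_on_res[OF \<rho> W(1) WX(1) S(1) S(4) W(4)] o_hom_on_res[OF \<rho> T(1) WX(2) S(1) S(5) T(4)]
            Q.res_res[OF U(1) W(1) S(1) S(4) W(3) q] Q.res_res[OF U(1) T(1) S(1) S(5) T(3) q'] W T by auto
        have "res Q U ?S (q \<oplus>\<^bsub>sec Q U\<^esub> q') = \<rho> ?S (?y \<oplus>\<^bsub>sec N ?S\<^esub> ?y')"
          using Q.res_add[OF U(1) S(1,2) q q'] o_hom_on_add[OF \<rho> S(1,3) y] r by simp
        then have "res Q' U ?S (F U (q \<oplus>\<^bsub>sec Q U\<^esub> q')) = res Q' U ?S (F U q \<oplus>\<^bsub>sec Q' U\<^esub> F U q')"
          using Fy[OF U qq S(1,2) N.add_closed[OF S(1) y]] Fy[OF U q S(1,2) y(1) r(1)] Fy[OF U q' S(1,2) y(2) r(2)]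
            Q'.res_add[OF U(1) S(1,2) F(1)[OF U q] F(1)[OF U q']] o_hom_on_add[OF \<rho>' S(1,3) y] by simp
        then show "\<exists>W. zopen W \<and> v \<in> W \<and> W \<subseteq> U \<and> res Q' U W (F U (q \<oplus>\<^bsub>sec Q U\<^esub> q')) = res Q' U W (F U q \<oplus>\<^bsub>sec Q' U\<^esub> F U q')"
          using S W T by (intro exI[of _ ?S]) auto
      qed
    next
      fix f assume f: "f \<in> regular 0 0 U"
      note qq = Q.smult_closed[OF U(1) f q]
      show "F U (f \<odot>\<^bsub>sec Q U\<^esub> q) = f \<odot>\<^bsub>sec Q' U\<^esub> F U q"
      proof (rule Q'.eq_locally[OF U(1) F(1)[OF U qq] Q'.pre.smult_closed[OF U(1) f F(1)[OF U q]]])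
        fix v assume v: "v \<in> U"
        obtain W y where W: "zopen W" "v \<in> W" "W \<subseteq> U" "y \<in> secs N W" "res Q U W q = \<rho> W y"
          using in_imageE[OF surj[OF U q] v] .
        have WX: "W \<subseteq> X" using W U by auto
        have fW: "rst W f \<in> regular 0 0 W" using regular_rst[OF f W(1,3)] .
        have "res Q U W (f \<odot>\<^bsub>sec Q U\<^esub> q) = \<rho> W (rst W f \<odot>\<^bsub>sec N W\<^esub> y)"
          using Q.res_smult[OF U(1) W(1,3) q f] o_hom_on_smult[OF \<rho> W(1) WX fW W(4)] W by simp
        then have "res Q' U W (F U (f \<odot>\<^bsub>sec Q U\<^esub> q)) = res Q' U W (f \<odot>\<^bsub>sec Q' U\<^esub> F U q)"
          using Fy[OF U qq W(1,3) N.smult_closed[OF W(1) fW W(4)]] Fy[OF U q W(1,3,4,5)]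
            Q'.res_smult[OF U(1) W(1,3) F(1)[OF U q] f] o_hom_on_smult[OF \<rho>' W(1) WX fW W(4)] by simp
        then show "\<exists>W. zopen W \<and> v \<in> W \<and> W \<subseteq> U \<and> res Q' U W (F U (f \<odot>\<^bsub>sec Q U\<^esub> q)) = res Q' U W (f \<odot>\<^bsub>sec Q' U\<^esub> F U q)"
          using W by blast
      qed
    next
      fix V assume V: "zopen V" "V \<subseteq> U"
      have VX: "V \<subseteq> X" using V U by auto
      note qV = Q.res_closed[OF U(1) V q]
      show "F V (res Q U V q) = res Q' U V (F U q)"
      proof (rule Q'.eq_locally[OF V(1) F(1)[OF V(1) VX qV] Q'.res_closed[OF U(1) V F(1)[OF U q]]])
        fix v assume v: "v \<in> V"
        obtain W y where W: "zopen W" "v \<in> W" "W \<subseteq> V" "y \<in> secs N W" "res Q V W (res Q U V q) = \<rho> W y"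
          using in_imageE[OF surj[OF V(1) VX qV] v] .
        have WU: "W \<subseteq> U" using W V by auto
        have "res Q U W q = \<rho> W y" using W(5) Q.res_res[OF U(1) V(1) W(1,3) V(2) q] by simp
        then have "res Q' V W (F V (res Q U V q)) = res Q' V W (res Q' U V (F U q))"
          using Fy[OF V(1) VX qV W(1,3,4,5)] Fy[OF U q W(1) WU W(4)]
            Q'.res_res[OF U(1) V(1) W(1,3) V(2) F(1)[OF U q]] by simp
        then show "\<exists>W. zopen W \<and> v \<in> W \<and> W \<subseteq> V \<and> res Q' V W (F V (res Q U V q)) = res Q' V W (res Q' U V (F U q))"
          using W by blast
      qed
    }
  qed
  then show thesis using that F\<rho> by blast
qed

text \<open>
  Two surjective homomorphisms with the same kernel factor through each other, and the two
  factorisations are inverse to each other. All identifications of cokernels rest on this.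
\<close>

lemma quotients_iso:
  assumes N: "presheaf N" and Q: "O_module Q" and Q': "O_module Q'"
    and \<rho>: "o_hom N Q \<rho>" and \<rho>': "o_hom N Q' \<rho>'"
    and surj: "\<And>U z. zopen U \<Longrightarrow> z \<in> secs Q U \<Longrightarrow> in_image N \<rho> Q U z"
    and surj': "\<And>U z. zopen U \<Longrightarrow> z \<in> secs Q' U \<Longrightarrow> in_image N \<rho>' Q' U z"
    and ker: "\<And>U y. zopen U \<Longrightarrow> y \<in> secs N U \<Longrightarrow> \<rho> U y = \<zero>\<^bsub>sec Q U\<^esub> \<longleftrightarrow> \<rho>' U y = \<zero>\<^bsub>sec Q' U\<^esub>"
  obtains F where "o_hom Q Q' F" "bij_on_sections Q Q' F"
    "\<And>U y. zopen U \<Longrightarrow> y \<in> secs N U \<Longrightarrow> F U (\<rho> U y) = \<rho>' U y"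
proof -
  have P: "presheaf Q" "presheaf Q'" using O_module.presheaf Q Q' by auto
  obtain F where F: "o_hom Q Q' F" "\<And>U y. zopen U \<Longrightarrow> U \<subseteq> ycone \<Longrightarrow> y \<in> secs N U \<Longrightarrow> F U (\<rho> U y) = \<rho>' U y"
    using hom_factor[OF N P(1) Q' \<rho> \<rho>'] surj ker by metis
  obtain G where G: "o_hom Q' Q G" "\<And>U y. zopen U \<Longrightarrow> U \<subseteq> ycone \<Longrightarrow> y \<in> secs N U \<Longrightarrow> G U (\<rho>' U y) = \<rho> U y"
    using hom_factor[OF N P(2) Q \<rho>' \<rho>] surj' ker by metis
  have inv: "H' U (H U q) = q"
    if R: "O_module R" and R': "presheaf R'" and H: "o_hom R R' H" and H': "o_hom R' R H'" and U: "zopen U" and q: "q \<in> secs R U"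
      and im: "in_image N \<tau> R U q"
      and t: "\<And>U y. zopen U \<Longrightarrow> y \<in> secs N U \<Longrightarrow> H U (\<tau> U y) = \<tau>' U y"
      and t': "\<And>U y. zopen U \<Longrightarrow> y \<in> secs N U \<Longrightarrow> H' U (\<tau>' U y) = \<tau> U y"
    for R :: "('a, 'm, 'x) osheaf_scheme" and R' :: "('a, 'n, 'y) osheaf_scheme" and H H' U q \<tau> \<tau>'
  proof (rule O_module.eq_locally[OF R U o_hom_closed[OF H' U o_hom_closed[OF H U q]] q])
    fix v assume v: "v \<in> U"
    obtain W y where W: "zopen W" "v \<in> W" "W \<subseteq> U" "y \<in> secs N W" "res R U W q = \<tau> W y"
      using in_imageE[OF im v] .
    have "res R U W (H' U (H U q)) = H' W (H W (res R U W q))"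
      using o_hom_res[OF H' U W(1,3) o_hom_closed[OF H U q]] o_hom_res[OF H U W(1,3) q] by simp
    also have "\<dots> = res R U W q" using W t t' by simp
    finally show "\<exists>W. zopen W \<and> v \<in> W \<and> W \<subseteq> U \<and> res R U W (H' U (H U q)) = res R U W q" using W by blast
  qed
  have "bij_on_sections Q Q' F"
    unfolding bij_on_sections_def
  proof (intro allI impI, rule bij_betw_byWitness)
    fix U :: "'a pt set" assume U: "zopen U"
    show "\<forall>q\<in>secs Q U. G U (F U q) = q"
      using inv[OF Q P(2) F(1) G(1) U _ surj[OF U]] F(2)[OF _ zopen_subset] G(2)[OF _ zopen_subset] by blast
    show "\<forall>q\<in>secs Q' U. F U (G U q) = q"
      using inv[OF Q' P(1) G(1) F(1) U _ surj'[OF U]] F(2)[OF _ zopen_subset] G(2)[OF _ zopen_subset] by blast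
    show "F U ` secs Q U \<subseteq> secs Q' U" using o_hom_closed[OF F(1) U] by blast
    show "G U ` secs Q' U \<subseteq> secs Q U" using o_hom_closed[OF G(1) U] by blast
  qed
  then show thesis using that[OF F(1)] F(2) zopen_subset by blast
qed

lemma image_abelian_group:
  assumes N: "abelian_group N" and car: "carrier Q = \<kappa> ` carrier N" and zero: "\<zero>\<^bsub>Q\<^esub> = \<kappa> \<zero>\<^bsub>N\<^esub>"
    and add: "\<And>x y. x \<in> carrier N \<Longrightarrow> y \<in> carrier N \<Longrightarrow> \<kappa> x \<oplus>\<^bsub>Q\<^esub> \<kappa> y = \<kappa> (x \<oplus>\<^bsub>N\<^esub> y)"
  shows "abelian_group Q"
proof -
  interpret N: abelian_group N by (rule N)
  show ?thesis
  proof (rule abelian_groupI)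
    fix x assume "x \<in> carrier Q"
    then obtain a where a: "a \<in> carrier N" "x = \<kappa> a" unfolding car by blast
    show "\<zero>\<^bsub>Q\<^esub> \<oplus>\<^bsub>Q\<^esub> x = x" unfolding zero a(2) using a(1) by (simp add: add)
    show "\<exists>y\<in>carrier Q. y \<oplus>\<^bsub>Q\<^esub> x = \<zero>\<^bsub>Q\<^esub>" unfolding zero a(2) car using a(1) N.l_neg
      by (intro bexI[of _ "\<kappa> (\<ominus>\<^bsub>N\<^esub> a)"]) (auto simp: add)
    fix y assume "y \<in> carrier Q"
    then obtain b where b: "b \<in> carrier N" "y = \<kappa> b" unfolding car by blast
    show "x \<oplus>\<^bsub>Q\<^esub> y \<in> carrier Q" unfolding car a(2) b(2) using a b by (auto simp: add)
    show "x \<oplus>\<^bsub>Q\<^esub> y = y \<oplus>\<^bsub>Q\<^esub> x" unfolding a(2) b(2) using a b by (simp add: add N.a_comm)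
    fix z assume "z \<in> carrier Q"
    then obtain c where c: "c \<in> carrier N" "z = \<kappa> c" unfolding car by blast
    show "x \<oplus>\<^bsub>Q\<^esub> y \<oplus>\<^bsub>Q\<^esub> z = x \<oplus>\<^bsub>Q\<^esub> (y \<oplus>\<^bsub>Q\<^esub> z)"
      unfolding a(2) b(2) c(2) using a b c by (simp add: add N.a_assoc)
  qed (auto simp: car zero)
qed

text \<open>
  A subpresheaf of modules is given by its sets of sections alone, with the operations of \<open>M\<close>.
\<close>

locale sub_presheaf = presheaf M for M :: "('k::field, 'm, 'z) osheaf_scheme" +
  fixes J :: "('k, 'm, 'y) osheaf_scheme"
  assumes sub_closed: "zopen U \<Longrightarrow> secs J U \<subseteq> secs M U"
    and sub_zero: "zopen U \<Longrightarrow> \<zero>\<^bsub>sec M U\<^esub> \<in> secs J U"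
    and sub_add: "\<lbrakk>zopen U; x \<in> secs J U; y \<in> secs J U\<rbrakk> \<Longrightarrow> x \<oplus>\<^bsub>sec M U\<^esub> y \<in> secs J U"
    and sub_smult: "\<lbrakk>zopen U; f \<in> regular 0 0 U; x \<in> secs J U\<rbrakk> \<Longrightarrow> f \<odot>\<^bsub>sec M U\<^esub> x \<in> secs J U"
    and sub_res: "\<lbrakk>zopen U; zopen W; W \<subseteq> U; x \<in> secs J U\<rbrakk> \<Longrightarrow> res M U W x \<in> secs J W"
begin

definition quot where
  "quot = \<lparr>
     sec = (\<lambda>U. \<lparr>carrier = a_rcosets\<^bsub>sec M U\<^esub> (secs J U), mult = undefined, monoid.one = undefined,
        ring.zero = secs J U, ring.add = set_add (sec M U),
        smult = (\<lambda>f X. \<Union>x\<in>X. secs J U +>\<^bsub>sec M U\<^esub> (f \<odot>\<^bsub>sec M U\<^esub> x))\<rparr>),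
     res = (\<lambda>U W X. \<Union>x\<in>X. secs J W +>\<^bsub>sec M W\<^esub> res M U W x)\<rparr>"

lemma oquotient_eq: "oquotient M J = sheafify quot"
  unfolding oquotient_def quot_def by simp

abbreviation coset where "coset U x \<equiv> secs J U +>\<^bsub>sec M U\<^esub> x"

lemma subgroup: assumes U: "zopen U" shows "abelian_subgroup (secs J U) (sec M U)"
proof (rule abelian_subgroupI3)
  interpret A: abelian_group "sec M U" using ab[OF U] .
  show "abelian_group (sec M U)" using ab[OF U] .
  have inv: "\<ominus>\<^bsub>sec M U\<^esub> x \<in> secs J U" if x: "x \<in> secs J U" for x
  proof -
    have xM: "x \<in> secs M U" using x sub_closed[OF U] by blast
    let ?n = "rst U (\<lambda>_. -1) \<odot>\<^bsub>sec M U\<^esub> x"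
    have n: "?n \<in> secs J U" using sub_smult[OF U regular_const[OF U] x] .
    then have "?n \<in> secs M U" using sub_closed[OF U] by blast
    then have "\<ominus>\<^bsub>sec M U\<^esub> x = ?n" using A.minus_equality[OF neg_one_smult[OF U xM] xM] by simp
    then show ?thesis using n by simp
  qed
  show "additive_subgroup (secs J U) (sec M U)"
    unfolding additive_subgroup_def
    by (rule group.subgroupI[OF A.a_group])
      (use sub_closed[OF U] sub_zero[OF U] sub_add[OF U] inv in \<open>auto simp: a_inv_def[symmetric]\<close>)
qed

lemma coset_eq_iff:
  assumes U: "zopen U" "x \<in> secs M U" "y \<in> secs M U"
  shows "coset U x = coset U y \<longleftrightarrow> x \<ominus>\<^bsub>sec M U\<^esub> y \<in> secs J U"
proof -
  interpret S: abelian_subgroup "secs J U" "sec M U" using subgroup[OF U(1)] .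
  show ?thesis
    using S.a_rcos_module[OF U(3,2)] S.a_rcos_self[OF U(2)] S.a_repr_independence'[OF _ U(3)]
    unfolding a_minus_def by metis
qed

lemma mem_coset:
  assumes U: "zopen U" "x \<in> secs M U" and z: "z \<in> coset U x"
  shows "z \<in> secs M U" "coset U z = coset U x"
proof -
  interpret S: abelian_subgroup "secs J U" "sec M U" using subgroup[OF U(1)] .
  show zM: "z \<in> secs M U" using S.a_r_coset_subset_G[OF sub_closed[OF U(1)] U(2)] z by blast
  show "coset U z = coset U x" using S.a_repr_independence'[OF z U(2)] by simp
qed

lemma self_coset: "zopen U \<Longrightarrow> x \<in> secs M U \<Longrightarrow> x \<in> coset U x"
  using abelian_subgroup.a_rcos_self[OF subgroup] .

lemma quot_carrier: "zopen U \<Longrightarrow> secs quot U = coset U ` secs M U"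
  by (auto simp: quot_def A_RCOSETS_def')

lemma quot_zero: "zopen U \<Longrightarrow> \<zero>\<^bsub>sec quot U\<^esub> = coset U \<zero>\<^bsub>sec M U\<^esub>"
  using abelian_group.a_coset_add_zero[OF ab sub_closed] by (simp add: quot_def)

lemma quot_add: "zopen U \<Longrightarrow> x \<in> secs M U \<Longrightarrow> y \<in> secs M U \<Longrightarrow>
    coset U x \<oplus>\<^bsub>sec quot U\<^esub> coset U y = coset U (x \<oplus>\<^bsub>sec M U\<^esub> y)"
  using abelian_subgroup.a_rcos_sum[OF subgroup] by (simp add: quot_def)

lemma quot_smult:
  assumes U: "zopen U" and f: "f \<in> regular 0 0 U" and x: "x \<in> secs M U"
  shows "f \<odot>\<^bsub>sec quot U\<^esub> coset U x = coset U (f \<odot>\<^bsub>sec M U\<^esub> x)"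
proof -
  have "(\<Union>z\<in>coset U x. coset U (f \<odot>\<^bsub>sec M U\<^esub> z)) = coset U (f \<odot>\<^bsub>sec M U\<^esub> x)"
  proof (rule Union_const)
    show "(\<lambda>z. coset U (f \<odot>\<^bsub>sec M U\<^esub> z)) ` coset U x \<noteq> {}" using self_coset[OF U x] by blast
    fix a assume "a \<in> (\<lambda>z. coset U (f \<odot>\<^bsub>sec M U\<^esub> z)) ` coset U x"
    then obtain z where z: "z \<in> coset U x" "a = coset U (f \<odot>\<^bsub>sec M U\<^esub> z)" by blast
    note zM = mem_coset[OF U x z(1)]
    interpret A: module "oring U" "sec M U" using sec_module[OF U] .
    have f': "f \<in> carrier (oring U)" using f by simp
    have "z \<ominus>\<^bsub>sec M U\<^esub> x \<in> secs J U" using coset_eq_iff[OF U zM(1) x] zM(2) by simp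
    then have "f \<odot>\<^bsub>sec M U\<^esub> (z \<ominus>\<^bsub>sec M U\<^esub> x) \<in> secs J U" using sub_smult[OF U f] by blast
    also have "f \<odot>\<^bsub>sec M U\<^esub> (z \<ominus>\<^bsub>sec M U\<^esub> x) = f \<odot>\<^bsub>sec M U\<^esub> z \<ominus>\<^bsub>sec M U\<^esub> f \<odot>\<^bsub>sec M U\<^esub> x"
      unfolding a_minus_def using A.smult_r_distr[OF f' zM(1), of "\<ominus>\<^bsub>sec M U\<^esub> x"] A.smult_r_minus[OF f' x] x
      by simp
    finally show "a = coset U (f \<odot>\<^bsub>sec M U\<^esub> x)"
      unfolding z(2) using coset_eq_iff[OF U smult_closed[OF U f zM(1)] smult_closed[OF U f x]] by simp
  qed
  then show ?thesis by (simp add: quot_def)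
qed

lemma quot_res:
  assumes U: "zopen U" "zopen W" "W \<subseteq> U" and x: "x \<in> secs M U"
  shows "res quot U W (coset U x) = coset W (res M U W x)"
proof -
  have "(\<Union>z\<in>coset U x. coset W (res M U W z)) = coset W (res M U W x)"
  proof (rule Union_const)
    show "(\<lambda>z. coset W (res M U W z)) ` coset U x \<noteq> {}" using self_coset[OF U(1) x] by blast
    fix a assume "a \<in> (\<lambda>z. coset W (res M U W z)) ` coset U x"
    then obtain z where z: "z \<in> coset U x" "a = coset W (res M U W z)" by blast
    note zM = mem_coset[OF U(1) x z(1)]
    have "z \<ominus>\<^bsub>sec M U\<^esub> x \<in> secs J U" using coset_eq_iff[OF U(1) zM(1) x] zM(2) by simp
    then have "res M U W z \<ominus>\<^bsub>sec M W\<^esub> res M U W x \<in> secs J W"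
      using sub_res[OF U] res_diff[OF U zM(1) x] by metis
    then show "a = coset W (res M U W x)"
      unfolding z(2) using coset_eq_iff[OF U(2) res_closed[OF U zM(1)] res_closed[OF U x]] by simp
  qed
  then show ?thesis by (simp add: quot_def)
qed

lemma coset_closed: "zopen U \<Longrightarrow> x \<in> secs M U \<Longrightarrow> coset U x \<in> secs quot U"
  by (simp add: quot_carrier)

lemma presheaf_quot: "presheaf quot"
proof (rule presheaf.intro)
  fix U :: "'k pt set" assume U: "zopen U"
  interpret A: module "oring U" "sec M U" using sec_module[OF U] .
  have E: "\<exists>x\<in>secs M U. X = coset U x" if "X \<in> secs quot U" for X using that quot_carrier[OF U] by blast
  show "module (oring U) (sec quot U)"
  proof (rule moduleI)
    show "cring (oring U)" by (rule oring_cring[OF U])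
    show "abelian_group (sec quot U)"
      by (rule image_abelian_group[OF ab[OF U] quot_carrier[OF U] quot_zero[OF U] quot_add[OF U]])
    fix X assume "X \<in> secs quot U"
    then obtain x where x: "x \<in> secs M U" and [simp]: "X = coset U x" using E by blast
    show "\<one>\<^bsub>oring U\<^esub> \<odot>\<^bsub>sec quot U\<^esub> X = X"
      using quot_smult[OF U regular_const[OF U] x] A.smult_one[OF x] by simp
    fix f assume "f \<in> carrier (oring U)"
    then have f: "f \<in> regular 0 0 U" "f \<in> carrier (oring U)" by auto
    show "f \<odot>\<^bsub>sec quot U\<^esub> X \<in> secs quot U"
      using quot_smult[OF U f(1) x] coset_closed[OF U smult_closed[OF U f(1) x]] by simp
    {
      fix g assume "g \<in> carrier (oring U)"
      then have g: "g \<in> regular 0 0 U" "g \<in> carrier (oring U)" by auto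
      show "(f \<oplus>\<^bsub>oring U\<^esub> g) \<odot>\<^bsub>sec quot U\<^esub> X = f \<odot>\<^bsub>sec quot U\<^esub> X \<oplus>\<^bsub>sec quot U\<^esub> g \<odot>\<^bsub>sec quot U\<^esub> X"
        using quot_smult[OF U f(1) x] quot_smult[OF U g(1) x] quot_smult[OF U regular_add[OF f(1) g(1)] x]
          quot_add[OF U smult_closed[OF U f(1) x] smult_closed[OF U g(1) x]] A.smult_l_distr[OF f(2) g(2) x] by simp
      show "(f \<otimes>\<^bsub>oring U\<^esub> g) \<odot>\<^bsub>sec quot U\<^esub> X = f \<odot>\<^bsub>sec quot U\<^esub> (g \<odot>\<^bsub>sec quot U\<^esub> X)"
        using quot_smult[OF U f(1) smult_closed[OF U g(1) x]] quot_smult[OF U g(1) x]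
          quot_smult[OF U regular_mult0[OF f(1) g(1)] x] A.smult_assoc1[OF f(2) g(2) x] by simp
    next
      fix Y assume "Y \<in> secs quot U"
      then obtain y where y: "y \<in> secs M U" and [simp]: "Y = coset U y" using E by blast
      show "f \<odot>\<^bsub>sec quot U\<^esub> (X \<oplus>\<^bsub>sec quot U\<^esub> Y) = f \<odot>\<^bsub>sec quot U\<^esub> X \<oplus>\<^bsub>sec quot U\<^esub> f \<odot>\<^bsub>sec quot U\<^esub> Y"
        using quot_smult[OF U f(1) x] quot_smult[OF U f(1) y] quot_smult[OF U f(1) add_closed[OF U x y]]
          quot_add[OF U smult_closed[OF U f(1) x] smult_closed[OF U f(1) y]] quot_add[OF U x y]
          A.smult_r_distr[OF f(2) x y] by simp
    }
  qed
next
  fix U X assume U: "zopen U" and "X \<in> secs quot U"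
  then obtain x where x: "x \<in> secs M U" and [simp]: "X = coset U x" using quot_carrier[OF U] by blast
  show "res quot U U X = X" using quot_res[OF U U _ x] res_id[OF U x] by simp
  fix W assume W: "zopen W" "W \<subseteq> U"
  note rx = quot_res[OF U W x]
  show "res quot U W X \<in> secs quot W" using rx coset_closed[OF W(1) res_closed[OF U W x]] by simp
  {
    fix Y assume "Y \<in> secs quot U"
    then obtain y where y: "y \<in> secs M U" and [simp]: "Y = coset U y" using quot_carrier[OF U] by blast
    show "res quot U W (X \<oplus>\<^bsub>sec quot U\<^esub> Y) = res quot U W X \<oplus>\<^bsub>sec quot W\<^esub> res quot U W Y"
      using rx quot_res[OF U W y] quot_res[OF U W add_closed[OF U x y]] quot_add[OF U x y] res_add[OF U W x y]
        quot_add[OF W(1) res_closed[OF U W x] res_closed[OF U W y]] by simp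
  next
    fix f assume f: "f \<in> regular 0 0 U"
    show "res quot U W (f \<odot>\<^bsub>sec quot U\<^esub> X) = rst W f \<odot>\<^bsub>sec quot W\<^esub> res quot U W X"
      using rx quot_res[OF U W smult_closed[OF U f x]] quot_smult[OF U f x] res_smult[OF U W x f]
        quot_smult[OF W(1) regular_rst[OF f W] res_closed[OF U W x]] by simp
  next
    fix T assume T: "zopen T" "T \<subseteq> W"
    have TU: "T \<subseteq> U" using T W by blast
    show "res quot W T (res quot U W X) = res quot U T X"
      using rx quot_res[OF W(1) T res_closed[OF U W x]] quot_res[OF U T(1) TU x] res_res[OF U W(1) T W(2) x] by simp
  }
qed

sublocale Q: presheaf quot
  using presheaf_quot .

definition proj where "proj U x = to_shf quot U (coset U x)"

lemma O_module_oquotient: "O_module (oquotient M J)"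
  unfolding oquotient_eq by (rule Q.O_module_sheafify)

lemma o_hom_proj: "o_hom M (oquotient M J) proj"
  unfolding oquotient_eq
proof (rule o_hom_onI)
  fix U x assume U: "zopen U" and x: "x \<in> secs M U"
  show "proj U x \<in> secs (sheafify quot) U" unfolding proj_def by (rule Q.to_shf_closed[OF U coset_closed[OF U x]])
  show "proj U (x \<oplus>\<^bsub>sec M U\<^esub> y) = proj U x \<oplus>\<^bsub>sec (sheafify quot) U\<^esub> proj U y" if y: "y \<in> secs M U" for y
    unfolding proj_def using Q.to_shf_add[OF U coset_closed[OF U x] coset_closed[OF U y]] quot_add[OF U x y] by simp
  show "proj U (f \<odot>\<^bsub>sec M U\<^esub> x) = f \<odot>\<^bsub>sec (sheafify quot) U\<^esub> proj U x" if f: "f \<in> regular 0 0 U" for f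
    unfolding proj_def using Q.to_shf_smult[OF U f coset_closed[OF U x]] quot_smult[OF U f x] by simp
  show "proj W (res M U W x) = res (sheafify quot) U W (proj U x)" if W: "zopen W" "W \<subseteq> U" for W
    unfolding proj_def using Q.to_shf_res[OF U W coset_closed[OF U x]] quot_res[OF U W x] by simp
qed

lemma proj_surj:
  assumes U: "zopen U" and z: "z \<in> secs (oquotient M J) U" shows "in_image M proj (oquotient M J) U z"
  unfolding in_image_def
proof
  fix v assume v: "v \<in> U"
  have z': "z \<in> secs (sheafify quot) U" using z unfolding oquotient_eq .
  obtain W X where W: "zopen W" "v \<in> W" "W \<subseteq> U" "X \<in> secs quot W" "res (sheafify quot) U W z = to_shf quot W X"
    using Q.to_shf_locally_surj[OF U z' v] .
  then obtain x where "x \<in> secs M W" "X = coset W x" using quot_carrier by blast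
  then have "res (oquotient M J) U W z \<in> proj W ` secs M W" using W unfolding oquotient_eq proj_def by auto
  then show "\<exists>W. zopen W \<and> v \<in> W \<and> W \<subseteq> U \<and> res (oquotient M J) U W z \<in> proj W ` secs M W" using W by blast
qed

text \<open>
  Sheafification makes the kernel of the projection local: it consists of the sections that lie
  locally in \<open>J\<close>.
\<close>

lemma proj_zero_iff:
  assumes U: "zopen U" and x: "x \<in> secs M U"
  shows "proj U x = \<zero>\<^bsub>sec (oquotient M J) U\<^esub> \<longleftrightarrow>
    (\<forall>v\<in>U. \<exists>W. zopen W \<and> v \<in> W \<and> W \<subseteq> U \<and> res M U W x \<in> secs J W)"
proof -
  have z: "\<zero>\<^bsub>sec M U\<^esub> \<in> secs M U" using zero_closed[OF U] .
  have "\<zero>\<^bsub>sec (oquotient M J) U\<^esub> = to_shf quot U (coset U \<zero>\<^bsub>sec M U\<^esub>)"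
    unfolding oquotient_eq sheafify_simps using quot_zero[OF U] by simp
  then have "proj U x = \<zero>\<^bsub>sec (oquotient M J) U\<^esub> \<longleftrightarrow> (\<forall>v\<in>U. \<exists>W. zopen W \<and> v \<in> W \<and> W \<subseteq> U \<and>
      res quot U W (coset U x) = res quot U W (coset U \<zero>\<^bsub>sec M U\<^esub>))"
    unfolding proj_def using Q.to_shf_eq_iff[OF U coset_closed[OF U x] coset_closed[OF U z]] by simp
  moreover have "res quot U W (coset U x) = res quot U W (coset U \<zero>\<^bsub>sec M U\<^esub>) \<longleftrightarrow> res M U W x \<in> secs J W"
    if W: "zopen W" "W \<subseteq> U" for W
  proof -
    interpret A: abelian_group "sec M W" using ab[OF W(1)] .
    have c: "res M U W x \<in> secs M W" using res_closed[OF U W x] .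
    have "res M U W x \<ominus>\<^bsub>sec M W\<^esub> \<zero>\<^bsub>sec M W\<^esub> = res M U W x" unfolding a_minus_def using c by simp
    then show ?thesis
      using quot_res[OF U W x] quot_res[OF U W z] res_zero[OF U W] coset_eq_iff[OF W(1) c zero_closed[OF W(1)]] by simp
  qed
  ultimately show ?thesis by (simp cong: conj_cong)
qed

end

section \<open>Tensor products\<close>

locale tensor_pair = M: module R M + N: module R N
  for R :: "'r ring" and M :: "('r, 'm) module" and N :: "('r, 'n) module"
begin

abbreviation "G \<equiv> free_Abelian_group (carrier M \<times> carrier N)"
abbreviation "H \<equiv> tensor_rels R M N"
abbreviation "K \<equiv> tensor_coset R M N"
abbreviation "fr m n \<equiv> frag_of (m, n)"

lemma keys_fr: "m \<in> carrier M \<Longrightarrow> n \<in> carrier N \<Longrightarrow> fr m n \<in> carrier G"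
  by simp

lemma G_diff: "a \<in> carrier G \<Longrightarrow> b \<in> carrier G \<Longrightarrow> a - b \<in> carrier G"
  using keys_diff[of a b] by auto

lemma G_add: "a \<in> carrier G \<Longrightarrow> b \<in> carrier G \<Longrightarrow> a + b \<in> carrier G"
  using keys_add[of a b] by auto

definition gens where
  "gens = {fr (m \<oplus>\<^bsub>M\<^esub> m') n - fr m n - fr m' n | m m' n.
        m \<in> carrier M \<and> m' \<in> carrier M \<and> n \<in> carrier N} \<union>
     {fr m (n \<oplus>\<^bsub>N\<^esub> n') - fr m n - fr m n' | m n n'.
        m \<in> carrier M \<and> n \<in> carrier N \<and> n' \<in> carrier N} \<union>
     {fr (r \<odot>\<^bsub>M\<^esub> m) n - fr m (r \<odot>\<^bsub>N\<^esub> n) | r m n.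
        r \<in> carrier R \<and> m \<in> carrier M \<and> n \<in> carrier N}"

lemma rels_eq: "H = generate G gens"
  unfolding tensor_rels_def gens_def ..

lemma gen_left: "m \<in> carrier M \<Longrightarrow> m' \<in> carrier M \<Longrightarrow> n \<in> carrier N \<Longrightarrow>
    fr (m \<oplus>\<^bsub>M\<^esub> m') n - fr m n - fr m' n \<in> gens"
  unfolding gens_def by blast

lemma gen_right: "m \<in> carrier M \<Longrightarrow> n \<in> carrier N \<Longrightarrow> n' \<in> carrier N \<Longrightarrow>
    fr m (n \<oplus>\<^bsub>N\<^esub> n') - fr m n - fr m n' \<in> gens"
  unfolding gens_def by blast

lemma gen_balanced: "r \<in> carrier R \<Longrightarrow> m \<in> carrier M \<Longrightarrow> n \<in> carrier N \<Longrightarrow>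
    fr (r \<odot>\<^bsub>M\<^esub> m) n - fr m (r \<odot>\<^bsub>N\<^esub> n) \<in> gens"
  unfolding gens_def by blast

lemma gens_closed: "gens \<subseteq> carrier G"
proof
  fix g assume "g \<in> gens"
  then show "g \<in> carrier G"
    unfolding gens_def
    by (elim UnE CollectE exE conjE; hypsubst; intro G_diff keys_fr)
      (simp_all del: carrier_free_Abelian_group_iff)
qed

text \<open>
  The relations form the subgroup generated by the bilinear ones, so a property of all relations
  follows from closure under differences.
\<close>

lemma rels_induct:
  assumes a: "a \<in> H" and zero: "P 0"
    and left: "\<And>m m' n. \<lbrakk>m \<in> carrier M; m' \<in> carrier M; n \<in> carrier N\<rbrakk> \<Longrightarrow> P (fr (m \<oplus>\<^bsub>M\<^esub> m') n - fr m n - fr m' n)"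
    and right: "\<And>m n n'. \<lbrakk>m \<in> carrier M; n \<in> carrier N; n' \<in> carrier N\<rbrakk> \<Longrightarrow> P (fr m (n \<oplus>\<^bsub>N\<^esub> n') - fr m n - fr m n')"
    and bal: "\<And>r m n. \<lbrakk>r \<in> carrier R; m \<in> carrier M; n \<in> carrier N\<rbrakk> \<Longrightarrow> P (fr (r \<odot>\<^bsub>M\<^esub> m) n - fr m (r \<odot>\<^bsub>N\<^esub> n))"
    and diff: "\<And>a b. P a \<Longrightarrow> P b \<Longrightarrow> P (a - b)"
  shows "P a"
proof -
  have gen: "P g" if "g \<in> gens" for g using that unfolding gens_def
  proof (elim UnE CollectE exE conjE)
    fix m m' n assume g: "g = fr (m \<oplus>\<^bsub>M\<^esub> m') n - fr m n - fr m' n"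
      and "m \<in> carrier M" "m' \<in> carrier M" "n \<in> carrier N"
    then show "P g" unfolding g by (intro left)
  next
    fix m n n' assume g: "g = fr m (n \<oplus>\<^bsub>N\<^esub> n') - fr m n - fr m n'"
      and "m \<in> carrier M" "n \<in> carrier N" "n' \<in> carrier N"
    then show "P g" unfolding g by (intro right)
  next
    fix r m n assume g: "g = fr (r \<odot>\<^bsub>M\<^esub> m) n - fr m (r \<odot>\<^bsub>N\<^esub> n)"
      and "r \<in> carrier R" "m \<in> carrier M" "n \<in> carrier N"
    then show "P g" unfolding g by (intro bal)
  qed
  have neg: "P (- b)" if "P b" for b using diff[OF zero that] by simp
  have add: "P (b + c)" if "P b" "P c" for b c using diff[OF that(1) neg[OF that(2)]] by simp
  show ?thesis using a unfolding rels_eq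
  proof (induction rule: generate.induct)
    case one then show ?case using zero by simp
  next
    case (incl h) then show ?case using gen by simp
  next
    case (inv h)
    then have "h \<in> carrier G" using gens_closed by blast
    then show ?case using neg[OF gen[OF inv]] by simp
  next
    case (eng a b) then show ?case using add by simp
  qed
qed

lemma rels_gen: "g \<in> gens \<Longrightarrow> g \<in> H"
  unfolding rels_eq by (rule generate.incl)

lemma rels_zero: "0 \<in> H"
  unfolding rels_eq using generate.one[of G gens] by simp

lemma rels_closed: "H \<subseteq> carrier G"
  unfolding rels_eq using group.generate_incl[OF group_free_Abelian_group gens_closed] .

lemma rels_add: "a \<in> H \<Longrightarrow> b \<in> H \<Longrightarrow> a + b \<in> H"
  unfolding rels_eq using generate.eng[of a G gens b] by simp

lemma rels_minus: "a \<in> H \<Longrightarrow> - a \<in> H"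
  using group.generate_m_inv_closed[OF group_free_Abelian_group gens_closed, of a] rels_closed
  unfolding rels_eq by auto

lemma rels_diff: "a \<in> H \<Longrightarrow> b \<in> H \<Longrightarrow> a - b \<in> H"
  using rels_add[OF _ rels_minus, of a b] by simp

lemma K_eq: "K a = (\<lambda>h. h + a) ` H"
  unfolding tensor_coset_def r_coset_def by auto

lemma mem_K: "b \<in> K a \<longleftrightarrow> b - a \<in> H"
proof
  assume "b - a \<in> H"
  then have "(b - a) + a \<in> K a" unfolding K_eq by blast
  then show "b \<in> K a" by simp
qed (auto simp: K_eq)

lemma K_eq_iff: "K a = K b \<longleftrightarrow> a - b \<in> H"
proof
  assume "K a = K b"
  moreover have "a \<in> K a" unfolding mem_K using rels_zero by simp
  ultimately show "a - b \<in> H" unfolding mem_K[symmetric] by simp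
next
  assume ab: "a - b \<in> H"
  have "c - a \<in> H \<longleftrightarrow> c - b \<in> H" for c
    using rels_add[OF _ ab, of "c - a"] rels_diff[OF _ ab, of "c - b"] by auto
  then show "K a = K b" using mem_K by blast
qed

lemma self_K: "a \<in> K a"
  unfolding mem_K using rels_zero by simp

abbreviation "T \<equiv> tensor_module R M N"

lemma T_carrier: "carrier T = K ` carrier G"
  by (auto simp: tensor_module_def Let_def FactGroup_def RCOSETS_def tensor_coset_def)

lemma K_zero: "K 0 = H"
  unfolding K_eq by simp

lemma T_zero: "\<zero>\<^bsub>T\<^esub> = K 0"
  by (simp add: tensor_module_def Let_def FactGroup_def K_zero)

lemma T_add: "K a \<oplus>\<^bsub>T\<^esub> K b = K (a + b)"
proof -
  have "K a \<oplus>\<^bsub>T\<^esub> K b = {x + y | x y. x \<in> K a \<and> y \<in> K b}"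
    by (auto simp: tensor_module_def Let_def FactGroup_def set_mult_def)
  also have "\<dots> = K (a + b)"
  proof (intro equalityI subsetI)
    fix z assume "z \<in> {x + y | x y. x \<in> K a \<and> y \<in> K b}"
    then obtain x y where xy: "z = x + y" "x - a \<in> H" "y - b \<in> H" by (auto simp: mem_K)
    have e: "z - (a + b) = (x - a) + (y - b)" unfolding xy(1) by (simp add: algebra_simps)
    show "z \<in> K (a + b)" unfolding mem_K e by (rule rels_add[OF xy(2,3)])
  next
    fix z assume z: "z \<in> K (a + b)"
    have "z - b \<in> K a" using z unfolding mem_K by (simp add: algebra_simps)
    moreover have "z = (z - b) + b" by simp
    ultimately show "z \<in> {x + y | x y. x \<in> K a \<and> y \<in> K b}" using self_K[of b] by blast
  qed
  finally show ?thesis .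
qed

text \<open>
  A pair of additive, compatible maps \<open>\<alpha>\<close>, \<open>\<beta>\<close> maps bilinear relations to bilinear relations,
  hence induces a map of tensor products. It is applied to restriction maps and to multiplication
  by a scalar.
\<close>

lemma rels_map:
  assumes pair: "tensor_pair R' M' N'"
    and \<alpha>: "\<And>m. m \<in> carrier M \<Longrightarrow> \<alpha> m \<in> carrier M'" and \<beta>: "\<And>n. n \<in> carrier N \<Longrightarrow> \<beta> n \<in> carrier N'"
    and \<alpha>a: "\<And>m m'. m \<in> carrier M \<Longrightarrow> m' \<in> carrier M \<Longrightarrow> \<alpha> (m \<oplus>\<^bsub>M\<^esub> m') = \<alpha> m \<oplus>\<^bsub>M'\<^esub> \<alpha> m'"
    and \<beta>a: "\<And>n n'. n \<in> carrier N \<Longrightarrow> n' \<in> carrier N \<Longrightarrow> \<beta> (n \<oplus>\<^bsub>N\<^esub> n') = \<beta> n \<oplus>\<^bsub>N'\<^esub> \<beta> n'"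
    and \<gamma>: "\<And>r. r \<in> carrier R \<Longrightarrow> \<gamma> r \<in> carrier R'"
    and \<alpha>s: "\<And>r m. r \<in> carrier R \<Longrightarrow> m \<in> carrier M \<Longrightarrow> \<alpha> (r \<odot>\<^bsub>M\<^esub> m) = \<gamma> r \<odot>\<^bsub>M'\<^esub> \<alpha> m"
    and \<beta>s: "\<And>r n. r \<in> carrier R \<Longrightarrow> n \<in> carrier N \<Longrightarrow> \<beta> (r \<odot>\<^bsub>N\<^esub> n) = \<gamma> r \<odot>\<^bsub>N'\<^esub> \<beta> n"
    and a: "a \<in> H"
  shows "frag_extend (\<lambda>(m, n). frag_of (\<alpha> m, \<beta> n)) a \<in> tensor_rels R' M' N'"
proof -
  interpret P: tensor_pair R' M' N' by (rule pair)
  show ?thesis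
  proof (rule rels_induct[OF a])
    show "frag_extend (\<lambda>(m, n). frag_of (\<alpha> m, \<beta> n)) 0 \<in> P.H" using P.rels_zero by simp
    show "frag_extend (\<lambda>(m, n). frag_of (\<alpha> m, \<beta> n)) (fr (m \<oplus>\<^bsub>M\<^esub> m') n - fr m n - fr m' n) \<in> P.H"
      if "m \<in> carrier M" "m' \<in> carrier M" "n \<in> carrier N" for m m' n
      using that P.rels_gen[OF P.gen_left] by (simp add: frag_extend_diff \<alpha> \<beta> \<alpha>a)
    show "frag_extend (\<lambda>(m, n). frag_of (\<alpha> m, \<beta> n)) (fr m (n \<oplus>\<^bsub>N\<^esub> n') - fr m n - fr m n') \<in> P.H"
      if "m \<in> carrier M" "n \<in> carrier N" "n' \<in> carrier N" for m n n'
      using that P.rels_gen[OF P.gen_right] by (simp add: frag_extend_diff \<alpha> \<beta> \<beta>a)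
    show "frag_extend (\<lambda>(m, n). frag_of (\<alpha> m, \<beta> n)) (fr (r \<odot>\<^bsub>M\<^esub> m) n - fr m (r \<odot>\<^bsub>N\<^esub> n)) \<in> P.H"
      if "r \<in> carrier R" "m \<in> carrier M" "n \<in> carrier N" for r m n
    proof -
      have "fr (\<gamma> r \<odot>\<^bsub>M'\<^esub> \<alpha> m) (\<beta> n) - fr (\<alpha> m) (\<gamma> r \<odot>\<^bsub>N'\<^esub> \<beta> n) \<in> P.H"
        by (rule P.rels_gen[OF P.gen_balanced]) (use that \<alpha> \<beta> \<gamma> in auto)
      then show ?thesis using that \<alpha>s \<beta>s by (simp add: frag_extend_diff)
    qed
    show "frag_extend (\<lambda>(m, n). frag_of (\<alpha> m, \<beta> n)) (a - b) \<in> P.H"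
      if "frag_extend (\<lambda>(m, n). frag_of (\<alpha> m, \<beta> n)) a \<in> P.H" "frag_extend (\<lambda>(m, n). frag_of (\<alpha> m, \<beta> n)) b \<in> P.H" for a b
      using P.rels_diff[OF that] by (simp add: frag_extend_diff)
  qed
qed

lemma Union_K_map:
  assumes pair: "tensor_pair R' M' N'" and E: "\<And>a. a \<in> H \<Longrightarrow> frag_extend g a \<in> tensor_rels R' M' N'"
  shows "(\<Union>b\<in>K a. tensor_coset R' M' N' (frag_extend g b)) = tensor_coset R' M' N' (frag_extend g a)"
proof (rule Union_const)
  interpret P: tensor_pair R' M' N' by (rule pair)
  show "(\<lambda>b. P.K (frag_extend g b)) ` K a \<noteq> {}" using self_K by blast
  fix X assume "X \<in> (\<lambda>b. P.K (frag_extend g b)) ` K a"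
  then obtain b where b: "b - a \<in> H" "X = P.K (frag_extend g b)" by (auto simp: mem_K)
  then show "X = P.K (frag_extend g a)"
    using E[OF b(1)] unfolding b(2) P.K_eq_iff by (simp add: frag_extend_diff)
qed

definition "sc r = frag_extend (\<lambda>(m, n). frag_of (r \<odot>\<^bsub>M\<^esub> m, n))"

lemma pair_axioms: "tensor_pair R M N"
  by unfold_locales

lemma sc_rels:
  assumes r: "r \<in> carrier R" and a: "a \<in> H" shows "sc r a \<in> H"
  unfolding sc_def
proof (rule rels_map[OF pair_axioms, where \<alpha> = "\<lambda>m. r \<odot>\<^bsub>M\<^esub> m" and \<beta> = "\<lambda>n. n" and \<gamma> = "\<lambda>s. s"])
  show "r \<odot>\<^bsub>M\<^esub> (s \<odot>\<^bsub>M\<^esub> m) = s \<odot>\<^bsub>M\<^esub> (r \<odot>\<^bsub>M\<^esub> m)" if "s \<in> carrier R" "m \<in> carrier M" for s m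
    using that r M.smult_assoc1[symmetric] M.R.m_comm by metis
qed (use r a M.smult_r_distr in auto)

lemma T_smult: "r \<in> carrier R \<Longrightarrow> r \<odot>\<^bsub>T\<^esub> K a = K (sc r a)"
  using Union_K_map[OF pair_axioms, of "\<lambda>(m, n). frag_of (r \<odot>\<^bsub>M\<^esub> m, n)" a] sc_rels[of r]
  unfolding sc_def by (simp add: tensor_module_def Let_def)

lemma sc_closed: "r \<in> carrier R \<Longrightarrow> a \<in> carrier G \<Longrightarrow> sc r a \<in> carrier G"
  unfolding sc_def using keys_frag_extend[of "\<lambda>(m, n). frag_of (r \<odot>\<^bsub>M\<^esub> m, n)" a] by fastforce

text \<open>
  Two additive maps agree modulo the relations if they agree on the pairs that generate the free
  group.
\<close>

lemma K_cong_induct: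
  assumes a: "a \<in> carrier G" and A: "\<And>a b. A (a - b) = A a - A b" and B: "\<And>a b. B (a - b) = B a - B b"
    and base: "\<And>m n. m \<in> carrier M \<Longrightarrow> n \<in> carrier N \<Longrightarrow> K (A (fr m n)) = K (B (fr m n))"
  shows "K (A a) = K (B a)"
proof -
  have "Poly_Mapping.keys a \<subseteq> carrier M \<times> carrier N" using a by simp
  then have "A a - B a \<in> H"
  proof (induction rule: free_Abelian_group_induct[consumes 1, case_names "1" "2" "3"])
    case 1
    have "A 0 = 0" "B 0 = 0" using A[of 0 0] B[of 0 0] by auto
    then show ?case using rels_zero by simp
  next
    case (2 x y)
    have "A (x - y) - B (x - y) = (A x - B x) - (A y - B y)" by (simp add: A B)
    then show ?case using rels_diff[OF 2(3,4)] by simp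
  next
    case (3 p)
    then show ?case using base[of "fst p" "snd p"] unfolding K_eq_iff by auto
  qed
  then show ?thesis unfolding K_eq_iff .
qed

lemma K_fr_add_left: "m \<in> carrier M \<Longrightarrow> m' \<in> carrier M \<Longrightarrow> n \<in> carrier N \<Longrightarrow>
    K (fr (m \<oplus>\<^bsub>M\<^esub> m') n) = K (fr m n + fr m' n)"
  unfolding K_eq_iff using rels_gen[OF gen_left] by (simp add: diff_diff_eq)

lemma K_fr_add_right: "m \<in> carrier M \<Longrightarrow> n \<in> carrier N \<Longrightarrow> n' \<in> carrier N \<Longrightarrow>
    K (fr m (n \<oplus>\<^bsub>N\<^esub> n')) = K (fr m n + fr m n')"
  unfolding K_eq_iff using rels_gen[OF gen_right] by (simp add: diff_diff_eq)

lemma K_fr_balanced: "r \<in> carrier R \<Longrightarrow> m \<in> carrier M \<Longrightarrow> n \<in> carrier N \<Longrightarrow>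
    K (fr (r \<odot>\<^bsub>M\<^esub> m) n) = K (fr m (r \<odot>\<^bsub>N\<^esub> n))"
  unfolding K_eq_iff by (rule rels_gen[OF gen_balanced])

lemma sc_diff: "sc r (a - b) = sc r a - sc r b"
  by (simp add: sc_def frag_extend_diff)

lemma sc_fr: "sc r (fr m n) = fr (r \<odot>\<^bsub>M\<^esub> m) n"
  by (simp add: sc_def)

lemma T_module: "module R T"
proof (rule moduleI)
  show "cring R" by (rule M.R.is_cring)
  let ?G = "\<lparr>carrier = carrier G, mult = undefined, monoid.one = undefined, ring.zero = 0, ring.add = (+)\<rparr> :: (('m \<times> 'n) \<Rightarrow>\<^sub>0 int) ring"
  have "abelian_group ?G"
  proof (rule abelian_groupI)
    show "\<exists>y\<in>carrier ?G. y \<oplus>\<^bsub>?G\<^esub> x = \<zero>\<^bsub>?G\<^esub>" if "x \<in> carrier ?G" for x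
      using that by (intro bexI[of _ "- x"]) (auto simp: keys_minus)
  qed (use G_add in \<open>auto simp: algebra_simps\<close>)
  then show "abelian_group T"
    by (rule image_abelian_group[where \<kappa> = K]) (auto simp: T_carrier T_zero T_add)
  have KG: "K a \<in> carrier T" if "a \<in> carrier G" for a using that T_carrier by blast
  fix r X assume r: "r \<in> carrier R" and "X \<in> carrier T"
  then obtain a where a: "a \<in> carrier G" and [simp]: "X = K a" unfolding T_carrier by blast
  show "r \<odot>\<^bsub>T\<^esub> X \<in> carrier T" using T_smult[OF r] KG[OF sc_closed[OF r a]] by simp
  {
    fix s assume s: "s \<in> carrier R"
    have "K (sc (r \<oplus>\<^bsub>R\<^esub> s) a) = K (sc r a + sc s a)"
      by (rule K_cong_induct[OF a, where B = "\<lambda>a. sc r a + sc s a"])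
        (simp_all add: sc_diff sc_fr M.smult_l_distr r s K_fr_add_left)
    then show "(r \<oplus>\<^bsub>R\<^esub> s) \<odot>\<^bsub>T\<^esub> X = r \<odot>\<^bsub>T\<^esub> X \<oplus>\<^bsub>T\<^esub> s \<odot>\<^bsub>T\<^esub> X"
      using r s by (simp add: T_smult T_add)
    have "K (sc (r \<otimes>\<^bsub>R\<^esub> s) a) = K (sc r (sc s a))"
      by (rule K_cong_induct[OF a, where B = "\<lambda>a. sc r (sc s a)"])
        (simp_all add: sc_diff sc_fr M.smult_assoc1 r s)
    then show "(r \<otimes>\<^bsub>R\<^esub> s) \<odot>\<^bsub>T\<^esub> X = r \<odot>\<^bsub>T\<^esub> (s \<odot>\<^bsub>T\<^esub> X)"
      using r s by (simp add: T_smult)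
  next
    fix Y assume "Y \<in> carrier T"
    then obtain b where b: "b \<in> carrier G" and [simp]: "Y = K b" unfolding T_carrier by blast
    have "sc r (a + b) = sc r a + sc r b" by (simp add: sc_def frag_extend_add)
    then show "r \<odot>\<^bsub>T\<^esub> (X \<oplus>\<^bsub>T\<^esub> Y) = r \<odot>\<^bsub>T\<^esub> X \<oplus>\<^bsub>T\<^esub> r \<odot>\<^bsub>T\<^esub> Y"
      using r by (simp add: T_smult T_add)
  }
next
  fix X assume "X \<in> carrier T"
  then obtain a where a: "a \<in> carrier G" and [simp]: "X = K a" unfolding T_carrier by blast
  have "K (sc \<one>\<^bsub>R\<^esub> a) = K a"
    by (rule K_cong_induct[OF a, where B = "\<lambda>a. a"]) (simp_all add: sc_diff sc_fr)
  then show "\<one>\<^bsub>R\<^esub> \<odot>\<^bsub>T\<^esub> X = X" by (simp add: T_smult)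
qed

text \<open>
  The universal property, in the form that it detects the equality of two pure tensors: a balanced
  biadditive map extends to the free abelian group and kills the relations.
\<close>

lemma tensor_lift:
  assumes B: "abelian_group B"
    and closed: "\<And>m n. m \<in> carrier M \<Longrightarrow> n \<in> carrier N \<Longrightarrow> \<beta> m n \<in> carrier B"
    and left: "\<And>m m' n. \<lbrakk>m \<in> carrier M; m' \<in> carrier M; n \<in> carrier N\<rbrakk> \<Longrightarrow> \<beta> (m \<oplus>\<^bsub>M\<^esub> m') n = \<beta> m n \<oplus>\<^bsub>B\<^esub> \<beta> m' n"
    and right: "\<And>m n n'. \<lbrakk>m \<in> carrier M; n \<in> carrier N; n' \<in> carrier N\<rbrakk> \<Longrightarrow> \<beta> m (n \<oplus>\<^bsub>N\<^esub> n') = \<beta> m n \<oplus>\<^bsub>B\<^esub> \<beta> m n'"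
    and bal: "\<And>r m n. \<lbrakk>r \<in> carrier R; m \<in> carrier M; n \<in> carrier N\<rbrakk> \<Longrightarrow> \<beta> (r \<odot>\<^bsub>M\<^esub> m) n = \<beta> m (r \<odot>\<^bsub>N\<^esub> n)"
    and mn: "m \<in> carrier M" "n \<in> carrier N" "m' \<in> carrier M" "n' \<in> carrier N" "K (fr m n) = K (fr m' n')"
  shows "\<beta> m n = \<beta> m' n'"
proof -
  interpret B: abelian_group B by (rule B)
  interpret C: Group.comm_group "add_monoid B" by (rule B.a_comm_group)
  obtain h where h: "h \<in> hom G (add_monoid B)" "\<And>x. x \<in> carrier M \<times> carrier N \<Longrightarrow> h (frag_of x) = (\<lambda>(m, n). \<beta> m n) x"
    by (rule comm_group.free_Abelian_group_universal[OF B.a_comm_group, of "\<lambda>(m, n). \<beta> m n" "carrier M \<times> carrier N"]) (use closed in auto)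
  interpret h: group_hom G "add_monoid B" h
    by (rule group_hom.intro[OF group_free_Abelian_group B.a_group]) (simp add: group_hom_axioms_def h(1))
  have hc: "h a \<in> carrier B" if "a \<in> carrier G" for a using h.hom_closed[OF that] by simp
  have hd: "h (a - b) = h a \<ominus>\<^bsub>B\<^esub> h b" if "a \<in> carrier G" "b \<in> carrier G" for a b
  proof -
    have "- b = inv\<^bsub>G\<^esub> b" using that(2) by simp
    moreover have "- b \<in> carrier G" using that(2) by simp
    ultimately have "h (a + - b) = h a \<oplus>\<^bsub>B\<^esub> \<ominus>\<^bsub>B\<^esub> h b"
      using h.hom_mult[OF that(1), of "- b"] h.hom_inv[OF that(2)] by (simp add: a_inv_def)
    then show ?thesis by (simp add: a_minus_def)
  qed
  have hfr: "h (fr m n) = \<beta> m n" if "m \<in> carrier M" "n \<in> carrier N" for m n using h(2)[of "(m, n)"] that by simp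
  have ker: "a \<in> carrier G \<and> h a = \<zero>\<^bsub>B\<^esub>" if "a \<in> H" for a
  proof (rule rels_induct[OF that, where P = "\<lambda>a. a \<in> carrier G \<and> h a = \<zero>\<^bsub>B\<^esub>"])
    show "0 \<in> carrier G \<and> h 0 = \<zero>\<^bsub>B\<^esub>" using h.hom_one by simp
    have cancel: "(x \<oplus>\<^bsub>B\<^esub> y) \<ominus>\<^bsub>B\<^esub> x \<ominus>\<^bsub>B\<^esub> y = \<zero>\<^bsub>B\<^esub>" if "x \<in> carrier B" "y \<in> carrier B" for x y
    proof -
      have "(x \<oplus>\<^bsub>B\<^esub> y) \<ominus>\<^bsub>B\<^esub> x \<ominus>\<^bsub>B\<^esub> y = (x \<oplus>\<^bsub>B\<^esub> y) \<oplus>\<^bsub>B\<^esub> \<ominus>\<^bsub>B\<^esub> (x \<oplus>\<^bsub>B\<^esub> y)"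
        using that by (simp add: a_minus_def B.minus_add B.a_assoc)
      then show ?thesis using that by (simp add: B.r_neg)
    qed
    show "fr (m \<oplus>\<^bsub>M\<^esub> m') n - fr m n - fr m' n \<in> carrier G \<and> h (fr (m \<oplus>\<^bsub>M\<^esub> m') n - fr m n - fr m' n) = \<zero>\<^bsub>B\<^esub>"
      if "m \<in> carrier M" "m' \<in> carrier M" "n \<in> carrier N" for m m' n
    proof -
      have "fr (m \<oplus>\<^bsub>M\<^esub> m') n \<in> carrier G" "fr m n \<in> carrier G" "fr m' n \<in> carrier G" using that by auto
      then show ?thesis using that by (simp only: hd G_diff hfr left M.add.m_closed cancel closed M.a_closed)
    qed
    show "fr m (n \<oplus>\<^bsub>N\<^esub> n') - fr m n - fr m n' \<in> carrier G \<and> h (fr m (n \<oplus>\<^bsub>N\<^esub> n') - fr m n - fr m n') = \<zero>\<^bsub>B\<^esub>"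
      if "m \<in> carrier M" "n \<in> carrier N" "n' \<in> carrier N" for m n n'
    proof -
      have "fr m (n \<oplus>\<^bsub>N\<^esub> n') \<in> carrier G" "fr m n \<in> carrier G" "fr m n' \<in> carrier G" using that by auto
      then show ?thesis using that by (simp only: hd G_diff hfr right N.add.m_closed cancel closed N.a_closed; simp)
    qed
    show "fr (r \<odot>\<^bsub>M\<^esub> m) n - fr m (r \<odot>\<^bsub>N\<^esub> n) \<in> carrier G \<and> h (fr (r \<odot>\<^bsub>M\<^esub> m) n - fr m (r \<odot>\<^bsub>N\<^esub> n)) = \<zero>\<^bsub>B\<^esub>"
      if "r \<in> carrier R" "m \<in> carrier M" "n \<in> carrier N" for r m n
    proof -
      have "fr (r \<odot>\<^bsub>M\<^esub> m) n \<in> carrier G" "fr m (r \<odot>\<^bsub>N\<^esub> n) \<in> carrier G" using that by auto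
      moreover have "\<beta> m (r \<odot>\<^bsub>N\<^esub> n) \<ominus>\<^bsub>B\<^esub> \<beta> m (r \<odot>\<^bsub>N\<^esub> n) = \<zero>\<^bsub>B\<^esub>"
        using closed[of m "r \<odot>\<^bsub>N\<^esub> n"] that by (simp add: a_minus_def B.r_neg)
      ultimately show ?thesis using that by (simp only: hd G_diff hfr bal M.smult_closed N.smult_closed; simp)
    qed
    show "a - b \<in> carrier G \<and> h (a - b) = \<zero>\<^bsub>B\<^esub>"
      if "a \<in> carrier G \<and> h a = \<zero>\<^bsub>B\<^esub>" "b \<in> carrier G \<and> h b = \<zero>\<^bsub>B\<^esub>" for a b
    proof -
      have "\<zero>\<^bsub>B\<^esub> \<ominus>\<^bsub>B\<^esub> \<zero>\<^bsub>B\<^esub> = \<zero>\<^bsub>B\<^esub>" by (simp add: a_minus_def)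
      then show ?thesis using that by (simp only: hd G_diff; simp)
    qed
  qed
  have "h (fr m n) \<ominus>\<^bsub>B\<^esub> h (fr m' n') = \<zero>\<^bsub>B\<^esub>"
    using ker[of "fr m n - fr m' n'"] mn hd[of "fr m n" "fr m' n'"] unfolding K_eq_iff by simp
  then have "\<beta> m n \<oplus>\<^bsub>B\<^esub> \<ominus>\<^bsub>B\<^esub> \<beta> m' n' = \<zero>\<^bsub>B\<^esub>" using hfr mn by (simp add: a_minus_def)
  then have "\<ominus>\<^bsub>B\<^esub> (\<ominus>\<^bsub>B\<^esub> \<beta> m' n') = \<beta> m n"
    using B.minus_equality closed[OF mn(1,2)] closed[OF mn(3,4)] by simp
  then show ?thesis using closed[OF mn(3,4)] by simp
qed

text \<open>
  If \<open>M\<close> is generated by \<open>e\<close>, then \<open>r e \<otimes> n = e \<otimes> r n\<close>, so sums of tensors collapse to a single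
  tensor \<open>e \<otimes> n\<close>.
\<close>

lemma tensor_collapse:
  assumes e: "e \<in> carrier M" and gen: "\<And>m. m \<in> carrier M \<Longrightarrow> \<exists>r\<in>carrier R. m = r \<odot>\<^bsub>M\<^esub> e"
    and X: "X \<in> carrier T"
  shows "\<exists>n\<in>carrier N. X = K (fr e n)"
proof -
  obtain a where a: "a \<in> carrier G" "X = K a" using X unfolding T_carrier by blast
  have "Poly_Mapping.keys a \<subseteq> carrier M \<times> carrier N" using a by simp
  then have "\<exists>n\<in>carrier N. K a = K (fr e n)"
  proof (induction rule: free_Abelian_group_induct[consumes 1, case_names "1" "2" "3"])
    case 1
    have "K (fr e (\<zero>\<^bsub>N\<^esub> \<oplus>\<^bsub>N\<^esub> \<zero>\<^bsub>N\<^esub>)) = K (fr e \<zero>\<^bsub>N\<^esub> + fr e \<zero>\<^bsub>N\<^esub>)" using K_fr_add_right e by blast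
    then have "0 - fr e \<zero>\<^bsub>N\<^esub> \<in> H" unfolding K_eq_iff by simp
    then show ?case unfolding K_eq_iff[symmetric] by blast
  next
    case (2 a b)
    then obtain n n' where n: "n \<in> carrier N" "K a = K (fr e n)" "n' \<in> carrier N" "K b = K (fr e n')" by blast
    let ?d = "n \<ominus>\<^bsub>N\<^esub> n'"
    have d: "?d \<in> carrier N" "?d \<oplus>\<^bsub>N\<^esub> n' = n" using n by (auto simp: a_minus_def N.a_assoc N.l_neg)
    have "K (fr e n) = K (fr e ?d + fr e n')" using K_fr_add_right[OF e d(1) n(3)] d(2) by simp
    then have "fr e n - fr e n' - fr e ?d \<in> H" unfolding K_eq_iff by (simp add: algebra_simps)
    moreover have "(a - fr e n) - (b - fr e n') \<in> H" using n(2,4) unfolding K_eq_iff by (rule rels_diff)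
    ultimately have "((a - fr e n) - (b - fr e n')) + (fr e n - fr e n' - fr e ?d) \<in> H" by (rule rels_add[rotated])
    moreover have "((a - fr e n) - (b - fr e n')) + (fr e n - fr e n' - fr e ?d) = a - b - fr e ?d" by simp
    ultimately have "K (a - b) = K (fr e ?d)" unfolding K_eq_iff by simp
    then show ?case using d(1) by blast
  next
    case (3 p)
    then obtain r where r: "r \<in> carrier R" "fst p = r \<odot>\<^bsub>M\<^esub> e" using gen[of "fst p"] by auto
    obtain q where q: "q \<in> carrier N" "p = (r \<odot>\<^bsub>M\<^esub> e, q)" using 3 r(2) by (cases p) auto
    have "K (frag_of p) = K (fr e (r \<odot>\<^bsub>N\<^esub> q))"
      unfolding q(2) by (rule K_fr_balanced[OF r(1) e q(1)])
    then show ?case using N.smult_closed[OF r(1) q(1)] by blast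
  qed
  then show ?thesis using a(2) by simp
qed

end

lemma tensor_presheaf_simps [simp]:
  "sec (tensor_presheaf M N) U = tensor_module (oring U) (sec M U) (sec N U)"
  by (simp add: tensor_presheaf_def)

locale presheaf_pair = M: presheaf M + N: presheaf N
  for M :: "('k::field, 'm, 'y) osheaf_scheme" and N :: "('k, 'n, 'z) osheaf_scheme"
begin

lemma pair: "zopen U \<Longrightarrow> tensor_pair (oring U) (sec M U) (sec N U)"
  unfolding tensor_pair_def using M.sec_module N.sec_module by blast

abbreviation "TP \<equiv> tensor_presheaf M N"
abbreviation "K U \<equiv> tensor_coset (oring U) (sec M U) (sec N U)"
abbreviation "rs U W \<equiv> frag_extend (\<lambda>(m, n). frag_of (res M U W m, res N U W n))"

lemma TP_res:
  assumes "zopen U" "zopen W" "W \<subseteq> U" shows "res TP U W (K U a) = K W (rs U W a)"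
proof -
  interpret P: tensor_pair "oring U" "sec M U" "sec N U" using pair[OF assms(1)] .
  have "rs U W a \<in> tensor_rels (oring W) (sec M W) (sec N W)" if a: "a \<in> P.H" for a
    by (rule P.rels_map[OF pair[OF assms(2)] _ _ _ _ _ _ _ a, where \<gamma> = "rst W"])
      (use M.res_closed[OF assms] N.res_closed[OF assms] M.res_add[OF assms] N.res_add[OF assms]
        M.res_smult[OF assms] N.res_smult[OF assms] regular_rst[OF _ assms(2,3)] in auto)
  then show ?thesis
    using P.Union_K_map[OF pair[OF assms(2)]] by (simp add: tensor_presheaf_def)
qed

lemma rs_closed:
  assumes "zopen U" "zopen W" "W \<subseteq> U" "Poly_Mapping.keys a \<subseteq> secs M U \<times> secs N U"
  shows "Poly_Mapping.keys (rs U W a) \<subseteq> secs M W \<times> secs N W"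
proof
  fix q assume "q \<in> Poly_Mapping.keys (rs U W a)"
  then obtain p where p: "p \<in> Poly_Mapping.keys a" "q \<in> Poly_Mapping.keys ((\<lambda>(m, n). frag_of (res M U W m, res N U W n)) p)"
    using keys_frag_extend[of "\<lambda>(m, n). frag_of (res M U W m, res N U W n)" a] by blast
  then have "q = (res M U W (fst p), res N U W (snd p))" by (auto simp: case_prod_unfold)
  moreover have "fst p \<in> secs M U" "snd p \<in> secs N U" using p(1) assms(4) by auto
  ultimately show "q \<in> secs M W \<times> secs N W" using M.res_closed N.res_closed assms by auto
qed

lemma presheaf_TP: "presheaf TP"
proof (rule presheaf.intro)
  fix U :: "'k pt set" assume U: "zopen U"
  interpret P: tensor_pair "oring U" "sec M U" "sec N U" using pair[OF U] .
  show "module (oring U) (sec TP U)" using P.T_module by simp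
  fix X assume "X \<in> secs TP U"
  then obtain a where a: "a \<in> carrier P.G" and [simp]: "X = K U a" using P.T_carrier by auto
  show "res TP U U X = X"
  proof -
    have "P.K (rs U U a) = P.K a"
      by (rule P.K_cong_induct[OF a, where B = "\<lambda>a. a"])
        (simp_all add: frag_extend_diff M.res_id[OF U] N.res_id[OF U])
    then show ?thesis using TP_res[OF U U] by simp
  qed
  fix W assume W: "zopen W" "W \<subseteq> U"
  interpret PW: tensor_pair "oring W" "sec M W" "sec N W" using pair[OF W(1)] .
  have ra: "rs U W a \<in> carrier PW.G" using rs_closed[OF U W, of a] a by simp
  note Xr = TP_res[OF U W]
  show "res TP U W X \<in> secs TP W" using ra Xr PW.T_carrier by auto
  {
    fix Y assume "Y \<in> secs TP U"
    then obtain b where b: "b \<in> carrier P.G" and [simp]: "Y = K U b" using P.T_carrier by auto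
    show "res TP U W (X \<oplus>\<^bsub>sec TP U\<^esub> Y) = res TP U W X \<oplus>\<^bsub>sec TP W\<^esub> res TP U W Y"
      by (simp add: P.T_add PW.T_add Xr frag_extend_add)
  next
    fix f assume f: "f \<in> regular 0 0 U"
    have fW: "rst W f \<in> regular 0 0 W" using regular_rst[OF f W] .
    have s: "P.sc f (x - y) = P.sc f x - P.sc f y" "PW.sc (rst W f) (x - y) = PW.sc (rst W f) x - PW.sc (rst W f) y" for x y
      by (simp_all add: P.sc_diff PW.sc_diff)
    have "rs U W (P.sc f a) = PW.sc (rst W f) (rs U W a)"
    proof -
      have "Poly_Mapping.keys a \<subseteq> secs M U \<times> secs N U" using a by simp
      then show ?thesis
      proof (induction rule: free_Abelian_group_induct[consumes 1, case_names "1" "2" "3"])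
        case 1 then show ?case by (simp add: P.sc_def PW.sc_def)
      next
        case (2 x y) then show ?case by (simp add: frag_extend_diff s)
      next
        case (3 p)
        then obtain m n where "p = (m, n)" "m \<in> secs M U" "n \<in> secs N U" by auto
        then show ?case using M.res_smult[OF U W _ f, of m] by (simp add: P.sc_fr PW.sc_fr)
      qed
    qed
    then show "res TP U W (f \<odot>\<^bsub>sec TP U\<^esub> X) = rst W f \<odot>\<^bsub>sec TP W\<^esub> res TP U W X"
      using f fW by (simp add: P.T_smult PW.T_smult Xr)
  next
    fix T assume T: "zopen T" "T \<subseteq> W"
    have TU: "T \<subseteq> U" using T W by blast
    have "rs W T (rs U W a) = rs U T a"
    proof -
      have "Poly_Mapping.keys a \<subseteq> secs M U \<times> secs N U" using a by simp
      then show ?thesis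
      proof (induction rule: free_Abelian_group_induct[consumes 1, case_names "1" "2" "3"])
        case 1 then show ?case by simp
      next
        case (2 x y) then show ?case by (simp add: frag_extend_diff)
      next
        case (3 p)
        then obtain m n where "p = (m, n)" "m \<in> secs M U" "n \<in> secs N U" by auto
        then show ?case using M.res_res[OF U W(1) T W(2)] N.res_res[OF U W(1) T W(2)] by simp
      qed
    qed
    then show "res TP W T (res TP U W X) = res TP U T X" using TP_res[OF W(1) T] TP_res[OF U T(1) TU] Xr by simp
  }
qed

end

section \<open>Direct sums and twisted pullbacks\<close>

lemma osum_simps [simp]:
  "secs (osum M N) U = secs M U \<times> secs N U" "\<zero>\<^bsub>sec (osum M N) U\<^esub> = (\<zero>\<^bsub>sec M U\<^esub>, \<zero>\<^bsub>sec N U\<^esub>)"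
  "(x, y) \<oplus>\<^bsub>sec (osum M N) U\<^esub> (x', y') = (x \<oplus>\<^bsub>sec M U\<^esub> x', y \<oplus>\<^bsub>sec N U\<^esub> y')"
  "f \<odot>\<^bsub>sec (osum M N) U\<^esub> (x, y) = (f \<odot>\<^bsub>sec M U\<^esub> x, f \<odot>\<^bsub>sec N U\<^esub> y)"
  "res (osum M N) U W (x, y) = (res M U W x, res N U W y)"
  by (simp_all add: osum_def)

lemma O_module_osum:
  assumes M: "O_module M" and N: "O_module N" shows "O_module (osum M N)"
proof -
  interpret M: O_module M by (rule M)
  interpret N: O_module N by (rule N)
  show ?thesis
  proof (rule O_module.intro)
    fix U :: "'a pt set" assume U: "zopen U"
    interpret MU: module "oring U" "sec M U" using M.sec_module[OF U] .
    interpret NU: module "oring U" "sec N U" using N.sec_module[OF U] .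
    show "module (oring U) (sec (osum M N) U)"
    proof (rule moduleI)
      show "cring (oring U)" by (rule oring_cring[OF U])
      show "abelian_group (sec (osum M N) U)"
      proof (rule abelian_groupI)
        show "\<exists>y\<in>secs (osum M N) U. y \<oplus>\<^bsub>sec (osum M N) U\<^esub> x = \<zero>\<^bsub>sec (osum M N) U\<^esub>"
          if "x \<in> secs (osum M N) U" for x
        proof -
          obtain a b where "x = (a, b)" "a \<in> secs M U" "b \<in> secs N U" using \<open>x \<in> _\<close> by auto
          then show ?thesis using MU.M.l_neg[of a] NU.M.l_neg[of b]
            by (intro bexI[of _ "(\<ominus>\<^bsub>sec M U\<^esub> a, \<ominus>\<^bsub>sec N U\<^esub> b)"]) auto
        qed
      qed (auto simp: MU.M.a_ac NU.M.a_ac)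
    qed (auto simp: MU.smult_l_distr NU.smult_l_distr MU.smult_r_distr NU.smult_r_distr
        MU.smult_assoc1[simplified] NU.smult_assoc1[simplified] MU.smult_l_distr[simplified] NU.smult_l_distr[simplified]
        MU.smult_one[simplified] NU.smult_one[simplified]
        MU.smult_closed[simplified] NU.smult_closed[simplified]
        simp del: MU.smult_one NU.smult_one)
  next
    fix \<W> :: "'a pt set set" and x y
    assume W: "\<And>W. W \<in> \<W> \<Longrightarrow> zopen W" "zopen (\<Union>\<W>)" "x \<in> secs (osum M N) (\<Union>\<W>)" "y \<in> secs (osum M N) (\<Union>\<W>)"
      and *: "\<And>W. W \<in> \<W> \<Longrightarrow> res (osum M N) (\<Union>\<W>) W x = res (osum M N) (\<Union>\<W>) W y"
    obtain x1 x2 y1 y2 where [simp]: "x = (x1, x2)" "y = (y1, y2)" by (cases x, cases y)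
    have "x1 = y1" using M.locality[OF W(1,2), of x1 y1] W(3,4) * by simp
    moreover have "x2 = y2" using N.locality[OF W(1,2), of x2 y2] W(3,4) * by simp
    ultimately show "x = y" by simp
  next
    fix \<W> :: "'a pt set set" and s
    assume W: "\<And>W. W \<in> \<W> \<Longrightarrow> zopen W" "zopen (\<Union>\<W>)" and s: "\<And>W. W \<in> \<W> \<Longrightarrow> s W \<in> secs (osum M N) W"
      and c: "\<And>W T. \<lbrakk>W \<in> \<W>; T \<in> \<W>\<rbrakk> \<Longrightarrow> res (osum M N) W (W \<inter> T) (s W) = res (osum M N) T (W \<inter> T) (s T)"
    have c': "res M W (W \<inter> T) (fst (s W)) = res M T (W \<inter> T) (fst (s T))"
      "res N W (W \<inter> T) (snd (s W)) = res N T (W \<inter> T) (snd (s T))" if "W \<in> \<W>" "T \<in> \<W>" for W T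
      using c[OF that] osum_simps(5)[of M N _ _ "fst (s W)" "snd (s W)"] osum_simps(5)[of M N _ _ "fst (s T)" "snd (s T)"] by simp_all
    have s': "fst (s W) \<in> secs M W" "snd (s W) \<in> secs N W" if "W \<in> \<W>" for W using s[OF that] by auto
    obtain x where x: "x \<in> secs M (\<Union>\<W>)" "\<forall>W\<in>\<W>. res M (\<Union>\<W>) W x = fst (s W)"
      using M.gluing[OF W s'(1) c'(1)] by blast
    obtain y where y: "y \<in> secs N (\<Union>\<W>)" "\<forall>W\<in>\<W>. res N (\<Union>\<W>) W y = snd (s W)"
      using N.gluing[OF W s'(2) c'(2)] by blast
    show "\<exists>x\<in>secs (osum M N) (\<Union>\<W>). \<forall>W\<in>\<W>. res (osum M N) (\<Union>\<W>) W x = s W"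
      using x y by (intro bexI[of _ "(x, y)"]) auto
  qed (auto simp: M.res_closed N.res_closed M.res_add N.res_add M.res_smult N.res_smult M.res_id N.res_id
      M.res_res N.res_res)
qed

lemma sig_pull_simps [simp]:
  "secs (sig_pull N) U = secs N (sig U)" "\<zero>\<^bsub>sec (sig_pull N) U\<^esub> = \<zero>\<^bsub>sec N (sig U)\<^esub>"
  "x \<oplus>\<^bsub>sec (sig_pull N) U\<^esub> y = x \<oplus>\<^bsub>sec N (sig U)\<^esub> y"
  "f \<odot>\<^bsub>sec (sig_pull N) U\<^esub> x = sigf f \<odot>\<^bsub>sec N (sig U)\<^esub> x"
  "res (sig_pull N) U W = res N (sig U) (sig W)"
  by (simp_all add: sig_pull_def)

lemma sigf_regular: "f \<in> regular a b U \<Longrightarrow> sigf f \<in> regular b a (sig U)"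
  by (rule regular_swap)

lemma sigf_regular': "f \<in> regular a b (sig U) \<Longrightarrow> sigf f \<in> regular b a U"
  using regular_swap[of f a b "sig U"] by simp

lemma sigf_rst: "sigf (rst U f) = rst (sig U) (sigf f)"
  by (auto simp: rst_def fun_eq_iff)

lemma sigf_add: "sigf (\<lambda>v. f v + g v) = (\<lambda>v. sigf f v + sigf g v)"
  by auto

lemma sigf_mult: "sigf (\<lambda>v. f v * g v) = (\<lambda>v. sigf f v * sigf g v)"
  by auto

lemma sigf_sigf [simp]: "sigf (sigf f) = f"
  by auto

lemma sigf_const: "sigf (\<lambda>_. c) = (\<lambda>_. c)"
  by auto

lemma presheaf_sig_pull: assumes N: "presheaf N" shows "presheaf (sig_pull N)"
proof -
  interpret N: presheaf N by (rule N)
  show ?thesis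
  proof (rule presheaf.intro)
    fix U :: "'a pt set" assume U: "zopen U"
    then have sU: "zopen (sig U)" by simp
    interpret NU: module "oring (sig U)" "sec N (sig U)" using N.sec_module[OF sU] .
    show "module (oring U) (sec (sig_pull N) U)"
    proof (rule moduleI)
      show "cring (oring U)" by (rule oring_cring[OF U])
      show "abelian_group (sec (sig_pull N) U)"
        by (rule image_abelian_group[OF N.ab[OF sU], where \<kappa> = "\<lambda>x. x"]) auto
      fix f x assume "f \<in> carrier (oring U)" and x: "x \<in> secs (sig_pull N) U"
      then have f: "sigf f \<in> carrier (oring (sig U))" using sigf_regular by auto
      show "f \<odot>\<^bsub>sec (sig_pull N) U\<^esub> x \<in> secs (sig_pull N) U" using NU.smult_closed[OF f] x by simp
      {
        fix g assume "g \<in> carrier (oring U)"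
        then have g: "sigf g \<in> carrier (oring (sig U))" using sigf_regular by auto
        show "(f \<oplus>\<^bsub>oring U\<^esub> g) \<odot>\<^bsub>sec (sig_pull N) U\<^esub> x =
            f \<odot>\<^bsub>sec (sig_pull N) U\<^esub> x \<oplus>\<^bsub>sec (sig_pull N) U\<^esub> g \<odot>\<^bsub>sec (sig_pull N) U\<^esub> x"
          using NU.smult_l_distr[OF f g] x by (simp add: sigf_add del: o_apply)
        show "(f \<otimes>\<^bsub>oring U\<^esub> g) \<odot>\<^bsub>sec (sig_pull N) U\<^esub> x =
            f \<odot>\<^bsub>sec (sig_pull N) U\<^esub> (g \<odot>\<^bsub>sec (sig_pull N) U\<^esub> x)"
          using NU.smult_assoc1[OF f g] x by (simp add: sigf_mult del: o_apply)
      next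
        fix y assume y: "y \<in> secs (sig_pull N) U"
        then show "f \<odot>\<^bsub>sec (sig_pull N) U\<^esub> (x \<oplus>\<^bsub>sec (sig_pull N) U\<^esub> y) =
            f \<odot>\<^bsub>sec (sig_pull N) U\<^esub> x \<oplus>\<^bsub>sec (sig_pull N) U\<^esub> f \<odot>\<^bsub>sec (sig_pull N) U\<^esub> y"
          using NU.smult_r_distr[OF f] x by simp
      }
    next
      fix x assume x: "x \<in> secs (sig_pull N) U"
      then show "\<one>\<^bsub>oring U\<^esub> \<odot>\<^bsub>sec (sig_pull N) U\<^esub> x = x"
        using NU.smult_one by (simp add: sigf_rst sigf_const)
    qed
  next
    fix U W :: "'a pt set" and x f assume "zopen U" "zopen W" "W \<subseteq> U" "x \<in> secs (sig_pull N) U" "f \<in> regular 0 0 U"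
    then show "res (sig_pull N) U W (f \<odot>\<^bsub>sec (sig_pull N) U\<^esub> x) = rst W f \<odot>\<^bsub>sec (sig_pull N) W\<^esub> res (sig_pull N) U W x"
      using N.res_smult[of "sig U" "sig W" x "sigf f"] sigf_regular[of f 0 0 U] by (simp add: sigf_rst image_mono)
  qed (auto simp: N.res_closed N.res_add N.res_id N.res_res image_mono)
qed

section \<open>The bimodule \<open>L_\<sigma>\<close>\<close>

lemma regular_divide:
  assumes "l \<in> regular a b W" "e \<in> regular a b W" "\<And>w. w \<in> W \<Longrightarrow> e w \<noteq> 0"
  shows "(\<lambda>v. l v * inverse (e v)) \<in> regular 0 0 W" "(\<lambda>v. l v * inverse (e v) * e v) = l"
proof -
  show "(\<lambda>v. l v * inverse (e v)) \<in> regular 0 0 W"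
    by (rule regular_mult[OF assms(1) regular_inverse[OF assms(2,3)]]) auto
  show "(\<lambda>v. l v * inverse (e v) * e v) = l"
  proof
    fix v show "l v * inverse (e v) * e v = l v"
      using assms(3)[of v] regular_outside[OF assms(1), of v] by (cases "v \<in> W") auto
  qed
qed

text \<open>
  Where \<open>e\<close> generates \<open>L\<close>, the map \<open>n \<mapsto> e \<otimes> n\<close> identifies \<open>\<sigma>\<^sup>*N\<close> with \<open>L_\<sigma> \<otimes> N\<close>: it is onto by
  \<open>pure_local\<close> and injective by \<open>pure_inj\<close>.
\<close>

locale Lsig = N: O_module N for N :: "('k::field, 'n) osheaf"
begin

sublocale PP: presheaf_pair "Lbd :: ('k, 'k fn) osheaf" "sig_pull N"
proof -
  show "presheaf_pair (Lbd :: ('k, 'k fn) osheaf) (sig_pull N)"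
    unfolding presheaf_pair_def using O_module.presheaf[OF O_module_Osh] presheaf_sig_pull[OF N.presheaf] by blast
qed

sublocale TP: presheaf PP.TP
  using PP.presheaf_TP .

abbreviation "LN \<equiv> Lsig_tensor N"
abbreviation "pure \<equiv> Lsig_pure N"

lemma LN_eq: "LN = sheafify PP.TP"
  unfolding Lsig_tensor_def otensor_def ..

sublocale LN: O_module LN
  unfolding LN_eq by (rule TP.O_module_sheafify)

lemma pure_eq: "pure U l n = to_shf PP.TP U (PP.K U (frag_of (l, n)))"
  unfolding Lsig_pure_def pure_tensor_def ..

lemma K_closed: "zopen U \<Longrightarrow> l \<in> Lsec U \<Longrightarrow> n \<in> secs N (sig U) \<Longrightarrow> PP.K U (frag_of (l, n)) \<in> secs PP.TP U"
  using tensor_pair.T_carrier[OF PP.pair] by auto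

lemma pure_closed: "zopen U \<Longrightarrow> l \<in> Lsec U \<Longrightarrow> n \<in> secs N (sig U) \<Longrightarrow> pure U l n \<in> secs LN U"
  unfolding pure_eq LN_eq by (rule TP.to_shf_closed[OF _ K_closed])

lemma pure_add_left:
  assumes U: "zopen U" "l \<in> Lsec U" "l' \<in> Lsec U" "n \<in> secs N (sig U)"
  shows "pure U (\<lambda>v. l v + l' v) n = pure U l n \<oplus>\<^bsub>sec LN U\<^esub> pure U l' n"
proof -
  interpret T: tensor_pair "oring U" "sec Lbd U" "sec (sig_pull N) U" using PP.pair[OF U(1)] .
  have "T.K (frag_of (\<lambda>v. l v + l' v, n)) = T.K (frag_of (l, n)) \<oplus>\<^bsub>sec PP.TP U\<^esub> T.K (frag_of (l', n))"
    using T.K_fr_add_left[of l l' n] U by (simp add: T.T_add)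
  then show ?thesis
    unfolding pure_eq LN_eq using TP.to_shf_add[OF U(1) K_closed[OF U(1,2,4)] K_closed[OF U(1,3,4)]] by simp
qed

lemma pure_add_right:
  assumes U: "zopen U" "l \<in> Lsec U" "n \<in> secs N (sig U)" "n' \<in> secs N (sig U)"
  shows "pure U l (n \<oplus>\<^bsub>sec N (sig U)\<^esub> n') = pure U l n \<oplus>\<^bsub>sec LN U\<^esub> pure U l n'"
proof -
  interpret T: tensor_pair "oring U" "sec Lbd U" "sec (sig_pull N) U" using PP.pair[OF U(1)] .
  have "T.K (frag_of (l, n \<oplus>\<^bsub>sec N (sig U)\<^esub> n')) = T.K (frag_of (l, n)) \<oplus>\<^bsub>sec PP.TP U\<^esub> T.K (frag_of (l, n'))"
    using T.K_fr_add_right[of l n n'] U by (simp add: T.T_add)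
  then show ?thesis
    unfolding pure_eq LN_eq using TP.to_shf_add[OF U(1) K_closed[OF U(1,2,3)] K_closed[OF U(1,2,4)]] by simp
qed

lemma pure_smult:
  assumes U: "zopen U" "f \<in> regular 0 0 U" "l \<in> Lsec U" "n \<in> secs N (sig U)"
  shows "f \<odot>\<^bsub>sec LN U\<^esub> pure U l n = pure U (\<lambda>v. f v * l v) n"
proof -
  interpret T: tensor_pair "oring U" "sec Lbd U" "sec (sig_pull N) U" using PP.pair[OF U(1)] .
  have "f \<odot>\<^bsub>sec PP.TP U\<^esub> T.K (frag_of (l, n)) = T.K (frag_of (\<lambda>v. f v * l v, n))"
    using T.T_smult[of f "frag_of (l, n)"] U by (simp add: T.sc_fr)
  then show ?thesis
    unfolding pure_eq LN_eq using TP.to_shf_smult[OF U(1,2) K_closed[OF U(1,3,4)]] by simp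
qed

lemma pure_balanced:
  assumes U: "zopen U" "f \<in> regular 0 0 U" "l \<in> Lsec U" "n \<in> secs N (sig U)"
  shows "pure U (\<lambda>v. f v * l v) n = pure U l (sigf f \<odot>\<^bsub>sec N (sig U)\<^esub> n)"
proof -
  interpret T: tensor_pair "oring U" "sec Lbd U" "sec (sig_pull N) U" using PP.pair[OF U(1)] .
  show ?thesis unfolding pure_eq using T.K_fr_balanced[of f l n] U by simp
qed

lemma pure_res:
  assumes U: "zopen U" "zopen W" "W \<subseteq> U" "l \<in> Lsec U" "n \<in> secs N (sig U)"
  shows "res LN U W (pure U l n) = pure W (rst W l) (res N (sig U) (sig W) n)"
  unfolding pure_eq LN_eq using TP.to_shf_res[OF U(1-3) K_closed[OF U(1,4,5)]] PP.TP_res[OF U(1-3)]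
  by simp

lemma pure_zero_right:
  assumes U: "zopen U" "l \<in> Lsec U" shows "pure U l \<zero>\<^bsub>sec N (sig U)\<^esub> = \<zero>\<^bsub>sec LN U\<^esub>"
proof -
  have z: "\<zero>\<^bsub>sec N (sig U)\<^esub> \<in> secs N (sig U)" using N.pre.zero_closed U by simp
  interpret A: module "oring U" "sec LN U" using LN.sec_module[OF U(1)] .
  have n: "(\<lambda>_. 0) \<odot>\<^bsub>sec N (sig U)\<^esub> \<zero>\<^bsub>sec N (sig U)\<^esub> = \<zero>\<^bsub>sec N (sig U)\<^esub>"
    using module.smult_l_null[OF N.sec_module z] U by simp
  have "pure U l \<zero>\<^bsub>sec N (sig U)\<^esub> = pure U (\<lambda>v. (\<lambda>_. 0) v * l v) \<zero>\<^bsub>sec N (sig U)\<^esub>"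
    using pure_balanced[OF U(1) regular_0[OF U(1)] U(2) z] n by (simp add: sigf_const)
  also have "\<dots> = (\<lambda>_. 0) \<odot>\<^bsub>sec LN U\<^esub> pure U l \<zero>\<^bsub>sec N (sig U)\<^esub>"
    using pure_smult[OF U(1) regular_0[OF U(1)] U(2) z] by simp
  also have "\<dots> = \<zero>\<^bsub>sec LN U\<^esub>" using A.smult_l_null[OF pure_closed[OF U z]] by simp
  finally show ?thesis .
qed

lemma pure_divide:
  assumes U: "zopen U" "l \<in> Lsec U" "n \<in> secs N (sig U)" and e: "e \<in> Lsec U" "\<And>w. w \<in> U \<Longrightarrow> e w \<noteq> 0"
  shows "pure U l n = pure U e (sigf (\<lambda>v. l v * inverse (e v)) \<odot>\<^bsub>sec N (sig U)\<^esub> n)"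
  using pure_balanced[OF U(1) regular_divide(1)[OF U(2) e] e(1) U(3)] regular_divide(2)[OF U(2) e] by simp

lemma pure_local:
  assumes U: "zopen U" and x: "x \<in> secs LN U" and v: "v \<in> U"
  obtains W e n where "zopen W" "v \<in> W" "W \<subseteq> U" "e \<in> Lsec W" "\<And>w. w \<in> W \<Longrightarrow> e w \<noteq> 0"
    "n \<in> secs N (sig W)" "res LN U W x = pure W e n"
proof -
  have x': "x \<in> secs (sheafify PP.TP) U" using x unfolding LN_eq .
  obtain T X where T: "zopen T" "v \<in> T" "T \<subseteq> U" "X \<in> secs PP.TP T" "res (sheafify PP.TP) U T x = to_shf PP.TP T X"
    using TP.to_shf_locally_surj[OF U x' v] .
  obtain W e where W: "zopen W" "v \<in> W" "W \<subseteq> T" "e \<in> Lsec W" "\<And>w. w \<in> W \<Longrightarrow> e w \<noteq> 0"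
    using local_unit[OF T(1,2), of "-1" "-1"] by metis
  interpret P: tensor_pair "oring W" "sec Lbd W" "sec (sig_pull N) W" using PP.pair[OF W(1)] .
  have XW: "res PP.TP T W X \<in> carrier P.T" using TP.res_closed[OF T(1) W(1,3) T(4)] by simp
  have "\<exists>n\<in>carrier (sec (sig_pull N) W). res PP.TP T W X = P.K (frag_of (e, n))"
  proof (rule P.tensor_collapse[OF _ _ XW])
    fix l assume "l \<in> secs Lbd W"
    then have "l \<in> Lsec W" by simp
    from regular_divide[OF this W(4,5)] show "\<exists>r\<in>carrier (oring W). l = r \<odot>\<^bsub>sec Lbd W\<^esub> e"
      by (intro bexI[of _ "\<lambda>v. l v * inverse (e v)"]) auto
  qed (use W in simp)
  then obtain n where n: "n \<in> secs N (sig W)" "res PP.TP T W X = P.K (frag_of (e, n))" by auto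
  have WU: "W \<subseteq> U" using W T by blast
  have "res LN U W x = res (sheafify PP.TP) T W (to_shf PP.TP T X)"
    unfolding LN_eq T(5)[symmetric]
    using O_module.res_res[OF TP.O_module_sheafify U T(1) W(1,3) T(3) x'] by simp
  also have "\<dots> = pure W e n" unfolding pure_eq using TP.to_shf_res[OF T(1) W(1,3) T(4)] n(2) by simp
  finally show ?thesis using that W WU n by blast
qed

text \<open>
  The assignment \<open>l \<otimes> n \<mapsto> \<sigma>(l / e) n\<close> is balanced, and it recovers \<open>n\<close> from \<open>e \<otimes> n\<close>.
\<close>

lemma pure_inj:
  assumes U: "zopen U" and e: "e \<in> Lsec U" "\<And>w. w \<in> U \<Longrightarrow> e w \<noteq> 0"
    and n: "n \<in> secs N (sig U)" "n' \<in> secs N (sig U)" and eq: "pure U e n = pure U e n'"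
  shows "n = n'"
proof (rule N.eq_locally[OF _ n])
  show sU: "zopen (sig U)" using U by simp
  fix v assume "v \<in> sig U"
  then have v: "prod.swap v \<in> U" by simp
  obtain W where W: "zopen W" "prod.swap v \<in> W" "W \<subseteq> U"
    "res PP.TP U W (PP.K U (frag_of (e, n))) = res PP.TP U W (PP.K U (frag_of (e, n')))"
    using eq v unfolding pure_eq TP.to_shf_eq_iff[OF U K_closed[OF U e(1) n(1)] K_closed[OF U e(1) n(2)]] by blast
  interpret P: tensor_pair "oring W" "sec Lbd W" "sec (sig_pull N) W" using PP.pair[OF W(1)] .
  have sW: "zopen (sig W)" using W by simp
  interpret NW: module "oring (sig W)" "sec N (sig W)" using N.sec_module[OF sW] .
  have eW: "rst W e \<in> Lsec W" "\<And>w. w \<in> W \<Longrightarrow> rst W e w \<noteq> 0"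
    using regular_rst[OF e(1) W(1,3)] e(2) W(3) by (auto simp: rst_def)
  let ?n = "res N (sig U) (sig W) n" and ?n' = "res N (sig U) (sig W) n'"
  have nW: "?n \<in> secs N (sig W)" "?n' \<in> secs N (sig W)"
    using N.res_closed[OF sU sW] n W(3) by (auto simp: image_mono)
  define \<beta> where "\<beta> l n = sigf (\<lambda>v. l v * inverse (rst W e v)) \<odot>\<^bsub>sec N (sig W)\<^esub> n" for l n
  have q: "sigf (\<lambda>v. l v * inverse (rst W e v)) \<in> carrier (oring (sig W))" if "l \<in> Lsec W" for l
    using sigf_regular[OF regular_divide(1)[OF that eW]] by simp
  have "\<beta> (rst W e) ?n = \<beta> (rst W e) ?n'"
  proof (rule P.tensor_lift[of "sec N (sig W)" \<beta>])
    show "abelian_group (sec N (sig W))" using N.pre.ab[OF sW] .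
    show "\<beta> m n \<in> secs N (sig W)" if "m \<in> secs Lbd W" "n \<in> secs (sig_pull N) W" for m n
      using q[of m] that NW.smult_closed unfolding \<beta>_def by auto
    show "\<beta> (m \<oplus>\<^bsub>sec Lbd W\<^esub> m') n = \<beta> m n \<oplus>\<^bsub>sec N (sig W)\<^esub> \<beta> m' n"
      if "m \<in> secs Lbd W" "m' \<in> secs Lbd W" "n \<in> secs (sig_pull N) W" for m m' n
    proof -
      have "sigf (\<lambda>v. (m v + m' v) * inverse (rst W e v)) =
          sigf (\<lambda>v. m v * inverse (rst W e v)) \<oplus>\<^bsub>oring (sig W)\<^esub> sigf (\<lambda>v. m' v * inverse (rst W e v))"
        by (auto simp: algebra_simps fun_eq_iff)
      then show ?thesis using NW.smult_l_distr[OF q[of m] q[of m']] that unfolding \<beta>_def by simp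
    qed
    show "\<beta> m (n \<oplus>\<^bsub>sec (sig_pull N) W\<^esub> n') = \<beta> m n \<oplus>\<^bsub>sec N (sig W)\<^esub> \<beta> m n'"
      if "m \<in> secs Lbd W" "n \<in> secs (sig_pull N) W" "n' \<in> secs (sig_pull N) W" for m n n'
      using NW.smult_r_distr[OF q[of m]] that unfolding \<beta>_def by simp
    show "\<beta> (r \<odot>\<^bsub>sec Lbd W\<^esub> m) n = \<beta> m (r \<odot>\<^bsub>sec (sig_pull N) W\<^esub> n)"
      if "r \<in> carrier (oring W)" "m \<in> secs Lbd W" "n \<in> secs (sig_pull N) W" for r m n
    proof -
      have r: "sigf r \<in> carrier (oring (sig W))" using sigf_regular[of r 0 0 W] that by simp
      have "sigf (\<lambda>v. r v * m v * inverse (rst W e v)) =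
          sigf (\<lambda>v. m v * inverse (rst W e v)) \<otimes>\<^bsub>oring (sig W)\<^esub> sigf r"
        by (auto simp: algebra_simps fun_eq_iff)
      then show ?thesis using NW.smult_assoc1[OF q[of m] r] that unfolding \<beta>_def by simp
    qed
    show "P.K (frag_of (rst W e, ?n)) = P.K (frag_of (rst W e, ?n'))"
      using W(4) PP.TP_res[OF U W(1,3)] by simp
  qed (use eW nW in auto)
  moreover have "sigf (\<lambda>v. rst W e v * inverse (rst W e v)) = \<one>\<^bsub>oring (sig W)\<^esub>"
    using eW(2) by (auto simp: rst_def fun_eq_iff)
  then have "\<beta> (rst W e) m = m" if "m \<in> secs N (sig W)" for m
    unfolding \<beta>_def using NW.smult_one[OF that] by simp
  ultimately have "?n = ?n'" using nW by simp
  then show "\<exists>W. zopen W \<and> v \<in> W \<and> W \<subseteq> sig U \<and> res N (sig U) W n = res N (sig U) W n'"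
    using sW W by (intro exI[of _ "sig W"]) (auto simp del: zopen_sig_iff)
qed

end

section \<open>Global sections\<close>

lemma poly_eq_off:
  fixes P Q R :: "'k::field_char_0 poly"
  assumes "R \<noteq> 0" "\<And>t. poly R t \<noteq> 0 \<Longrightarrow> poly P t = poly Q t" shows "P = Q"
proof -
  have "poly (R * (P - Q)) t = 0" for t using assms(2)[of t] by (cases "poly R t = 0") auto
  then have "R * (P - Q) = 0" using poly_all_0_iff_0 by blast
  then show ?thesis using assms(1) by simp
qed

text \<open>
  A function that is locally a quotient of polynomials is a polynomial: among all representations
  take one with a denominator of minimal degree. At a zero of this denominator, the local
  representation shows that numerator and denominator have a common factor, which could be
  cancelled.
\<close>

lemma locally_rational_polyfun:
  fixes g :: "'k::{alg_closed_field, field_char_0} \<Rightarrow> 'k"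
  assumes loc: "\<And>t0. \<exists>P Q R. poly Q t0 \<noteq> 0 \<and> poly R t0 \<noteq> 0 \<and> (\<forall>t. poly R t \<noteq> 0 \<longrightarrow> g t * poly Q t = poly P t)"
  shows "polyfun g"
proof -
  define S where "S Q \<longleftrightarrow> Q \<noteq> 0 \<and> (\<exists>P R. R \<noteq> 0 \<and> (\<forall>t. poly R t \<noteq> 0 \<longrightarrow> g t * poly Q t = poly P t))" for Q
  obtain Q0 where "S Q0" using loc[of 0] unfolding S_def by (metis poly_0)
  then obtain Q where Q: "S Q" "\<And>Q'. S Q' \<Longrightarrow> degree Q \<le> degree Q'"
    using ex_has_least_nat[of S Q0 degree] by blast
  obtain P R where PR: "R \<noteq> 0" "\<And>t. poly R t \<noteq> 0 \<Longrightarrow> g t * poly Q t = poly P t" "Q \<noteq> 0"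
    using Q(1) unfolding S_def by blast
  have cross: "P * Q' = P' * Q" if "poly R' t0 \<noteq> 0" "\<forall>t. poly R' t \<noteq> 0 \<longrightarrow> g t * poly Q' t = poly P' t" for P' Q' R' t0
  proof (rule poly_eq_off[of "R * R'"])
    show "R * R' \<noteq> 0" using PR(1) that(1) by auto
    show "poly (P * Q') t = poly (P' * Q) t" if "poly (R * R') t \<noteq> 0" for t
    proof -
      have "poly R t \<noteq> 0" "poly R' t \<noteq> 0" using that by auto
      then have "poly P t = g t * poly Q t" "poly P' t = g t * poly Q' t"
        using PR(2)[of t] \<open>\<forall>t. poly R' t \<noteq> 0 \<longrightarrow> g t * poly Q' t = poly P' t\<close> by auto
      then show ?thesis by simp
    qed
  qed
  have "degree Q = 0"
  proof (rule ccontr)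
    assume "degree Q \<noteq> 0"
    then obtain a where a: "poly Q a = 0" using alg_closed_imp_poly_has_root[of Q] by auto
    obtain P' Q' R' where L: "poly Q' a \<noteq> 0" "poly R' a \<noteq> 0" "\<forall>t. poly R' t \<noteq> 0 \<longrightarrow> g t * poly Q' t = poly P' t"
      using loc[of a] by blast
    have "poly (P * Q') a = poly (P' * Q) a" using cross[OF L(2,3)] by simp
    then have "poly P a = 0" using a L(1) by simp
    then obtain P1 where P1: "P = [:-a, 1:] * P1" by (auto simp: poly_eq_0_iff_dvd)
    obtain Q1 where Q1: "Q = [:-a, 1:] * Q1" using a by (auto simp: poly_eq_0_iff_dvd)
    have Q1n: "Q1 \<noteq> 0" using PR(3) Q1 by auto
    have "S Q1" unfolding S_def
    proof (intro conjI exI allI impI)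
      show "Q1 \<noteq> 0" by (rule Q1n)
      show "R * [:-a, 1:] \<noteq> 0" using PR(1) by (simp only: mult_eq_0_iff) simp
      show "g t * poly Q1 t = poly P1 t" if "poly (R * [:-a, 1:]) t \<noteq> 0" for t
      proof -
        have "poly R t \<noteq> 0" "t - a \<noteq> 0" using that by auto
        then have "(t - a) * (g t * poly Q1 t) = (t - a) * poly P1 t" using PR(2)[of t] unfolding P1 Q1 by (simp add: algebra_simps)
        then show ?thesis using \<open>t - a \<noteq> 0\<close> mult_left_cancel by blast
      qed
    qed
    moreover have "degree Q = Suc (degree Q1)" unfolding Q1 using Q1n by (subst degree_mult_eq) auto
    ultimately show False using Q(2)[of Q1] by simp
  qed
  then obtain c where c: "Q = [:c:]" "c \<noteq> 0" using PR(3) by (metis degree_eq_zeroE pCons_0_0)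
  have "g t0 = poly (Polynomial.smult (inverse c) P) t0" for t0
  proof -
    obtain P' Q' R' where L: "poly Q' t0 \<noteq> 0" "poly R' t0 \<noteq> 0" "\<forall>t. poly R' t \<noteq> 0 \<longrightarrow> g t * poly Q' t = poly P' t"
      using loc[of t0] by blast
    have "poly (P * Q') t0 = poly (P' * Q) t0" using cross[OF L(2,3)] by simp
    then have "poly P t0 * poly Q' t0 = g t0 * poly Q' t0 * c" using L(2,3) c(1) by simp
    then have "poly P t0 = g t0 * c" using L(1) by (simp add: mult.commute mult.left_commute)
    then show ?thesis using c(2) by (simp add: field_simps)
  qed
  then show ?thesis unfolding polyfun_def by blast
qed

lemma zopen_basis:
  assumes "zopen W" "v \<in> W"
  obtains m n F where "bihom m n F" "F v \<noteq> 0" "\<And>w. w \<in> ycone \<Longrightarrow> F w \<noteq> 0 \<Longrightarrow> w \<in> W"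
proof -
  obtain S where S: "\<forall>F\<in>S. \<exists>m n. bihom m n F" "W = {v \<in> ycone. \<exists>F\<in>S. F v \<noteq> 0}"
    using assms(1) unfolding zopen_def by blast
  then obtain F where "F \<in> S" "F v \<noteq> 0" using assms(2) by blast
  then show ?thesis using S that by blast
qed

lemma regular_line_polyfun:
  fixes f :: "'k::{alg_closed_field, field_char_0} fn"
  assumes f: "f \<in> regular a b ycone" and \<gamma>: "\<And>t. \<gamma> t \<in> ycone"
    and x: "\<And>i. polyfun (\<lambda>t. fst (\<gamma> t) $ i)" and y: "\<And>i. polyfun (\<lambda>t. snd (\<gamma> t) $ i)"
  shows "polyfun (\<lambda>t. f (\<gamma> t))"
proof (rule locally_rational_polyfun)
  fix t0
  obtain W where W: "zopen W" "\<gamma> t0 \<in> W" "W \<subseteq> ycone" "quot_on a b W f" using regularE[OF f \<gamma>] .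
  obtain m n H where H: "bihom m n H" "H (\<gamma> t0) \<noteq> 0" "\<And>w. w \<in> ycone \<Longrightarrow> H w \<noteq> 0 \<Longrightarrow> w \<in> W"
    by (rule zopen_basis[OF W(1,2)]) blast
  obtain m n m' n' F G where FG: "bihom m n F" "bihom m' n' G" "\<And>w. w \<in> W \<Longrightarrow> G w \<noteq> 0 \<and> f w = F w / G w"
    using W(4) unfolding quot_on_def by blast
  obtain P where P: "\<And>t. F (\<gamma> t) = poly P t" using bihom_polyfun[OF FG(1) x y] unfolding polyfun_def by blast
  obtain Q where Q: "\<And>t. G (\<gamma> t) = poly Q t" using bihom_polyfun[OF FG(2) x y] unfolding polyfun_def by blast
  obtain R where R: "\<And>t. H (\<gamma> t) = poly R t" using bihom_polyfun[OF H(1) x y] unfolding polyfun_def by blast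
  have "f (\<gamma> t) * poly Q t = poly P t" if "poly R t \<noteq> 0" for t
    using FG(3)[OF H(3)[OF \<gamma>[of t]]] that P Q R by simp
  moreover have "poly Q t0 \<noteq> 0" "poly R t0 \<noteq> 0" using FG(3)[OF W(2)] H(2) Q R by auto
  ultimately show "\<exists>P Q R. poly Q t0 \<noteq> 0 \<and> poly R t0 \<noteq> 0 \<and> (\<forall>t. poly R t \<noteq> 0 \<longrightarrow> f (\<gamma> t) * poly Q t = poly P t)"
    by blast
qed

lemma bihom_scale_snd: "bihom m n F \<Longrightarrow> F (x, c *s y) = c ^ n * F (x, y)"
proof -
  assume "bihom m n F"
  then obtain d where d: "\<And>x y. F (x, y) =
     (\<Sum>i\<le>m. \<Sum>j\<le>n. d i j * (x$1)^i * (x$2)^(m - i) * (y$1)^j * (y$2)^(n - j))"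
    unfolding bihom_def by blast
  have A: "(c * y$1)^j * (c * y$2)^(n - j) = c ^ n * ((y$1)^j * (y$2)^(n - j))" if "j \<le> n" for j
  proof -
    have "c ^ n = c ^ j * c ^ (n - j)" using that by (simp flip: power_add)
    then show ?thesis by (simp add: power_mult_distrib mult_ac)
  qed
  then have "d i j * (x$1)^i * (x$2)^(m - i) * (c * y$1)^j * (c * y$2)^(n - j) =
      c ^ n * (d i j * (x$1)^i * (x$2)^(m - i) * (y$1)^j * (y$2)^(n - j))" if "j \<le> n" for i j
  proof -
    have "d i j * (x$1)^i * (x$2)^(m - i) * (c * y$1)^j * (c * y$2)^(n - j) =
      (d i j * (x$1)^i * (x$2)^(m - i)) * ((c * y$1)^j * (c * y$2)^(n - j))" if "j \<le> n" for i j
      by (simp only: mult.assoc)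
    then show ?thesis using A[OF that] that by (simp add: mult_ac)
  qed
  then show ?thesis unfolding d sum_distrib_left by (intro sum.cong refl) simp
qed

definition vec2 :: "'k \<Rightarrow> 'k \<Rightarrow> 'k^2" where
  "vec2 s t = (\<chi> i. if i = 1 then s else t)"

lemma vec2_simps [simp]: "vec2 s t $ 1 = s" "vec2 s t $ 2 = t"
  by (simp_all add: vec2_def)

lemma vec2_eq: "x = vec2 (x $ 1) (x $ 2)"
  by (simp add: vec_eq_iff forall_2)

lemma vec2_zero_iff: "vec2 s t = 0 \<longleftrightarrow> s = 0 \<and> t = (0::'k::zero)"
  by (simp add: vec_eq_iff forall_2)

lemma smult_vec2: "c *s vec2 s t = vec2 (c * s) (c * t)"
  by (simp add: vec_eq_iff forall_2)

lemma vec2_inject: "vec2 s t = vec2 s' t' \<longleftrightarrow> s = s' \<and> t = t'"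
  by (auto simp: vec_eq_iff forall_2)

lemma polyfun_const: "polyfun (\<lambda>_. c)"
  unfolding polyfun_def by (rule exI[of _ "[:c:]"]) simp

lemma polyfun_ident: "polyfun (\<lambda>t. t)"
  unfolding polyfun_def by (rule exI[of _ "[:0, 1:]"]) simp

lemma polyfun_vec2: "polyfun f \<Longrightarrow> polyfun g \<Longrightarrow> polyfun (\<lambda>t. vec2 (f t) (g t) $ i)"
  using exhaust_2[of i] by auto

text \<open>
  In the second variable, a section of \<open>O(a, -k)\<close> with \<open>k \<ge> 0\<close> is given by polynomials \<open>P\<close>, \<open>Q\<close> in
  the two affine charts of the projective line, related by \<open>Q(1/t) = t^k P(t)\<close>; comparing degrees
  shows that they are constant, and zero if \<open>k > 0\<close>.
\<close>

lemma global_section_snd: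
  fixes f :: "'k::{alg_closed_field, field_char_0} fn"
  assumes f: "f \<in> regular a (- int k) ycone" and x: "x \<noteq> 0"
  obtains c where "\<And>y. y \<noteq> 0 \<Longrightarrow> f (x, y) = (if k = 0 then c else 0)"
proof -
  have hom: "f (x, y) = c ^ k * f (x, c *s y)" if y: "y \<noteq> 0" and c: "c \<noteq> 0" for y c
  proof -
    have v: "(x, y) \<in> ycone" "(x, c *s y) \<in> ycone" using x y c by (auto simp: ycone_def)
    obtain W where W: "zopen W" "(x, y) \<in> W" "W \<subseteq> ycone" "quot_on a (- int k) W f" using regularE[OF f v(1)] .
    obtain m n m' n' F G where FG: "bihom m n F" "bihom m' n' G" "int n - int n' = - int k"
      "\<And>w. w \<in> W \<Longrightarrow> G w \<noteq> 0 \<and> f w = F w / G w"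
      using W(4) unfolding quot_on_def by blast
    obtain m1 n1 H where H: "bihom m1 n1 H" "H (x, y) \<noteq> 0" "\<And>w. w \<in> ycone \<Longrightarrow> H w \<noteq> 0 \<Longrightarrow> w \<in> W"
      by (rule zopen_basis[OF W(1,2)]) blast
    have "(x, c *s y) \<in> W" using H(3)[OF v(2)] H(2) bihom_scale_snd[OF H(1)] c by simp
    from FG(4)[OF this] FG(4)[OF W(2)] have "f (x, y) = F (x, y) / G (x, y)" "G (x, y) \<noteq> 0"
      "f (x, c *s y) = (c ^ n * F (x, y)) / (c ^ n' * G (x, y))"
      using bihom_scale_snd[OF FG(1)] bihom_scale_snd[OF FG(2)] by auto
    moreover have "n' = n + k" using FG(3) by simp
    ultimately have "c ^ n * G (x, y) * f (x, y) = c ^ n * G (x, y) * (c ^ k * f (x, c *s y))"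
      using c by (simp add: power_add field_simps)
    then show ?thesis using c \<open>G (x, y) \<noteq> 0\<close> by simp
  qed
  have "polyfun (\<lambda>t. f (x, vec2 t 1))"
    by (rule regular_line_polyfun[OF f, where \<gamma> = "\<lambda>t. (x, vec2 t 1)"])
      (use x in \<open>auto simp: ycone_def vec2_zero_iff intro: polyfun_const polyfun_ident polyfun_vec2\<close>)
  then obtain P where P: "\<And>t. f (x, vec2 t 1) = poly P t" unfolding polyfun_def by blast
  have "polyfun (\<lambda>t. f (x, vec2 1 t))"
    by (rule regular_line_polyfun[OF f, where \<gamma> = "\<lambda>t. (x, vec2 1 t)"])
      (use x in \<open>auto simp: ycone_def vec2_zero_iff intro: polyfun_const polyfun_ident polyfun_vec2\<close>)
  then obtain Q where Q: "\<And>t. f (x, vec2 1 t) = poly Q t" unfolding polyfun_def by blast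
  have PQ: "poly Q (inverse t) = t ^ k * poly P t" if "t \<noteq> 0" for t
  proof -
    have "t *s vec2 1 (inverse t) = vec2 t 1" using that by (simp add: smult_vec2)
    then show ?thesis using hom[of "vec2 1 (inverse t)" t] that P Q by (simp add: vec2_zero_iff)
  qed
  let ?n = "degree Q"
  \<comment> \<open>Reflection turns \<open>Q(1/t)\<close> into a polynomial, whose degree is at most that of \<open>Q\<close>.\<close>
  have refl: "reflect_poly Q = monom 1 (?n + k) * P"
  proof (rule poly_eq_off[of "[:0, 1:]"])
    show "poly (reflect_poly Q) t = poly (monom 1 (?n + k) * P) t" if "poly [:0, 1:] t \<noteq> 0" for t
      using that PQ[of t] by (simp add: poly_reflect_poly_nz poly_monom power_add)
  qed simp
  have Pk: "P = 0 \<or> (k = 0 \<and> degree P = 0)"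
  proof (rule disjCI)
    assume "\<not> (k = 0 \<and> degree P = 0)"
    then show "P = 0"
    proof (rule contrapos_np)
      assume "P \<noteq> 0"
      then have "degree (reflect_poly Q) = (?n + k) + degree P"
        unfolding refl by (subst degree_mult_eq) (auto simp: degree_monom_eq)
      then show "k = 0 \<and> degree P = 0" using degree_reflect_poly_le[of Q] by simp
    qed
  qed
  obtain c where c: "\<And>t. poly P t = (if k = 0 then c else 0)"
  proof (cases "P = 0")
    case True then show thesis using that[of 0] by simp
  next
    case False
    then obtain d where "k = 0" "P = [:d:]" using Pk by (metis degree_eq_zeroE)
    then show thesis using that[of d] by simp
  qed
  have "Q = [:if k = 0 then c else 0:]"
  proof (rule poly_eq_off[of "[:0, 1:]"])
    fix t :: 'k assume "poly [:0, 1:] t \<noteq> 0"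
    then have "t \<noteq> 0" by simp
    then show "poly Q t = poly [:if k = 0 then c else 0:] t" using PQ[of "inverse t"] c by simp
  qed simp
  then have c': "poly Q t = (if k = 0 then c else 0)" for t by simp
  show thesis
  proof (rule that[of c])
    fix y :: "'k^2" assume y: "y \<noteq> 0"
    show "f (x, y) = (if k = 0 then c else 0)"
    proof (cases "y $ 2 = 0")
      case False
      have "inverse (y $ 2) *s y = vec2 (inverse (y $ 2) * y $ 1) 1"
        using False by (subst vec2_eq[of y]) (simp add: smult_vec2)
      then show ?thesis using hom[OF y, of "inverse (y $ 2)"] False P c by simp
    next
      case True
      then have y1: "y $ 1 \<noteq> 0" using y vec2_eq[of y] vec2_zero_iff[of "y $ 1" "y $ 2"] by auto
      have "inverse (y $ 1) *s y = vec2 1 0"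
        using y1 True by (subst vec2_eq[of y]) (simp add: smult_vec2)
      then show ?thesis using hom[OF y, of "inverse (y $ 1)"] y1 Q c' by simp
    qed
  qed
qed

lemma global_section_zero_snd:
  fixes f :: "'k::{alg_closed_field, field_char_0} fn"
  assumes "f \<in> regular a b ycone" "b < 0" shows "f = (\<lambda>_. 0)"
proof
  fix v show "f v = 0"
  proof (cases "v \<in> ycone")
    case True
    then have "fst v \<noteq> 0" "snd v \<noteq> 0" by (auto simp: ycone_def)
    obtain k where k: "b = - int k" "k \<noteq> 0" using assms(2) by (metis neg_int_cases of_nat_0 less_irrefl neg_equal_0_iff_equal)
    obtain c where c: "\<And>y. y \<noteq> 0 \<Longrightarrow> f (fst v, y) = (if k = 0 then c else 0)"
      using global_section_snd[OF assms(1)[unfolded k(1)] \<open>fst v \<noteq> 0\<close>] by blast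
    have "f (fst v, snd v) = (if k = 0 then c else 0)" by (rule c[OF \<open>snd v \<noteq> 0\<close>])
    then show ?thesis using k(2) by simp
  qed (use regular_outside[OF assms(1)] in blast)
qed

lemma global_section_zero_fst:
  fixes f :: "'k::{alg_closed_field, field_char_0} fn"
  assumes "f \<in> regular a b ycone" "a < 0" shows "f = (\<lambda>_. 0)"
proof -
  have "sigf f \<in> regular b a ycone" using regular_swap[OF assms(1)] by simp
  then have "sigf f = (\<lambda>_. 0)" using assms(2) by (rule global_section_zero_snd)
  then have "sigf (sigf f) = sigf (\<lambda>_. 0)" by (rule arg_cong)
  then show ?thesis unfolding sigf_sigf sigf_const .
qed

lemma global_section_const:
  fixes f :: "'k::{alg_closed_field, field_char_0} fn"
  assumes f: "f \<in> regular 0 0 ycone" obtains c where "\<And>v. v \<in> ycone \<Longrightarrow> f v = c"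
proof -
  have sf: "sigf f \<in> regular 0 0 ycone" using regular_swap[OF f] by simp
  have const: "g (x, y) = g (x, y')" if "g \<in> regular 0 0 ycone" and x: "x \<noteq> 0" and y: "y \<noteq> 0" "y' \<noteq> 0" for g :: "'k fn" and x y y'
  proof -
    have g: "g \<in> regular 0 (- int 0) ycone" using that(1) by simp
    obtain c where "\<And>y. y \<noteq> 0 \<Longrightarrow> g (x, y) = (if (0::nat) = 0 then c else 0)"
      using global_section_snd[OF g x] by blast
    then show ?thesis using y by simp
  qed
  have 1: "f (x, y) = f (x, y')" if "x \<noteq> 0" "y \<noteq> 0" "y' \<noteq> 0" for x y y'
    using const[OF f that] .
  have 2: "f (x, y) = f (x', y)" if "x \<noteq> 0" "x' \<noteq> 0" "y \<noteq> 0" for x x' y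
    using const[OF sf that(3,1,2)] by simp
  show thesis
  proof (rule that[of "f (vec2 1 0, vec2 1 0)"])
    fix v :: "'k pt" assume "v \<in> ycone"
    then show "f v = f (vec2 1 0, vec2 1 0)"
      using 1[of "fst v" "snd v" "vec2 1 0"] 2[of "fst v" "vec2 1 0" "vec2 1 0"]
      by (auto simp: ycone_def vec2_zero_iff)
  qed
qed

section \<open>The double cover and the pullback of the second conic\<close>

lemma conic_form: "smooth_conic q \<Longrightarrow> \<exists>a :: 'k::field^3^3. \<forall>z. q z = (\<Sum>i\<in>UNIV. \<Sum>j\<in>UNIV. a$i$j * z$i * z$j)"
  unfolding smooth_conic_def by blast

lemma conic_scale: assumes "smooth_conic q" shows "q (c *s z) = c^2 * q z"
proof -
  obtain a where "\<forall>z. q z = (\<Sum>i\<in>UNIV. \<Sum>j\<in>UNIV. a$i$j * z$i * z$j)" using conic_form[OF assms] by blast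
  then show ?thesis by (simp add: sum_distrib_left power2_eq_square mult_ac)
qed

lemma bihom_conic:
  assumes "smooth_conic q" "\<And>i. bihom 1 1 (\<lambda>v. p v $ i)" shows "bihom 2 2 (q \<circ> p)"
proof -
  obtain a where a: "\<And>z. q z = (\<Sum>i\<in>UNIV. \<Sum>j\<in>UNIV. a$i$j * z$i * z$j)" using conic_form[OF assms(1)] by blast
  have "bihom (1 + 1) (1 + 1) (\<lambda>v. a$i$j * (p v $ i * p v $ j))" for i j
    by (intro bihom_cmult bihom_mult assms(2))
  then have "bihom 2 2 (\<lambda>v. \<Sum>i\<in>UNIV. \<Sum>j\<in>UNIV. a$i$j * (p v $ i * p v $ j))"
    by (intro bihom_sum) (simp only: one_add_one)
  then show ?thesis unfolding comp_def a by (simp add: mult.assoc)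
qed

lemma point_P2_eqD: "point_P2 z = point_P2 w \<Longrightarrow> \<exists>c. c \<noteq> 0 \<and> z = c *s w"
proof -
  assume "point_P2 z = point_P2 w"
  moreover have "z = 1 *s z" by simp
  then have "z \<in> point_P2 z" unfolding point_P2_def by (metis (mono_tags, lifting) mem_Collect_eq zero_neq_one)
  ultimately show ?thesis unfolding point_P2_def by blast
qed

lemma double_coverD:
  assumes "double_cover p q"
  shows "bihom 1 1 (\<lambda>v. p v $ i)" "v \<in> ycone \<Longrightarrow> p v \<noteq> 0"
    "z \<noteq> 0 \<Longrightarrow> \<exists>v\<in>ycone. point_P2 (p v) = point_P2 z"
    "v \<in> ycone \<Longrightarrow> w \<in> ycone \<Longrightarrow> point_P2 (p v) = point_P2 (p w) \<longleftrightarrow> same_pt v w \<or> same_pt (prod.swap v) w"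
    "v \<in> ycone \<Longrightarrow> q (p v) = 0 \<longleftrightarrow> same_pt v (prod.swap v)"
proof -
  note a = assms[unfolded double_cover_def]
  show "bihom 1 1 (\<lambda>v. p v $ i)" by (rule a[THEN conjunct1, THEN spec])
  show "v \<in> ycone \<Longrightarrow> p v \<noteq> 0" by (rule a[THEN conjunct2, THEN conjunct1, THEN bspec])
  show "z \<noteq> 0 \<Longrightarrow> \<exists>v\<in>ycone. point_P2 (p v) = point_P2 z"
    by (rule a[THEN conjunct2, THEN conjunct2, THEN conjunct1, THEN spec, THEN mp])
  show "v \<in> ycone \<Longrightarrow> w \<in> ycone \<Longrightarrow> point_P2 (p v) = point_P2 (p w) \<longleftrightarrow> same_pt v w \<or> same_pt (prod.swap v) w"
    by (rule a[THEN conjunct2, THEN conjunct2, THEN conjunct2, THEN conjunct1, THEN bspec, THEN bspec])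
  show "v \<in> ycone \<Longrightarrow> q (p v) = 0 \<longleftrightarrow> same_pt v (prod.swap v)"
    by (rule a[THEN conjunct2, THEN conjunct2, THEN conjunct2, THEN conjunct2, THEN bspec])
qed

text \<open>
  As \<open>p v\<close> and \<open>p (\<sigma> v)\<close> represent the same point of the plane, \<open>p \<circ> \<sigma> = \<lambda> p\<close> with a regular
  function \<open>\<lambda>\<close> on \<open>Y\<close>. It is constant, and \<open>1\<close> because it is \<open>1\<close> on the diagonal.
\<close>

lemma double_cover_symmetric:
  fixes p :: "'k::{alg_closed_field, field_char_0} pt \<Rightarrow> 'k^3"
  assumes p: "double_cover p q" and v: "v \<in> ycone"
  shows "p (prod.swap v) = p v"
proof -
  note bi = double_coverD(1)[OF p] and nz = double_coverD(2)[OF p]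
  have sw: "prod.swap v \<in> ycone" if "v \<in> ycone" for v :: "'k pt" using that by (auto simp: ycone_def)
  have "\<exists>c. c \<noteq> 0 \<and> p (prod.swap v) = c *s p v" if v: "v \<in> ycone" for v
  proof (rule point_P2_eqD)
    have "same_pt (prod.swap v) (prod.swap v)" unfolding same_pt_def by (intro exI[of _ 1]) auto
    then have "point_P2 (p v) = point_P2 (p (prod.swap v))"
      using double_coverD(4)[OF p v sw[OF v]] by blast
    then show "point_P2 (p (prod.swap v)) = point_P2 (p v)" ..
  qed
  then obtain lam where lam: "\<And>v. v \<in> ycone \<Longrightarrow> p (prod.swap v) = lam v *s p v" by metis
  let ?l = "rst ycone lam"
  have "?l \<in> regular 0 0 ycone" unfolding regular_iff
  proof (intro conjI allI impI ballI)
    fix w :: "'k pt" assume w: "w \<in> ycone"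
    obtain i where i: "p w $ i \<noteq> 0" using nz[OF w] by (auto simp: vec_eq_iff)
    let ?W = "{w \<in> ycone. p w $ i \<noteq> 0}"
    have "quot_on 0 0 ?W ?l"
    proof (rule quot_onI[OF bihom_swap[OF bi[of i]] bi[of i]])
      show "p w $ i \<noteq> 0 \<and> ?l w = ((\<lambda>v. p v $ i) \<circ> prod.swap) w / p w $ i" if "w \<in> ?W" for w
        using that lam[of w] by (simp add: rst_def)
    qed auto
    then show "\<exists>W. zopen W \<and> w \<in> W \<and> W \<subseteq> ycone \<and> quot_on 0 0 W ?l"
      using i w zopen_nonzero[OF bi[of i]] by (intro exI[of _ ?W]) auto
  qed (simp add: rst_def)
  then obtain c where c: "\<And>v. v \<in> ycone \<Longrightarrow> ?l v = c" using global_section_const by metis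
  let ?d = "(vec2 1 1, vec2 1 1) :: 'k pt"
  have d: "?d \<in> ycone" by (simp add: ycone_def vec2_zero_iff)
  have "p ?d = c *s p ?d" using lam[OF d] c[OF d] d by (simp add: rst_def)
  moreover obtain i where "p ?d $ i \<noteq> 0" using nz[OF d] by (auto simp: vec_eq_iff)
  ultimately have "c = 1" by (metis mult_cancel_right1 vector_smult_component)
  then show ?thesis using lam[OF v] c[OF v] v by (simp add: rst_def)
qed

text \<open>
  The diagonal is the preimage of the branch conic \<open>E\<close>, so the pullback of \<open>E'\<close> to it is a form of
  degree \<open>4\<close> with zeros at the four points of \<open>E \<inter> E'\<close>. At least three of these are visible in an
  affine chart, and three zeros of even order would need degree \<open>6\<close>.
\<close>

lemma odd_zero_on_diagonal:
  fixes p :: "'k::{alg_closed_field, field_char_0} pt \<Rightarrow> 'k^3"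
  assumes E: "smooth_conic E" and p: "double_cover p E" and E': "smooth_conic E'" and meet: "meet_in 4 E E'"
  obtains \<rho> a where "\<And>t. E' (p (vec2 t 1, vec2 t 1)) = poly \<rho> t" "\<rho> \<noteq> 0" "odd (Polynomial.order a \<rho>)"
proof -
  note bi = double_coverD(1)[OF p] and nz = double_coverD(2)[OF p]
  define D :: "'k \<Rightarrow> 'k pt" where "D t = (vec2 t 1, vec2 t 1)" for t
  define D0 :: "'k pt" where "D0 = (vec2 1 0, vec2 1 0)"
  have D: "D t \<in> ycone" "D0 \<in> ycone" for t unfolding D_def D0_def by (simp_all add: ycone_def vec2_zero_iff)
  note pt = double_coverD(4)[OF p] and ram = double_coverD(5)[OF p]
  obtain c where c: "\<And>x y. E' (p (x, y)) =
     (\<Sum>i\<le>2. \<Sum>j\<le>2. c i j * (x$1)^i * (x$2)^(2 - i) * (y$1)^j * (y$2)^(2 - j))"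
    using bihom_conic[OF E' bi] unfolding bihom_def comp_def by blast
  define \<rho> where "\<rho> = (\<Sum>i\<le>(2::nat). \<Sum>j\<le>(2::nat). monom (c i j) (i + j))"
  have \<rho>: "E' (p (D t)) = poly \<rho> t" for t
    unfolding D_def c \<rho>_def by (simp add: poly_sum poly_monom power_add mult_ac)
  have deg: "degree \<rho> \<le> 4" unfolding \<rho>_def
    by (intro degree_sum_le) (auto intro: order.trans[OF degree_monom_le])
  let ?Z = "point_P2 ` {z. z \<noteq> 0 \<and> E z = 0 \<and> E' z = 0}"
  have Z: "finite ?Z" "card ?Z = 4" using meet unfolding meet_in_def by auto
  have same_refl: "same_pt (D t) (prod.swap (D t))" for t
    unfolding same_pt_def D_def by (intro exI[of _ 1]) auto
  have inj: "inj (\<lambda>t. point_P2 (p (D t)))"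
  proof (rule injI)
    fix t t' assume "point_P2 (p (D t)) = point_P2 (p (D t'))"
    then have "same_pt (D t) (D t')" using pt[OF D(1) D(1)] by (auto simp: D_def)
    then show "t = t'" by (auto simp: same_pt_def D_def smult_vec2 vec2_inject)
  qed
  have ED: "E (p (D t)) = 0" for t using ram[OF D(1)] same_refl by blast
  have "\<rho> \<noteq> 0"
  proof
    assume "\<rho> = 0"
    then have "E' (p (D t)) = 0" for t using \<rho> by simp
    then have "range (\<lambda>t. point_P2 (p (D t))) \<subseteq> ?Z" using nz[OF D(1)] ED by blast
    then have "finite (range (\<lambda>t. point_P2 (p (D t))))" using Z(1) finite_subset by blast
    then show False using inj finite_imageD infinite_UNIV_char_0 by blast
  qed
  let ?R = "{t. poly \<rho> t = 0}"
  have finR: "finite ?R" using poly_roots_finite[OF \<open>\<rho> \<noteq> 0\<close>] .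
  \<comment> \<open>\<open>D0\<close> is the point of the diagonal outside the affine chart.\<close>
  have "?Z \<subseteq> insert (point_P2 (p D0)) ((\<lambda>t. point_P2 (p (D t))) ` ?R)"
  proof (rule image_subsetI)
    fix z assume "z \<in> {z. z \<noteq> 0 \<and> E z = 0 \<and> E' z = 0}"
    then have z: "z \<noteq> 0" "E z = 0" "E' z = 0" by auto
    then obtain v where v: "v \<in> ycone" "point_P2 (p v) = point_P2 z" using double_coverD(3)[OF p z(1)] by blast
    then obtain d where d: "d \<noteq> 0" "p v = d *s z" using point_P2_eqD by blast
    have "E (p v) = 0" using d z conic_scale[OF E] by simp
    then have sv: "same_pt v (prod.swap v)" using ram[OF v(1)] by blast
    then obtain s where s: "s \<noteq> 0" "snd v = s *s fst v" unfolding same_pt_def by auto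
    have x: "fst v \<noteq> 0" using v(1) by (auto simp: ycone_def)
    show "point_P2 z \<in> insert (point_P2 (p D0)) ((\<lambda>t. point_P2 (p (D t))) ` ?R)"
    proof (cases "fst v $ 2 = 0")
      case True
      then have x1: "fst v $ 1 \<noteq> 0" using x vec2_eq[of "fst v"] vec2_zero_iff[of "fst v $ 1" "fst v $ 2"] by auto
      have "same_pt v D0" unfolding same_pt_def D0_def
        by (intro exI[of _ "inverse (fst v $ 1)"] exI[of _ "inverse (s * fst v $ 1)"])
          (use x1 s True in \<open>auto simp: vec_eq_iff forall_2 field_simps\<close>)
      then show ?thesis using pt[OF v(1) D(2)] v(2) by simp
    next
      case False
      let ?t = "fst v $ 1 / fst v $ 2"
      have sp: "same_pt v (D ?t)" unfolding same_pt_def D_def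
        by (intro exI[of _ "inverse (fst v $ 2)"] exI[of _ "inverse (s * fst v $ 2)"])
          (use False s in \<open>auto simp: vec_eq_iff forall_2 field_simps\<close>)
      have "point_P2 (p v) = point_P2 (p (D ?t))" by (rule iffD2[OF pt[OF v(1) D(1)] disjI1[OF sp]])
      then have e: "point_P2 (p (D ?t)) = point_P2 z" using v(2) by simp
      then obtain c where "p (D ?t) = c *s z" using point_P2_eqD by blast
      then have "E' (p (D ?t)) = 0" using conic_scale[OF E'] z by simp
      then have "?t \<in> ?R" using \<rho> by simp
      then show ?thesis unfolding e[symmetric] by blast
    qed
  qed
  then have "card ?Z \<le> card (insert (point_P2 (p D0)) ((\<lambda>t. point_P2 (p (D t))) ` ?R))"
    using finR by (intro card_mono) auto
  also have "\<dots> \<le> Suc (card ?R)"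
    using card_image_le[OF finR, of "\<lambda>t. point_P2 (p (D t))"] finR by (simp add: card_insert_if)
  finally have card: "3 \<le> card ?R" using Z(2) by simp
  have "\<exists>a. odd (Polynomial.order a \<rho>)"
  proof (rule ccontr)
    assume "\<not> (\<exists>a. odd (Polynomial.order a \<rho>))"
    then have even: "even (Polynomial.order a \<rho>)" for a by blast
    have "2 \<le> Polynomial.order a \<rho>" if "a \<in> ?R" for a
    proof -
      have "Polynomial.order a \<rho> \<noteq> 0" using that \<open>\<rho> \<noteq> 0\<close> order_root[of \<rho> a] by simp
      then show ?thesis using even[of a] by (cases "Polynomial.order a \<rho> = 1") auto
    qed
    then have "(\<Sum>a\<in>?R. 2) \<le> (\<Sum>a\<in>?R. Polynomial.order a \<rho>)" by (intro sum_mono) blast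
    also have "\<dots> \<le> degree \<rho>" using sum_order_le_degree[OF \<open>\<rho> \<noteq> 0\<close>] .
    finally show False using card deg by simp
  qed
  then show thesis using that \<rho> \<open>\<rho> \<noteq> 0\<close> unfolding D_def by blast
qed

section \<open>The multiplication of the order\<close>

lemma ideal_sheaf_simps [simp]:
  "secs (ideal_sheaf I) U = I U" "\<zero>\<^bsub>sec (ideal_sheaf I) U\<^esub> = (\<lambda>_. 0)"
  "f \<oplus>\<^bsub>sec (ideal_sheaf I) U\<^esub> g = (\<lambda>v. f v + g v)" "f \<odot>\<^bsub>sec (ideal_sheaf I) U\<^esub> g = (\<lambda>v. f v * g v)"
  "res (ideal_sheaf I) U W = rst W"
  by (simp_all add: ideal_sheaf_def Osh_def)

lemma local_unit_pair:
  assumes U: "zopen U" "v \<in> U"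
  obtains W e e' where "zopen W" "v \<in> W" "W \<subseteq> U" "e \<in> Lsec W" "\<And>w. w \<in> W \<Longrightarrow> e w \<noteq> 0"
    "e' \<in> Lsec (sig W)" "\<And>w. w \<in> sig W \<Longrightarrow> e' w \<noteq> 0"
proof -
  obtain V e where V: "zopen V" "v \<in> V" "V \<subseteq> U" "e \<in> Lsec V" "\<And>w. w \<in> V \<Longrightarrow> e w \<noteq> 0"
    using local_unit[OF U, of "-1" "-1"] by metis
  have sU: "zopen (sig U)" "prod.swap v \<in> sig U" using U by auto
  obtain T e' where T: "zopen T" "prod.swap v \<in> T" "T \<subseteq> sig U" "e' \<in> Lsec T" "\<And>w. w \<in> T \<Longrightarrow> e' w \<noteq> 0"
    using local_unit[OF sU, of "-1" "-1"] by metis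
  let ?W = "V \<inter> sig T"
  have W: "zopen ?W" using V T by (intro zopen_Int) auto
  have sW: "zopen (sig ?W)" "sig ?W \<subseteq> T" "?W \<subseteq> V" using W zopen_sig by auto
  show ?thesis
  proof (rule that[of ?W "rst ?W e" "rst (sig ?W) e'"])
    show "rst ?W e \<in> Lsec ?W" using regular_rst[OF V(4) W] by blast
    show "rst (sig ?W) e' \<in> Lsec (sig ?W)" using regular_rst[OF T(4) sW(1,2)] .
    show "rst ?W e w \<noteq> 0" if "w \<in> ?W" for w using V(5) that by (simp add: rst_def)
    show "rst (sig ?W) e' w \<noteq> 0" if "w \<in> sig ?W" for w using T(5)[of w] that sW(2) by (simp add: rst_def)
  qed (use V T W in auto)
qed

text \<open>
  Locally \<open>L_\<sigma> \<otimes> L_\<sigma>\<close> is free of rank one, so \<open>\<phi>\<close> is multiplication by a function \<open>R\<close> on the cone,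
  that is \<open>\<phi>(l \<otimes> l') = R l \<sigma>(l')\<close>. Since \<open>\<phi>\<close> has values in the ideal generated by \<open>h\<close>, the
  quotient \<open>R / h\<close> is a global regular function, hence a constant, which is not zero because \<open>\<phi>\<close>
  is onto the ideal.
\<close>

lemma phi_form:
  fixes \<phi> :: "'k::{alg_closed_field, field_char_0} phi_map"
  assumes phi: "phi_iso (zero_divisor 2 2 h) \<phi>" and h: "bihom 2 2 h" and h0: "\<exists>v\<in>ycone. h v \<noteq> 0"
  obtains c where "c \<noteq> 0" "\<And>U l l'. zopen U \<Longrightarrow> l \<in> Lsec U \<Longrightarrow> l' \<in> Lsec (sig U) \<Longrightarrow>
    \<phi> U (Lsig_pure Lbd U l l') = (\<lambda>v. c * h v * l v * l' (prod.swap v))"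
proof -
  let ?D = "zero_divisor 2 2 h"
  interpret L: Lsig "Lbd :: ('k, 'k fn) osheaf" unfolding Lsig_def by (rule O_module_Osh)
  have hom: "o_hom L.LN (ideal_sheaf ?D) \<phi>" and bij: "bij_on_sections L.LN (ideal_sheaf ?D) \<phi>"
    using phi unfolding phi_iso_def by auto
  define b where "b U l l' = \<phi> U (L.pure U l l')" for U l l'
  have bcl: "b U l l' \<in> ?D U" if "zopen U" "l \<in> Lsec U" "l' \<in> Lsec (sig U)" for U l l'
    using o_hom_closed[OF hom that(1) L.pure_closed[OF that(1,2)]] that unfolding b_def by simp
  have bl: "b U (\<lambda>v. f v * l v) l' = (\<lambda>v. f v * b U l l' v)"
    if "zopen U" "f \<in> regular 0 0 U" "l \<in> Lsec U" "l' \<in> Lsec (sig U)" for U f l l'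
    using o_hom_smult[OF hom that(1,2) L.pure_closed[OF that(1,3)]] L.pure_smult[OF that(1,2,3)] that unfolding b_def by simp
  have br: "b U l (\<lambda>v. g v * l' v) = (\<lambda>v. g (prod.swap v) * b U l l' v)"
    if "zopen U" "g \<in> regular 0 0 (sig U)" "l \<in> Lsec U" "l' \<in> Lsec (sig U)" for U g l l'
  proof -
    have "b U (\<lambda>v. sigf g v * l v) l' = b U l (\<lambda>v. g v * l' v)"
      using L.pure_balanced[OF that(1) sigf_regular'[OF that(2)] that(3)] that(4) unfolding b_def by simp
    then show ?thesis using bl[OF that(1) sigf_regular'[OF that(2)] that(3,4)] by simp
  qed
  have bres: "rst W (b U l l') = b W (rst W l) (rst (sig W) l')"
    if "zopen U" "zopen W" "W \<subseteq> U" "l \<in> Lsec U" "l' \<in> Lsec (sig U)" for U W l l'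
    using o_hom_res[OF hom that(1,2,3) L.pure_closed[OF that(1,4)]] L.pure_res[OF that(1-4)] that(5) unfolding b_def by simp
  \<comment> \<open>\<open>r\<close> is the value of \<open>R\<close> at \<open>v\<close>, computed from local generators \<open>e\<close> of \<open>L\<close> and \<open>e'\<close> of
      \<open>\<sigma>\<^sup>*L\<close>.\<close>
  define G where "G v r \<longleftrightarrow> (\<exists>W e e'. zopen W \<and> v \<in> W \<and> e \<in> Lsec W \<and> e' \<in> Lsec (sig W) \<and>
    (\<forall>w\<in>W. e w \<noteq> 0) \<and> (\<forall>w\<in>sig W. e' w \<noteq> 0) \<and> r = b W e e' v * inverse (e v) * inverse (e' (prod.swap v)))" for v r
  have val: "b U l l' v = r * l v * l' (prod.swap v)"
    if U: "zopen U" "l \<in> Lsec U" "l' \<in> Lsec (sig U)" "v \<in> U" and G: "G v r" for U l l' v r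
  proof -
    obtain W e e' where W: "zopen W" "v \<in> W" "e \<in> Lsec W" "e' \<in> Lsec (sig W)"
      "\<And>w. w \<in> W \<Longrightarrow> e w \<noteq> 0" "\<And>w. w \<in> sig W \<Longrightarrow> e' w \<noteq> 0" "r = b W e e' v * inverse (e v) * inverse (e' (prod.swap v))"
      using G unfolding G_def by blast
    let ?T = "U \<inter> W"
    have T: "zopen ?T" "?T \<subseteq> U" "?T \<subseteq> W" "v \<in> ?T" using U W zopen_Int by auto
    have sT: "zopen (sig ?T)" "sig ?T \<subseteq> sig U" "sig ?T \<subseteq> sig W" using zopen_sig[OF T(1)] by auto
    have eT: "rst ?T e \<in> Lsec ?T" "\<And>w. w \<in> ?T \<Longrightarrow> rst ?T e w \<noteq> 0"
      using regular_rst[OF W(3) T(1,3)] W(5) by (auto simp: rst_def)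
    have eT': "rst (sig ?T) e' \<in> Lsec (sig ?T)" "\<And>w. w \<in> sig ?T \<Longrightarrow> rst (sig ?T) e' w \<noteq> 0"
      using regular_rst[OF W(4) sT(1,3)] W(6) by (auto simp: rst_def)
    have lT: "rst ?T l \<in> Lsec ?T" "rst (sig ?T) l' \<in> Lsec (sig ?T)"
      using regular_rst[OF U(2) T(1,2)] regular_rst[OF U(3) sT(1,2)] by auto
    let ?f = "\<lambda>v. rst ?T l v * inverse (rst ?T e v)" and ?g = "\<lambda>v. rst (sig ?T) l' v * inverse (rst (sig ?T) e' v)"
    note f = regular_divide[OF lT(1) eT] and g = regular_divide[OF lT(2) eT']
    have vT: "prod.swap v \<in> sig ?T" using T(4) by simp
    have "rst ?T (b U l l') = b ?T (rst ?T l) (rst (sig ?T) l')" by (rule bres[OF U(1) T(1,2) U(2,3)])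
    also have "\<dots> = b ?T (\<lambda>v. ?f v * rst ?T e v) (\<lambda>v. ?g v * rst (sig ?T) e' v)"
      by (rule arg_cong2[OF f(2)[symmetric] g(2)[symmetric], of "b ?T"])
    finally have "rst ?T (b U l l') v = b ?T (\<lambda>v. ?f v * rst ?T e v) (\<lambda>v. ?g v * rst (sig ?T) e' v) v"
      by (rule fun_cong)
    then have "b U l l' v = b ?T (\<lambda>v. ?f v * rst ?T e v) (\<lambda>v. ?g v * rst (sig ?T) e' v) v"
      using T(4) by (simp add: rst_def)
    also have "\<dots> = ?f v * (?g (prod.swap v) * b ?T (rst ?T e) (rst (sig ?T) e') v)"
      using bl[OF T(1) f(1) eT(1), of "\<lambda>v. ?g v * rst (sig ?T) e' v"] br[OF T(1) g(1) eT(1) eT'(1)] lT(2) g(2) by simp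
    also have "b ?T (rst ?T e) (rst (sig ?T) e') v = b W e e' v"
      unfolding bres[OF W(1) T(1,3) W(3,4), symmetric] using T(4) by (simp add: rst_def)
    finally show ?thesis using T(4) vT unfolding W(7) by (simp add: rst_def mult_ac)
  qed
  have exG: "\<exists>r. G v r" if v: "v \<in> ycone" for v
  proof -
    obtain W e e' where "zopen W" "v \<in> W" "W \<subseteq> ycone" "e \<in> Lsec W" "\<And>w. w \<in> W \<Longrightarrow> e w \<noteq> 0"
      "e' \<in> Lsec (sig W)" "\<And>w. w \<in> sig W \<Longrightarrow> e' w \<noteq> 0" by (rule local_unit_pair[OF zopen_ycone v]) blast
    then show ?thesis unfolding G_def by blast
  qed
  define R where "R v = (SOME r. G v r)" for v
  have RG: "G v (R v)" if "v \<in> ycone" for v unfolding R_def using someI_ex[OF exG[OF that]] .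
  have bR: "b U l l' v = R v * l v * l' (prod.swap v)"
    if "zopen U" "l \<in> Lsec U" "l' \<in> Lsec (sig U)" "v \<in> U" for U l l' v
    using val[OF that RG] zopen_subset[OF that(1)] that(4) by blast
  \<comment> \<open>Locally \<open>R = h y\<close> with a regular function \<open>y\<close>; these glue to the function \<open>u = R / h\<close>.\<close>
  have locu: "\<exists>W y. zopen W \<and> v \<in> W \<and> W \<subseteq> ycone \<and> y \<in> regular 0 0 W \<and> (\<forall>w\<in>W. R w = h w * y w)" if v: "v \<in> ycone" for v
  proof -
    obtain W e e' where W: "zopen W" "v \<in> W" "W \<subseteq> ycone" "e \<in> Lsec W" "\<And>w. w \<in> W \<Longrightarrow> e w \<noteq> 0"
      "e' \<in> Lsec (sig W)" "\<And>w. w \<in> sig W \<Longrightarrow> e' w \<noteq> 0" by (rule local_unit_pair[OF zopen_ycone v]) blast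
    obtain g where g: "g \<in> regular (-2) (-2) W" "b W e e' = (\<lambda>v. h v * g v)"
      using bcl[OF W(1,4,6)] unfolding zero_divisor_def by auto
    have se: "sigf e' \<in> Lsec W" "\<And>w. w \<in> W \<Longrightarrow> sigf e' w \<noteq> 0" using sigf_regular'[OF W(6)] W(7) by auto
    let ?y = "\<lambda>v. (g v * inverse (e v)) * inverse (sigf e' v)"
    have "?y \<in> regular 0 0 W"
      by (rule regular_mult[OF regular_mult[OF g(1) regular_inverse[OF W(4,5)] refl refl] regular_inverse[OF se]]) auto
    moreover have "R w = h w * ?y w" if w: "w \<in> W" for w
    proof -
      have nz: "e w \<noteq> 0" "e' (prod.swap w) \<noteq> 0" using W(5)[OF w] se(2)[OF w] by auto
      have "h w * g w = R w * e w * e' (prod.swap w)"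
        using bR[OF W(1,4,6) w] g(2) by simp
      then have "h w * g w * inverse (e w) * inverse (e' (prod.swap w)) = R w"
        using nz by (simp add: field_simps)
      then show ?thesis by (simp add: mult_ac)
    qed
    ultimately show ?thesis using W by blast
  qed
  interpret OO: O_module "Osh 0 0 :: ('k, 'k fn) osheaf" by (rule O_module_Osh)
  have "\<exists>!u. u \<in> secs (Osh 0 0) ycone \<and> (\<forall>v\<in>ycone. \<exists>W. zopen W \<and> v \<in> W \<and> W \<subseteq> ycone \<and>
      (\<forall>w\<in>W. R w = h w * res (Osh 0 0) ycone W u w))"
  proof (rule OO.glue_unique[OF zopen_ycone, where R = "\<lambda>W y. \<forall>w\<in>W. R w = h w * y w"])
    fix W T y assume "zopen W" "W \<subseteq> ycone" "zopen T" "T \<subseteq> W" "y \<in> secs (Osh 0 0) W" "\<forall>w\<in>W. R w = h w * y w"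
    then show "\<forall>w\<in>T. R w = h w * res (Osh 0 0) W T y w" by (auto simp: rst_def)
  next
    fix W :: "'k pt set" and y y' :: "'k fn"
    assume W: "zopen W" "y \<in> secs (Osh 0 0) W" "y' \<in> secs (Osh 0 0) W" "\<forall>w\<in>W. R w = h w * y w" "\<forall>w\<in>W. R w = h w * y' w"
    have y: "y \<in> regular 0 0 W" "y' \<in> regular 0 0 W" using W by auto
    show "y = y'"
    proof
      fix v show "y v = y' v"
      proof (cases "v \<in> W")
        case True
        let ?V = "W \<inter> {v \<in> ycone. h v \<noteq> 0}"
        have hV: "zopen {v \<in> ycone. h v \<noteq> 0}" by (rule zopen_nonzero[OF h])
        have "?V \<noteq> {}" using zopen_dense[OF W(1) hV] True h0 by blast
        moreover have "y w - y' w = 0" if "w \<in> ?V" for w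
        proof -
          have "h w * y w = h w * y' w" "h w \<noteq> 0" using W(4,5) that by auto
          then show ?thesis by simp
        qed
        ultimately have "y v - y' v = 0"
          using regular_density[OF regular_diff[OF y W(1)] W(1) zopen_Int[OF W(1) hV]] by blast
        then show ?thesis by simp
      qed (use y regular_outside in metis)
    qed
  qed (use locu in auto)
  from ex1_implies_ex[OF this] obtain u where u0: "u \<in> secs (Osh 0 0) ycone"
    "\<forall>v\<in>ycone. \<exists>W. zopen W \<and> v \<in> W \<and> W \<subseteq> ycone \<and> (\<forall>w\<in>W. R w = h w * res (Osh 0 0) ycone W u w)"
    by (elim exE conjE)
  have u: "u \<in> regular 0 0 ycone" "\<exists>W. v \<in> W \<and> (\<forall>w\<in>W. R w = h w * rst W u w)" if "v \<in> ycone" for v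
  proof -
    show "u \<in> regular 0 0 ycone" using u0(1) by simp
    show "\<exists>W. v \<in> W \<and> (\<forall>w\<in>W. R w = h w * rst W u w)"
      using bspec[OF u0(2) \<open>v \<in> ycone\<close>] unfolding Osh_simps by blast
  qed
  obtain c where c: "\<And>v. v \<in> ycone \<Longrightarrow> u v = c" using global_section_const[OF u(1)] h0 by blast
  have Rc: "R v = c * h v" if "v \<in> ycone" for v using u(2)[OF that] c[OF that] by (auto simp: rst_def)
  have form: "b U l l' = (\<lambda>v. c * h v * l v * l' (prod.swap v))"
    if U: "zopen U" "l \<in> Lsec U" "l' \<in> Lsec (sig U)" for U l l'
  proof
    fix v show "b U l l' v = c * h v * l v * l' (prod.swap v)"
    proof (cases "v \<in> U")
      case True
      then show ?thesis using bR[OF U True] Rc[OF subsetD[OF zopen_subset[OF U(1)] True]] by simp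
    next
      case False
      obtain g where g: "g \<in> regular (-2) (-2) U" "b U l l' = (\<lambda>v. h v * g v)"
        using bcl[OF U] unfolding zero_divisor_def by auto
      then show ?thesis using regular_outside[OF g(1) False] regular_outside[OF U(2) False] by simp
    qed
  qed
  have "c \<noteq> 0"
  proof
    assume c0: "c = 0"
    obtain v where v: "v \<in> ycone" "h v \<noteq> 0" using h0 by blast
    obtain W e where W: "zopen W" "v \<in> W" "W \<subseteq> ycone" "e \<in> regular (-2) (-2) W" "\<And>w. w \<in> W \<Longrightarrow> e w \<noteq> 0"
      using local_unit[OF zopen_ycone v(1)] by metis
    let ?s = "\<lambda>v. h v * e v"
    have "?s \<in> secs (ideal_sheaf ?D) W" using W(4) by (auto simp: zero_divisor_def)
    moreover have "bij_betw (\<phi> W) (secs L.LN W) (secs (ideal_sheaf ?D) W)"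
      by (rule bij[unfolded bij_on_sections_def, THEN spec, THEN mp, OF W(1)])
    ultimately have "?s \<in> \<phi> W ` secs L.LN W" by (simp only: bij_betw_imp_surj_on)
    then obtain X where X: "X \<in> secs L.LN W" "\<phi> W X = ?s" by (elim imageE) simp
    obtain T l n where T: "zopen T" "v \<in> T" "T \<subseteq> W" "l \<in> Lsec T" "n \<in> secs Lbd (sig T)" "res L.LN W T X = L.pure T l n"
      by (rule L.pure_local[OF W(1) X(1) W(2)]) blast
    have "rst T ?s = b T l n"
      unfolding X(2)[symmetric] b_def using o_hom_res[OF hom W(1) T(1,3) X(1)] T(6) by simp
    then have "rst T ?s v = 0" using form[OF T(1,4)] T(5) c0 by simp
    then show False using T(2) v(2) W(5)[OF W(2)] by (simp add: rst_def)
  qed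
  then show thesis using that form unfolding b_def by blast
qed

section \<open>The action of \<open>L_\<sigma>\<close> on an induced module\<close>

text \<open>
  The multiplication of the order is \<open>l \<cdot> l' = r l \<sigma>(l')\<close> with a symmetric form \<open>r\<close> of bidegree
  \<open>(2, 2)\<close>, a multiple of the equation of \<open>D\<close>.
\<close>

locale mult_form =
  fixes \<phi> :: "'k::{alg_closed_field, field_char_0} phi_map" and r :: "'k fn"
  assumes r_bihom: "bihom 2 2 r" and r_swap: "\<And>v. v \<in> ycone \<Longrightarrow> r (prod.swap v) = r v"
    and phi_pure: "\<And>U l l'. zopen U \<Longrightarrow> l \<in> Lsec U \<Longrightarrow> l' \<in> Lsec (sig U) \<Longrightarrow>
      \<phi> U (Lsig_pure Lbd U l l') = (\<lambda>v. r v * l v * l' (prod.swap v))"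
begin

definition lmul :: "'k fn \<Rightarrow> 'k fn \<Rightarrow> 'k fn" where
  "lmul l l' = (\<lambda>v. r v * l v * l' (prod.swap v))"

lemma phi_lmul: "zopen U \<Longrightarrow> l \<in> Lsec U \<Longrightarrow> l' \<in> Lsec (sig U) \<Longrightarrow> \<phi> U (Lsig_pure Lbd U l l') = lmul l l'"
  unfolding lmul_def by (rule phi_pure)

lemma lmul_regular:
  assumes U: "zopen U" "l \<in> Lsec U" "l' \<in> Lsec (sig U)" shows "lmul l l' \<in> regular 0 0 U"
proof -
  have "rst U r \<in> regular 2 2 U" by (rule regular_bihom[OF r_bihom U(1)]) auto
  from regular_mult[OF regular_mult[OF this U(2) refl refl] sigf_regular'[OF U(3)], of 0 0]
  have "(\<lambda>v. rst U r v * l v * sigf l' v) \<in> regular 0 0 U" by simp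
  moreover have "(\<lambda>v. rst U r v * l v * sigf l' v) = lmul l l'"
    using regular_outside[OF U(2)] by (auto simp: lmul_def rst_def fun_eq_iff)
  ultimately show ?thesis by simp
qed

lemma lmul_rst:
  assumes "W \<subseteq> U" shows "rst W (lmul l l') = lmul (rst W l) (rst (sig W) l')"
  by (auto simp: lmul_def rst_def fun_eq_iff)

end

lemma (in presheaf) res_finsum:
  assumes U: "zopen U" "zopen W" "W \<subseteq> U" and f: "f \<in> {..<n::nat} \<rightarrow> secs P U"
  shows "res P U W (\<Oplus>\<^bsub>sec P U\<^esub>i\<in>{..<n}. f i) = (\<Oplus>\<^bsub>sec P W\<^esub>i\<in>{..<n}. res P U W (f i))"
  using f
proof (induction n)
  case 0
  interpret A: abelian_group "sec P U" using ab[OF U(1)] .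
  interpret B: abelian_group "sec P W" using ab[OF U(2)] .
  show ?case using res_zero[OF U] by simp
next
  case (Suc n)
  interpret A: abelian_group "sec P U" using ab[OF U(1)] .
  interpret B: abelian_group "sec P W" using ab[OF U(2)] .
  have f: "f \<in> {..<n} \<rightarrow> secs P U" "f n \<in> secs P U" using Suc.prems by auto
  have g: "(\<lambda>i. res P U W (f i)) \<in> {..<n} \<rightarrow> secs P W" "res P U W (f n) \<in> secs P W"
    using f res_closed[OF U] by auto
  show ?case unfolding lessThan_Suc
    using A.finsum_insert[of "{..<n}" n f] B.finsum_insert[of "{..<n}" n "\<lambda>i. res P U W (f i)"] f g Suc.IH[OF f(1)]
      res_add[OF U f(2) A.finsum_closed[OF f(1)]] by simp
qed

locale induced = mult_form \<phi> r + Lsig N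
  for \<phi> :: "'k::{alg_closed_field, field_char_0} phi_map" and r and N :: "('k, 'n) osheaf"
begin

text \<open>
  The relation by which \<open>contract\<close> is defined: over \<open>W\<close>, \<open>x\<close> is a sum of pure tensors whose
  contraction with \<open>l\<close> is \<open>y\<close>.
\<close>

definition expands :: "'k pt set \<Rightarrow> 'k fn \<Rightarrow> ('k, 'n) Lsig \<Rightarrow> 'k pt set \<Rightarrow> 'n \<Rightarrow> bool" where
  "expands U l x W y \<longleftrightarrow> (\<exists>n ls ns. ls \<in> {..<n::nat} \<rightarrow> Lsec (sig W) \<and> ns \<in> {..<n} \<rightarrow> secs N W \<and>
     res LN (sig U) (sig W) x = (\<Oplus>\<^bsub>sec LN (sig W)\<^esub>i\<in>{..<n}. pure (sig W) (ls i) (ns i)) \<and>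
     y = (\<Oplus>\<^bsub>sec N W\<^esub>i\<in>{..<n}. \<phi> W (Lsig_pure Lbd W (rst W l) (ls i)) \<odot>\<^bsub>sec N W\<^esub> ns i))"

lemma contract_eq: "contract \<phi> N U l x = (THE y. y \<in> secs N U \<and>
    (\<forall>v\<in>U. \<exists>W. zopen W \<and> v \<in> W \<and> W \<subseteq> U \<and> expands U l x W (res N U W y)))"
  unfolding contract_def expands_def
  by (intro arg_cong[of _ _ The] ext conj_cong refl ball_cong) blast

lemma expands_single:
  assumes "zopen W" "W \<subseteq> U" "l \<in> Lsec U" "l' \<in> Lsec (sig W)" "n \<in> secs N W"
    "res LN (sig U) (sig W) x = pure (sig W) l' n" "y = lmul (rst W l) l' \<odot>\<^bsub>sec N W\<^esub> n"
  shows "expands U l x W y"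
proof -
  have sW: "zopen (sig W)" using assms(1) by simp
  interpret A: abelian_group "sec LN (sig W)" using LN.pre.ab[OF sW] .
  interpret B: abelian_group "sec N W" using N.pre.ab[OF assms(1)] .
  have lW: "rst W l \<in> Lsec W" using regular_rst[OF assms(3,1,2)] .
  have p: "pure (sig W) l' n \<in> secs LN (sig W)" using pure_closed[OF sW assms(4)] assms(5) by simp
  have q: "lmul (rst W l) l' \<odot>\<^bsub>sec N W\<^esub> n \<in> secs N W"
    using N.pre.smult_closed[OF assms(1) lmul_regular[OF assms(1) lW assms(4)] assms(5)] .
  have one: "{..<Suc 0} = {0}" by auto
  show ?thesis unfolding expands_def
    using assms p q phi_lmul[OF assms(1) lW assms(4)] A.finsum_insert[of "{}" 0 "\<lambda>_. pure (sig W) l' n"]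
      B.finsum_insert[of "{}" 0 "\<lambda>_. lmul (rst W l) l' \<odot>\<^bsub>sec N W\<^esub> n"]
    by (intro exI[of _ "Suc 0"] exI[of _ "\<lambda>_. l'"] exI[of _ "\<lambda>_. n"]) (simp add: one)
qed

lemma expands_res:
  assumes U: "zopen U" "l \<in> Lsec U" "x \<in> secs LN (sig U)" and W: "zopen W" "W \<subseteq> U" and T: "zopen T" "T \<subseteq> W"
    and e: "expands U l x W y"
  shows "expands U l x T (res N W T y)"
proof -
  obtain n ls ns where *: "ls \<in> {..<n::nat} \<rightarrow> Lsec (sig W)" "ns \<in> {..<n} \<rightarrow> secs N W"
     "res LN (sig U) (sig W) x = (\<Oplus>\<^bsub>sec LN (sig W)\<^esub>i\<in>{..<n}. pure (sig W) (ls i) (ns i))"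
     "y = (\<Oplus>\<^bsub>sec N W\<^esub>i\<in>{..<n}. \<phi> W (Lsig_pure Lbd W (rst W l) (ls i)) \<odot>\<^bsub>sec N W\<^esub> ns i)"
    using e unfolding expands_def by blast
  have s: "zopen (sig U)" "zopen (sig W)" "zopen (sig T)" "sig W \<subseteq> sig U" "sig T \<subseteq> sig W"
    using U W T by (auto simp: image_mono simp del: mem_sig)
  let ?ls = "\<lambda>i. rst (sig T) (ls i)" and ?ns = "\<lambda>i. res N W T (ns i)"
  have lW: "rst W l \<in> Lsec W" and lT: "rst T l \<in> Lsec T"
    using regular_rst[OF U(2) W] regular_rst[OF U(2) T(1)] W T by auto
  have li: "ls i \<in> Lsec (sig W)" "ns i \<in> secs N W" "?ls i \<in> Lsec (sig T)" "?ns i \<in> secs N T" if "i < n" for i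
    using * that regular_rst[of "ls i" "-1" "-1" "sig W", OF _ s(3,5)] N.res_closed[OF W(1) T] by (auto simp: Pi_iff)
  have cl: "(\<lambda>i. pure (sig W) (ls i) (ns i)) \<in> {..<n} \<rightarrow> secs LN (sig W)"
    "(\<lambda>i. pure (sig T) (?ls i) (?ns i)) \<in> {..<n} \<rightarrow> secs LN (sig T)"
    using li pure_closed[OF s(2)] pure_closed[OF s(3)] by (auto simp: Pi_iff)
  have ph: "\<phi> W (Lsig_pure Lbd W (rst W l) (ls i)) = lmul (rst W l) (ls i)"
    "\<phi> T (Lsig_pure Lbd T (rst T l) (?ls i)) = rst T (lmul (rst W l) (ls i))"
    "lmul (rst W l) (ls i) \<in> regular 0 0 W" if "i < n" for i
    using phi_lmul[OF W(1) lW li(1)[OF that]] phi_lmul[OF T(1) lT li(3)[OF that]] lmul_rst[OF T(2), of "rst W l" "ls i"]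
      lmul_regular[OF W(1) lW li(1)[OF that]] T(2) by auto
  have cl': "(\<lambda>i. \<phi> W (Lsig_pure Lbd W (rst W l) (ls i)) \<odot>\<^bsub>sec N W\<^esub> ns i) \<in> {..<n} \<rightarrow> secs N W"
    using ph li N.pre.smult_closed[OF W(1)] by (auto simp: Pi_iff)
  have cl'': "(\<lambda>i. \<phi> T (Lsig_pure Lbd T (rst T l) (?ls i)) \<odot>\<^bsub>sec N T\<^esub> ?ns i) \<in> {..<n} \<rightarrow> secs N T"
    using ph li N.pre.smult_closed[OF T(1)] regular_rst[OF ph(3) T] by (auto simp: Pi_iff)
  have "res LN (sig U) (sig T) x = res LN (sig W) (sig T) (res LN (sig U) (sig W) x)"
    using LN.res_res[OF s(1-3) s(5,4) U(3)] by simp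
  also have "\<dots> = (\<Oplus>\<^bsub>sec LN (sig T)\<^esub>i\<in>{..<n}. res LN (sig W) (sig T) (pure (sig W) (ls i) (ns i)))"
    unfolding *(3) by (rule LN.pre.res_finsum[OF s(2,3,5) cl(1)])
  also have "\<dots> = (\<Oplus>\<^bsub>sec LN (sig T)\<^esub>i\<in>{..<n}. pure (sig T) (?ls i) (?ns i))"
  proof (rule abelian_monoid.finsum_cong'[OF abelian_group.axioms(1)[OF LN.pre.ab[OF s(3)]] refl cl(2)])
    fix i assume "i \<in> {..<n}"
    then have i: "i < n" by simp
    show "res LN (sig W) (sig T) (pure (sig W) (ls i) (ns i)) = pure (sig T) (?ls i) (?ns i)"
      using pure_res[OF s(2,3,5) li(1)[OF i]] li(2)[OF i] by simp
  qed
  finally have 1: "res LN (sig U) (sig T) x = (\<Oplus>\<^bsub>sec LN (sig T)\<^esub>i\<in>{..<n}. pure (sig T) (?ls i) (?ns i))" .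
  have "res N W T y = (\<Oplus>\<^bsub>sec N T\<^esub>i\<in>{..<n}. res N W T (\<phi> W (Lsig_pure Lbd W (rst W l) (ls i)) \<odot>\<^bsub>sec N W\<^esub> ns i))"
    unfolding *(4) by (rule N.pre.res_finsum[OF W(1) T cl'])
  also have "\<dots> = (\<Oplus>\<^bsub>sec N T\<^esub>i\<in>{..<n}. \<phi> T (Lsig_pure Lbd T (rst T l) (?ls i)) \<odot>\<^bsub>sec N T\<^esub> ?ns i)"
  proof (rule abelian_monoid.finsum_cong'[OF abelian_group.axioms(1)[OF N.pre.ab[OF T(1)]] refl cl''])
    fix i assume "i \<in> {..<n}"
    then have i: "i < n" by simp
    show "res N W T (\<phi> W (Lsig_pure Lbd W (rst W l) (ls i)) \<odot>\<^bsub>sec N W\<^esub> ns i) =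
        \<phi> T (Lsig_pure Lbd T (rst T l) (?ls i)) \<odot>\<^bsub>sec N T\<^esub> ?ns i"
      using ph[OF i] N.res_smult[OF W(1) T li(2)[OF i] ph(3)[OF i]] by simp
  qed
  finally have 2: "res N W T y = (\<Oplus>\<^bsub>sec N T\<^esub>i\<in>{..<n}. \<phi> T (Lsig_pure Lbd T (rst T l) (?ls i)) \<odot>\<^bsub>sec N T\<^esub> ?ns i)" .
  show ?thesis unfolding expands_def
    using li 1 2 by (intro exI[of _ n] exI[of _ ?ls] exI[of _ ?ns]) auto
qed

text \<open>
  Where \<open>e\<close> generates \<open>L\<close>, an expansion \<open>\<Sum>i. l_i \<otimes> n_i\<close> may be collapsed to \<open>e \<otimes> m\<close>, with the same
  contraction. The choice of the expansion is thereby reduced to that of \<open>m\<close>, which is unique.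
\<close>

lemma expands_collapse:
  assumes W: "zopen W" and l: "l \<in> Lsec W" and e: "e \<in> Lsec (sig W)" "\<And>w. w \<in> sig W \<Longrightarrow> e w \<noteq> 0"
    and ls: "ls \<in> {..<n::nat} \<rightarrow> Lsec (sig W)" and ns: "ns \<in> {..<n} \<rightarrow> secs N W"
  shows "\<exists>m\<in>secs N W. (\<Oplus>\<^bsub>sec LN (sig W)\<^esub>i\<in>{..<n}. pure (sig W) (ls i) (ns i)) = pure (sig W) e m \<and>
    (\<Oplus>\<^bsub>sec N W\<^esub>i\<in>{..<n}. \<phi> W (Lsig_pure Lbd W l (ls i)) \<odot>\<^bsub>sec N W\<^esub> ns i) = lmul l e \<odot>\<^bsub>sec N W\<^esub> m"
  using ls ns
proof (induction n)
  case 0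
  have sW: "zopen (sig W)" using W by simp
  interpret A: abelian_group "sec LN (sig W)" using LN.pre.ab[OF sW] .
  interpret B: module "oring W" "sec N W" using N.sec_module[OF W] .
  have "lmul l e \<odot>\<^bsub>sec N W\<^esub> \<zero>\<^bsub>sec N W\<^esub> = \<zero>\<^bsub>sec N W\<^esub>"
    using B.smult_r_null lmul_regular[OF W l e(1)] by simp
  then show ?case using pure_zero_right[OF sW e(1)] by (intro bexI[of _ "\<zero>\<^bsub>sec N W\<^esub>"]) auto
next
  case (Suc n)
  have sW: "zopen (sig W)" using W by simp
  interpret A: abelian_group "sec LN (sig W)" using LN.pre.ab[OF sW] .
  interpret B: module "oring W" "sec N W" using N.sec_module[OF W] .
  have f: "ls \<in> {..<n} \<rightarrow> Lsec (sig W)" "ns \<in> {..<n} \<rightarrow> secs N W" "ls n \<in> Lsec (sig W)" "ns n \<in> secs N W"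
    using Suc.prems by auto
  obtain m where m: "m \<in> secs N W" "(\<Oplus>\<^bsub>sec LN (sig W)\<^esub>i\<in>{..<n}. pure (sig W) (ls i) (ns i)) = pure (sig W) e m"
    "(\<Oplus>\<^bsub>sec N W\<^esub>i\<in>{..<n}. \<phi> W (Lsig_pure Lbd W l (ls i)) \<odot>\<^bsub>sec N W\<^esub> ns i) = lmul l e \<odot>\<^bsub>sec N W\<^esub> m"
    using Suc.IH[OF f(1,2)] by blast
  let ?q = "sigf (\<lambda>v. ls n v * inverse (e v))"
  note q0 = regular_divide[OF f(3) e]
  have q: "?q \<in> regular 0 0 W" using sigf_regular'[OF q0(1)] .
  let ?k = "?q \<odot>\<^bsub>sec N W\<^esub> ns n"
  have k: "?k \<in> secs N W" using N.pre.smult_closed[OF W q f(4)] .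
  have p: "pure (sig W) (ls n) (ns n) = pure (sig W) e ?k"
    using pure_divide[OF sW f(3) _ e] f(4) by simp
  have "lmul l (ls n) = (\<lambda>v. lmul l e v * ?q v)"
  proof
    fix v
    have "ls n (prod.swap v) * inverse (e (prod.swap v)) * e (prod.swap v) = ls n (prod.swap v)"
      using fun_cong[OF q0(2), of "prod.swap v"] .
    then show "lmul l (ls n) v = lmul l e v * ?q v" unfolding lmul_def by (simp add: mult_ac)
  qed
  then have lm: "\<phi> W (Lsig_pure Lbd W l (ls n)) \<odot>\<^bsub>sec N W\<^esub> ns n = lmul l e \<odot>\<^bsub>sec N W\<^esub> ?k"
    using phi_lmul[OF W l f(3)] B.smult_assoc1[of "lmul l e" ?q "ns n"] lmul_regular[OF W l e(1)] q f(4) by simp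
  have cl: "(\<lambda>i. pure (sig W) (ls i) (ns i)) \<in> {..<n} \<rightarrow> secs LN (sig W)"
    using f(1,2) pure_closed[OF sW] by (auto simp: Pi_iff)
  have cl': "(\<lambda>i. \<phi> W (Lsig_pure Lbd W l (ls i)) \<odot>\<^bsub>sec N W\<^esub> ns i) \<in> {..<n} \<rightarrow> secs N W"
    using f(1,2) phi_lmul[OF W l] lmul_regular[OF W l] N.pre.smult_closed[OF W] by (auto simp: Pi_iff)
  have pk: "pure (sig W) e ?k \<in> secs LN (sig W)" using pure_closed[OF sW e(1)] k by simp
  have lk: "lmul l e \<odot>\<^bsub>sec N W\<^esub> ?k \<in> secs N W" using N.pre.smult_closed[OF W lmul_regular[OF W l e(1)] k] .
  have "(\<Oplus>\<^bsub>sec LN (sig W)\<^esub>i\<in>{..<Suc n}. pure (sig W) (ls i) (ns i)) = pure (sig W) e (?k \<oplus>\<^bsub>sec N W\<^esub> m)"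
    unfolding lessThan_Suc
    using A.finsum_insert[of "{..<n}" n "\<lambda>i. pure (sig W) (ls i) (ns i)"] cl pk p m(2)
      pure_add_right[OF sW e(1), of ?k m] k m(1) by simp
  moreover have "(\<Oplus>\<^bsub>sec N W\<^esub>i\<in>{..<Suc n}. \<phi> W (Lsig_pure Lbd W l (ls i)) \<odot>\<^bsub>sec N W\<^esub> ns i) =
      lmul l e \<odot>\<^bsub>sec N W\<^esub> (?k \<oplus>\<^bsub>sec N W\<^esub> m)"
    unfolding lessThan_Suc
    using B.finsum_insert[of "{..<n}" n "\<lambda>i. \<phi> W (Lsig_pure Lbd W l (ls i)) \<odot>\<^bsub>sec N W\<^esub> ns i"] cl' lk lm m(3)
      B.smult_r_distr[of "lmul l e" ?k m] lmul_regular[OF W l e(1)] k m(1) by simp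
  ultimately show ?case using N.pre.add_closed[OF W k m(1)] by blast
qed

lemma expands_unique:
  assumes U: "zopen U" "l \<in> Lsec U" "x \<in> secs LN (sig U)" and W: "zopen W" "W \<subseteq> U"
    and y: "y \<in> secs N W" "y' \<in> secs N W" and e: "expands U l x W y" "expands U l x W y'"
  shows "y = y'"
proof (rule N.eq_locally[OF W(1) y])
  fix v assume v: "v \<in> W"
  then have sv: "zopen (sig W)" "prod.swap v \<in> sig W" using W by auto
  obtain T0 g where T0: "zopen T0" "prod.swap v \<in> T0" "T0 \<subseteq> sig W" "g \<in> Lsec T0" "\<And>w. w \<in> T0 \<Longrightarrow> g w \<noteq> 0"
    using local_unit[OF sv, of "-1" "-1"] by metis
  define T where "T = sig T0"
  have T: "zopen T" "v \<in> T" "T \<subseteq> W" "sig T = T0" using T0 unfolding T_def by auto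
  have sT: "zopen (sig T)" unfolding T(4) by (rule T0(1))
  have g: "g \<in> Lsec (sig T)" "\<And>w. w \<in> sig T \<Longrightarrow> g w \<noteq> 0" using T0 T(4) by auto
  have lT: "rst T l \<in> Lsec T" using regular_rst[OF U(2) T(1)] T W by auto
  have "\<exists>m\<in>secs N T. res LN (sig U) (sig T) x = pure (sig T) g m \<and> res N W T z = lmul (rst T l) g \<odot>\<^bsub>sec N T\<^esub> m"
    if z: "expands U l x W z" for z
  proof -
    obtain n ls ns where *: "ls \<in> {..<n::nat} \<rightarrow> Lsec (sig T)" "ns \<in> {..<n} \<rightarrow> secs N T"
     "res LN (sig U) (sig T) x = (\<Oplus>\<^bsub>sec LN (sig T)\<^esub>i\<in>{..<n}. pure (sig T) (ls i) (ns i))"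
     "res N W T z = (\<Oplus>\<^bsub>sec N T\<^esub>i\<in>{..<n}. \<phi> T (Lsig_pure Lbd T (rst T l) (ls i)) \<odot>\<^bsub>sec N T\<^esub> ns i)"
      using expands_res[OF U W T(1,3) z] unfolding expands_def by blast
    show ?thesis using expands_collapse[OF T(1) lT g *(1,2)] unfolding *(3,4) .
  qed
  from this[OF e(1)] this[OF e(2)] obtain m m' where m: "m \<in> secs N T" "m' \<in> secs N T"
    "res LN (sig U) (sig T) x = pure (sig T) g m" "res LN (sig U) (sig T) x = pure (sig T) g m'"
    "res N W T y = lmul (rst T l) g \<odot>\<^bsub>sec N T\<^esub> m" "res N W T y' = lmul (rst T l) g \<odot>\<^bsub>sec N T\<^esub> m'" by blast
  have "m = m'" using pure_inj[OF sT g, of m m'] m by simp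
  then show "\<exists>T. zopen T \<and> v \<in> T \<and> T \<subseteq> W \<and> res N W T y = res N W T y'" using m T by auto
qed

text \<open>
  The contraction is well defined: local expansions exist, and their contractions are unique, so
  they glue.
\<close>

lemma contract_ex1:
  assumes U: "zopen U" "l \<in> Lsec U" "x \<in> secs LN (sig U)"
  shows "\<exists>!y. y \<in> secs N U \<and> (\<forall>v\<in>U. \<exists>W. zopen W \<and> v \<in> W \<and> W \<subseteq> U \<and> expands U l x W (res N U W y))"
proof (rule N.glue_unique[OF U(1)])
  show "expands U l x T (res N W T y)" if "zopen W" "W \<subseteq> U" "zopen T" "T \<subseteq> W" "y \<in> secs N W" "expands U l x W y" for W T y
    using expands_res[OF U that(1-4,6)] .
  show "y = y'" if "zopen W" "W \<subseteq> U" "y \<in> secs N W" "y' \<in> secs N W" "expands U l x W y" "expands U l x W y'" for W y y'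
    using expands_unique[OF U that] .
  show "\<exists>W y. zopen W \<and> v \<in> W \<and> W \<subseteq> U \<and> y \<in> secs N W \<and> expands U l x W y" if v: "v \<in> U" for v
  proof -
    have sU: "zopen (sig U)" "prod.swap v \<in> sig U" using U v by auto
    obtain T e n where T: "zopen T" "prod.swap v \<in> T" "T \<subseteq> sig U" "e \<in> Lsec T" "n \<in> secs N (sig T)"
      "res LN (sig U) T x = pure T e n"
      by (rule pure_local[OF sU(1) U(3) sU(2)]) blast
    let ?W = "sig T"
    have W: "zopen ?W" "v \<in> ?W" "?W \<subseteq> U" using T by auto
    have e: "e \<in> Lsec (sig ?W)" using T by simp
    have x: "res LN (sig U) (sig ?W) x = pure (sig ?W) e n" using T by simp
    show ?thesis
      using expands_single[OF W(1,3) U(2) e T(5) x refl] W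
        N.pre.smult_closed[OF W(1) lmul_regular[OF W(1) regular_rst[OF U(2) W(1,3)] e] T(5)] by blast
  qed
qed

lemma contract_closed:
  assumes "zopen U" "l \<in> Lsec U" "x \<in> secs LN (sig U)"
  shows "contract \<phi> N U l x \<in> secs N U"
    and "\<And>v. v \<in> U \<Longrightarrow> \<exists>W. zopen W \<and> v \<in> W \<and> W \<subseteq> U \<and> expands U l x W (res N U W (contract \<phi> N U l x))"
  using theI'[OF contract_ex1[OF assms]] unfolding contract_eq by auto

lemma contract_eqI:
  assumes "zopen U" "l \<in> Lsec U" "x \<in> secs LN (sig U)" "y \<in> secs N U" "expands U l x U y"
  shows "contract \<phi> N U l x = y"
  unfolding contract_eq
proof (rule the1_equality[OF contract_ex1[OF assms(1-3)]], intro conjI ballI)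
  fix v assume "v \<in> U"
  then show "\<exists>W. zopen W \<and> v \<in> W \<and> W \<subseteq> U \<and> expands U l x W (res N U W y)"
    using assms N.res_id[OF assms(1,4)] by (intro exI[of _ U]) auto
qed (rule assms(4))

lemma contract_pure:
  assumes U: "zopen U" "l \<in> Lsec U" "l' \<in> Lsec (sig U)" "n \<in> secs N U"
  shows "contract \<phi> N U l (pure (sig U) l' n) = lmul l l' \<odot>\<^bsub>sec N U\<^esub> n"
proof -
  have sU: "zopen (sig U)" using U by simp
  have p: "pure (sig U) l' n \<in> secs LN (sig U)" using pure_closed[OF sU U(3)] U(4) by simp
  have "expands U l (pure (sig U) l' n) U (lmul l l' \<odot>\<^bsub>sec N U\<^esub> n)"
    by (rule expands_single[OF U(1) _ U(2,3,4) LN.res_id[OF sU p]]) (simp_all add: rst_self[OF U(2)])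
  then show ?thesis
    by (rule contract_eqI[OF U(1,2) p N.pre.smult_closed[OF U(1) lmul_regular[OF U(1-3)] U(4)]])
qed

lemma contract_zero:
  assumes U: "zopen U" "l \<in> Lsec U"
  shows "contract \<phi> N U l \<zero>\<^bsub>sec LN (sig U)\<^esub> = \<zero>\<^bsub>sec N U\<^esub>"
proof -
  have sU: "zopen (sig U)" using U by simp
  have z: "\<zero>\<^bsub>sec N U\<^esub> \<in> secs N U" using N.pre.zero_closed[OF U(1)] .
  have l: "(\<lambda>_. 0) \<in> Lsec (sig U)" by (rule regular_0[OF sU])
  have "lmul l (\<lambda>_. 0) \<odot>\<^bsub>sec N U\<^esub> \<zero>\<^bsub>sec N U\<^esub> = \<zero>\<^bsub>sec N U\<^esub>"
    using module.smult_r_null[OF N.sec_module[OF U(1)]] lmul_regular[OF U l] by simp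
  then show ?thesis using contract_pure[OF U l z] pure_zero_right[OF sU l] by simp
qed

lemma contract_res:
  assumes U: "zopen U" "l \<in> Lsec U" "x \<in> secs LN (sig U)" and W: "zopen W" "W \<subseteq> U"
  shows "res N U W (contract \<phi> N U l x) = contract \<phi> N W (rst W l) (res LN (sig U) (sig W) x)"
proof (rule N.eq_locally[OF W(1)])
  let ?x = "res LN (sig U) (sig W) x"
  have s: "zopen (sig U)" "zopen (sig W)" "sig W \<subseteq> sig U" using U W by (auto simp: image_mono simp del: mem_sig)
  have l: "rst W l \<in> Lsec W" using regular_rst[OF U(2) W] .
  have x: "?x \<in> secs LN (sig W)" using LN.res_closed[OF s U(3)] .
  note c = contract_closed[OF U] and c' = contract_closed[OF W(1) l x]
  show "res N U W (contract \<phi> N U l x) \<in> secs N W" using N.res_closed[OF U(1) W c(1)] .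
  show "contract \<phi> N W (rst W l) ?x \<in> secs N W" by (rule c'(1))
  fix v assume v: "v \<in> W"
  obtain T where T: "zopen T" "v \<in> T" "T \<subseteq> U" "expands U l x T (res N U T (contract \<phi> N U l x))"
    using c(2) v W by blast
  obtain T' where T': "zopen T'" "v \<in> T'" "T' \<subseteq> W" "expands W (rst W l) ?x T' (res N W T' (contract \<phi> N W (rst W l) ?x))"
    using c'(2)[OF v] by blast
  let ?S = "T \<inter> T'"
  have S: "zopen ?S" "?S \<subseteq> T" "?S \<subseteq> T'" "?S \<subseteq> U" "?S \<subseteq> W" using T T' W zopen_Int by auto
  have sS: "zopen (sig ?S)" "sig ?S \<subseteq> sig W" using S by (auto simp: image_mono simp del: mem_sig)
  have "expands U l x ?S (res N U ?S (contract \<phi> N U l x))"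
    using expands_res[OF U T(1,3) S(1,2) T(4)] N.res_res[OF U(1) T(1) S(1,2) T(3) c(1)] by simp
  moreover have "expands W (rst W l) ?x ?S (res N W ?S (contract \<phi> N W (rst W l) ?x))"
    using expands_res[OF W(1) l x T'(1,3) S(1,3) T'(4)] N.res_res[OF W(1) T'(1) S(1,3) T'(3) c'(1)] by simp
  then have "expands U l x ?S (res N W ?S (contract \<phi> N W (rst W l) ?x))"
    unfolding expands_def using LN.res_res[OF s(1,2) sS s(3) U(3)] S(5) by simp
  ultimately have "res N U ?S (contract \<phi> N U l x) = res N W ?S (contract \<phi> N W (rst W l) ?x)"
    using expands_unique[OF U S(1,4)] N.res_closed[OF U(1) S(1,4) c(1)] N.res_closed[OF W(1) S(1,5) c'(1)] by blast
  then show "\<exists>T. zopen T \<and> v \<in> T \<and> T \<subseteq> W \<and> res N W T (res N U W (contract \<phi> N U l x)) = res N W T (contract \<phi> N W (rst W l) ?x)"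
    using N.res_res[OF U(1) W(1) S(1,5) W(2) c(1)] S T T' by (intro exI[of _ ?S]) auto
qed

end

section \<open>The order as a module over itself\<close>

lemma Aalg_simps [simp]:
  "sec (Aalg \<phi>) = sec (osum (Osh 0 0) Lbd)" "res (Aalg \<phi>) = res (osum (Osh 0 0) Lbd)"
  "lact (Aalg \<phi>) U l (f, l') = (\<phi> U (Lsig_pure Lbd U l l'), \<lambda>v. l v * sigf f v)"
  by (simp_all add: Aalg_def osheaf.defs amod.defs)

lemma A_tensor_simps [simp]:
  "sec (A_tensor \<phi> N) = sec (osum N (Lsig_tensor N))" "res (A_tensor \<phi> N) = res (osum N (Lsig_tensor N))"
  "lact (A_tensor \<phi> N) U l (n, x) = (contract \<phi> N U l x, Lsig_pure N U l n)"
  by (simp_all add: A_tensor_def osheaf.defs amod.defs)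

lemma O_module_cong: "sec M = sec N \<Longrightarrow> res M = res N \<Longrightarrow> O_module N \<Longrightarrow> O_module M"
  by (simp add: O_module_def)

lemma O_module_Aalg: "O_module (Aalg \<phi>)"
  by (rule O_module_cong[OF _ _ O_module_osum[OF O_module_Osh O_module_Osh]]) simp_all

context mult_form
begin

lemma A_lact: "zopen U \<Longrightarrow> l \<in> Lsec U \<Longrightarrow> l' \<in> Lsec (sig U) \<Longrightarrow>
    lact (Aalg \<phi>) U l (f, l') = (lmul l l', \<lambda>v. l v * f (prod.swap v))"
  by (simp add: phi_lmul)

lemma lsig_regular: "l \<in> Lsec U \<Longrightarrow> f \<in> regular 0 0 (sig U) \<Longrightarrow> (\<lambda>v. l v * f (prod.swap v)) \<in> Lsec U"
  using regular_mult[of l "-1" "-1" U "sigf f" 0 0, OF _ sigf_regular'] by simp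

text \<open>
  Associativity is the only axiom with content: \<open>(l \<cdot> l') \<cdot> k = l \<cdot> (l' \<cdot> k)\<close> says that
  \<open>r \<sigma>(l') l k\<close> does not change if \<open>r\<close> is replaced by \<open>\<sigma>(r)\<close>, so it is the symmetry of \<open>r\<close>.
\<close>

lemma A_module_Aalg: "A_module (Aalg \<phi>) \<phi>"
proof (rule A_module.intro[OF O_module_Aalg A_module_axioms.intro])
  let ?A = "Aalg \<phi>"
  fix U :: "'k pt set" and l m assume U: "zopen U" and l: "l \<in> Lsec U" and m: "m \<in> secs ?A (sig U)"
  obtain f k where m': "m = (f, k)" "f \<in> regular 0 0 (sig U)" "k \<in> Lsec (sig U)" using m by auto
  have am: "lact ?A U l m = (lmul l k, \<lambda>v. l v * f (prod.swap v))" if "l \<in> Lsec U" for l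
    using A_lact[OF U that m'(3)] m'(1) by simp
  show "lact ?A U l m \<in> secs ?A U"
    unfolding am[OF l] using lmul_regular[OF U l m'(3)] lsig_regular[OF l m'(2)] by simp
  {
    fix l' assume l': "l' \<in> Lsec U"
    show "lact ?A U (\<lambda>v. l v + l' v) m = lact ?A U l m \<oplus>\<^bsub>sec ?A U\<^esub> lact ?A U l' m"
      unfolding am[OF l] am[OF l'] am[OF regular_add[OF l l']] by (simp add: lmul_def algebra_simps)
  next
    fix m2 assume "m2 \<in> secs ?A (sig U)"
    then obtain f2 k2 where m2: "m2 = (f2, k2)" "f2 \<in> regular 0 0 (sig U)" "k2 \<in> Lsec (sig U)" by auto
    show "lact ?A U l (m \<oplus>\<^bsub>sec ?A (sig U)\<^esub> m2) = lact ?A U l m \<oplus>\<^bsub>sec ?A U\<^esub> lact ?A U l m2"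
      using A_lact[OF U l m'(3)] A_lact[OF U l m2(3)] A_lact[OF U l regular_add[OF m'(3) m2(3)]]
      unfolding m'(1) m2(1) by (simp add: lmul_def algebra_simps)
  next
    fix g assume g: "g \<in> regular 0 0 U"
    show "lact ?A U (\<lambda>v. g v * l v) m = g \<odot>\<^bsub>sec ?A U\<^esub> lact ?A U l m"
      unfolding am[OF l] am[OF regular_mult0[OF g l]] by (simp add: lmul_def algebra_simps)
  next
    fix g assume g: "g \<in> regular 0 0 (sig U)"
    show "lact ?A U l (g \<odot>\<^bsub>sec ?A (sig U)\<^esub> m) = lact ?A U (\<lambda>v. sigf g v * l v) m"
      using A_lact[OF U l regular_mult0[OF g m'(3)]] am[OF regular_mult0[OF sigf_regular'[OF g] l]]
      unfolding m'(1) by (simp add: lmul_def algebra_simps)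
  next
    fix W assume W: "zopen W" "W \<subseteq> U"
    have sW: "zopen (sig W)" "sig W \<subseteq> sig U" using W by auto
    have "res ?A U W (lact ?A U l m) = (rst W (lmul l k), rst W (\<lambda>v. l v * f (prod.swap v)))"
      unfolding am[OF l] by simp
    moreover have "lact ?A W (rst W l) (res ?A (sig U) (sig W) m) =
        (lmul (rst W l) (rst (sig W) k), \<lambda>v. rst W l v * rst (sig W) f (prod.swap v))"
      using A_lact[OF W(1) regular_rst[OF l W] regular_rst[OF m'(3) sW]] unfolding m'(1) by simp
    moreover have "rst W (\<lambda>v. l v * f (prod.swap v)) = (\<lambda>v. rst W l v * rst (sig W) f (prod.swap v))"
      by (rule ext) (simp add: rst_def)
    ultimately show "res ?A U W (lact ?A U l m) = lact ?A W (rst W l) (res ?A (sig U) (sig W) m)"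
      using lmul_rst[OF W(2), of l k] by simp
  }
next
  let ?A = "Aalg \<phi>"
  fix U :: "'k pt set" and l l' m assume U: "zopen U" and l: "l \<in> Lsec U" and l': "l' \<in> Lsec (sig U)" and m: "m \<in> secs ?A U"
  obtain f k where m': "m = (f, k)" "f \<in> regular 0 0 U" "k \<in> Lsec U" using m by auto
  have sU: "zopen (sig U)" using U by simp
  have f: "f \<in> regular 0 0 (sig (sig U))" "k \<in> Lsec (sig (sig U))" using m' by auto
  have "lact ?A U l (lact ?A (sig U) l' m) = (lmul l (\<lambda>v. l' v * f (prod.swap v)), \<lambda>v. l v * lmul l' k (prod.swap v))"
    unfolding m'(1) using A_lact[OF sU l' f(2)] A_lact[OF U l lsig_regular[OF l' f(1)]] by simp
  also have "\<dots> = lmul l l' \<odot>\<^bsub>sec ?A U\<^esub> m"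
  proof -
    have "l v * lmul l' k (prod.swap v) = lmul l l' v * k v" for v
      using r_swap[of v] regular_outside[OF l, of v] zopen_subset[OF U] by (cases "v \<in> U") (auto simp: lmul_def)
    then show ?thesis unfolding m'(1) by (auto simp: lmul_def fun_eq_iff)
  qed
  finally show "lact ?A U l (lact ?A (sig U) l' m) = \<phi> U (Lsig_pure Lbd U l l') \<odot>\<^bsub>sec ?A U\<^esub> m"
    using phi_lmul[OF U l l'] by simp
qed

end

section \<open>The order is a domain\<close>

text \<open>
  In the coordinates \<open>u\<close>, \<open>w\<close> with \<open>x = (u + w : 1)\<close> and \<open>y = (u - w : 1)\<close> the involution is
  \<open>w \<mapsto> -w\<close> and the diagonal is \<open>w = 0\<close>. A polynomial in \<open>u\<close> and \<open>w\<close> is treated as a polynomial in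
  \<open>w\<close> over the polynomials in \<open>u\<close>.
\<close>

lemma bihom_poly2:
  fixes F :: "'k::field_char_0 fn"
  assumes "bihom m n F"
  obtains p :: "'k poly poly" where "\<And>u w. F (vec2 (u + w) 1, vec2 (u - w) 1) = poly (poly p [:w:]) u"
proof -
  define S where "S f \<longleftrightarrow> (\<exists>p :: 'k poly poly. \<forall>t. f t = poly (poly p [:snd t:]) (fst t))" for f
  have "S (\<lambda>t. F (vec2 (fst t + snd t) 1, vec2 (fst t - snd t) 1))"
  proof (rule bihom_closure[OF assms, where \<gamma> = "\<lambda>t. (vec2 (fst t + snd t) 1, vec2 (fst t - snd t) 1)"])
    show c: "S (\<lambda>_. c)" for c unfolding S_def by (rule exI[of _ "[:[:c:]:]"]) simp
    show "S (\<lambda>t. f t + g t)" if "S f" "S g" for f g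
      using that unfolding S_def by (elim exE, rule_tac x="p + pa" in exI) simp
    show "S (\<lambda>t. f t * g t)" if "S f" "S g" for f g
      using that unfolding S_def by (elim exE, rule_tac x="p * pa" in exI) simp
    have "S (\<lambda>t. fst t + snd t)" unfolding S_def by (rule exI[of _ "[:[:0, 1:], 1:]"]) simp
    then show "S (\<lambda>t. fst (vec2 (fst t + snd t) 1, vec2 (fst t - snd t) 1) $ i)" for i
      using exhaust_2[of i] c[of 1] by auto
    have "S (\<lambda>t. fst t - snd t)" unfolding S_def by (rule exI[of _ "[:[:0, 1:], -1:]"]) simp
    then show "S (\<lambda>t. snd (vec2 (fst t + snd t) 1, vec2 (fst t - snd t) 1) $ i)" for i
      using exhaust_2[of i] c[of 1] by auto
  qed
  then obtain p where "\<forall>t. F (vec2 (fst t + snd t) 1, vec2 (fst t - snd t) 1) = poly (poly p [:snd t:]) (fst t)"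
    unfolding S_def by blast
  note p = this
  have "F (vec2 (u + w) 1, vec2 (u - w) 1) = poly (poly p [:w:]) u" for u w
    using p[THEN spec, of "(u, w)"] by simp
  then show thesis by (rule that)
qed

lemma poly2_eqI:
  fixes p q :: "'k::field_char_0 poly poly"
  assumes "\<And>u w. poly (poly p [:w:]) u = poly (poly q [:w:]) u" shows "p = q"
proof (rule ccontr)
  assume "p \<noteq> q"
  then have "finite {x. poly (p - q) x = 0}" by (intro poly_roots_finite) simp
  moreover have "range (\<lambda>w. [:w:]) \<subseteq> {x. poly (p - q) x = 0}"
  proof
    fix x assume "x \<in> range (\<lambda>w::'k. [:w:])"
    then obtain w where x: "x = [:w:]" by blast
    have "poly p [:w:] = poly q [:w:]" using assms poly_eq_poly_eq_iff by blast
    then show "x \<in> {x. poly (p - q) x = 0}" unfolding x by simp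
  qed
  ultimately have "finite (range (\<lambda>w::'k. [:w:]))" using finite_subset by blast
  moreover have "inj (\<lambda>w::'k. [:w:])" by (auto intro: injI)
  ultimately show False using finite_imageD infinite_UNIV_char_0 by blast
qed

lemma monom_factor_unique:
  fixes A B :: "'a::idom poly"
  assumes "[:0, 1:] ^ i * A = [:0, 1:] ^ j * B" "poly A 0 \<noteq> 0" "poly B 0 \<noteq> 0"
  shows "i = j" "A = B"
proof -
  have le: "i \<ge> j" if "[:0, 1:] ^ i * A = [:0, 1:] ^ j * B" "poly A 0 \<noteq> 0" for i j and A B :: "'a poly"
  proof (rule ccontr)
    assume "\<not> i \<ge> j"
    then have "[:0, 1:] ^ j = [:0, 1:] ^ i * ([:0, 1:] ^ (j - i) :: 'a poly)" by (simp flip: power_add)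
    then have "[:0, 1:] ^ i * A = [:0, 1:] ^ i * ([:0, 1:] ^ (j - i) * B)" using that(1) by (simp add: mult.assoc)
    then have "A = [:0, 1:] ^ (j - i) * B" by simp
    then have "poly A 0 = 0" using \<open>\<not> i \<ge> j\<close> by (simp add: poly_power)
    then show False using that(2) by simp
  qed
  show "i = j" using le[OF assms(1,2)] le[OF assms(1)[symmetric] assms(3)] by simp
  then show "A = B" using assms(1) by simp
qed

text \<open>
  The odd zero on the diagonal is what prevents \<open>r l \<sigma>(l)\<close> with \<open>l \<noteq> 0\<close> from being a norm
  \<open>f \<sigma>(f)\<close>; this is the reason why \<open>k(A)\<close> is a division ring.
\<close>

locale division_form = mult_form +
  assumes odd_zero: "\<exists>\<rho> a. (\<forall>t. r (vec2 t 1, vec2 t 1) = poly \<rho> t) \<and> \<rho> \<noteq> 0 \<and> odd (Polynomial.order a \<rho>)"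
begin

text \<open>
  Let \<open>P \<sigma>(P) = r N \<sigma>(N)\<close> with \<open>N \<noteq> 0\<close>, and expand along the diagonal, in powers of \<open>w\<close>. The
  lowest coefficients of both sides are \<open>\<plusminus> p^2\<close> and \<open>\<plusminus> \<rho> q^2\<close>, where \<open>\<rho>\<close> is the restriction of \<open>r\<close>
  and the signs agree because the orders do. Then \<open>\<rho>\<close> has only zeros of even order, a
  contradiction.
\<close>

lemma norm_poly:
  assumes P: "bihom m n P" and N: "bihom m' n' N"
    and eq: "\<And>v. v \<in> ycone \<Longrightarrow> P v * P (prod.swap v) = r v * (N v * N (prod.swap v))"
  shows "N (vec2 s 1, vec2 t 1) = 0"
proof -
  obtain p where p: "\<And>u w. P (vec2 (u + w) 1, vec2 (u - w) 1) = poly (poly p [:w:]) u" by (rule bihom_poly2[OF P]) blast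
  obtain q where q: "\<And>u w. N (vec2 (u + w) 1, vec2 (u - w) 1) = poly (poly q [:w:]) u" by (rule bihom_poly2[OF N]) blast
  obtain d where d: "\<And>u w. r (vec2 (u + w) 1, vec2 (u - w) 1) = poly (poly d [:w:]) u" by (rule bihom_poly2[OF r_bihom]) blast
  \<comment> \<open>\<open>bar\<close> is the involution \<open>w \<mapsto> -w\<close>.\<close>
  define bar :: "'a poly poly \<Rightarrow> 'a poly poly" where "bar f = pcompose f [:0, -1:]" for f
  have bar: "poly (bar f) x = poly f (- x)" for f x unfolding bar_def by (simp add: poly_pcompose)
  have main: "p * bar p = d * (q * bar q)"
  proof (rule poly2_eqI)
    fix u w :: 'a
    have c: "(vec2 (u + w) 1, vec2 (u - w) (1::'a)) \<in> ycone" by (simp add: ycone_def vec2_zero_iff)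
    have "P (vec2 (u - w) 1, vec2 (u + w) 1) = poly (poly p (- [:w:])) u" "N (vec2 (u - w) 1, vec2 (u + w) 1) = poly (poly q (- [:w:])) u"
      using p[of u "- w"] q[of u "- w"] by simp_all
    then show "poly (poly (p * bar p) [:w:]) u = poly (poly (d * (q * bar q)) [:w:]) u"
      using eq[OF c] p[of u w] q[of u w] d[of u w] by (simp add: bar)
  qed
  obtain \<rho> a where \<rho>: "\<And>t. r (vec2 t 1, vec2 t 1) = poly \<rho> t" "\<rho> \<noteq> 0" "odd (Polynomial.order a \<rho>)" using odd_zero by blast
  have "poly (poly d 0) t = poly \<rho> t" for t using d[of t 0] \<rho>(1)[of t] by simp
  then have d0: "poly d 0 = \<rho>" using poly_eq_poly_eq_iff by blast
  have "q = 0"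
  proof (rule ccontr)
    assume q0: "q \<noteq> 0"
    have bar0: "bar f \<noteq> 0" if "f \<noteq> 0" for f
    proof
      assume "bar f = 0"
      then have "poly f (- x) = 0" for x using bar[of f x] by simp
      then have "poly f x = 0" for x by (metis minus_minus)
      then show False using that poly_all_0_iff_0 by blast
    qed
    have "d \<noteq> 0" using d0 \<rho>(2) by auto
    then have "p * bar p \<noteq> 0" unfolding main using q0 bar0 by simp
    then have p0: "p \<noteq> 0" by auto
    have dec: "\<exists>i f1. f = [:0, 1:] ^ i * f1 \<and> poly f1 0 \<noteq> 0" if "f \<noteq> 0" for f :: "'a poly poly"
      using order_decomp[OF that, of 0] by (auto simp: poly_eq_0_iff_dvd)
    obtain i p1 where p1: "p = [:0, 1:] ^ i * p1" "poly p1 0 \<noteq> 0" using dec[OF p0] by blast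
    obtain j q1 where q1: "q = [:0, 1:] ^ j * q1" "poly q1 0 \<noteq> 0" using dec[OF q0] by blast
    have barm: "bar ([:0, 1:] ^ i * f) = (-1) ^ i * ([:0, 1:] ^ i * bar f)" for i f
    proof -
      have "bar ([:0, 1:] ^ i) = [:0, -1:] ^ i"
        by (induction i) (simp_all add: bar_def pcompose_1 pcompose_mult pcompose_pCons)
      then have "bar ([:0, 1:] ^ i * f) = [:0, -1:] ^ i * bar f"
        unfolding bar_def by (simp add: pcompose_mult)
      also have "[:0, -1:] = - 1 * [:0, 1 :: 'a poly:]" by simp
      finally show ?thesis by (simp only: power_mult_distrib mult.assoc)
    qed
    have e1: "p * bar p = [:0, 1:] ^ (i + i) * ((-1) ^ i * (p1 * bar p1))"
      unfolding p1(1) barm power_add by (simp only: mult_ac)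
    have e2: "d * (q * bar q) = [:0, 1:] ^ (j + j) * ((-1) ^ j * (d * (q1 * bar q1)))"
      unfolding q1(1) barm power_add by (simp only: mult_ac)
    have nz: "poly ((-1) ^ i * (p1 * bar p1)) 0 \<noteq> 0" "poly ((-1) ^ j * (d * (q1 * bar q1))) 0 \<noteq> 0"
      using p1(2) q1(2) d0 \<rho>(2) by (simp_all add: bar poly_power)
    have ij: "i = j" "(-1) ^ i * (p1 * bar p1) = (-1) ^ j * (d * (q1 * bar q1))"
      using monom_factor_unique[OF main[unfolded e1 e2] nz] by auto
    then have "(-1) ^ i * (p1 * bar p1) = (-1) ^ i * (d * (q1 * bar q1))" by simp
    then have "p1 * bar p1 = d * (q1 * bar q1)" by simp
    then have "poly (p1 * bar p1) 0 = poly (d * (q1 * bar q1)) 0" by simp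
    then have sq: "poly p1 0 * poly p1 0 = \<rho> * (poly q1 0 * poly q1 0)" by (simp add: bar d0)
    have "Polynomial.order a (poly p1 0 * poly p1 0) = 2 * Polynomial.order a (poly p1 0)"
      using p1(2) by (simp add: order_mult)
    moreover have "Polynomial.order a (\<rho> * (poly q1 0 * poly q1 0)) = Polynomial.order a \<rho> + 2 * Polynomial.order a (poly q1 0)"
      using q1(2) \<rho>(2) by (simp add: order_mult)
    ultimately have "even (Polynomial.order a \<rho>)" using sq by (metis dvd_add_left_iff dvd_triv_left)
    then show False using \<rho>(3) by simp
  qed
  have "(s + t) / 2 + (s - t) / 2 = s" "(s + t) / 2 - (s - t) / 2 = t" by (simp_all add: field_simps)
  then show ?thesis using q[of "(s + t) / 2" "(s - t) / 2"] \<open>q = 0\<close> by simp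
qed

lemma bihom_zero_of_chart:
  assumes N: "bihom m n N" and z: "\<And>s t. N (vec2 s 1, vec2 t 1) = 0" and v: "v \<in> ycone"
  shows "N v = (0 :: 'a)"
proof -
  let ?W = "{v \<in> ycone. fst v $ 2 * snd v $ 2 \<noteq> (0 :: 'a)}"
  have W: "zopen ?W" by (rule zopen_nonzero[OF bihom_fst_snd])
  have "(vec2 0 1, vec2 0 1) \<in> ?W" by (simp add: ycone_def vec2_zero_iff)
  then have ne: "?W \<noteq> {}" by blast
  have scale1: "N (c *s x, y) = c ^ m * N (x, y)" for c x y
    using bihom_scale_snd[OF bihom_swap[OF N], of y c x] by simp
  have zW: "rst ycone N w = 0" if w: "w \<in> ?W" for w
  proof -
    obtain x y where xy: "w = (x, y)" "x $ 2 \<noteq> 0" "y $ 2 \<noteq> 0" using w by (cases w) auto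
    have "x = x $ 2 *s vec2 (x $ 1 / x $ 2) 1" "y = y $ 2 *s vec2 (y $ 1 / y $ 2) 1"
      using xy by (simp_all add: vec_eq_iff forall_2)
    then have "N w = (x $ 2) ^ m * ((y $ 2) ^ n * N (vec2 (x $ 1 / x $ 2) 1, vec2 (y $ 1 / y $ 2) 1))"
      unfolding xy(1) by (metis scale1 bihom_scale_snd[OF N])
    then show ?thesis using z by (simp add: rst_def)
  qed
  have "rst ycone N \<in> regular (int m) (int n) ycone" by (rule regular_bihom[OF N zopen_ycone refl refl])
  then have "rst ycone N v = 0" by (rule regular_density[OF _ zopen_ycone W ne zW])
  then show ?thesis using v by (simp add: rst_def)
qed

text \<open>
  Locally \<open>f\<close> and \<open>l\<close> are fractions of forms; clearing the denominators turns the equation into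
  one between forms that holds on a nonempty open set, hence everywhere.
\<close>

lemma norm_zero:
  assumes T: "zopen T" "sig T = T" and f: "f \<in> regular 0 0 T" and l: "l \<in> Lsec T"
    and eq: "\<And>v. v \<in> T \<Longrightarrow> f v * f (prod.swap v) = r v * (l v * l (prod.swap v))"
  shows "l = (\<lambda>_. 0)"
proof (rule ccontr)
  assume "l \<noteq> (\<lambda>_. 0)"
  then obtain v0 where v0: "l v0 \<noteq> 0" by blast
  then have v0T: "v0 \<in> T" using regular_outside[OF l] by blast
  obtain W where W: "zopen W" "v0 \<in> W" "W \<subseteq> T" "quot_on (-1) (-1) W l" using regularE[OF l v0T] .
  obtain V where V: "zopen V" "v0 \<in> V" "V \<subseteq> T" "quot_on 0 0 V f" using regularE[OF f v0T] .
  obtain m n m' n' F G where F: "bihom m n F" "bihom m' n' G" "int m - int m' = 0" "int n - int n' = 0"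
     "\<And>w. w \<in> V \<Longrightarrow> G w \<noteq> 0 \<and> f w = F w / G w" using V(4) unfolding quot_on_def by blast
  obtain i j i' j' F' G' where F': "bihom i j F'" "bihom i' j' G'" "int i - int i' = -1" "int j - int j' = -1"
     "\<And>w. w \<in> W \<Longrightarrow> G' w \<noteq> 0 \<and> l w = F' w / G' w" using W(4) unfolding quot_on_def by blast
  let ?P = "\<lambda>v. F v * G' v" and ?N = "\<lambda>v. F' v * G v"
  have P: "bihom (m + i') (n + j') ?P" using bihom_mult[OF F(1) F'(2)] .
  have N: "bihom (i + m') (j + n') ?N" using bihom_mult[OF F'(1) F(2)] .
  have L: "bihom ((m + i') + (n + j')) ((n + j') + (m + i')) (\<lambda>v. ?P v * (?P \<circ> prod.swap) v)"
    by (rule bihom_mult[OF P bihom_swap[OF P]])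
  have R: "bihom (2 + ((i + m') + (j + n'))) (2 + ((j + n') + (i + m'))) (\<lambda>v. r v * (?N v * (?N \<circ> prod.swap) v))"
    by (rule bihom_mult[OF r_bihom bihom_mult[OF N bihom_swap[OF N]]])
  have deg: "2 + ((i + m') + (j + n')) = (m + i') + (n + j')" "2 + ((j + n') + (i + m')) = (n + j') + (m + i')"
    using F(3,4) F'(3,4) by linarith+
  let ?D = "\<lambda>v. rst ycone (\<lambda>v. ?P v * (?P \<circ> prod.swap) v) v - rst ycone (\<lambda>v. r v * (?N v * (?N \<circ> prod.swap) v)) v"
  have D: "?D \<in> regular (int ((m + i') + (n + j'))) (int ((n + j') + (m + i'))) ycone"
    by (intro regular_diff regular_bihom[OF L zopen_ycone refl refl] regular_bihom[OF R[unfolded deg] zopen_ycone refl refl] zopen_ycone)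
  let ?S = "(W \<inter> V) \<inter> sig (W \<inter> V)"
  have WV: "zopen (W \<inter> V)" "zopen (sig (W \<inter> V))" using zopen_Int[OF W(1) V(1)] by (auto simp del: zopen_sig_iff intro: zopen_sig)
  have S: "zopen ?S" using zopen_Int[OF WV] .
  have "prod.swap v0 \<in> sig (W \<inter> V)" using W V by simp
  then have Sn: "?S \<noteq> {}" using zopen_dense[OF WV] W(2) V(2) by blast
  have "?D w = 0" if w: "w \<in> ?S" for w
  proof -
    have w': "w \<in> V" "prod.swap w \<in> V" "w \<in> W" "prod.swap w \<in> W" "w \<in> T" "w \<in> ycone"
      using w V(3) zopen_subset[OF T(1)] by auto
    have q: "F x = f x * G x" "F' x = l x * G' x" if "x \<in> V" "x \<in> W" for x using F(5)[OF that(1)] F'(5)[OF that(2)] by auto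
    have "F w * G' w * (F (prod.swap w) * G' (prod.swap w)) =
        (f w * f (prod.swap w)) * (G w * G' w * G (prod.swap w) * G' (prod.swap w))"
      unfolding q(1)[OF w'(1,3)] q(1)[OF w'(2,4)] by (simp add: mult_ac)
    also have "\<dots> = r w * ((F' w * G w) * (F' (prod.swap w) * G (prod.swap w)))"
      unfolding eq[OF w'(5)] q(2)[OF w'(1,3)] q(2)[OF w'(2,4)] by (simp add: mult_ac)
    finally show ?thesis using w'(6) by (simp add: rst_def)
  qed
  then have D0: "?D v = 0" for v using regular_density[OF D zopen_ycone S Sn] by blast
  have "?P v * ?P (prod.swap v) = r v * (?N v * ?N (prod.swap v))" if "v \<in> ycone" for v
    using D0[of v] that by (simp add: rst_def)
  then have "?N (vec2 s 1, vec2 t 1) = 0" for s t by (rule norm_poly[OF P N])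
  then have "?N v0 = 0" using bihom_zero_of_chart[OF N] v0T zopen_subset[OF T(1)] by blast
  moreover have "F' v0 \<noteq> 0" "G v0 \<noteq> 0" using F'(5)[OF W(2)] F(5)[OF V(2)] v0 by auto
  ultimately show False by simp
qed

text \<open>
  If \<open>(f + l) (g + k) = 0\<close>, multiplication by the conjugate of \<open>f + l\<close> shows that its norm
  \<open>f \<sigma>(f) - r l \<sigma>(l)\<close> annihilates \<open>g\<close> and \<open>k\<close>. So \<open>g = k = 0\<close>, or the norm of \<open>f + l\<close> is zero, and
  then \<open>f = l = 0\<close> since \<open>r\<close> is not a norm.
\<close>

lemma order_is_domain:
  assumes T: "zopen T" "sig T = T" and a: "a \<in> secs (Aalg \<phi>) T" and b: "b \<in> secs (Aalg \<phi>) T"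
    and ab: "a_act (Aalg \<phi>) T a b = \<zero>\<^bsub>sec (Aalg \<phi>) T\<^esub>"
  shows "a = \<zero>\<^bsub>sec (Aalg \<phi>) T\<^esub> \<or> b = \<zero>\<^bsub>sec (Aalg \<phi>) T\<^esub>"
proof -
  obtain f l where a': "a = (f, l)" "f \<in> regular 0 0 T" "l \<in> Lsec T" using a by auto
  obtain g k where b': "b = (g, k)" "g \<in> regular 0 0 T" "k \<in> Lsec T" using b by auto
  have sT: "f \<in> regular 0 0 (sig T)" "l \<in> Lsec (sig T)" "k \<in> Lsec (sig T)" using T a' b' by auto
  have "a_act (Aalg \<phi>) T a b = (\<lambda>v. f v * g v + lmul l k v, \<lambda>v. f v * k v + l v * g (prod.swap v))"
    unfolding a_act_def a'(1) b'(1) using A_lact[OF T(1) a'(3) sT(3)] by simp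
  then have z: "(\<lambda>v. f v * g v + lmul l k v) = (\<lambda>_. 0)" "(\<lambda>v. f v * k v + l v * g (prod.swap v)) = (\<lambda>_. 0)"
    using ab by auto
  have e1: "f v * g v + r v * l v * k (prod.swap v) = 0" and e2: "f v * k v + l v * g (prod.swap v) = 0" for v
    using fun_cong[OF z(1), of v] fun_cong[OF z(2), of v] by (auto simp: lmul_def)
  \<comment> \<open>\<open>D\<close> is the norm of \<open>f + l\<close>.\<close>
  define D where "D v = f v * f (prod.swap v) - lmul l l v" for v
  have D: "D \<in> regular 0 0 T"
  proof -
    have "(\<lambda>v. f v * sigf f v) \<in> regular 0 0 T" by (rule regular_mult0[OF a'(2) sigf_regular'[OF sT(1)]])
    from regular_diff[OF this lmul_regular[OF T(1) a'(3) sT(2)] T(1)] show ?thesis unfolding D_def by simp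
  qed
  have Dg: "D v * g v = 0" for v
  proof -
    have "D v * g v = f (prod.swap v) * (f v * g v) - r v * l v * (l (prod.swap v) * g v)"
      unfolding D_def lmul_def by (simp add: algebra_simps)
    also have "f v * g v = - (r v * l v * k (prod.swap v))" using e1[of v] by (simp add: add_eq_0_iff2)
    also have "l (prod.swap v) * g v = - (f (prod.swap v) * k (prod.swap v))" using e2[of "prod.swap v"] by (simp add: add_eq_0_iff2 add.commute)
    finally show ?thesis by (simp add: algebra_simps)
  qed
  have Dk: "D v * k v = 0" if v: "v \<in> T" for v
  proof -
    have rv: "r (prod.swap v) = r v" using r_swap v zopen_subset[OF T(1)] by blast
    have "D v * k v = f (prod.swap v) * (f v * k v) - l v * (r v * l (prod.swap v) * k v)"
      unfolding D_def lmul_def by (simp add: algebra_simps)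
    also have "f v * k v = - (l v * g (prod.swap v))" using e2[of v] by (simp add: add_eq_0_iff2)
    also have "r v * l (prod.swap v) * k v = - (f (prod.swap v) * g (prod.swap v))"
      using e1[of "prod.swap v"] rv by (simp add: add_eq_0_iff2 add.commute)
    finally show ?thesis by (simp add: algebra_simps)
  qed
  show ?thesis
  proof (rule disjCI)
    assume "b \<noteq> \<zero>\<^bsub>sec (Aalg \<phi>) T\<^esub>"
    then have "g \<noteq> (\<lambda>_. 0) \<or> k \<noteq> (\<lambda>_. 0)" using b'(1) by auto
    then have "\<exists>h c d. h \<in> regular c d T \<and> h \<noteq> (\<lambda>_. 0) \<and> (\<forall>v\<in>T. D v * h v = 0)"
    proof
      assume "g \<noteq> (\<lambda>_. 0)"
      then show ?thesis using b'(2) Dg by (intro exI[of _ g] exI[of _ 0]) simp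
    next
      assume "k \<noteq> (\<lambda>_. 0)"
      then show ?thesis using b'(3) Dk by (intro exI[of _ k] exI[of _ "-1"]) simp
    qed
    then obtain h c d where h': "h \<in> regular c d T" "h \<noteq> (\<lambda>_. 0)" "\<forall>v\<in>T. D v * h v = 0" by (elim exE conjE)
    obtain v0 where "h v0 \<noteq> 0" using h'(2) ext by metis
    then have h: "h \<in> regular c d T" "h v0 \<noteq> 0" "\<And>v. v \<in> T \<Longrightarrow> D v * h v = 0" using h' by auto
    obtain W where W: "zopen W" "v0 \<in> W" "W \<subseteq> T" "\<And>w. w \<in> W \<Longrightarrow> h w \<noteq> 0"
      using regular_nonzero_open[OF h(1) T(1) h(2)] by metis
    have "D v = 0" for v
    proof (rule regular_density[OF D T(1) W(1)])
      show "W \<noteq> {}" using W by blast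
      show "D w = 0" if "w \<in> W" for w using h(3)[of w] W that by auto
    qed
    then have nrm: "f v * f (prod.swap v) = r v * (l v * l (prod.swap v))" for v
      unfolding D_def lmul_def by (simp add: mult.assoc)
    have l0: "l = (\<lambda>_. 0)" by (rule norm_zero[OF T a'(2,3) nrm])
    have "f = (\<lambda>_. 0)"
    proof (rule ccontr)
      assume "f \<noteq> (\<lambda>_. 0)"
      then obtain v1 where v1: "f v1 \<noteq> 0" by blast
      obtain V where V: "zopen V" "v1 \<in> V" "V \<subseteq> T" "\<And>w. w \<in> V \<Longrightarrow> f w \<noteq> 0"
        using regular_nonzero_open[OF a'(2) T(1) v1] by metis
      have "prod.swap v1 \<in> sig V" using V by simp
      then have "V \<inter> sig V \<noteq> {}" using zopen_dense[OF V(1) zopen_sig[OF V(1)]] V(2) by blast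
      then obtain w where "w \<in> V" "prod.swap w \<in> V" by auto
      then show False using nrm[of w] V(4) l0 by simp
    qed
    then show "a = \<zero>\<^bsub>sec (Aalg \<phi>) T\<^esub>" using a'(1) l0 by simp
  qed
qed

end

section \<open>Homomorphisms from a line bundle to the order\<close>

lemma A_power_simps [simp]:
  "secs (A_power n M) U = {..<n} \<rightarrow>\<^sub>E secs M U"
  "f \<odot>\<^bsub>sec (A_power n M) U\<^esub> x = (\<lambda>i\<in>{..<n}. f \<odot>\<^bsub>sec M U\<^esub> x i)"
  "res (A_power n M) U W x = (\<lambda>i\<in>{..<n}. res M U W (x i))"
  by (simp_all add: A_power_def)

lemma Aalg_density:
  assumes a: "a \<in> secs (Aalg \<phi>) U" and U: "zopen U" and T: "zopen T" "T \<subseteq> U" "T \<noteq> {}"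
    and z: "res (Aalg \<phi>) U T a = \<zero>\<^bsub>sec (Aalg \<phi>) T\<^esub>"
  shows "a = \<zero>\<^bsub>sec (Aalg (\<phi> :: 'k::field_char_0 phi_map)) U\<^esub>"
proof -
  obtain f l where a': "a = (f, l)" "f \<in> regular 0 0 U" "l \<in> Lsec U" using a by auto
  have "rst T f = (\<lambda>_. 0)" "rst T l = (\<lambda>_. 0)" using z a'(1) by auto
  then have "f w = 0" "l w = 0" if "w \<in> T" for w using that by (auto simp: rst_def fun_eq_iff) (metis)+
  then have "f v = 0" "l v = 0" for v
    using regular_density[OF a'(2) U T(1,3)] regular_density[OF a'(3) U T(1,3)] by blast+
  then show ?thesis using a'(1) by auto
qed

text \<open>
  A locally projective module embeds locally into a free module over \<open>A\<close>, whose sections consist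
  of functions that satisfy the identity principle.
\<close>

lemma locally_projective_density:
  fixes M :: "('k::field_char_0, 'm) amod"
  assumes M: "O_module M" and lp: "locally_projective \<phi> M"
    and U: "zopen U" and z: "z \<in> secs M U" and T: "zopen T" "T \<subseteq> U" "T \<noteq> {}"
    and zT: "res M U T z = \<zero>\<^bsub>sec M T\<^esub>"
  shows "z = \<zero>\<^bsub>sec M U\<^esub>"
proof -
  interpret M: O_module M by (rule M)
  have zero: "\<zero>\<^bsub>sec M U\<^esub> \<in> secs M U" by (rule M.pre.zero_closed[OF U])
  show ?thesis
  proof (rule M.eq_locally[OF U z zero])
    fix v assume v: "v \<in> U"
    then have "v \<in> ycone" using zopen_subset[OF U] by blast
    from lp[unfolded locally_projective_def, THEN bspec, OF this]
    obtain V n F G where V: "zopen_stable V" "v \<in> V" and F: "a_hom_on V M (A_power n (Aalg \<phi>)) F"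
      and GF: "\<forall>W. zopen W \<and> W \<subseteq> V \<longrightarrow> (\<forall>x\<in>secs M W. G W (F W x) = x)"
      by (elim exE conjE)
    have F: "o_hom_on V M (A_power n (Aalg \<phi>)) F" using F unfolding a_hom_on_def by blast
    let ?W = "U \<inter> V" and ?S = "U \<inter> V \<inter> T"
    have W: "zopen ?W" "?W \<subseteq> V" "?W \<subseteq> U" "v \<in> ?W" using U V v zopen_Int unfolding zopen_stable_def by auto
    have S: "zopen ?S" "?S \<subseteq> ?W" "?S \<subseteq> V" "?S \<subseteq> U" "?S \<subseteq> T" using zopen_Int[OF W(1) T(1)] by auto
    have Sn: "?S \<noteq> {}" using zopen_dense[OF W(1) T(1)] W(4) T(3) by blast
    let ?z = "res M U ?W z" and ?o = "\<zero>\<^bsub>sec M ?W\<^esub>"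
    have zW: "?z \<in> secs M ?W" "?o \<in> secs M ?W" using M.res_closed[OF U W(1,3) z] M.pre.zero_closed[OF W(1)] by auto
    have zS: "res M ?W ?S ?z = \<zero>\<^bsub>sec M ?S\<^esub>" "res M ?W ?S ?o = \<zero>\<^bsub>sec M ?S\<^esub>"
      using M.res_res[OF U W(1) S(1,2) W(3) z] M.res_res[OF U T(1) S(1,5) T(2) z] zT M.pre.res_zero[OF T(1) S(1,5)]
        M.pre.res_zero[OF W(1) S(1,2)] by auto
    have z0: "\<zero>\<^bsub>sec M ?S\<^esub> \<in> secs M ?S" by (rule M.pre.zero_closed[OF S(1)])
    have "F ?S \<zero>\<^bsub>sec M ?S\<^esub> = (\<lambda>_. 0) \<odot>\<^bsub>sec (A_power n (Aalg \<phi>)) ?S\<^esub> F ?S \<zero>\<^bsub>sec M ?S\<^esub>"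
      using o_hom_on_smult[OF F S(1,3) regular_0[OF S(1)] z0] module.smult_l_null[OF M.sec_module[OF S(1)] z0] by simp
    then have F0: "F ?S \<zero>\<^bsub>sec M ?S\<^esub> i = \<zero>\<^bsub>sec (Aalg \<phi>) ?S\<^esub>" if "i < n" for i
      using that by (cases "F ?S \<zero>\<^bsub>sec M ?S\<^esub> i") (simp add: fun_eq_iff, metis (no_types, lifting) lessThan_iff mult_zero_left
        osum_simps(4) Osh_simps(4) prod.inject restrict_apply')
    have Fi: "F ?W x i = \<zero>\<^bsub>sec (Aalg \<phi>) ?W\<^esub>"
      if x: "x \<in> secs M ?W" "res M ?W ?S x = \<zero>\<^bsub>sec M ?S\<^esub>" and i: "i < n" for x i
    proof (rule Aalg_density[OF _ W(1) S(1,2) Sn])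
      show "F ?W x i \<in> secs (Aalg \<phi>) ?W" using o_hom_on_closed[OF F W(1,2) x(1)] i by auto
      have "F ?S (res M ?W ?S x) i = res (Aalg \<phi>) ?W ?S (F ?W x i)"
        using o_hom_on_res[OF F W(1,2) S(1,2) x(1)] i by simp
      then show "res (Aalg \<phi>) ?W ?S (F ?W x i) = \<zero>\<^bsub>sec (Aalg \<phi>) ?S\<^esub>" using F0[OF i] x(2) by simp
    qed
    have eq: "F ?W ?z = F ?W ?o"
    proof (rule PiE_ext)
      show "F ?W ?z \<in> {..<n} \<rightarrow>\<^sub>E secs (Aalg \<phi>) ?W" using o_hom_on_closed[OF F W(1,2) zW(1)] by simp
      show "F ?W ?o \<in> {..<n} \<rightarrow>\<^sub>E secs (Aalg \<phi>) ?W" using o_hom_on_closed[OF F W(1,2) zW(2)] by simp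
      show "F ?W ?z i = F ?W ?o i" if "i \<in> {..<n}" for i using Fi zW zS that by simp
    qed
    have GF: "G ?W (F ?W x) = x" if "x \<in> secs M ?W" for x
      by (rule GF[THEN spec, THEN mp, OF conjI[OF W(1,2)], THEN bspec, OF that])
    have "?z = G ?W (F ?W ?z)" by (rule GF[OF zW(1), symmetric])
    also have "\<dots> = G ?W (F ?W ?o)" by (rule arg_cong[OF eq])
    also have "\<dots> = ?o" by (rule GF[OF zW(2)])
    finally have "?z = ?o" .
    then have "res M U ?W z = res M U ?W \<zero>\<^bsub>sec M U\<^esub>" using M.pre.res_zero[OF U W(1,3)] by simp
    then show "\<exists>W. zopen W \<and> v \<in> W \<and> W \<subseteq> U \<and> res M U W z = res M U W \<zero>\<^bsub>sec M U\<^esub>" using W by blast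
  qed
qed

lemma a_act_hom:
  assumes F: "a_hom M N F" and T: "zopen T" "sig T = T" and M: "A_module M \<phi>"
    and a: "a \<in> secs (Aalg \<phi>) T" and m: "m \<in> secs M T"
  shows "F T (a_act M T a m) = a_act N T a (F T m)"
proof -
  interpret M: A_module M \<phi> by (rule M)
  have o: "o_hom M N F" using F unfolding a_hom_on_def by blast
  have fl: "fst a \<in> regular 0 0 T" "snd a \<in> Lsec T" using a by auto
  have m': "m \<in> secs M (sig T)" using m T by simp
  have "F T (lact M T (snd a) m) = lact N T (snd a) (F T m)"
    using F T fl(2) m' zopen_subset[OF T(1)] unfolding a_hom_on_def by (metis (no_types, lifting))
  then show ?thesis unfolding a_act_def
    using o_hom_add[OF o T(1) M.pre.smult_closed[OF T(1) fl(1) m] M.lact_closed[OF T(1) fl(2) m']]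
      o_hom_smult[OF o T(1) fl(1) m] by simp
qed

lemma (in A_module) a_act_zero:
  assumes T: "zopen T" "sig T = T" and m: "m \<in> secs M T"
  shows "a_act M T \<zero>\<^bsub>sec (Aalg \<phi>) T\<^esub> m = \<zero>\<^bsub>sec M T\<^esub>"
proof -
  interpret MM: module "oring T" "sec M T" using sec_module[OF T(1)] .
  have m': "m \<in> secs M (sig T)" using m T by simp
  have l: "(\<lambda>_. 0) \<in> Lsec T" by (rule regular_0[OF T(1)])
  have "lact M T (\<lambda>v. (\<lambda>_. 0) v * (\<lambda>_. 0) v) m = (\<lambda>_. 0) \<odot>\<^bsub>sec M T\<^esub> lact M T (\<lambda>_. 0) m"
    by (rule lact_left[OF T(1) regular_0[OF T(1)] l m'])
  then have "lact M T (\<lambda>_. 0) m = \<zero>\<^bsub>sec M T\<^esub>"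
    using MM.smult_l_null[OF lact_closed[OF T(1) l m']] by simp
  then show ?thesis unfolding a_act_def using MM.smult_l_null[OF m] by simp
qed

text \<open>
  A nonzero homomorphism is injective: generically every section of \<open>M\<close> is a multiple \<open>a m\<close> of a
  fixed \<open>m\<close>, so the homomorphism is \<open>a m \<mapsto> a b\<close> with \<open>b = \<psi>(m)\<close>. As \<open>A\<close> is a domain and \<open>b \<noteq> 0\<close>,
  this vanishes only for \<open>a = 0\<close>, and a section that is generically zero is zero.
\<close>

lemma (in division_form) line_bundle_hom_injective:
  fixes M :: "('a, 'm) amod"
  assumes M: "A_line_bundle \<phi> M" and \<psi>: "a_hom M (Aalg \<phi>) \<psi>"
    and nz: "zopen U0" "x0 \<in> secs M U0" "\<psi> U0 x0 \<noteq> \<zero>\<^bsub>sec (Aalg \<phi>) U0\<^esub>"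
    and U: "zopen U"
  shows "inj_on (\<psi> U) (secs M U)"
proof -
  interpret M: A_module M \<phi> using M unfolding A_line_bundle_def by blast
  have lp: "locally_projective \<phi> M" and gd: "generic_dim_one \<phi> M" using M unfolding A_line_bundle_def by auto
  interpret A: O_module "Aalg \<phi>" by (rule O_module_Aalg)
  have \<psi>o: "o_hom M (Aalg \<phi>) \<psi>" using \<psi> unfolding a_hom_on_def by blast
  obtain B m where B: "zopen_stable B" "B \<noteq> {}" "m \<in> secs M B"
    and gen: "\<forall>W x. zopen_stable W \<and> W \<noteq> {} \<and> x \<in> secs M W \<longrightarrow>
        (\<exists>T a. zopen_stable T \<and> T \<noteq> {} \<and> T \<subseteq> B \<inter> W \<and> a \<in> secs (Aalg \<phi>) T \<and>
           res M W T x = a_act M T a (res M B T m))"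
    using gd[unfolded generic_dim_one_def] by (elim exE conjE)
  have B': "zopen B" using B(1) unfolding zopen_stable_def by blast
  have rep: "\<exists>T a. zopen T \<and> sig T = T \<and> T \<noteq> {} \<and> T \<subseteq> B \<and> T \<subseteq> W \<and> a \<in> secs (Aalg \<phi>) T \<and>
      res M W T x = a_act M T a (res M B T m)" if W: "zopen W" "W \<noteq> {}" and x: "x \<in> secs M W" for W x
  proof -
    \<comment> \<open>Generators are only available over stable open sets, so \<open>W\<close> is replaced by its stable
        part.\<close>
    let ?V = "W \<inter> sig W"
    have sW: "zopen (sig W)" "sig W \<noteq> {}" using W by auto
    have V: "zopen ?V" "?V \<noteq> {}" "?V \<subseteq> W" using zopen_Int[OF W(1) sW(1)] zopen_dense[OF W(1) sW(1) W(2) sW(2)] by auto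
    have st: "zopen_stable ?V" unfolding zopen_stable_def using V(1) by (auto simp: sig_Int)
    obtain T a where T: "zopen_stable T" "T \<noteq> {}" "T \<subseteq> B \<inter> ?V" "a \<in> secs (Aalg \<phi>) T"
      "res M ?V T (res M W ?V x) = a_act M T a (res M B T m)"
      using gen[THEN spec, THEN spec, THEN mp, OF conjI[OF st conjI[OF V(2) M.res_closed[OF W(1) V(1,3) x]]]]
      by (elim exE conjE)
    then have "res M W T x = a_act M T a (res M B T m)"
      using M.res_res[OF W(1) V(1) _ _ V(3) x, of T] unfolding zopen_stable_def by auto
    then show ?thesis using T unfolding zopen_stable_def by blast
  qed
  have \<psi>rep: "\<psi> T (res M W T x) = a_act (Aalg \<phi>) T a (res (Aalg \<phi>) B T (\<psi> B m))"
    if "zopen T" "sig T = T" "T \<subseteq> B" "a \<in> secs (Aalg \<phi>) T" "res M W T x = a_act M T a (res M B T m)" for T a W x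
    using a_act_hom[OF \<psi> that(1,2) M.A_module_axioms that(4) M.res_closed[OF B' that(1,3) B(3)]]
      o_hom_res[OF \<psi>o B' that(1,3) B(3)] that(5) by simp
  have \<psi>m: "\<psi> B m \<in> secs (Aalg \<phi>) B" using o_hom_closed[OF \<psi>o B' B(3)] .
  have m0: "\<psi> B m \<noteq> \<zero>\<^bsub>sec (Aalg \<phi>) B\<^esub>"
  proof
    assume z: "\<psi> B m = \<zero>\<^bsub>sec (Aalg \<phi>) B\<^esub>"
    have "U0 \<noteq> {}"
    proof
      assume "U0 = {}"
      then have "x0 = \<zero>\<^bsub>sec M U0\<^esub>"
        using M.eq_locally[OF nz(1,2) M.pre.zero_closed[OF nz(1)]] by blast
      then show False using nz(3) o_hom_zero[OF \<psi>o M.presheaf A.presheaf nz(1) nz(1)] by simp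
    qed
    then obtain T a where T: "zopen T" "sig T = T" "T \<noteq> {}" "T \<subseteq> B" "T \<subseteq> U0" "a \<in> secs (Aalg \<phi>) T"
      "res M U0 T x0 = a_act M T a (res M B T m)" using rep[OF nz(1) _ nz(2)] by blast
    have z0: "\<zero>\<^bsub>sec (Aalg \<phi>) T\<^esub> \<in> secs (Aalg \<phi>) T" by (rule A.pre.zero_closed[OF T(1)])
    have "a_act (Aalg \<phi>) T a \<zero>\<^bsub>sec (Aalg \<phi>) T\<^esub> = \<zero>\<^bsub>sec (Aalg \<phi>) T\<^esub>"
    proof -
      obtain f l where a: "a = (f, l)" "l \<in> Lsec T" using T(6) by auto
      have "(\<lambda>_. 0) \<in> Lsec (sig T)" by (rule regular_0) (use T in simp)
      then show ?thesis unfolding a_act_def using a A_lact[OF T(1) a(2), of "\<lambda>_. 0" "\<lambda>_. 0"] by (simp add: lmul_def)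
    qed
    then have "res (Aalg \<phi>) U0 T (\<psi> U0 x0) = \<zero>\<^bsub>sec (Aalg \<phi>) T\<^esub>"
      using \<psi>rep[OF T(1,2,4,6,7)] o_hom_res[OF \<psi>o nz(1) T(1,5) nz(2)] z A.pre.res_zero[OF B' T(1,4)] by simp
    then show False using Aalg_density[OF o_hom_closed[OF \<psi>o nz(1,2)] nz(1) T(1,5,3)] nz(3) by blast
  qed
  have ker: "z = \<zero>\<^bsub>sec M U\<^esub>" if z: "z \<in> secs M U" "\<psi> U z = \<zero>\<^bsub>sec (Aalg \<phi>) U\<^esub>" for z
  proof (cases "U = {}")
    case True
    then show ?thesis using M.eq_locally[OF U z(1) M.pre.zero_closed[OF U]] by blast
  next
    case False
    obtain T a where T: "zopen T" "sig T = T" "T \<noteq> {}" "T \<subseteq> B" "T \<subseteq> U" "a \<in> secs (Aalg \<phi>) T"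
      "res M U T z = a_act M T a (res M B T m)" using rep[OF U False z(1)] by blast
    have "a_act (Aalg \<phi>) T a (res (Aalg \<phi>) B T (\<psi> B m)) = \<zero>\<^bsub>sec (Aalg \<phi>) T\<^esub>"
      using \<psi>rep[OF T(1,2,4,6,7)] o_hom_res[OF \<psi>o U T(1,5) z(1)] z(2) A.pre.res_zero[OF U T(1,5)] by simp
    then consider "a = \<zero>\<^bsub>sec (Aalg \<phi>) T\<^esub>" | "res (Aalg \<phi>) B T (\<psi> B m) = \<zero>\<^bsub>sec (Aalg \<phi>) T\<^esub>"
      using order_is_domain[OF T(1,2,6) A.res_closed[OF B' T(1,4) \<psi>m]] by blast
    then have "a = \<zero>\<^bsub>sec (Aalg \<phi>) T\<^esub>"
      using Aalg_density[OF \<psi>m B' T(1,4,3)] m0 by cases blast+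
    then have "res M U T z = \<zero>\<^bsub>sec M T\<^esub>"
      using T(7) M.a_act_zero[OF T(1,2) M.res_closed[OF B' T(1,4) B(3)]] by simp
    then show ?thesis by (rule locally_projective_density[OF M.O_module_axioms lp U z(1) T(1,5,3)])
  qed
  show ?thesis
  proof (rule inj_onI)
    fix x y assume xy: "x \<in> secs M U" "y \<in> secs M U" "\<psi> U x = \<psi> U y"
    have "\<psi> U (x \<ominus>\<^bsub>sec M U\<^esub> y) = \<zero>\<^bsub>sec (Aalg \<phi>) U\<^esub>"
      using o_hom_on_eq_iff[OF \<psi>o M.presheaf A.presheaf U zopen_subset[OF U] xy(1,2)] xy(3) by simp
    then show "x = y" using ker[OF M.pre.diff_closed[OF U xy(1,2)]] M.pre.diff_zero_iff[OF U xy(1,2)] by simp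
  qed
qed

section \<open>The cokernel as a module over the order\<close>

lemma o_hom_sig: "o_hom M N F \<Longrightarrow> o_hom_on X (sig_pull M) (sig_pull N) (\<lambda>W. F (sig W))"
  by (rule o_hom_onI) (auto simp: o_hom_closed o_hom_add o_hom_smult o_hom_res sigf_regular image_mono)

lemma in_image_sig:
  assumes "in_image M F N (sig U) y" shows "in_image (sig_pull M) (\<lambda>W. F (sig W)) (sig_pull N) U y"
  unfolding in_image_def
proof
  fix v assume "v \<in> U"
  then have "prod.swap v \<in> sig U" by simp
  then obtain W x where W: "zopen W" "prod.swap v \<in> W" "W \<subseteq> sig U" "x \<in> secs M W" "res N (sig U) W y = F W x"
    using in_imageE[OF assms] by metis
  then have "zopen (sig W)" "v \<in> sig W" "sig W \<subseteq> U" "res (sig_pull N) U (sig W) y \<in> F (sig (sig W)) ` secs (sig_pull M) (sig W)"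
    by auto
  then show "\<exists>W. zopen W \<and> v \<in> W \<and> W \<subseteq> U \<and> res (sig_pull N) U W y \<in> F (sig W) ` secs (sig_pull M) W" by blast
qed

lemma (in A_module) o_hom_lact:
  assumes U: "zopen U" and l: "l \<in> Lsec U"
  shows "o_hom_on U (sig_pull M) M (\<lambda>W. lact M W (rst W l))"
proof (rule o_hom_onI)
  fix W x assume W: "zopen W" "W \<subseteq> U" and x: "x \<in> secs (sig_pull M) W"
  have lW: "rst W l \<in> Lsec W" by (rule regular_rst[OF l W])
  have x': "x \<in> secs M (sig W)" using x by simp
  show "lact M W (rst W l) x \<in> secs M W" by (rule lact_closed[OF W(1) lW x'])
  show "lact M W (rst W l) (x \<oplus>\<^bsub>sec (sig_pull M) W\<^esub> y) = lact M W (rst W l) x \<oplus>\<^bsub>sec M W\<^esub> lact M W (rst W l) y"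
    if "y \<in> secs (sig_pull M) W" for y
    using lact_add_right[OF W(1) lW x'] that by simp
  show "lact M W (rst W l) (f \<odot>\<^bsub>sec (sig_pull M) W\<^esub> x) = f \<odot>\<^bsub>sec M W\<^esub> lact M W (rst W l) x"
    if f: "f \<in> regular 0 0 W" for f
    using lact_balanced[OF W(1) sigf_regular[OF f] lW x'] lact_left[OF W(1) f lW x'] by simp
  show "lact M T (rst T l) (res (sig_pull M) W T x) = res M W T (lact M W (rst W l) x)" if T: "zopen T" "T \<subseteq> W" for T
    using lact_res[OF W(1) T lW x'] T by simp
qed

text \<open>
  The quotient of \<open>A\<close> by the image of a homomorphism is again an \<open>A\<close>-module: multiplication by a
  section of \<open>L_\<sigma>\<close> preserves the image, hence factors through the quotient sheaf by \<open>hom_factor\<close>.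
  The axioms of an \<open>A\<close>-module that do not follow from this are verified on local preimages in \<open>A\<close>.
\<close>

lemma (in mult_form) cokernel:
  fixes M :: "('k, 'm) amod"
  assumes M: "A_module M \<phi>" and \<psi>: "a_hom M (Aalg \<phi>) \<psi>"
  obtains Q :: "('k, ('k, ('k fn \<times> 'k fn) set) shf) amod" and \<rho>
  where "A_module Q \<phi>" "a_hom (Aalg \<phi>) Q \<rho>" "\<And>U z. zopen U \<Longrightarrow> z \<in> secs Q U \<Longrightarrow> in_image (Aalg \<phi>) \<rho> Q U z"
    "\<And>U y. zopen U \<Longrightarrow> y \<in> secs (Aalg \<phi>) U \<Longrightarrow> \<rho> U y = \<zero>\<^bsub>sec Q U\<^esub> \<longleftrightarrow> in_image M \<psi> (Aalg \<phi>) U y"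
proof -
  let ?A = "Aalg \<phi>"
  interpret M: A_module M \<phi> by (rule M)
  interpret A: A_module ?A \<phi> by (rule A_module_Aalg)
  have \<psi>o: "o_hom M ?A \<psi>" using \<psi> unfolding a_hom_on_def by blast
  have \<psi>l: "\<psi> U (lact M U l m) = lact ?A U l (\<psi> (sig U) m)" if "zopen U" "l \<in> Lsec U" "m \<in> secs M (sig U)" for U l m
    using \<psi> that zopen_subset[OF that(1)] unfolding a_hom_on_def by blast
  define J where "J = ?A\<lparr>sec := \<lambda>U. (sec ?A U)\<lparr>carrier := \<psi> U ` secs M U\<rparr>\<rparr>"
  have J: "secs J U = \<psi> U ` secs M U" for U unfolding J_def by simp
  interpret S: sub_presheaf ?A J
  proof (rule sub_presheaf.intro[OF A.presheaf sub_presheaf_axioms.intro])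
    fix U :: "'k pt set" assume U: "zopen U"
    show "secs J U \<subseteq> secs ?A U" unfolding J using o_hom_closed[OF \<psi>o U] by blast
    show "\<zero>\<^bsub>sec ?A U\<^esub> \<in> secs J U" unfolding J
      using o_hom_zero[OF \<psi>o M.presheaf A.presheaf U U] M.pre.zero_closed[OF U] by (metis imageI)
    fix x assume "x \<in> secs J U"
    then obtain m where m: "m \<in> secs M U" "x = \<psi> U m" unfolding J by blast
    show "f \<odot>\<^bsub>sec ?A U\<^esub> x \<in> secs J U" if f: "f \<in> regular 0 0 U" for f
      unfolding J m(2) using o_hom_smult[OF \<psi>o U f m(1)] M.pre.smult_closed[OF U f m(1)] by (metis imageI)
    show "res ?A U W x \<in> secs J W" if W: "zopen W" "W \<subseteq> U" for W
      unfolding J m(2) using o_hom_res[OF \<psi>o U W m(1)] M.res_closed[OF U W m(1)] by (metis imageI)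
    fix y assume "y \<in> secs J U"
    then obtain n where n: "n \<in> secs M U" "y = \<psi> U n" unfolding J by blast
    show "x \<oplus>\<^bsub>sec ?A U\<^esub> y \<in> secs J U"
      unfolding J m(2) n(2) using o_hom_add[OF \<psi>o U m(1) n(1)] M.pre.add_closed[OF U m(1) n(1)] by (metis imageI)
  qed
  define OQ where "OQ = oquotient ?A J"
  interpret OQ: O_module OQ unfolding OQ_def by (rule S.O_module_oquotient)
  let ?p = "S.proj"
  have p: "o_hom ?A OQ ?p" unfolding OQ_def by (rule S.o_hom_proj)
  have surj: "in_image ?A ?p OQ U z" if "zopen U" "z \<in> secs OQ U" for U z
    using S.proj_surj[OF that(1)] that(2) unfolding OQ_def by blast
  have ker: "?p U y = \<zero>\<^bsub>sec OQ U\<^esub> \<longleftrightarrow> in_image M \<psi> ?A U y" if "zopen U" "y \<in> secs ?A U" for U y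
    using S.proj_zero_iff[OF that] unfolding OQ_def in_image_def J .
  have ex: "\<exists>F. o_hom_on U (sig_pull OQ) OQ F \<and>
      (\<forall>W a. zopen W \<and> W \<subseteq> U \<and> a \<in> secs ?A (sig W) \<longrightarrow> F W (?p (sig W) a) = ?p W (lact ?A W (rst W l) a))"
    if U: "zopen U" and l: "l \<in> Lsec U" for U l
  proof -
    have lW: "rst W l \<in> Lsec W" if "zopen W" "W \<subseteq> U" for W by (rule regular_rst[OF l that])
    have h: "o_hom_on U (sig_pull ?A) OQ (\<lambda>W a. ?p W (lact ?A W (rst W l) a))"
    proof (rule o_hom_onI)
      note L = A.o_hom_lact[OF U l]
      fix W a assume W: "zopen W" "W \<subseteq> U" and a: "a \<in> secs (sig_pull ?A) W"
      note la = o_hom_on_closed[OF L W a]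
      show "?p W (lact ?A W (rst W l) a) \<in> secs OQ W" by (rule o_hom_closed[OF p W(1) la])
      show "?p W (lact ?A W (rst W l) (a \<oplus>\<^bsub>sec (sig_pull ?A) W\<^esub> b)) =
          ?p W (lact ?A W (rst W l) a) \<oplus>\<^bsub>sec OQ W\<^esub> ?p W (lact ?A W (rst W l) b)"
        if b: "b \<in> secs (sig_pull ?A) W" for b
        unfolding o_hom_on_add[OF L W a b] by (rule o_hom_add[OF p W(1) la o_hom_on_closed[OF L W b]])
      show "?p W (lact ?A W (rst W l) (f \<odot>\<^bsub>sec (sig_pull ?A) W\<^esub> a)) = f \<odot>\<^bsub>sec OQ W\<^esub> ?p W (lact ?A W (rst W l) a)"
        if f: "f \<in> regular 0 0 W" for f
        unfolding o_hom_on_smult[OF L W f a] by (rule o_hom_smult[OF p W(1) f la])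
      show "?p T (lact ?A T (rst T l) (res (sig_pull ?A) W T a)) = res OQ W T (?p W (lact ?A W (rst W l) a))"
        if T: "zopen T" "T \<subseteq> W" for T
        unfolding o_hom_on_res[OF L W T a] by (rule o_hom_res[OF p W(1) T la])
    qed
    have k: "?p W (lact ?A W (rst W l) a) = \<zero>\<^bsub>sec OQ W\<^esub>"
      if W: "zopen W" "W \<subseteq> U" and a: "a \<in> secs (sig_pull ?A) W" and z: "?p (sig W) a = \<zero>\<^bsub>sec (sig_pull OQ) W\<^esub>" for W a
    proof -
      have sW: "zopen (sig W)" using W by simp
      have a': "a \<in> secs ?A (sig W)" using a by simp
      have im: "in_image M \<psi> ?A (sig W) a" using ker[OF sW a'] z by simp
      have la: "lact ?A W (rst W l) a \<in> secs ?A W" by (rule A.lact_closed[OF W(1) lW[OF W] a'])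
      have "in_image M \<psi> ?A W (lact ?A W (rst W l) a)" unfolding in_image_def
      proof
        fix v assume "v \<in> W"
        then have "prod.swap v \<in> sig W" by simp
        then obtain T m where T: "zopen T" "prod.swap v \<in> T" "T \<subseteq> sig W" "m \<in> secs M T" "res ?A (sig W) T a = \<psi> T m"
          using in_imageE[OF im] by metis
        have V1: "zopen (sig T)" "v \<in> sig T" "sig T \<subseteq> W" using T by auto
        have V: "zopen (sig T)" "v \<in> sig T" "sig T \<subseteq> W" "sig T \<subseteq> U" by (rule V1 subset_trans[OF V1(3) W(2)])+
        have m: "m \<in> secs M (sig (sig T))" using T(4) by simp
        have "res ?A W (sig T) (lact ?A W (rst W l) a) = lact ?A (sig T) (rst (sig T) l) (\<psi> (sig (sig T)) m)"
          using A.lact_res[OF W(1) V(1,3) lW[OF W] a'] T(5) V(3) by (simp del: Aalg_simps)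
        also have "\<dots> = \<psi> (sig T) (lact M (sig T) (rst (sig T) l) m)"
          using \<psi>l[OF V(1) lW[OF V(1,4)] m] by (simp del: Aalg_simps)
        finally show "\<exists>T. zopen T \<and> v \<in> T \<and> T \<subseteq> W \<and> res ?A W T (lact ?A W (rst W l) a) \<in> \<psi> T ` secs M T"
          using V M.lact_closed[OF V(1) lW[OF V(1,4)] m] by (intro exI[of _ "sig T"]) (simp del: Aalg_simps)
      qed
      then show ?thesis using ker[OF W(1) la] by blast
    qed
    have sj: "in_image (sig_pull ?A) (\<lambda>W. ?p (sig W)) (sig_pull OQ) W z"
      if "zopen W" "W \<subseteq> U" "z \<in> secs (sig_pull OQ) W" for W z
      by (rule in_image_sig[OF surj]) (use that in simp_all)
    obtain F where F: "o_hom_on U (sig_pull OQ) OQ F"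
      "\<And>W a. zopen W \<Longrightarrow> W \<subseteq> U \<Longrightarrow> a \<in> secs (sig_pull ?A) W \<Longrightarrow> F W (?p (sig W) a) = ?p W (lact ?A W (rst W l) a)"
      by (rule hom_factor[OF presheaf_sig_pull[OF A.presheaf] presheaf_sig_pull[OF OQ.presheaf] OQ.O_module_axioms
          o_hom_sig[OF p] h sj k]) blast+
    show ?thesis using F by (intro exI[of _ F] conjI allI impI) (auto simp del: Aalg_simps)
  qed
  define F where "F U l = (SOME F. o_hom_on U (sig_pull OQ) OQ F \<and>
      (\<forall>W a. zopen W \<and> W \<subseteq> U \<and> a \<in> secs ?A (sig W) \<longrightarrow> F W (?p (sig W) a) = ?p W (lact ?A W (rst W l) a)))" for U l
  have F1: "o_hom_on U (sig_pull OQ) OQ (F U l)"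
    and F2: "\<And>W a. zopen W \<Longrightarrow> W \<subseteq> U \<Longrightarrow> a \<in> secs ?A (sig W) \<Longrightarrow> F U l W (?p (sig W) a) = ?p W (lact ?A W (rst W l) a)"
    if "zopen U" "l \<in> Lsec U" for U l
    using someI_ex[OF ex[OF that]] unfolding F_def[symmetric] by blast+
  define Q where "Q = osheaf.extend OQ (amod.fields (\<lambda>U l q. F U l U q))"
  have Qs: "sec Q = sec OQ" "res Q = res OQ" "lact Q U l q = F U l U q" for U l q
    unfolding Q_def by (simp_all add: osheaf.defs amod.defs)
  \<comment> \<open>The action on \<open>Q\<close> is computed by the action on local preimages in \<open>A\<close>.\<close>
  have key: "res OQ U W (lact Q U l q) = ?p W (lact ?A W (rst W l) a)"
    if U: "zopen U" "l \<in> Lsec U" "q \<in> secs OQ (sig U)" and W: "zopen W" "W \<subseteq> U" and a: "a \<in> secs ?A (sig W)"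
      and e: "res OQ (sig U) (sig W) q = ?p (sig W) a" for U l q W a
  proof -
    have "res OQ U W (F U l U q) = F U l W (res (sig_pull OQ) U W q)"
      using o_hom_on_res[OF F1[OF U(1,2)] U(1) subset_refl W, of q] U(3) by simp
    also have "\<dots> = ?p W (lact ?A W (rst W l) a)" using F2[OF U(1,2) W a] e by simp
    finally show ?thesis unfolding Qs .
  qed
  have cl: "lact Q U l q \<in> secs OQ U" if "zopen U" "l \<in> Lsec U" "q \<in> secs OQ (sig U)" for U l q
    unfolding Qs using o_hom_on_closed[OF F1[OF that(1,2)] that(1) subset_refl] that(3) by simp
  have loc: "\<exists>W a. zopen W \<and> v \<in> W \<and> W \<subseteq> U \<and> a \<in> secs ?A (sig W) \<and> res OQ (sig U) (sig W) q = ?p (sig W) a"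
    if t: "zopen U" "q \<in> secs OQ (sig U)" "v \<in> U" for U q v
  proof -
    have sU: "zopen (sig U)" "prod.swap v \<in> sig U" using t by auto
    obtain T a where T: "zopen T" "prod.swap v \<in> T" "T \<subseteq> sig U" "a \<in> secs ?A T" "res OQ (sig U) T q = ?p T a"
      by (rule in_imageE[OF surj[OF sU(1) t(2)] sU(2)]) blast
    have "zopen (sig T)" "v \<in> sig T" "sig T \<subseteq> U" using T(1-3) by auto
    with T(4,5) show ?thesis by (intro exI[of _ "sig T"] exI[of _ a]) simp
  qed
  have "A_module Q \<phi>"
  proof (rule A_module.intro[OF O_module_cong[OF Qs(1,2) OQ.O_module_axioms] A_module_axioms.intro], unfold Qs(1,2))
    fix U :: "'k pt set" and l q assume U: "zopen U" and l: "l \<in> Lsec U" and q: "q \<in> secs OQ (sig U)"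
    show "lact Q U l q \<in> secs OQ U" by (rule cl[OF U l q])
    {
      fix l' assume l': "l' \<in> Lsec U"
      note ll = regular_add[OF l l']
      show "lact Q U (\<lambda>v. l v + l' v) q = lact Q U l q \<oplus>\<^bsub>sec OQ U\<^esub> lact Q U l' q"
      proof (rule OQ.eq_locally[OF U cl[OF U ll q] OQ.pre.add_closed[OF U cl[OF U l q] cl[OF U l' q]]])
        fix v assume "v \<in> U"
        then obtain W a where W: "zopen W" "v \<in> W" "W \<subseteq> U" and a: "a \<in> secs ?A (sig W)" "res OQ (sig U) (sig W) q = ?p (sig W) a"
          using loc[OF U q] by blast
        have lW: "rst W l \<in> Lsec W" "rst W l' \<in> Lsec W" using regular_rst[OF l W(1,3)] regular_rst[OF l' W(1,3)] by auto
        have "lact ?A W (rst W (\<lambda>v. l v + l' v)) a = lact ?A W (rst W l) a \<oplus>\<^bsub>sec ?A W\<^esub> lact ?A W (rst W l') a"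
          unfolding rst_add by (rule A.lact_add_left[OF W(1) lW a(1)])
        then have "res OQ U W (lact Q U (\<lambda>v. l v + l' v) q) = res OQ U W (lact Q U l q \<oplus>\<^bsub>sec OQ U\<^esub> lact Q U l' q)"
          unfolding key[OF U ll q W(1,3) a] OQ.res_add[OF U W(1,3) cl[OF U l q] cl[OF U l' q]]
            key[OF U l q W(1,3) a] key[OF U l' q W(1,3) a]
          using o_hom_add[OF p W(1) A.lact_closed[OF W(1) lW(1) a(1)] A.lact_closed[OF W(1) lW(2) a(1)]] by metis
        then show "\<exists>W. zopen W \<and> v \<in> W \<and> W \<subseteq> U \<and> res OQ U W (lact Q U (\<lambda>v. l v + l' v) q) = res OQ U W (lact Q U l q \<oplus>\<^bsub>sec OQ U\<^esub> lact Q U l' q)"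
          using W by blast
      qed
    next
      fix q' assume q': "q' \<in> secs OQ (sig U)"
      show "lact Q U l (q \<oplus>\<^bsub>sec OQ (sig U)\<^esub> q') = lact Q U l q \<oplus>\<^bsub>sec OQ U\<^esub> lact Q U l q'"
        unfolding Qs using o_hom_on_add[OF F1[OF U l] U subset_refl, of q q'] q q' by simp
    next
      fix W assume W: "zopen W" "W \<subseteq> U"
      have sW: "zopen (sig U)" "zopen (sig W)" "sig W \<subseteq> sig U" using U W by auto
      have lW: "rst W l \<in> Lsec W" by (rule regular_rst[OF l W])
      have qW: "res OQ (sig U) (sig W) q \<in> secs OQ (sig W)" by (rule OQ.res_closed[OF sW q])
      show "res OQ U W (lact Q U l q) = lact Q W (rst W l) (res OQ (sig U) (sig W) q)"
      proof (rule OQ.eq_locally[OF W(1) OQ.res_closed[OF U W cl[OF U l q]] cl[OF W(1) lW qW]])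
        fix v assume "v \<in> W"
        then obtain T a where T: "zopen T" "v \<in> T" "T \<subseteq> W" and a: "a \<in> secs ?A (sig T)"
          "res OQ (sig W) (sig T) (res OQ (sig U) (sig W) q) = ?p (sig T) a"
          using loc[OF W(1) qW] by blast
        have sT: "zopen (sig T)" "sig T \<subseteq> sig W" "T \<subseteq> U" using T W by auto
        have a2: "res OQ (sig U) (sig T) q = ?p (sig T) a" using a(2) OQ.res_res[OF sW(1,2) sT(1,2) sW(3) q] by simp
        have "res OQ W T (res OQ U W (lact Q U l q)) = res OQ W T (lact Q W (rst W l) (res OQ (sig U) (sig W) q))"
          unfolding OQ.res_res[OF U W(1) T(1,3) W(2) cl[OF U l q]] key[OF U l q T(1) sT(3) a(1) a2] key[OF W(1) lW qW T(1,3) a]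
          using T(3) by (simp del: Aalg_simps)
        then show "\<exists>T. zopen T \<and> v \<in> T \<and> T \<subseteq> W \<and> res OQ W T (res OQ U W (lact Q U l q)) = res OQ W T (lact Q W (rst W l) (res OQ (sig U) (sig W) q))"
          using T by blast
      qed
    }
    have left: "lact Q U (\<lambda>v. f v * l v) q = f \<odot>\<^bsub>sec OQ U\<^esub> lact Q U l q" if f: "f \<in> regular 0 0 U" for f
    proof -
      note fl = regular_mult0[OF f l]
      show ?thesis
      proof (rule OQ.eq_locally[OF U cl[OF U fl q] OQ.pre.smult_closed[OF U f cl[OF U l q]]])
        fix v assume "v \<in> U"
        then obtain W a where W: "zopen W" "v \<in> W" "W \<subseteq> U" and a: "a \<in> secs ?A (sig W)" "res OQ (sig U) (sig W) q = ?p (sig W) a"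
          using loc[OF U q] by blast
        have lW: "rst W l \<in> Lsec W" "rst W f \<in> regular 0 0 W" using regular_rst[OF l W(1,3)] regular_rst[OF f W(1,3)] by auto
        have "lact ?A W (rst W (\<lambda>v. f v * l v)) a = rst W f \<odot>\<^bsub>sec ?A W\<^esub> lact ?A W (rst W l) a"
          unfolding rst_mult by (rule A.lact_left[OF W(1) lW(2,1) a(1)])
        then have "res OQ U W (lact Q U (\<lambda>v. f v * l v) q) = res OQ U W (f \<odot>\<^bsub>sec OQ U\<^esub> lact Q U l q)"
          unfolding key[OF U fl q W(1,3) a] OQ.res_smult[OF U W(1,3) cl[OF U l q] f] key[OF U l q W(1,3) a]
          using o_hom_smult[OF p W(1) lW(2) A.lact_closed[OF W(1) lW(1) a(1)]] by metis
        then show "\<exists>W. zopen W \<and> v \<in> W \<and> W \<subseteq> U \<and> res OQ U W (lact Q U (\<lambda>v. f v * l v) q) = res OQ U W (f \<odot>\<^bsub>sec OQ U\<^esub> lact Q U l q)"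
          using W by blast
      qed
    qed
    show "lact Q U (\<lambda>v. f v * l v) q = f \<odot>\<^bsub>sec OQ U\<^esub> lact Q U l q" if "f \<in> regular 0 0 U" for f
      by (rule left[OF that])
    show "lact Q U l (f \<odot>\<^bsub>sec OQ (sig U)\<^esub> q) = lact Q U (\<lambda>v. sigf f v * l v) q" if f: "f \<in> regular 0 0 (sig U)" for f
      unfolding left[OF sigf_regular'[OF f]] unfolding Qs
      using o_hom_on_smult[OF F1[OF U l] U subset_refl sigf_regular'[OF f], of q] q by simp
  next
    fix U :: "'k pt set" and l l' q assume U: "zopen U" and l: "l \<in> Lsec U" and l': "l' \<in> Lsec (sig U)" and q: "q \<in> secs OQ U"
    have sU: "zopen (sig U)" using U by simp
    have q': "q \<in> secs OQ (sig (sig U))" using q by simp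
    note lq = cl[OF sU l' q']
    have ph: "\<phi> U (Lsig_pure Lbd U l l') = lmul l l'" "lmul l l' \<in> regular 0 0 U"
      using phi_lmul[OF U l l'] lmul_regular[OF U l l'] by auto
    show "lact Q U l (lact Q (sig U) l' q) = \<phi> U (Lsig_pure Lbd U l l') \<odot>\<^bsub>sec OQ U\<^esub> q"
      unfolding ph(1)
    proof (rule OQ.eq_locally[OF U cl[OF U l lq] OQ.pre.smult_closed[OF U ph(2) q]])
      fix v assume v: "v \<in> U"
      obtain W a where W: "zopen W" "v \<in> W" "W \<subseteq> U" and a: "a \<in> secs ?A W" "res OQ U W q = ?p W a"
        by (rule in_imageE[OF surj[OF U q] v]) blast
      have sW: "zopen (sig W)" "sig W \<subseteq> sig U" using W by auto
      have a': "a \<in> secs ?A (sig (sig W))" "res OQ (sig (sig U)) (sig (sig W)) q = ?p (sig (sig W)) a" using a by auto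
      have lW: "rst W l \<in> Lsec W" "rst (sig W) l' \<in> Lsec (sig W)" using regular_rst[OF l W(1,3)] regular_rst[OF l' sW] by auto
      have la: "lact ?A (sig W) (rst (sig W) l') a \<in> secs ?A (sig W)" by (rule A.lact_closed[OF sW(1) lW(2) a'(1)])
      note 1 = key[OF sU l' q' sW a']
      have "res OQ U W (lact Q U l (lact Q (sig U) l' q)) = ?p W (lact ?A W (rst W l) (lact ?A (sig W) (rst (sig W) l') a))"
        by (rule key[OF U l lq W(1,3) la 1])
      also have "\<dots> = ?p W (lmul (rst W l) (rst (sig W) l') \<odot>\<^bsub>sec ?A W\<^esub> a)"
        unfolding A.lact_assoc[OF W(1) lW a(1)] phi_lmul[OF W(1) lW] ..
      also have "\<dots> = lmul (rst W l) (rst (sig W) l') \<odot>\<^bsub>sec OQ W\<^esub> ?p W a"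
        by (rule o_hom_smult[OF p W(1) lmul_regular[OF W(1) lW] a(1)])
      also have "\<dots> = res OQ U W (lmul l l' \<odot>\<^bsub>sec OQ U\<^esub> q)"
        unfolding OQ.res_smult[OF U W(1,3) q ph(2)] lmul_rst[OF W(3)] a(2) ..
      finally show "\<exists>W. zopen W \<and> v \<in> W \<and> W \<subseteq> U \<and> res OQ U W (lact Q U l (lact Q (sig U) l' q)) = res OQ U W (lmul l l' \<odot>\<^bsub>sec OQ U\<^esub> q)"
        using W by blast
    qed
  qed
  moreover have "a_hom ?A Q ?p"
    unfolding a_hom_on_def
  proof (intro conjI allI impI ballI)
    show "o_hom ?A Q ?p" using p unfolding o_hom_on_def Qs .
    fix U :: "'k pt set" and l m assume U: "zopen U \<and> U \<subseteq> ycone" and l: "l \<in> Lsec U" and m: "m \<in> secs ?A (sig U)"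
    then show "?p U (lact ?A U l m) = lact Q U l (?p (sig U) m)"
      unfolding Qs using F2[OF _ l _ subset_refl m] rst_self[OF l] by (simp del: Aalg_simps)
  qed
  moreover have "in_image ?A ?p Q U z" if "zopen U" "z \<in> secs Q U" for U z
    using surj[OF that(1), of z] that(2) unfolding in_image_def Qs .
  moreover have "?p U y = \<zero>\<^bsub>sec Q U\<^esub> \<longleftrightarrow> in_image M \<psi> ?A U y" if "zopen U" "y \<in> secs ?A U" for U y
    using ker[OF that] unfolding Qs .
  ultimately show thesis by (rule that)
qed

text \<open>
  The isomorphism of \<open>quotients_iso\<close> commutes with the action of \<open>L_\<sigma>\<close>, because \<open>\<rho>\<close> and \<open>\<rho>'\<close> do
  and every section of \<open>Q\<close> is locally in the image of \<open>\<rho>\<close>.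
\<close>

lemma quotients_A_iso:
  assumes N: "A_module N \<phi>" and Q: "A_module Q \<phi>" and Q': "O_module Q'"
    and \<rho>: "a_hom N Q \<rho>" and \<rho>': "a_hom N Q' \<rho>'"
    and lc: "\<And>U l m. zopen U \<Longrightarrow> l \<in> Lsec U \<Longrightarrow> m \<in> secs Q' (sig U) \<Longrightarrow> lact Q' U l m \<in> secs Q' U"
    and lr: "\<And>U W l m. zopen U \<Longrightarrow> zopen W \<Longrightarrow> W \<subseteq> U \<Longrightarrow> l \<in> Lsec U \<Longrightarrow> m \<in> secs Q' (sig U) \<Longrightarrow>
      res Q' U W (lact Q' U l m) = lact Q' W (rst W l) (res Q' (sig U) (sig W) m)"
    and surj: "\<And>U z. zopen U \<Longrightarrow> z \<in> secs Q U \<Longrightarrow> in_image N \<rho> Q U z"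
    and surj': "\<And>U z. zopen U \<Longrightarrow> z \<in> secs Q' U \<Longrightarrow> in_image N \<rho>' Q' U z"
    and ker: "\<And>U y. zopen U \<Longrightarrow> y \<in> secs N U \<Longrightarrow> \<rho> U y = \<zero>\<^bsub>sec Q U\<^esub> \<longleftrightarrow> \<rho>' U y = \<zero>\<^bsub>sec Q' U\<^esub>"
  shows "Q \<cong>\<^sub>A Q'"
proof -
  interpret N: A_module N \<phi> by (rule N)
  interpret Q: A_module Q \<phi> by (rule Q)
  interpret Q': O_module Q' by (rule Q')
  have o: "o_hom N Q \<rho>" "o_hom N Q' \<rho>'" using \<rho> \<rho>' unfolding a_hom_on_def by auto
  have l\<rho>: "\<rho> U (lact N U l m) = lact Q U l (\<rho> (sig U) m)" "\<rho>' U (lact N U l m) = lact Q' U l (\<rho>' (sig U) m)"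
    if "zopen U" "l \<in> Lsec U" "m \<in> secs N (sig U)" for U l m
    using \<rho> \<rho>' that zopen_subset[OF that(1)] unfolding a_hom_on_def by blast+
  obtain F where F: "o_hom Q Q' F" "bij_on_sections Q Q' F"
    "\<And>U y. zopen U \<Longrightarrow> y \<in> secs N U \<Longrightarrow> F U (\<rho> U y) = \<rho>' U y"
    by (rule quotients_iso[OF N.presheaf Q.O_module_axioms Q' o surj surj' ker]) blast+
  have "F U (lact Q U l q) = lact Q' U l (F (sig U) q)" if U: "zopen U" and l: "l \<in> Lsec U" and q: "q \<in> secs Q (sig U)" for U l q
  proof -
    have sU: "zopen (sig U)" using U by simp
    note lq = Q.lact_closed[OF U l q] and Fq = o_hom_closed[OF F(1) sU q]
    show ?thesis
    proof (rule Q'.eq_locally[OF U o_hom_closed[OF F(1) U lq] lc[OF U l Fq]])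
      fix v assume "v \<in> U"
      then have sv: "prod.swap v \<in> sig U" by simp
      obtain T y where T: "zopen T" "prod.swap v \<in> T" "T \<subseteq> sig U" "y \<in> secs N T" "res Q (sig U) T q = \<rho> T y"
        using in_imageE[OF surj[OF sU q] sv] .
      define W where "W = sig T"
      have W: "zopen W" "v \<in> W" "W \<subseteq> U" "sig W = T" "zopen (sig W)" "sig W \<subseteq> sig U" using T unfolding W_def by auto
      have y: "y \<in> secs N (sig W)" "res Q (sig U) (sig W) q = \<rho> (sig W) y" using T W(4) by auto
      have lW: "rst W l \<in> Lsec W" by (rule regular_rst[OF l W(1,3)])
      have "res Q' U W (F U (lact Q U l q)) = F W (lact Q W (rst W l) (\<rho> (sig W) y))"
        using o_hom_res[OF F(1) U W(1,3) lq] Q.lact_res[OF U W(1,3) l q] y(2) by simp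
      also have "\<dots> = \<rho>' W (lact N W (rst W l) y)"
        using l\<rho>(1)[OF W(1) lW y(1)] F(3)[OF W(1) N.lact_closed[OF W(1) lW y(1)]] by simp
      also have "\<dots> = lact Q' W (rst W l) (F (sig W) (res Q (sig U) (sig W) q))"
        using l\<rho>(2)[OF W(1) lW y(1)] F(3)[OF W(5) y(1)] y(2) by simp
      also have "\<dots> = res Q' U W (lact Q' U l (F (sig U) q))"
        using o_hom_res[OF F(1) sU W(5,6) q] lr[OF U W(1,3) l Fq] by simp
      finally show "\<exists>W. zopen W \<and> v \<in> W \<and> W \<subseteq> U \<and> res Q' U W (F U (lact Q U l q)) = res Q' U W (lact Q' U l (F (sig U) q))"
        using W by blast
    qed
  qed
  then have "a_hom Q Q' F" unfolding a_hom_on_def using F(1) by blast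
  then show ?thesis unfolding a_iso_def using F(2) by blast
qed

section \<open>Divisors\<close>

text \<open>
  Homomorphisms between the sheaves \<open>O(a, b)\<close> are multiplications by global sections: where \<open>e\<close>
  generates \<open>O(a, b)\<close>, the factor is \<open>G(e) / e\<close>, and it does not depend on \<open>e\<close>.
\<close>

lemma o_hom_Osh:
  fixes G :: "'k::{alg_closed_field, field_char_0} pt set \<Rightarrow> 'k fn \<Rightarrow> 'k fn"
  assumes G: "o_hom (Osh a b) (Osh c d) G"
  obtains g where "g \<in> regular (c - a) (d - b) ycone"
    "\<And>U n. zopen U \<Longrightarrow> n \<in> regular a b U \<Longrightarrow> G U n = (\<lambda>v. g v * n v)"
proof -
  have cl: "G U n \<in> regular c d U" if "zopen U" "n \<in> regular a b U" for U n
    using o_hom_closed[OF G that(1), of n] that(2) by simp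
  have val: "G U n v * e v = G W e v * n v" if U: "zopen U" "n \<in> regular a b U" "v \<in> U"
    and W: "zopen W" "e \<in> regular a b W" "v \<in> W" "\<And>w. w \<in> W \<Longrightarrow> e w \<noteq> 0" for U n v W e
  proof -
    let ?T = "U \<inter> W"
    have T: "zopen ?T" "?T \<subseteq> U" "?T \<subseteq> W" "v \<in> ?T" using U W zopen_Int by auto
    have eT: "rst ?T e \<in> regular a b ?T" "\<And>w. w \<in> ?T \<Longrightarrow> rst ?T e w \<noteq> 0"
      using regular_rst[OF W(2) T(1,3)] W(4) by (auto simp: rst_def)
    have nT: "rst ?T n \<in> regular a b ?T" by (rule regular_rst[OF U(2) T(1,2)])
    note q = regular_divide[OF nT eT]
    have "rst ?T (G U n) = G ?T (rst ?T n)" using o_hom_res[OF G U(1) T(1,2), of n] U(2) by simp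
    also have "\<dots> = G ?T (\<lambda>v. rst ?T n v * inverse (rst ?T e v) * rst ?T e v)"
      by (rule arg_cong[OF q(2)[symmetric], of "G ?T"])
    also have "\<dots> = (\<lambda>v. rst ?T n v * inverse (rst ?T e v) * G ?T (rst ?T e) v)"
      using o_hom_smult[OF G T(1) q(1), of "rst ?T e"] eT(1) by simp
    also have "G ?T (rst ?T e) = rst ?T (G W e)" using o_hom_res[OF G W(1) T(1,3), of e] W(2) by simp
    finally have "rst ?T (G U n) v = rst ?T n v * inverse (rst ?T e v) * rst ?T (G W e) v" by (rule fun_cong)
    then have "G U n v = n v * inverse (e v) * G W e v" using T(4) by (simp add: rst_def)
    then show ?thesis using W(4)[OF W(3)] by simp
  qed
  define R where "R v g \<longleftrightarrow> (\<exists>W e. zopen W \<and> v \<in> W \<and> e \<in> regular a b W \<and> (\<forall>w\<in>W. e w \<noteq> 0) \<and> g = G W e v * inverse (e v))" for v g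
  have ex: "\<exists>g. R v g" if v: "v \<in> ycone" for v
  proof -
    obtain W e where "zopen W" "v \<in> W" "W \<subseteq> ycone" "e \<in> regular a b W" "\<And>w. w \<in> W \<Longrightarrow> e w \<noteq> 0"
      using local_unit[OF zopen_ycone v, of a b] by metis
    then show ?thesis unfolding R_def by blast
  qed
  define g where "g v = (if v \<in> ycone then SOME x. R v x else 0)" for v
  have Rg: "R v (g v)" if "v \<in> ycone" for v using someI_ex[OF ex[OF that]] that unfolding g_def by simp
  have gval: "G U n v = g v * n v" if U: "zopen U" "n \<in> regular a b U" "v \<in> U" for U n v
  proof -
    have "v \<in> ycone" using U zopen_subset by blast
    from Rg[OF this] obtain W e where W: "zopen W" "v \<in> W" "e \<in> regular a b W" "\<forall>w\<in>W. e w \<noteq> 0" "g v = G W e v * inverse (e v)"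
      unfolding R_def by blast
    have "G U n v * e v = G W e v * n v" using val[OF U W(1,3,2)] W(4) by blast
    moreover have "e v \<noteq> 0" using W(2,4) by blast
    ultimately have "G U n v = G W e v * n v * inverse (e v)" by (simp add: field_simps)
    then show ?thesis unfolding W(5) by (simp add: mult_ac)
  qed
  show thesis
  proof (rule that)
    show "g \<in> regular (c - a) (d - b) ycone"
    proof (rule regular_locally)
      fix v :: "'k pt" assume v: "v \<in> ycone"
      obtain W e where W: "zopen W" "v \<in> W" "W \<subseteq> ycone" "e \<in> regular a b W" "\<And>w. w \<in> W \<Longrightarrow> e w \<noteq> 0"
        using local_unit[OF zopen_ycone v, of a b] by metis
      have "(\<lambda>v. G W e v * inverse (e v)) \<in> regular (c - a) (d - b) W"
        by (rule regular_mult[OF cl[OF W(1,4)] regular_inverse[OF W(4,5)]]) auto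
      moreover have "rst W g = (\<lambda>v. G W e v * inverse (e v))"
      proof
        fix w show "rst W g w = G W e w * inverse (e w)"
          using gval[OF W(1,4), of w] W(5)[of w] regular_outside[OF W(4), of w] by (cases "w \<in> W") (auto simp: rst_def)
      qed
      ultimately show "\<exists>W. zopen W \<and> v \<in> W \<and> W \<subseteq> ycone \<and> rst W g \<in> regular (c - a) (d - b) W" using W by auto
    qed (simp add: g_def)
    show "G U n = (\<lambda>v. g v * n v)" if U: "zopen U" "n \<in> regular a b U" for U n
    proof
      fix v show "G U n v = g v * n v"
        using gval[OF U, of v] regular_outside[OF cl[OF U], of v] regular_outside[OF U(2), of v] by (cases "v \<in> U") auto
    qed
  qed
qed

locale divisor_form =
  fixes a b :: int and h :: "'k::{alg_closed_field, field_char_0} fn"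
  assumes h: "h \<in> regular a b ycone" and h0: "h \<noteq> (\<lambda>_. 0)"
begin

abbreviation "F \<equiv> zero_divisor a b h"

lemma h_rst: "zopen U \<Longrightarrow> rst U h \<in> regular a b U"
  using regular_rst[OF h _ zopen_subset] by blast

lemma mem_F: "f \<in> F U \<longleftrightarrow> (\<exists>g\<in>regular (-a) (-b) U. f = (\<lambda>v. h v * g v))"
  unfolding zero_divisor_def by blast

lemma h_mult_regular:
  assumes "zopen U" "g \<in> regular c d U" "c' = a + c" "d' = b + d" shows "(\<lambda>v. h v * g v) \<in> regular c' d' U"
proof -
  have "(\<lambda>v. rst U h v * g v) = (\<lambda>v. h v * g v)"
    using regular_outside[OF assms(2)] by (auto simp: rst_def fun_eq_iff)
  then show ?thesis using regular_mult[OF h_rst[OF assms(1)] assms(2-4)] by simp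
qed

lemma F_subset: "zopen U \<Longrightarrow> F U \<subseteq> regular 0 0 U"
  unfolding zero_divisor_def using h_mult_regular[of U _ "-a" "-b" 0 0] by auto

text \<open>
  The form \<open>h\<close> is nonzero on a dense open set, so it may be cancelled.
\<close>

lemma h_cancel:
  assumes U: "zopen U" and g: "g \<in> regular c d U" "g' \<in> regular c d U" and eq: "\<And>v. v \<in> U \<Longrightarrow> h v * g v = h v * g' v"
  shows "g = g'"
proof
  fix v
  obtain v0 where v0: "h v0 \<noteq> 0" using h0 by (metis ext)
  obtain V where V: "zopen V" "v0 \<in> V" "\<And>w. w \<in> V \<Longrightarrow> h w \<noteq> 0"
    using regular_nonzero_open[OF h zopen_ycone v0] by metis
  show "g v = g' v"
  proof (cases "v \<in> U")
    case True
    have ne: "U \<inter> V \<noteq> {}" using zopen_dense[OF U V(1)] True V(2) by blast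
    have "g w - g' w = 0" if "w \<in> U \<inter> V" for w
    proof -
      have "h w * g w = h w * g' w" "h w \<noteq> 0" using eq[of w] V(3)[of w] that by auto
      then show ?thesis by simp
    qed
    then have "g v - g' v = 0" using regular_density[OF regular_diff[OF g U] U zopen_Int[OF U V(1)] ne] by blast
    then show ?thesis by simp
  qed (use g regular_outside in metis)
qed

lemma F_add:
  assumes "f \<in> F U" "f' \<in> F U" shows "(\<lambda>v. f v + f' v) \<in> F U"
proof -
  obtain g g' where g: "g \<in> regular (-a) (-b) U" "f = (\<lambda>v. h v * g v)" "g' \<in> regular (-a) (-b) U" "f' = (\<lambda>v. h v * g' v)"
    using assms unfolding mem_F by blast
  show ?thesis unfolding mem_F g(2,4) by (rule bexI[OF _ regular_add[OF g(1,3)]]) (simp add: distrib_left)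
qed

lemma F_mult:
  assumes "f \<in> regular 0 0 U" "f' \<in> F U" shows "(\<lambda>v. f v * f' v) \<in> F U"
proof -
  obtain g where g: "g \<in> regular (-a) (-b) U" "f' = (\<lambda>v. h v * g v)" using assms(2) unfolding mem_F by blast
  show ?thesis unfolding mem_F g(2) by (rule bexI[OF _ regular_mult0[OF assms(1) g(1)]]) (simp add: mult_ac)
qed

lemma F_rst:
  assumes "f \<in> F U" "zopen W" "W \<subseteq> U" shows "rst W f \<in> F W"
proof -
  obtain g where g: "g \<in> regular (-a) (-b) U" "f = (\<lambda>v. h v * g v)" using assms(1) unfolding mem_F by blast
  show ?thesis unfolding mem_F g(2) by (rule bexI[OF _ regular_rst[OF g(1) assms(2,3)]]) (auto simp: rst_def)
qed

lemma F_zero: "zopen U \<Longrightarrow> (\<lambda>_. 0) \<in> F U"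
  unfolding mem_F by (intro bexI[of _ "\<lambda>_. 0"]) (auto intro: regular_0)

text \<open>
  Membership in the ideal sheaf is local, because the quotient by \<open>h\<close> is unique.
\<close>

lemma F_local:
  assumes U: "zopen U" and f: "f \<in> regular 0 0 U" and loc: "\<And>v. v \<in> U \<Longrightarrow> \<exists>W. zopen W \<and> v \<in> W \<and> W \<subseteq> U \<and> rst W f \<in> F W"
  shows "f \<in> F U"
proof -
  interpret O: O_module "Osh (-a) (-b) :: ('k, 'k fn) osheaf" by (rule O_module_Osh)
  let ?R = "\<lambda>W y. \<forall>w\<in>W. f w = h w * y w"
  have "\<exists>!g. g \<in> secs (Osh (-a) (-b)) U \<and> (\<forall>v\<in>U. \<exists>W. zopen W \<and> v \<in> W \<and> W \<subseteq> U \<and> ?R W (res (Osh (-a) (-b)) U W g))"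
  proof (rule O.glue_unique[OF U])
    show "?R T (res (Osh (-a) (-b)) W T y)" if "?R W y" "T \<subseteq> W" for W T y using that by (auto simp: rst_def)
    show "y = y'" if W: "zopen W" "y \<in> secs (Osh (-a) (-b)) W" "y' \<in> secs (Osh (-a) (-b)) W" "?R W y" "?R W y'" for W y y'
    proof (rule h_cancel[OF W(1) W(2,3)[unfolded Osh_simps]])
      fix v assume v: "v \<in> W"
      show "h v * y v = h v * y' v" using W(4)[THEN bspec, OF v] W(5)[THEN bspec, OF v] by (rule trans[OF sym])
    qed
    fix v assume "v \<in> U"
    then obtain W where W: "zopen W" "v \<in> W" "W \<subseteq> U" "rst W f \<in> F W" using loc by blast
    then obtain g where g: "g \<in> regular (-a) (-b) W" "rst W f = (\<lambda>v. h v * g v)" unfolding mem_F by blast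
    have "f w = h w * g w" if "w \<in> W" for w using fun_cong[OF g(2), of w] that by (simp add: rst_def)
    then show "\<exists>W y. zopen W \<and> v \<in> W \<and> W \<subseteq> U \<and> y \<in> secs (Osh (-a) (-b)) W \<and> ?R W y"
      using W g(1) by (intro exI[of _ W] exI[of _ g]) simp
  qed
  from ex1_implies_ex[OF this] obtain g where g: "g \<in> secs (Osh (-a) (-b)) U"
    "\<forall>v\<in>U. \<exists>W. zopen W \<and> v \<in> W \<and> W \<subseteq> U \<and> ?R W (res (Osh (-a) (-b)) U W g)" by (elim exE conjE)
  have "f v = h v * g v" for v
  proof (cases "v \<in> U")
    case True
    then obtain W where "v \<in> W" "?R W (res (Osh (-a) (-b)) U W g)" using g(2) by blast
    then show ?thesis by (simp add: rst_def)
  next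
    case False
    then show ?thesis using regular_outside[OF f] g(1) regular_outside[of g] by simp
  qed
  then have "f = (\<lambda>v. h v * g v)" by (rule ext)
  moreover have "g \<in> regular (-a) (-b) U" using g(1) by simp
  ultimately show ?thesis unfolding mem_F by blast
qed

lemma O_module_ideal: "O_module (ideal_sheaf F)"
proof (rule O_module.intro)
  let ?I = "ideal_sheaf F"
  interpret O: O_module "Osh 0 0 :: ('k, 'k fn) osheaf" by (rule O_module_Osh)
  fix U :: "'k pt set" assume U: "zopen U"
  show "module (oring U) (sec ?I U)"
  proof (rule moduleI)
    show "cring (oring U)" by (rule oring_cring[OF U])
    show "abelian_group (sec ?I U)"
    proof (rule abelian_groupI)
      show "\<exists>y\<in>secs ?I U. y \<oplus>\<^bsub>sec ?I U\<^esub> x = \<zero>\<^bsub>sec ?I U\<^esub>" if "x \<in> secs ?I U" for x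
      proof (rule bexI)
        show "(\<lambda>v. rst U (\<lambda>_. -1) v * x v) \<in> secs ?I U" using F_mult[OF regular_const[OF U]] that by simp
        have "x v = 0" if "v \<notin> U" for v using F_subset[OF U] \<open>x \<in> secs ?I U\<close> regular_outside that by fastforce
        then show "(\<lambda>v. rst U (\<lambda>_. -1) v * x v) \<oplus>\<^bsub>sec ?I U\<^esub> x = \<zero>\<^bsub>sec ?I U\<^esub>" by (auto simp: rst_def fun_eq_iff)
      qed
    qed (use U in \<open>auto simp: algebra_simps F_add F_zero\<close>)
    show "\<one>\<^bsub>oring U\<^esub> \<odot>\<^bsub>sec ?I U\<^esub> x = x" if "x \<in> secs ?I U" for x
      using rst_one_mult[of x 0 0 U] subsetD[OF F_subset[OF U], of x] that by simp
  qed (auto simp: algebra_simps F_mult)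
next
  fix U x assume "zopen U" "x \<in> secs (ideal_sheaf F) U"
  then have "x \<in> regular 0 0 U" using subsetD[OF F_subset[of U], of x] by simp
  then show "res (ideal_sheaf F) U U x = x" using rst_self[of x 0 0 U] by simp
next
  fix \<W> :: "'k pt set set" and x y
  assume W: "\<And>W. W \<in> \<W> \<Longrightarrow> zopen W" "zopen (\<Union>\<W>)" "x \<in> secs (ideal_sheaf F) (\<Union>\<W>)" "y \<in> secs (ideal_sheaf F) (\<Union>\<W>)"
    "\<And>W. W \<in> \<W> \<Longrightarrow> res (ideal_sheaf F) (\<Union>\<W>) W x = res (ideal_sheaf F) (\<Union>\<W>) W y"
  then show "x = y" using O_module.locality[OF O_module_Osh[of 0 0], of \<W> x y] F_subset[OF W(2)] by auto
next
  fix \<W> :: "'k pt set set" and s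
  assume W: "\<And>W. W \<in> \<W> \<Longrightarrow> zopen W" "zopen (\<Union>\<W>)" and s: "\<And>W. W \<in> \<W> \<Longrightarrow> s W \<in> secs (ideal_sheaf F) W"
    and c: "\<And>W T. \<lbrakk>W \<in> \<W>; T \<in> \<W>\<rbrakk> \<Longrightarrow> res (ideal_sheaf F) W (W \<inter> T) (s W) = res (ideal_sheaf F) T (W \<inter> T) (s T)"
  have s': "s W \<in> secs (Osh 0 0) W" if "W \<in> \<W>" for W using s[OF that] F_subset[OF W(1)[OF that]] by auto
  obtain x where x: "x \<in> secs (Osh 0 0) (\<Union>\<W>)" "\<forall>W\<in>\<W>. res (Osh 0 0) (\<Union>\<W>) W x = s W"
    using O_module.gluing[OF O_module_Osh[of 0 0] W s'] c by auto
  have "x \<in> F (\<Union>\<W>)"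
  proof (rule F_local[OF W(2)])
    show "x \<in> regular 0 0 (\<Union>\<W>)" using x(1) by simp
    fix v assume "v \<in> \<Union>\<W>"
    then obtain T where "T \<in> \<W>" "v \<in> T" by blast
    then show "\<exists>W. zopen W \<and> v \<in> W \<and> W \<subseteq> \<Union>\<W> \<and> rst W x \<in> F W"
      using x(2) s[of T] W(1) by (intro exI[of _ T]) auto
  qed
  then show "\<exists>x\<in>secs (ideal_sheaf F) (\<Union>\<W>). \<forall>W\<in>\<W>. res (ideal_sheaf F) (\<Union>\<W>) W x = s W" using x(2) by auto
qed (auto simp: rst_add rst_mult F_rst)

text \<open>
  Division by \<open>h\<close> is an isomorphism from the ideal sheaf to \<open>O(-a, -b)\<close>.
\<close>

lemma is_divisor_F: "is_divisor a b F"
  unfolding is_divisor_def effective_divisor_def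
proof (intro conjI allI impI ballI)
  show "F U \<subseteq> regular 0 0 U" if "zopen U" for U by (rule F_subset[OF that])
  show "O_module (ideal_sheaf F)" by (rule O_module_ideal)
  fix v :: "'k pt" assume v: "v \<in> ycone"
  obtain W e where W: "zopen W" "v \<in> W" "W \<subseteq> ycone" "e \<in> regular (-a) (-b) W" "\<And>w. w \<in> W \<Longrightarrow> e w \<noteq> 0"
    using local_unit[OF zopen_ycone v, of "-a" "-b"] by metis
  let ?g = "\<lambda>v. h v * e v"
  have g: "?g \<in> regular 0 0 W" by (rule h_mult_regular[OF W(1,4)]) auto
  have "?g \<noteq> (\<lambda>_. 0)"
  proof
    assume z: "?g = (\<lambda>_. 0)"
    have "e = (\<lambda>_. 0)" by (rule h_cancel[OF W(1,4) regular_0[OF W(1)]]) (use fun_cong[OF z] in simp)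
    then show False using W(5)[OF W(2)] by simp
  qed
  moreover have "F T = {\<lambda>v. f v * ?g v | f. f \<in> regular 0 0 T}" if T: "zopen T" "T \<subseteq> W" for T
  proof (intro equalityI subsetI)
    have eT: "rst T e \<in> regular (-a) (-b) T" "\<And>w. w \<in> T \<Longrightarrow> rst T e w \<noteq> 0"
      using regular_rst[OF W(4) T] W(5) T by (auto simp: rst_def)
    fix x
    {
      assume "x \<in> F T"
      then obtain k where k: "k \<in> regular (-a) (-b) T" "x = (\<lambda>v. h v * k v)" unfolding mem_F by blast
      note q = regular_divide[OF k(1) eT]
      have "x v = k v * inverse (rst T e v) * (h v * e v)" for v
        using fun_cong[OF q(2), of v] regular_outside[OF k(1), of v] unfolding k(2)
        by (cases "v \<in> T") (auto simp: rst_def mult_ac)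
      then have "x = (\<lambda>v. k v * inverse (rst T e v) * ?g v)" by (rule ext)
      with q(1) show "x \<in> {\<lambda>v. f v * ?g v | f. f \<in> regular 0 0 T}"
        by (intro CollectI exI[of _ "\<lambda>v. k v * inverse (rst T e v)"] conjI)
    next
      assume "x \<in> {\<lambda>v. f v * ?g v | f. f \<in> regular 0 0 T}"
      then obtain f where f: "f \<in> regular 0 0 T" "x = (\<lambda>v. f v * ?g v)" by blast
      have "x = (\<lambda>v. h v * (f v * rst T e v))" unfolding f(2) using regular_outside[OF f(1)] by (auto simp: rst_def fun_eq_iff)
      then show "x \<in> F T" unfolding mem_F by (rule bexI[OF _ regular_mult0[OF f(1) eT(1)]])
    }
  qed
  ultimately show "\<exists>W g. zopen W \<and> v \<in> W \<and> g \<in> regular 0 0 W \<and> g \<noteq> (\<lambda>_. 0) \<and>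
        (\<forall>T. zopen T \<and> T \<subseteq> W \<longrightarrow> F T = {\<lambda>v. f v * g v | f. f \<in> regular 0 0 T})"
    using W g by (intro exI[of _ W] exI[of _ ?g]) simp
next
  define G where "G U f = (THE g. g \<in> regular (-a) (-b) U \<and> f = (\<lambda>v. h v * g v))" for U f
  have G: "G U (\<lambda>v. h v * g v) = g" if U: "zopen U" and g: "g \<in> regular (-a) (-b) U" for U g
    unfolding G_def
  proof (rule the_equality)
    show "g \<in> regular (-a) (-b) U \<and> (\<lambda>v. h v * g v) = (\<lambda>v. h v * g v)" using g by simp
    fix g' assume g': "g' \<in> regular (-a) (-b) U \<and> (\<lambda>v. h v * g v) = (\<lambda>v. h v * g' v)"
    have "h v * g' v = h v * g v" for v using fun_cong[OF conjunct2[OF g'], of v] by (rule sym)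
    then show "g' = g" by (rule h_cancel[OF U conjunct1[OF g'] g])
  qed
  have "o_hom (ideal_sheaf F) (Osh (-a) (-b)) G"
  proof (rule o_hom_onI)
    fix U x assume U: "zopen U" and "x \<in> secs (ideal_sheaf F) U"
    then obtain g where g: "g \<in> regular (-a) (-b) U" "x = (\<lambda>v. h v * g v)" by (auto simp: mem_F)
    show "G U x \<in> secs (Osh (-a) (-b)) U" unfolding g(2) G[OF U g(1)] using g(1) by simp
    show "G U (x \<oplus>\<^bsub>sec (ideal_sheaf F) U\<^esub> y) = G U x \<oplus>\<^bsub>sec (Osh (-a) (-b)) U\<^esub> G U y" if "y \<in> secs (ideal_sheaf F) U" for y
    proof -
      obtain k where k: "k \<in> regular (-a) (-b) U" "y = (\<lambda>v. h v * k v)" using \<open>y \<in> _\<close> by (auto simp: mem_F)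
      have "x \<oplus>\<^bsub>sec (ideal_sheaf F) U\<^esub> y = (\<lambda>v. h v * (g v + k v))" unfolding g(2) k(2) by (simp add: algebra_simps)
      then show ?thesis using G[OF U regular_add[OF g(1) k(1)]] G[OF U g(1)] G[OF U k(1)] g(2) k(2) by simp
    qed
    show "G U (f \<odot>\<^bsub>sec (ideal_sheaf F) U\<^esub> x) = f \<odot>\<^bsub>sec (Osh (-a) (-b)) U\<^esub> G U x" if f: "f \<in> regular 0 0 U" for f
    proof -
      have "f \<odot>\<^bsub>sec (ideal_sheaf F) U\<^esub> x = (\<lambda>v. h v * (f v * g v))" unfolding g(2) by (simp add: algebra_simps)
      then show ?thesis using G[OF U regular_mult0[OF f g(1)]] G[OF U g(1)] g(2) by simp
    qed
    show "G W (res (ideal_sheaf F) U W x) = res (Osh (-a) (-b)) U W (G U x)" if W: "zopen W" "W \<subseteq> U" for W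
    proof -
      have "res (ideal_sheaf F) U W x = (\<lambda>v. h v * rst W g v)" unfolding g(2) by (auto simp: rst_def)
      then show ?thesis using G[OF W(1) regular_rst[OF g(1) W]] G[OF U g(1)] g(2) by simp
    qed
  qed
  moreover have "bij_on_sections (ideal_sheaf F) (Osh (-a) (-b)) G"
    unfolding bij_on_sections_def
  proof (intro allI impI, rule bij_betw_byWitness[where f' = "\<lambda>g v. h v * g v"])
    fix U :: "'k pt set" assume U: "zopen U"
    show "\<forall>x\<in>secs (ideal_sheaf F) U. (\<lambda>v. h v * G U x v) = x" using G[OF U] by (auto simp: mem_F)
    show "\<forall>g\<in>secs (Osh (-a) (-b)) U. G U (\<lambda>v. h v * g v) = g" using G[OF U] by simp
    show "G U ` secs (ideal_sheaf F) U \<subseteq> secs (Osh (-a) (-b)) U" using G[OF U] by (auto simp: mem_F)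
    show "(\<lambda>g v. h v * g v) ` secs (Osh (-a) (-b)) U \<subseteq> secs (ideal_sheaf F) U" by (auto simp: mem_F)
  qed
  ultimately show "ideal_sheaf F \<cong>\<^sub>O (Osh (-a) (-b) :: ('k, 'k fn) osheaf)" unfolding o_iso_def by blast
qed

sublocale S: sub_presheaf "Osh 0 0 :: ('k, 'k fn) osheaf" "ideal_sheaf F"
proof -
  show "sub_presheaf (Osh 0 0 :: ('k, 'k fn) osheaf) (ideal_sheaf F)"
  proof (rule sub_presheaf.intro[OF O_module.presheaf[OF O_module_Osh] sub_presheaf_axioms.intro])
    show "secs (ideal_sheaf F) U \<subseteq> secs (Osh 0 0) U" if "zopen U" for U using F_subset[OF that] by simp
  qed (auto simp: F_zero F_add F_mult F_rst)
qed

lemma structure_sheaf_eq: "structure_sheaf F = oquotient (Osh 0 0) (ideal_sheaf F)"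
  unfolding structure_sheaf_def ..

lemma O_module_structure: "O_module (structure_sheaf F)"
  unfolding structure_sheaf_eq by (rule S.O_module_oquotient)

lemma o_hom_structure: "o_hom (Osh 0 0) (structure_sheaf F) S.proj"
  unfolding structure_sheaf_eq by (rule S.o_hom_proj)

lemma structure_surj: "zopen U \<Longrightarrow> z \<in> secs (structure_sheaf F) U \<Longrightarrow> in_image (Osh 0 0) S.proj (structure_sheaf F) U z"
  unfolding structure_sheaf_eq by (rule S.proj_surj)

lemma structure_zero_iff:
  assumes U: "zopen U" and f: "f \<in> regular 0 0 U"
  shows "S.proj U f = \<zero>\<^bsub>sec (structure_sheaf F) U\<^esub> \<longleftrightarrow> f \<in> F U"
proof -
  have "S.proj U f = \<zero>\<^bsub>sec (structure_sheaf F) U\<^esub> \<longleftrightarrow> (\<forall>v\<in>U. \<exists>W. zopen W \<and> v \<in> W \<and> W \<subseteq> U \<and> rst W f \<in> F W)"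
    unfolding structure_sheaf_eq using S.proj_zero_iff[OF U, of f] f by simp
  also have "\<dots> \<longleftrightarrow> f \<in> F U"
  proof
    assume "\<forall>v\<in>U. \<exists>W. zopen W \<and> v \<in> W \<and> W \<subseteq> U \<and> rst W f \<in> F W"
    then show "f \<in> F U" by (intro F_local[OF U f]) blast
  next
    assume "f \<in> F U"
    then show "\<forall>v\<in>U. \<exists>W. zopen W \<and> v \<in> W \<and> W \<subseteq> U \<and> rst W f \<in> F W"
      using U F_rst by blast
  qed
  finally show ?thesis .
qed

end

section \<open>The two cases\<close>

lemma o_hom_comp:
  assumes F: "o_hom M N F" and G: "o_hom N P G" shows "o_hom M P (\<lambda>U x. G U (F U x))"
proof (rule o_hom_onI)
  fix U x assume U: "zopen U" and x: "x \<in> secs M U"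
  note Fx = o_hom_closed[OF F U x]
  show "G U (F U x) \<in> secs P U" by (rule o_hom_closed[OF G U Fx])
  show "G U (F U (x \<oplus>\<^bsub>sec M U\<^esub> y)) = G U (F U x) \<oplus>\<^bsub>sec P U\<^esub> G U (F U y)" if y: "y \<in> secs M U" for y
    unfolding o_hom_add[OF F U x y] by (rule o_hom_add[OF G U Fx o_hom_closed[OF F U y]])
  show "G U (F U (f \<odot>\<^bsub>sec M U\<^esub> x)) = f \<odot>\<^bsub>sec P U\<^esub> G U (F U x)" if f: "f \<in> regular 0 0 U" for f
    unfolding o_hom_smult[OF F U f x] by (rule o_hom_smult[OF G U f Fx])
  show "G W (F W (res M U W x)) = res P U W (G U (F U x))" if W: "zopen W" "W \<subseteq> U" for W
    unfolding o_hom_res[OF F U W x] by (rule o_hom_res[OF G U W Fx])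
qed

lemma iso_inverse:
  assumes M: "presheaf M" and F: "o_hom M N F" and bij: "bij_on_sections M N F"
  obtains G where "o_hom N M G" "\<And>U x. zopen U \<Longrightarrow> x \<in> secs M U \<Longrightarrow> G U (F U x) = x"
    "\<And>U y. zopen U \<Longrightarrow> y \<in> secs N U \<Longrightarrow> F U (G U y) = y"
proof -
  interpret M: presheaf M by (rule M)
  define G where "G U = inv_into (secs M U) (F U)" for U
  have b: "bij_betw (F U) (secs M U) (secs N U)" if "zopen U" for U
    by (rule bij[unfolded bij_on_sections_def, THEN spec, THEN mp, OF that])
  have GF: "G U (F U x) = x" if "zopen U" "x \<in> secs M U" for U x
    unfolding G_def by (rule bij_betw_inv_into_left[OF b[OF that(1)] that(2)])
  have FG: "F U (G U y) = y" if "zopen U" "y \<in> secs N U" for U y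
    unfolding G_def by (rule bij_betw_inv_into_right[OF b[OF that(1)] that(2)])
  have cl: "G U y \<in> secs M U" if "zopen U" "y \<in> secs N U" for U y
    unfolding G_def using bij_betw_imp_surj_on[OF b[OF that(1)]] that(2) by (auto intro: inv_into_into)
  have "o_hom N M G"
  proof (rule o_hom_onI)
    fix U y assume U: "zopen U" and y: "y \<in> secs N U"
    show "G U y \<in> secs M U" by (rule cl[OF U y])
    show "G U (y \<oplus>\<^bsub>sec N U\<^esub> z) = G U y \<oplus>\<^bsub>sec M U\<^esub> G U z" if z: "z \<in> secs N U" for z
      using GF[OF U M.add_closed[OF U cl[OF U y] cl[OF U z]]] o_hom_add[OF F U cl[OF U y] cl[OF U z]] FG[OF U y] FG[OF U z] by simp
    show "G U (f \<odot>\<^bsub>sec N U\<^esub> y) = f \<odot>\<^bsub>sec M U\<^esub> G U y" if f: "f \<in> regular 0 0 U" for f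
      using GF[OF U M.smult_closed[OF U f cl[OF U y]]] o_hom_smult[OF F U f cl[OF U y]] FG[OF U y] by simp
    show "G W (res N U W y) = res M U W (G U y)" if W: "zopen W" "W \<subseteq> U" for W
      using GF[OF W(1) M.res_closed[OF U W cl[OF U y]]] o_hom_res[OF F U W cl[OF U y]] FG[OF U y] by simp
  qed
  then show thesis using that GF FG by blast
qed

lemma o_hom_fst: "o_hom (osum M N) M (\<lambda>U. fst)" and o_hom_snd: "o_hom (osum M N) N (\<lambda>U. snd)"
  by (auto intro!: o_hom_onI)

lemma o_hom_inl:
  assumes "presheaf N" shows "o_hom M (osum M N) (\<lambda>U x. (x, \<zero>\<^bsub>sec N U\<^esub>))"
proof (rule o_hom_onI)
  interpret N: presheaf N by (rule assms)
  fix U x assume U: "zopen U" and x: "x \<in> secs M U"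
  interpret A: module "oring U" "sec N U" using N.sec_module[OF U] .
  show "(x, \<zero>\<^bsub>sec N U\<^esub>) \<in> secs (osum M N) U" using x by simp
  show "(f \<odot>\<^bsub>sec M U\<^esub> x, \<zero>\<^bsub>sec N U\<^esub>) = f \<odot>\<^bsub>sec (osum M N) U\<^esub> (x, \<zero>\<^bsub>sec N U\<^esub>)" if "f \<in> regular 0 0 U" for f
    using A.smult_r_null[of f] that by simp
  show "(x \<oplus>\<^bsub>sec M U\<^esub> y, \<zero>\<^bsub>sec N U\<^esub>) = (x, \<zero>\<^bsub>sec N U\<^esub>) \<oplus>\<^bsub>sec (osum M N) U\<^esub> (y, \<zero>\<^bsub>sec N U\<^esub>)" if "y \<in> secs M U" for y
    by simp
  show "(res M U W x, \<zero>\<^bsub>sec N W\<^esub>) = res (osum M N) U W (x, \<zero>\<^bsub>sec N U\<^esub>)" if "zopen W" "W \<subseteq> U" for W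
    using N.res_zero[OF U that] by simp
qed

lemma o_hom_inr:
  assumes "presheaf M" shows "o_hom N (osum M N) (\<lambda>U x. (\<zero>\<^bsub>sec M U\<^esub>, x))"
proof (rule o_hom_onI)
  interpret M: presheaf M by (rule assms)
  fix U x assume U: "zopen U" and x: "x \<in> secs N U"
  interpret A: module "oring U" "sec M U" using M.sec_module[OF U] .
  show "(\<zero>\<^bsub>sec M U\<^esub>, x) \<in> secs (osum M N) U" using x by simp
  show "(\<zero>\<^bsub>sec M U\<^esub>, f \<odot>\<^bsub>sec N U\<^esub> x) = f \<odot>\<^bsub>sec (osum M N) U\<^esub> (\<zero>\<^bsub>sec M U\<^esub>, x)" if "f \<in> regular 0 0 U" for f
    using A.smult_r_null[of f] that by simp
  show "(\<zero>\<^bsub>sec M U\<^esub>, x \<oplus>\<^bsub>sec N U\<^esub> y) = (\<zero>\<^bsub>sec M U\<^esub>, x) \<oplus>\<^bsub>sec (osum M N) U\<^esub> (\<zero>\<^bsub>sec M U\<^esub>, y)" if "y \<in> secs N U" for y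
    by simp
  show "(\<zero>\<^bsub>sec M W\<^esub>, res N U W x) = res (osum M N) U W (\<zero>\<^bsub>sec M U\<^esub>, x)" if "zopen W" "W \<subseteq> U" for W
    using M.res_zero[OF U that] by simp
qed

lemma o_hom_Aalg: "o_hom M (Aalg \<phi>) F \<longleftrightarrow> o_hom M (osum (Osh 0 0) Lbd) F"
  unfolding o_hom_on_def Aalg_simps ..

lemma o_hom_A_tensor:
  "o_hom M (A_tensor \<phi> N) F \<longleftrightarrow> o_hom M (osum N (Lsig_tensor N)) F"
  "o_hom (A_tensor \<phi> N) M G \<longleftrightarrow> o_hom (osum N (Lsig_tensor N)) M G"
  unfolding o_hom_on_def A_tensor_simps by (rule refl)+

text \<open>
  The two components of a homomorphism from \<open>O(a, b)\<close> to \<open>A = O \<oplus> L\<close> are multiplications by global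
  sections.
\<close>

lemma o_hom_Osh_Aalg:
  fixes G :: "'k::{alg_closed_field, field_char_0} pt set \<Rightarrow> 'k fn \<Rightarrow> 'k fn \<times> 'k fn"
  assumes G: "o_hom (Osh a b) (Aalg \<phi>) G"
  obtains s c where "s \<in> regular (- a) (- b) ycone" "c \<in> regular (- a - 1) (- b - 1) ycone"
    "\<And>U n. zopen U \<Longrightarrow> n \<in> regular a b U \<Longrightarrow> G U n = (\<lambda>v. s v * n v, \<lambda>v. c v * n v)"
proof -
  have G': "o_hom (Osh a b) (osum (Osh 0 0) Lbd) G" using G unfolding o_hom_Aalg .
  obtain s where s: "s \<in> regular (0 - a) (0 - b) ycone" "\<And>U n. zopen U \<Longrightarrow> n \<in> regular a b U \<Longrightarrow> fst (G U n) = (\<lambda>v. s v * n v)"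
    by (rule o_hom_Osh[OF o_hom_comp[OF G' o_hom_fst]]) blast
  obtain c where c: "c \<in> regular (- 1 - a) (- 1 - b) ycone" "\<And>U n. zopen U \<Longrightarrow> n \<in> regular a b U \<Longrightarrow> snd (G U n) = (\<lambda>v. c v * n v)"
    by (rule o_hom_Osh[OF o_hom_comp[OF G' o_hom_snd]]) blast
  have eq: "- 1 - a = - a - 1" "- 1 - b = - b - 1" "0 - a = - a" "0 - b = - b" by auto
  show thesis
  proof (rule that)
    show "s \<in> regular (- a) (- b) ycone" "c \<in> regular (- a - 1) (- b - 1) ycone"
      by (rule s(1)[unfolded eq] c(1)[unfolded eq])+
    show "G U n = (\<lambda>v. s v * n v, \<lambda>v. c v * n v)" if "zopen U" "n \<in> regular a b U" for U n
      using s(2)[OF that] c(2)[OF that] by (simp add: prod_eq_iff)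
  qed
qed

subsection \<open>Induced modules\<close>

text \<open>
  The homomorphism \<open>A \<rightarrow> A \<otimes> O_F\<close>, \<open>f + l \<mapsto> f + l \<otimes> 1\<close>, where \<open>F\<close> is the divisor of zeros of \<open>h\<close>.
  It is surjective, and its kernel is generated by \<open>h O(-a, -b)\<close> as a left ideal.
\<close>

locale induced_quotient = mult_form \<phi> r + divisor_form a b h
  for \<phi> :: "'k::{alg_closed_field, field_char_0} phi_map" and r and a b :: int and h :: "'k fn"
begin

abbreviation "O\<^sub>F \<equiv> structure_sheaf F"

sublocale I: induced \<phi> r O\<^sub>F
proof -
  show "induced \<phi> r O\<^sub>F" unfolding induced_def Lsig_def using mult_form_axioms O_module_structure by blast
qed

definition one :: "'k pt set \<Rightarrow> ('k, 'k fn set) shf" where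
  "one V = S.proj V (rst V (\<lambda>_. 1))"

definition quo where "quo U y = (S.proj U (fst y), I.pure U (snd y) (one (sig U)))"

lemma one_closed: "zopen V \<Longrightarrow> one V \<in> secs O\<^sub>F V"
  unfolding one_def using o_hom_closed[OF o_hom_structure, of V] regular_const[of V] by simp

lemma one_res: "zopen V \<Longrightarrow> zopen W \<Longrightarrow> W \<subseteq> V \<Longrightarrow> res O\<^sub>F V W (one V) = one W"
  unfolding one_def using o_hom_res[OF o_hom_structure, of V W "rst V (\<lambda>_. 1)"] regular_const[of V] by simp

lemma smult_one: "zopen V \<Longrightarrow> g \<in> regular 0 0 V \<Longrightarrow> g \<odot>\<^bsub>sec O\<^sub>F V\<^esub> one V = S.proj V g"
  unfolding one_def using o_hom_smult[OF o_hom_structure, of V g "rst V (\<lambda>_. 1)"] regular_const[of V] mult_rst_one[of g 0 0 V]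
  by simp

lemma pure_one:
  assumes U: "zopen U" and e: "e \<in> Lsec U" and g: "g \<in> regular 0 0 (sig U)"
  shows "I.pure U (\<lambda>v. e v * g (prod.swap v)) (one (sig U)) = I.pure U e (S.proj (sig U) g)"
proof -
  have sU: "zopen (sig U)" using U by simp
  have "I.pure U (\<lambda>v. sigf g v * e v) (one (sig U)) = I.pure U e (sigf (sigf g) \<odot>\<^bsub>sec O\<^sub>F (sig U)\<^esub> one (sig U))"
    by (rule I.pure_balanced[OF U sigf_regular'[OF g] e one_closed[OF sU]])
  then show ?thesis unfolding sigf_sigf smult_one[OF sU g] by (simp add: mult.commute)
qed

lemma O_module_A_tensor: "O_module (A_tensor \<phi> O\<^sub>F)"
  by (rule O_module_cong[OF _ _ O_module_osum[OF O_module_structure I.LN.O_module_axioms]]) simp_all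

lemma a_hom_quo: "a_hom (Aalg \<phi>) (A_tensor \<phi> O\<^sub>F) quo"
  unfolding a_hom_on_def
proof (intro conjI allI impI ballI)
  show "o_hom (Aalg \<phi>) (A_tensor \<phi> O\<^sub>F) quo" unfolding o_hom_A_tensor
  proof (rule o_hom_onI)
    note p = o_hom_structure
    fix U y assume U: "zopen U" and "y \<in> secs (Aalg \<phi>) U"
    then obtain f l where y: "y = (f, l)" "f \<in> regular 0 0 U" "l \<in> Lsec U" by auto
    have sU: "zopen (sig U)" using U by simp
    note o1 = one_closed[OF sU]
    have pf: "S.proj U f \<in> secs O\<^sub>F U" using o_hom_closed[OF p U, of f] y(2) by simp
    show "quo U y \<in> secs (osum O\<^sub>F I.LN) U"
      unfolding quo_def y(1) using pf I.pure_closed[OF U y(3) o1] by simp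
    show "quo U (y \<oplus>\<^bsub>sec (Aalg \<phi>) U\<^esub> y') = quo U y \<oplus>\<^bsub>sec (osum O\<^sub>F I.LN) U\<^esub> quo U y'" if "y' \<in> secs (Aalg \<phi>) U" for y'
    proof -
      obtain f' l' where y': "y' = (f', l')" "f' \<in> regular 0 0 U" "l' \<in> Lsec U" using \<open>y' \<in> _\<close> by auto
      show ?thesis unfolding quo_def y(1) y'(1)
        using o_hom_add[OF p U, of f f'] y(2) y'(2) I.pure_add_left[OF U y(3) y'(3) o1] by simp
    qed
    show "quo U (g \<odot>\<^bsub>sec (Aalg \<phi>) U\<^esub> y) = g \<odot>\<^bsub>sec (osum O\<^sub>F I.LN) U\<^esub> quo U y" if g: "g \<in> regular 0 0 U" for g
      unfolding quo_def y(1) using o_hom_smult[OF p U g, of f] y(2) I.pure_smult[OF U g y(3) o1] by simp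
    show "quo W (res (Aalg \<phi>) U W y) = res (osum O\<^sub>F I.LN) U W (quo U y)" if W: "zopen W" "W \<subseteq> U" for W
    proof -
      have sW: "zopen (sig W)" "sig W \<subseteq> sig U" using W by auto
      show ?thesis unfolding quo_def y(1)
        using o_hom_res[OF p U W, of f] y(2) I.pure_res[OF U W y(3) o1] one_res[OF sU sW] by simp
    qed
  qed
  fix U :: "'k pt set" and l y assume "zopen U \<and> U \<subseteq> ycone" and l: "l \<in> Lsec U" and "y \<in> secs (Aalg \<phi>) (sig U)"
  then have U: "zopen U" and sU: "zopen (sig U)" by auto
  obtain f k where y: "y = (f, k)" "f \<in> regular 0 0 (sig U)" "k \<in> Lsec (sig U)" using \<open>y \<in> _\<close> by auto
  note o1 = one_closed[OF U]
  have "contract \<phi> O\<^sub>F U l (I.pure (sig U) k (one U)) = S.proj U (lmul l k)"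
    using I.contract_pure[OF U l y(3) o1] smult_one[OF U lmul_regular[OF U l y(3)]] by simp
  moreover have "I.pure U (\<lambda>v. l v * f (prod.swap v)) (one (sig U)) = I.pure U l (S.proj (sig U) f)"
    by (rule pure_one[OF U l y(2)])
  ultimately show "quo U (lact (Aalg \<phi>) U l y) = lact (A_tensor \<phi> O\<^sub>F) U l (quo (sig U) y)"
    unfolding quo_def y(1) A_lact[OF U l y(3)] by simp
qed

text \<open>
  The sections of \<open>O_F\<close> are locally induced by functions, and those of \<open>L_\<sigma> \<otimes> O_F\<close> are locally of
  the form \<open>e \<otimes> g = e \<sigma>(g) \<otimes> 1\<close>.
\<close>

lemma quo_surj:
  assumes U: "zopen U" and z: "z \<in> secs (A_tensor \<phi> O\<^sub>F) U" shows "in_image (Aalg \<phi>) quo (A_tensor \<phi> O\<^sub>F) U z"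
  unfolding in_image_def
proof
  note p = o_hom_structure
  fix v assume v: "v \<in> U"
  obtain s x where z': "z = (s, x)" "s \<in> secs O\<^sub>F U" "x \<in> secs I.LN U" using z by auto
  obtain V f where V: "zopen V" "v \<in> V" "V \<subseteq> U" "f \<in> secs (Osh 0 0) V" "res O\<^sub>F U V s = S.proj V f"
    by (rule in_imageE[OF structure_surj[OF U z'(2)] v]) blast
  obtain W e n where W: "zopen W" "v \<in> W" "W \<subseteq> U" "e \<in> Lsec W" "n \<in> secs O\<^sub>F (sig W)" "res I.LN U W x = I.pure W e n"
    by (rule I.pure_local[OF U z'(3) v]) blast
  have sW: "zopen (sig W)" "prod.swap v \<in> sig W" using W by auto
  obtain T g where T: "zopen T" "prod.swap v \<in> T" "T \<subseteq> sig W" "g \<in> secs (Osh 0 0) T" "res O\<^sub>F (sig W) T n = S.proj T g"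
    by (rule in_imageE[OF structure_surj[OF sW(1) W(5)] sW(2)]) blast
  let ?X = "V \<inter> sig T"
  have X: "zopen ?X" "v \<in> ?X" "?X \<subseteq> V" "?X \<subseteq> W" "?X \<subseteq> U" using V T W zopen_Int[OF V(1), of "sig T"] by auto
  have sX: "zopen (sig ?X)" "sig ?X \<subseteq> T" "sig ?X \<subseteq> sig W" using zopen_sig[OF X(1)] T by auto
  have fX: "rst ?X f \<in> regular 0 0 ?X" using regular_rst[of f 0 0 V ?X] V(4) X by simp
  have eX: "rst ?X e \<in> Lsec ?X" by (rule regular_rst[OF W(4) X(1,4)])
  have gX: "rst (sig ?X) g \<in> regular 0 0 (sig ?X)" using regular_rst[of g 0 0 T "sig ?X"] T(4) sX by simp
  let ?l = "\<lambda>v. rst ?X e v * rst (sig ?X) g (prod.swap v)"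
  have "res O\<^sub>F U ?X s = S.proj ?X (rst ?X f)"
    using I.N.res_res[OF U V(1) X(1,3) V(3) z'(2)] V(5) o_hom_res[OF p V(1) X(1,3) V(4)] by simp
  moreover have "res I.LN U ?X x = I.pure ?X ?l (one (sig ?X))"
  proof -
    have "res I.LN U ?X x = res I.LN W ?X (I.pure W e n)"
      using I.LN.res_res[OF U W(1) X(1,4) W(3) z'(3)] W(6) by simp
    also have "\<dots> = I.pure ?X (rst ?X e) (res O\<^sub>F (sig W) (sig ?X) n)" by (rule I.pure_res[OF W(1) X(1,4) W(4,5)])
    also have "res O\<^sub>F (sig W) (sig ?X) n = S.proj (sig ?X) (rst (sig ?X) g)"
      using I.N.res_res[OF sW(1) T(1) sX(1,2) T(3) W(5)] T(5) o_hom_res[OF p T(1) sX(1,2) T(4)] by simp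
    finally show ?thesis using pure_one[OF X(1) eX gX] by simp
  qed
  ultimately have "res (A_tensor \<phi> O\<^sub>F) U ?X z = quo ?X (rst ?X f, ?l)" unfolding z'(1) quo_def by simp
  moreover have "(rst ?X f, ?l) \<in> secs (Aalg \<phi>) ?X" using fX lsig_regular[OF eX gX] by simp
  ultimately show "\<exists>W. zopen W \<and> v \<in> W \<and> W \<subseteq> U \<and> res (A_tensor \<phi> O\<^sub>F) U W z \<in> quo W ` secs (Aalg \<phi>) W"
    using X(1,2,5) by blast
qed

text \<open>
  A product of \<open>e\<close> and a section of \<open>\<sigma>\<^sup>*O(-F)\<close> is killed, since \<open>e \<sigma>(g) \<otimes> 1 = e \<otimes> g\<close>.
\<close>

lemma quo_kernel_local:
  assumes U: "zopen U" and n: "n \<in> regular (-a) (-b) U" and e: "e \<in> Lsec U" and n': "n' \<in> regular (-a) (-b) (sig U)"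
  shows "quo U (\<lambda>v. h v * n v, \<lambda>v. e v * (h (prod.swap v) * n' (prod.swap v))) = \<zero>\<^bsub>sec (A_tensor \<phi> O\<^sub>F) U\<^esub>"
proof -
  have sU: "zopen (sig U)" using U by simp
  have "(\<lambda>v. h v * n v) \<in> F U" "(\<lambda>v. h v * n' v) \<in> F (sig U)" using n n' unfolding mem_F by blast+
  then have z: "S.proj U (\<lambda>v. h v * n v) = \<zero>\<^bsub>sec O\<^sub>F U\<^esub>" "S.proj (sig U) (\<lambda>v. h v * n' v) = \<zero>\<^bsub>sec O\<^sub>F (sig U)\<^esub>"
    and g: "(\<lambda>v. h v * n' v) \<in> regular 0 0 (sig U)"
    using structure_zero_iff[OF U] structure_zero_iff[OF sU] F_subset[OF U] F_subset[OF sU] by blast+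
  show ?thesis unfolding quo_def using pure_one[OF U e g] z I.pure_zero_right[OF U e] by simp
qed

text \<open>
  Conversely, write a local section \<open>l\<close> of \<open>L\<close> as \<open>e \<sigma>(g)\<close> with a generator \<open>e\<close>. If
  \<open>l \<otimes> 1 = e \<otimes> g\<close> is zero, then so is the class of \<open>g\<close> in \<open>O_F\<close>, that is, \<open>g\<close> is divisible by \<open>h\<close>.
\<close>

lemma quo_kernel_localD:
  assumes U: "zopen U" and y: "y \<in> secs (Aalg \<phi>) U" and z: "quo U y = \<zero>\<^bsub>sec (A_tensor \<phi> O\<^sub>F) U\<^esub>" and v: "v \<in> U"
  obtains W n e n' where "zopen W" "v \<in> W" "W \<subseteq> U" "n \<in> regular (-a) (-b) W" "e \<in> Lsec W" "n' \<in> regular (-a) (-b) (sig W)"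
    "res (Aalg \<phi>) U W y = (\<lambda>v. h v * n v, \<lambda>v. e v * (h (prod.swap v) * n' (prod.swap v)))"
proof -
  obtain f l where y': "y = (f, l)" "f \<in> regular 0 0 U" "l \<in> Lsec U" using y by auto
  have sU: "zopen (sig U)" using U by simp
  have "S.proj U f = \<zero>\<^bsub>sec O\<^sub>F U\<^esub>" and pl: "I.pure U l (one (sig U)) = \<zero>\<^bsub>sec I.LN U\<^esub>"
    using z unfolding quo_def y'(1) by auto
  then have "f \<in> F U" using structure_zero_iff[OF U y'(2)] by blast
  then obtain n where n: "n \<in> regular (-a) (-b) U" "f = (\<lambda>v. h v * n v)" unfolding mem_F by blast
  obtain W e where W: "zopen W" "v \<in> W" "W \<subseteq> U" "e \<in> Lsec W" "\<And>w. w \<in> W \<Longrightarrow> e w \<noteq> 0"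
    using local_unit[OF U v, of "-1" "-1"] by metis
  have sW: "zopen (sig W)" "sig W \<subseteq> sig U" using W by auto
  have lW: "rst W l \<in> Lsec W" by (rule regular_rst[OF y'(3) W(1,3)])
  let ?q = "\<lambda>v. rst W l v * inverse (e v)"
  note q = regular_divide[OF lW W(4,5)]
  have sq: "sigf ?q \<in> regular 0 0 (sig W)" by (rule sigf_regular[OF q(1)])
  have "I.pure W (rst W l) (one (sig W)) = \<zero>\<^bsub>sec I.LN W\<^esub>"
    using I.pure_res[OF U W(1,3) y'(3) one_closed[OF sU]] one_res[OF sU sW] pl I.LN.pre.res_zero[OF U W(1,3)] by simp
  moreover have "I.pure W (rst W l) (one (sig W)) = I.pure W e (sigf ?q \<odot>\<^bsub>sec O\<^sub>F (sig W)\<^esub> one (sig W))"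
    by (rule I.pure_divide[OF W(1) lW one_closed[OF sW(1)] W(4,5)])
  ultimately have "I.pure W e (S.proj (sig W) (sigf ?q)) = I.pure W e \<zero>\<^bsub>sec O\<^sub>F (sig W)\<^esub>"
    using smult_one[OF sW(1) sq] I.pure_zero_right[OF W(1,4)] by simp
  moreover have "S.proj (sig W) (sigf ?q) \<in> secs O\<^sub>F (sig W)" using o_hom_closed[OF o_hom_structure sW(1)] sq by simp
  ultimately have "S.proj (sig W) (sigf ?q) = \<zero>\<^bsub>sec O\<^sub>F (sig W)\<^esub>"
    using I.pure_inj[OF W(1,4,5) _ I.N.pre.zero_closed[OF sW(1)]] by blast
  then have "sigf ?q \<in> F (sig W)" using structure_zero_iff[OF sW(1) sq] by blast
  then obtain n' where n': "n' \<in> regular (-a) (-b) (sig W)" "sigf ?q = (\<lambda>v. h v * n' v)" unfolding mem_F by blast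
  have "rst W l v = e v * (h (prod.swap v) * n' (prod.swap v))" for v
  proof -
    have "?q v = h (prod.swap v) * n' (prod.swap v)" using fun_cong[OF n'(2), of "prod.swap v"] by simp
    moreover have "?q v * e v = rst W l v" using fun_cong[OF q(2), of v] .
    ultimately show ?thesis by (simp add: mult.commute)
  qed
  then have "rst W l = (\<lambda>v. e v * (h (prod.swap v) * n' (prod.swap v)))" by (rule ext)
  moreover have "rst W f = (\<lambda>v. h v * rst W n v)" unfolding n(2) by (auto simp: rst_def)
  ultimately have "res (Aalg \<phi>) U W y = (\<lambda>v. h v * rst W n v, \<lambda>v. e v * (h (prod.swap v) * n' (prod.swap v)))"
    unfolding y'(1) by simp
  then show thesis by (rule that[OF W(1-3) regular_rst[OF n(1) W(1,3)] W(4) n'(1)])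
qed

end

text \<open>
  A homomorphism from \<open>A \<otimes> O(-a, -b)\<close> to \<open>A\<close> is determined by its restriction to \<open>O(-a, -b)\<close>. The
  component of this restriction in \<open>L\<close> is a section of \<open>O(a - 1, b - 1)\<close> and vanishes by
  assumption; the other component is multiplication by a section \<open>h\<close> of \<open>O(a, b)\<close>. Thus the image
  is the left ideal generated by \<open>h O(-a, -b)\<close>, which is the kernel of \<open>A \<rightarrow> A \<otimes> O_F\<close>.
\<close>

lemma (in mult_form) cokernel_of_induced:
  fixes M :: "('k, 'm) amod"
  assumes M: "A_module M \<phi>" and \<psi>: "a_hom M (Aalg \<phi>) \<psi>"
    and nz: "zopen U0" "x0 \<in> secs M U0" "\<psi> U0 x0 \<noteq> \<zero>\<^bsub>sec (Aalg \<phi>) U0\<^esub>"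
    and vanish: "\<And>g :: 'k fn. g \<in> regular (a - 1) (b - 1) ycone \<Longrightarrow> g = (\<lambda>_. 0)"
    and iso: "M \<cong>\<^sub>A A_tensor \<phi> (Osh (-a) (-b))"
    and Q: "A_module Q \<phi>" and \<rho>: "a_hom (Aalg \<phi>) Q \<rho>" and surj: "\<And>U z. zopen U \<Longrightarrow> z \<in> secs Q U \<Longrightarrow> in_image (Aalg \<phi>) \<rho> Q U z"
    and ker: "\<And>U y. zopen U \<Longrightarrow> y \<in> secs (Aalg \<phi>) U \<Longrightarrow> \<rho> U y = \<zero>\<^bsub>sec Q U\<^esub> \<longleftrightarrow> in_image M \<psi> (Aalg \<phi>) U y"
  shows "\<exists>F. is_divisor a b F \<and> Q \<cong>\<^sub>A A_tensor \<phi> (structure_sheaf F)"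
proof -
  let ?A = "Aalg \<phi>" and ?N = "Osh (-a) (-b) :: ('k, 'k fn) osheaf"
  let ?T = "A_tensor \<phi> ?N"
  interpret M: A_module M \<phi> by (rule M)
  interpret A: A_module ?A \<phi> by (rule A_module_Aalg)
  interpret I: induced \<phi> r ?N unfolding induced_def Lsig_def using mult_form_axioms O_module_Osh by blast
  have \<psi>o: "o_hom M ?A \<psi>" using \<psi> unfolding a_hom_on_def by blast
  have \<psi>l: "\<psi> U (lact M U l m) = lact ?A U l (\<psi> (sig U) m)" if "zopen U" "l \<in> Lsec U" "m \<in> secs M (sig U)" for U l m
    using \<psi> that zopen_subset[OF that(1)] unfolding a_hom_on_def by blast
  obtain \<theta> where \<theta>: "a_hom M ?T \<theta>" and bij: "bij_on_sections M ?T \<theta>" using iso unfolding a_iso_def by blast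
  have \<theta>o: "o_hom M ?T \<theta>" using \<theta> unfolding a_hom_on_def by blast
  have \<theta>l: "\<theta> U (lact M U l m) = lact ?T U l (\<theta> (sig U) m)" if "zopen U" "l \<in> Lsec U" "m \<in> secs M (sig U)" for U l m
    using \<theta> that zopen_subset[OF that(1)] unfolding a_hom_on_def by blast
  obtain \<eta> where \<eta>: "o_hom ?T M \<eta>" "\<And>U x. zopen U \<Longrightarrow> x \<in> secs M U \<Longrightarrow> \<eta> U (\<theta> U x) = x"
    "\<And>U y. zopen U \<Longrightarrow> y \<in> secs ?T U \<Longrightarrow> \<theta> U (\<eta> U y) = y"
    by (rule iso_inverse[OF M.presheaf \<theta>o bij]) blast
  have \<eta>l: "\<eta> U (lact ?T U l t) = lact M U l (\<eta> (sig U) t)" if "zopen U" "l \<in> Lsec U" "t \<in> secs ?T (sig U)" for U l t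
  proof -
    have sU: "zopen (sig U)" using that by simp
    have c: "\<eta> (sig U) t \<in> secs M (sig U)" by (rule o_hom_closed[OF \<eta>(1) sU that(3)])
    have "lact ?T U l t = \<theta> U (lact M U l (\<eta> (sig U) t))"
      using \<theta>l[OF that(1,2) c] \<eta>(3)[OF sU that(3)] by simp
    then show ?thesis using \<eta>(2)[OF that(1) M.lact_closed[OF that(1,2) c]] by simp
  qed
  have inl: "o_hom ?N ?T (\<lambda>U n. (n, \<zero>\<^bsub>sec I.LN U\<^esub>))"
    unfolding o_hom_A_tensor by (rule o_hom_inl[OF I.LN.presheaf])
  have hom: "o_hom ?N ?A (\<lambda>U n. \<psi> U (\<eta> U (n, \<zero>\<^bsub>sec I.LN U\<^esub>)))"
    by (rule o_hom_comp[OF o_hom_comp[OF inl \<eta>(1)] \<psi>o])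
  obtain h c where hc: "h \<in> regular (- (- a)) (- (- b)) ycone" "c \<in> regular (- (- a) - 1) (- (- b) - 1) ycone"
    "\<And>U n. zopen U \<Longrightarrow> n \<in> regular (-a) (-b) U \<Longrightarrow> \<psi> U (\<eta> U (n, \<zero>\<^bsub>sec I.LN U\<^esub>)) = (\<lambda>v. h v * n v, \<lambda>v. c v * n v)"
    by (rule o_hom_Osh_Aalg[OF hom]) blast
  have h: "h \<in> regular a b ycone" using hc(1) by simp
  have c0: "c = (\<lambda>_. 0)" using vanish[of c] hc(2) by simp
  have left: "\<psi> U (\<eta> U (n, \<zero>\<^bsub>sec I.LN U\<^esub>)) = (\<lambda>v. h v * n v, \<lambda>_. 0)" if "zopen U" "n \<in> regular (-a) (-b) U" for U n
    using hc(3)[OF that] unfolding c0 by simp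
  have val: "\<psi> U (\<eta> U (n, I.pure U e n')) = (\<lambda>v. h v * n v, \<lambda>v. e v * (h (prod.swap v) * n' (prod.swap v)))"
    if U: "zopen U" and n: "n \<in> regular (-a) (-b) U" and e: "e \<in> Lsec U" and n': "n' \<in> regular (-a) (-b) (sig U)" for U n e n'
  proof -
    have sU: "zopen (sig U)" using U by simp
    interpret L: abelian_group "sec I.LN U" using I.LN.pre.ab[OF U] .
    let ?z = "\<zero>\<^bsub>sec I.LN U\<^esub>" and ?x = "I.pure U e n'"
    have t: "(n', \<zero>\<^bsub>sec I.LN (sig U)\<^esub>) \<in> secs ?T (sig U)" using n' I.LN.pre.zero_closed[OF sU] by simp
    have px: "?x \<in> secs I.LN U" using I.pure_closed[OF U e] n' by simp
    have la: "lact ?T U e (n', \<zero>\<^bsub>sec I.LN (sig U)\<^esub>) = (\<lambda>_. 0, ?x)" using I.contract_zero[OF U e] by simp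
    have "\<psi> U (\<eta> U (\<lambda>_. 0, ?x)) = \<psi> U (lact M U e (\<eta> (sig U) (n', \<zero>\<^bsub>sec I.LN (sig U)\<^esub>)))"
      using \<eta>l[OF U e t] la by simp
    also have "\<dots> = lact ?A U e (\<lambda>v. h v * n' v, \<lambda>_. 0)"
      using \<psi>l[OF U e o_hom_closed[OF \<eta>(1) sU t]] left[OF sU n'] by simp
    also have "\<dots> = (\<lambda>_. 0, \<lambda>v. e v * (h (prod.swap v) * n' (prod.swap v)))"
      using A_lact[OF U e regular_0[OF sU]] by (simp add: lmul_def)
    finally have right: "\<psi> U (\<eta> U (\<lambda>_. 0, ?x)) = (\<lambda>_. 0, \<lambda>v. e v * (h (prod.swap v) * n' (prod.swap v)))" .
    have s1: "(n, ?z) \<in> secs ?T U" and s2: "(\<lambda>_. 0, ?x) \<in> secs ?T U"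
      using n px regular_0[OF U] by auto
    have "(n, ?x) = (n, ?z) \<oplus>\<^bsub>sec ?T U\<^esub> (\<lambda>_. 0, ?x)" using px by simp
    then show ?thesis
      using o_hom_add[OF o_hom_comp[OF \<eta>(1) \<psi>o] U s1 s2] left[OF U n] right by simp
  qed
  have local_form: "\<exists>W n e n'. zopen W \<and> v \<in> W \<and> W \<subseteq> U \<and> n \<in> regular (-a) (-b) W \<and> e \<in> Lsec W \<and> n' \<in> regular (-a) (-b) (sig W) \<and>
      res ?A U W (\<psi> U x) = (\<lambda>v. h v * n v, \<lambda>v. e v * (h (prod.swap v) * n' (prod.swap v)))"
    if U: "zopen U" and x: "x \<in> secs M U" and v: "v \<in> U" for U x v
  proof -
    have "\<theta> U x \<in> secs ?T U" by (rule o_hom_closed[OF \<theta>o U x])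
    then obtain n X where nX: "\<theta> U x = (n, X)" "n \<in> regular (-a) (-b) U" "X \<in> secs I.LN U" by auto
    obtain W e n' where W: "zopen W" "v \<in> W" "W \<subseteq> U" "e \<in> Lsec W" "n' \<in> secs ?N (sig W)" "res I.LN U W X = I.pure W e n'"
      by (rule I.pure_local[OF U nX(3) v]) blast
    have "res ?A U W (\<psi> U x) = \<psi> W (\<eta> W (\<theta> W (res M U W x)))"
      using o_hom_res[OF \<psi>o U W(1,3) x] \<eta>(2)[OF W(1) M.res_closed[OF U W(1,3) x]] by simp
    also have "\<theta> W (res M U W x) = (rst W n, I.pure W e n')"
      using o_hom_res[OF \<theta>o U W(1,3) x] nX(1) W(6) by simp
    also have "\<psi> W (\<eta> W (rst W n, I.pure W e n')) = (\<lambda>v. h v * rst W n v, \<lambda>v. e v * (h (prod.swap v) * n' (prod.swap v)))"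
      by (rule val[OF W(1) regular_rst[OF nX(2) W(1,3)] W(4)]) (use W(5) in simp)
    finally show ?thesis using W regular_rst[OF nX(2) W(1,3)] by (simp del: Aalg_simps) blast
  qed
  have "h \<noteq> (\<lambda>_. 0)"
  proof
    assume h0: "h = (\<lambda>_. 0)"
    have "\<psi> U0 x0 = \<zero>\<^bsub>sec ?A U0\<^esub>"
    proof (rule A.eq_locally[OF nz(1) o_hom_closed[OF \<psi>o nz(1,2)] A.pre.zero_closed[OF nz(1)]])
      fix v assume "v \<in> U0"
      from local_form[OF nz(1,2) this] obtain W where W: "zopen W" "v \<in> W" "W \<subseteq> U0" "res ?A U0 W (\<psi> U0 x0) = (\<lambda>_. 0, \<lambda>_. 0)"
        unfolding h0 by auto
      have "res ?A U0 W (\<psi> U0 x0) = res ?A U0 W \<zero>\<^bsub>sec ?A U0\<^esub>"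
        unfolding W(4) A.pre.res_zero[OF nz(1) W(1,3)] by simp
      then show "\<exists>W. zopen W \<and> v \<in> W \<and> W \<subseteq> U0 \<and> res ?A U0 W (\<psi> U0 x0) = res ?A U0 W \<zero>\<^bsub>sec ?A U0\<^esub>"
        using W by blast
    qed
    then show False using nz(3) by blast
  qed
  interpret D: induced_quotient \<phi> r a b h
    unfolding induced_quotient_def divisor_form_def using mult_form_axioms h \<open>h \<noteq> (\<lambda>_. 0)\<close> by blast
  let ?Q' = "A_tensor \<phi> D.O\<^sub>F"
  interpret Q': O_module ?Q' by (rule D.O_module_A_tensor)
  have qo: "o_hom ?A ?Q' D.quo" using D.a_hom_quo unfolding a_hom_on_def by blast
  have ker': "D.quo U y = \<zero>\<^bsub>sec ?Q' U\<^esub> \<longleftrightarrow> in_image M \<psi> ?A U y" if U: "zopen U" and y: "y \<in> secs ?A U" for U y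
  proof
    assume z: "D.quo U y = \<zero>\<^bsub>sec ?Q' U\<^esub>"
    show "in_image M \<psi> ?A U y" unfolding in_image_def
    proof
      fix v assume v: "v \<in> U"
      obtain W n e n' where W: "zopen W" "v \<in> W" "W \<subseteq> U" and n: "n \<in> regular (-a) (-b) W" "e \<in> Lsec W" "n' \<in> regular (-a) (-b) (sig W)"
        and yW: "res ?A U W y = (\<lambda>v. h v * n v, \<lambda>v. e v * (h (prod.swap v) * n' (prod.swap v)))"
        by (rule D.quo_kernel_localD[OF U y z v]) blast
      have "(n, I.pure W e n') \<in> secs ?T W" using n I.pure_closed[OF W(1) n(2)] by simp
      then have "\<eta> W (n, I.pure W e n') \<in> secs M W" by (rule o_hom_closed[OF \<eta>(1) W(1)])
      moreover have "res ?A U W y = \<psi> W (\<eta> W (n, I.pure W e n'))" unfolding yW val[OF W(1) n] ..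
      ultimately show "\<exists>W. zopen W \<and> v \<in> W \<and> W \<subseteq> U \<and> res ?A U W y \<in> \<psi> W ` secs M W" using W by blast
    qed
  next
    assume im: "in_image M \<psi> ?A U y"
    show "D.quo U y = \<zero>\<^bsub>sec ?Q' U\<^esub>"
    proof (rule Q'.eq_locally[OF U o_hom_closed[OF qo U y] Q'.pre.zero_closed[OF U]])
      fix v assume v: "v \<in> U"
      obtain W x where W: "zopen W" "v \<in> W" "W \<subseteq> U" "x \<in> secs M W" "res ?A U W y = \<psi> W x" using in_imageE[OF im v] .
      from local_form[OF W(1,4,2)] obtain V n e n' where V: "zopen V" "v \<in> V" "V \<subseteq> W"
        and n: "n \<in> regular (-a) (-b) V" "e \<in> Lsec V" "n' \<in> regular (-a) (-b) (sig V)"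
        and x: "res ?A W V (\<psi> W x) = (\<lambda>v. h v * n v, \<lambda>v. e v * (h (prod.swap v) * n' (prod.swap v)))"
        by (elim exE conjE)
      have VU: "V \<subseteq> U" using V W by blast
      have "res ?A U V y = res ?A W V (res ?A U W y)" using A.res_res[OF U W(1) V(1,3) W(3) y] by (rule sym)
      then have "res ?Q' U V (D.quo U y) = \<zero>\<^bsub>sec ?Q' V\<^esub>"
        using o_hom_res[OF qo U V(1) VU y] D.quo_kernel_local[OF V(1) n] W(5) x by (simp del: Aalg_simps A_tensor_simps)
      then show "\<exists>W. zopen W \<and> v \<in> W \<and> W \<subseteq> U \<and> res ?Q' U W (D.quo U y) = res ?Q' U W \<zero>\<^bsub>sec ?Q' U\<^esub>"
        using V VU Q'.pre.res_zero[OF U V(1) VU] by metis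
    qed
  qed
  have "Q \<cong>\<^sub>A ?Q'"
  proof (rule quotients_A_iso[OF A_module_Aalg Q D.O_module_A_tensor \<rho> D.a_hom_quo])
    show "in_image ?A \<rho> Q U z" if "zopen U" "z \<in> secs Q U" for U z by (rule surj[OF that])
    show "in_image ?A D.quo ?Q' U z" if "zopen U" "z \<in> secs ?Q' U" for U z by (rule D.quo_surj[OF that])
    show "\<rho> U y = \<zero>\<^bsub>sec Q U\<^esub> \<longleftrightarrow> D.quo U y = \<zero>\<^bsub>sec ?Q' U\<^esub>" if "zopen U" "y \<in> secs ?A U" for U y
      unfolding ker[OF that] ker'[OF that] ..
    fix U :: "'k pt set" and l m assume U: "zopen U" and l: "l \<in> Lsec U" and "m \<in> secs ?Q' (sig U)"
    then obtain s x where m: "m = (s, x)" "s \<in> secs D.O\<^sub>F (sig U)" "x \<in> secs D.I.LN (sig U)" by auto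
    show "lact ?Q' U l m \<in> secs ?Q' U"
      unfolding m(1) using D.I.contract_closed(1)[OF U l m(3)] D.I.pure_closed[OF U l m(2)] by simp
    show "res ?Q' U W (lact ?Q' U l m) = lact ?Q' W (rst W l) (res ?Q' (sig U) (sig W) m)" if W: "zopen W" "W \<subseteq> U" for W
      unfolding m(1) using D.I.contract_res[OF U l m(3) W] D.I.pure_res[OF U W l m(2)] by simp
  qed
  then show ?thesis using D.is_divisor_F by blast
qed

subsection \<open>Modules with underlying sheaf \<open>O(-1, -1) \<oplus> O(-1, -1)\<close>\<close>

text \<open>
  A homomorphism from \<open>O(-1, -1)\<^sup>2\<close> to \<open>A = O \<oplus> O(-1, -1)\<close> is a matrix of two forms \<open>s_i\<close> of
  bidegree \<open>(1, 1)\<close> and two constants \<open>c_i\<close>. If \<open>c_2 \<noteq> 0\<close>, elimination of the second summand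
  leaves \<open>O / s O(-1, -1)\<close> as cokernel, with \<open>s = s_1 - c_1 s_2 / c_2\<close>. The map from \<open>A\<close> to it is
  \<open>f + l \<mapsto> f - s_2 l / c_2\<close>.
\<close>

lemma cokernel_elimination:
  fixes \<psi> :: "'k::{alg_closed_field, field_char_0} pt set \<Rightarrow> 'm \<Rightarrow> 'k fn \<times> 'k fn" and Q :: "('k, 'q, 'z) osheaf_scheme"
    and M :: "('k, 'm, 'y) osheaf_scheme"
  assumes Q: "O_module Q" and \<rho>: "o_hom (Aalg \<phi>) Q \<rho>"
    and surj: "\<And>U z. zopen U \<Longrightarrow> z \<in> secs Q U \<Longrightarrow> in_image (Aalg \<phi>) \<rho> Q U z"
    and ker: "\<And>U y. zopen U \<Longrightarrow> y \<in> secs (Aalg \<phi>) U \<Longrightarrow> \<rho> U y = \<zero>\<^bsub>sec Q U\<^esub> \<longleftrightarrow> in_image M \<psi> (Aalg \<phi>) U y"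
    and s: "s1 \<in> regular 1 1 ycone" "s2 \<in> regular 1 1 ycone" and c2: "c2 \<noteq> 0"
    and \<Theta>: "\<And>U x. zopen U \<Longrightarrow> x \<in> secs M U \<Longrightarrow> \<exists>m\<in>Lsec U. \<exists>n\<in>Lsec U. x = \<Theta> U m n"
    and \<Theta>c: "\<And>U m n. zopen U \<Longrightarrow> m \<in> Lsec U \<Longrightarrow> n \<in> Lsec U \<Longrightarrow> \<Theta> U m n \<in> secs M U"
    and \<psi>: "\<And>U m n. zopen U \<Longrightarrow> m \<in> Lsec U \<Longrightarrow> n \<in> Lsec U \<Longrightarrow>
      \<psi> U (\<Theta> U m n) = (\<lambda>v. s1 v * m v + s2 v * n v, \<lambda>v. c1 * m v + c2 * n v)"
    and inj: "\<And>U m n. zopen U \<Longrightarrow> m \<in> Lsec U \<Longrightarrow> n \<in> Lsec U \<Longrightarrow> \<psi> U (\<Theta> U m n) = (\<lambda>_. 0, \<lambda>_. 0) \<Longrightarrow> m = (\<lambda>_. 0)"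
  shows "\<exists>C. is_divisor 1 1 C \<and> Q \<cong>\<^sub>O structure_sheaf C"
proof -
  let ?A = "Aalg \<phi>"
  define sv where "sv v = s1 v - c1 / c2 * s2 v" for v
  define t where "t v = s2 v / c2" for v
  have t: "t \<in> regular 1 1 ycone" unfolding t_def using regular_cmult[OF s(2) zopen_ycone, of "inverse c2"] by (simp add: field_simps)
  have sv: "sv \<in> regular 1 1 ycone" unfolding sv_def
    by (rule regular_diff[OF s(1) regular_cmult[OF s(2) zopen_ycone] zopen_ycone])
  have "sv \<noteq> (\<lambda>_. 0)"
  proof
    assume z: "sv = (\<lambda>_. 0)"
    have "(vec2 1 0, vec2 1 0 :: 'k^2) \<in> ycone" by (simp add: ycone_def vec2_zero_iff)
    then obtain W and k :: "'k fn" where W: "zopen W" "(vec2 1 0, vec2 1 0) \<in> W" "k \<in> Lsec W" "\<And>w. w \<in> W \<Longrightarrow> k w \<noteq> 0"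
      using local_unit[OF zopen_ycone, of "(vec2 1 0, vec2 1 0)" "-1" "-1"] by metis
    \<comment> \<open>This pair is mapped to \<open>(sv k, 0)\<close>; if \<open>sv\<close> were zero, it would violate injectivity.\<close>
    let ?n = "\<lambda>v. - (c1 / c2) * k v"
    have n: "?n \<in> Lsec W" by (rule regular_cmult[OF W(3,1)])
    have "\<psi> W (\<Theta> W k ?n) = (\<lambda>v. sv v * k v, \<lambda>v. 0)"
      unfolding \<psi>[OF W(1,3) n] sv_def using c2 by (auto simp: algebra_simps)
    then have "k = (\<lambda>_. 0)" using inj[OF W(1,3) n] unfolding z by simp
    then show False using W(2,4) by auto
  qed
  interpret D: divisor_form 1 1 sv using sv \<open>sv \<noteq> (\<lambda>_. 0)\<close> by unfold_locales
  let ?C = "structure_sheaf D.F"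
  have tl: "(\<lambda>v. f v - t v * l v) \<in> regular 0 0 U" if "zopen U" "f \<in> regular 0 0 U" "l \<in> Lsec U" for U f l
  proof -
    have "(\<lambda>v. rst U t v * l v) \<in> regular 0 0 U"
      by (rule regular_mult[OF regular_rst[OF t that(1) zopen_subset[OF that(1)]] that(3)]) auto
    moreover have "(\<lambda>v. rst U t v * l v) = (\<lambda>v. t v * l v)" using regular_outside[OF that(3)] by (auto simp: rst_def fun_eq_iff)
    ultimately show ?thesis using regular_diff[OF that(2) _ that(1)] by simp
  qed
  define \<delta> where "\<delta> U y = (\<lambda>v. fst y v - t v * snd y v)" for U :: "'k pt set" and y :: "'k fn \<times> 'k fn"
  have \<delta>: "o_hom ?A (Osh 0 0) \<delta>"
  proof (rule o_hom_onI)
    fix U y assume U: "zopen U" and "y \<in> secs ?A U"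
    then obtain f l where y: "y = (f, l)" "f \<in> regular 0 0 U" "l \<in> Lsec U" by auto
    show "\<delta> U y \<in> secs (Osh 0 0) U" using tl[OF U y(2,3)] by (simp add: \<delta>_def y(1))
  qed (auto simp: \<delta>_def algebra_simps rst_def)
  let ?\<rho>' = "\<lambda>U y. D.S.proj U (\<delta> U y)"
  have \<rho>': "o_hom ?A ?C ?\<rho>'" by (rule o_hom_comp[OF \<delta> D.o_hom_structure])
  have surj': "in_image ?A ?\<rho>' ?C U z" if U: "zopen U" and z: "z \<in> secs ?C U" for U z
    unfolding in_image_def
  proof
    fix v assume v: "v \<in> U"
    obtain W f where W: "zopen W" "v \<in> W" "W \<subseteq> U" "f \<in> secs (Osh 0 0) W" "res ?C U W z = D.S.proj W f"
      using in_imageE[OF D.structure_surj[OF U z] v] .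
    have "(f, \<lambda>_. 0) \<in> secs ?A W" "\<delta> W (f, \<lambda>_. 0) = f" using W(4) regular_0[OF W(1)] by (auto simp: \<delta>_def)
    then have "res ?C U W z \<in> ?\<rho>' W ` secs ?A W" using W(5) by (metis (no_types, lifting) imageI)
    then show "\<exists>W. zopen W \<and> v \<in> W \<and> W \<subseteq> U \<and> res ?C U W z \<in> ?\<rho>' W ` secs ?A W" using W by blast
  qed
  have ker': "?\<rho>' U y = \<zero>\<^bsub>sec ?C U\<^esub> \<longleftrightarrow> in_image M \<psi> ?A U y" if U: "zopen U" and y: "y \<in> secs ?A U" for U y
  proof -
    obtain f l where fl: "y = (f, l)" "f \<in> regular 0 0 U" "l \<in> Lsec U" using y by auto
    have \<delta>y: "\<delta> U y \<in> regular 0 0 U" using o_hom_closed[OF \<delta> U y] by simp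
    have "\<delta> U y \<in> D.F U \<longleftrightarrow> in_image M \<psi> ?A U y"
    proof
      assume "\<delta> U y \<in> D.F U"
      then obtain g where g: "g \<in> Lsec U" "\<delta> U y = (\<lambda>v. sv v * g v)" unfolding D.mem_F by auto
      \<comment> \<open>The preimage of \<open>(f, l)\<close> is determined by the second row of the matrix.\<close>
      let ?n = "\<lambda>v. inverse c2 * (l v - c1 * g v)"
      have n: "?n \<in> Lsec U"
        by (rule regular_cmult[OF regular_diff[OF fl(3) regular_cmult[OF g(1) U] U] U])
      have f: "f v = t v * l v + sv v * g v" for v using fun_cong[OF g(2), of v] by (simp add: \<delta>_def fl(1) algebra_simps)
      have "\<psi> U (\<Theta> U g ?n) = y" unfolding \<psi>[OF U g(1) n] fl(1)
        using c2 f by (auto simp: fun_eq_iff sv_def t_def field_simps)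
      then have "res ?A U U y = \<psi> U (\<Theta> U g ?n)" using O_module.res_id[OF O_module_Aalg U y] by (rule trans[OF _ sym, rotated])
      then have "res ?A U U y \<in> \<psi> U ` secs M U" by (rule image_eqI[OF _ \<Theta>c[OF U g(1) n]])
      then show "in_image M \<psi> ?A U y" unfolding in_image_def using U by blast
    next
      assume im: "in_image M \<psi> ?A U y"
      show "\<delta> U y \<in> D.F U"
      proof (rule D.F_local[OF U \<delta>y])
        fix v assume v: "v \<in> U"
        obtain W x where W: "zopen W" "v \<in> W" "W \<subseteq> U" "x \<in> secs M W" "res ?A U W y = \<psi> W x" using in_imageE[OF im v] .
        obtain m n where mn: "m \<in> Lsec W" "n \<in> Lsec W" "x = \<Theta> W m n" using \<Theta>[OF W(1,4)] by blast
        have "rst W (\<delta> U y) = \<delta> W (\<psi> W x)" using o_hom_res[OF \<delta> U W(1,3) y] W(5) by simp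
        also have "\<dots> = (\<lambda>v. sv v * m v)" unfolding mn(3) \<psi>[OF W(1) mn(1,2)] \<delta>_def sv_def t_def
          using c2 by (auto simp: field_simps)
        finally have "rst W (\<delta> U y) \<in> D.F W" unfolding D.mem_F using mn(1) by blast
        then show "\<exists>W. zopen W \<and> v \<in> W \<and> W \<subseteq> U \<and> rst W (\<delta> U y) \<in> D.F W" using W by blast
      qed
    qed
    then show ?thesis using D.structure_zero_iff[OF U \<delta>y] by simp
  qed
  obtain G where "o_hom Q ?C G" "bij_on_sections Q ?C G"
    by (rule quotients_iso[OF O_module.presheaf[OF O_module_Aalg] Q D.O_module_structure \<rho> \<rho>' surj surj'])
      (use ker ker' in blast)+
  then have "Q \<cong>\<^sub>O ?C" unfolding o_iso_def by blast
  then show ?thesis using D.is_divisor_F by blast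
qed

text \<open>
  Injectivity implies that the constants \<open>c_1\<close> and \<open>c_2\<close> are not both zero: otherwise
  \<open>(s_2 e, - s_1 e)\<close>, with a local section \<open>e\<close> of \<open>O(-2, -2)\<close>, would be in the kernel.
\<close>

lemma cokernel_of_split:
  fixes M :: "('k::{alg_closed_field, field_char_0}, 'm) amod" and Q :: "('k, 'q) amod"
  assumes M: "O_module M" and \<psi>: "o_hom M (Aalg \<phi>) \<psi>" and inj: "\<And>U. zopen U \<Longrightarrow> inj_on (\<psi> U) (secs M U)"
    and iso: "M \<cong>\<^sub>O osum (Osh (-1) (-1) :: ('k, 'k fn) osheaf) (Osh (-1) (-1) :: ('k, 'k fn) osheaf)"
    and Q: "O_module Q" and \<rho>: "o_hom (Aalg \<phi>) Q \<rho>"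
    and surj: "\<And>U z. zopen U \<Longrightarrow> z \<in> secs Q U \<Longrightarrow> in_image (Aalg \<phi>) \<rho> Q U z"
    and ker: "\<And>U y. zopen U \<Longrightarrow> y \<in> secs (Aalg \<phi>) U \<Longrightarrow> \<rho> U y = \<zero>\<^bsub>sec Q U\<^esub> \<longleftrightarrow> in_image M \<psi> (Aalg \<phi>) U y"
  shows "\<exists>C. is_divisor 1 1 C \<and> Q \<cong>\<^sub>O structure_sheaf C"
proof -
  let ?A = "Aalg \<phi>" and ?S = "osum Lbd Lbd :: ('k, 'k fn \<times> 'k fn) osheaf"
  interpret M: O_module M by (rule M)
  obtain \<theta> where \<theta>: "o_hom M ?S \<theta>" "bij_on_sections M ?S \<theta>" using iso unfolding o_iso_def by blast
  obtain \<eta> where \<eta>: "o_hom ?S M \<eta>" "\<And>U x. zopen U \<Longrightarrow> x \<in> secs M U \<Longrightarrow> \<eta> U (\<theta> U x) = x"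
    "\<And>U y. zopen U \<Longrightarrow> y \<in> secs ?S U \<Longrightarrow> \<theta> U (\<eta> U y) = y"
    by (rule iso_inverse[OF M.presheaf \<theta>]) blast
  have P: "presheaf (Lbd :: ('k, 'k fn) osheaf)" by (rule O_module.presheaf[OF O_module_Osh])
  note h = o_hom_comp[OF \<eta>(1) \<psi>]
  obtain s1 k1 where 1: "s1 \<in> regular (- (- 1)) (- (- 1)) ycone" "k1 \<in> regular (- (- 1) - 1) (- (- 1) - 1) ycone"
    "\<And>U n. zopen U \<Longrightarrow> n \<in> Lsec U \<Longrightarrow> \<psi> U (\<eta> U (n, \<zero>\<^bsub>sec Lbd U\<^esub>)) = (\<lambda>v. s1 v * n v, \<lambda>v. k1 v * n v)"
    by (rule o_hom_Osh_Aalg[OF o_hom_comp[OF o_hom_inl[OF P] h]]) blast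
  obtain s2 k2 where 2: "s2 \<in> regular (- (- 1)) (- (- 1)) ycone" "k2 \<in> regular (- (- 1) - 1) (- (- 1) - 1) ycone"
    "\<And>U n. zopen U \<Longrightarrow> n \<in> Lsec U \<Longrightarrow> \<psi> U (\<eta> U (\<zero>\<^bsub>sec Lbd U\<^esub>, n)) = (\<lambda>v. s2 v * n v, \<lambda>v. k2 v * n v)"
    by (rule o_hom_Osh_Aalg[OF o_hom_comp[OF o_hom_inr[OF P] h]]) blast
  have s: "s1 \<in> regular 1 1 ycone" "s2 \<in> regular 1 1 ycone" using 1(1) 2(1) by auto
  obtain c1 where c1: "\<And>v. v \<in> ycone \<Longrightarrow> k1 v = c1" by (rule global_section_const[of k1]) (use 1(2) in auto)
  obtain c2 where c2: "\<And>v. v \<in> ycone \<Longrightarrow> k2 v = c2" by (rule global_section_const[of k2]) (use 2(2) in auto)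
  have kc: "(\<lambda>v. k v * n v) = (\<lambda>v. c * n v)" if "zopen U" "n \<in> Lsec U" "\<And>v. v \<in> ycone \<Longrightarrow> k v = c" for U n k and c :: 'k
  proof
    fix v show "k v * n v = c * n v"
      using that(3)[of v] regular_outside[OF that(2), of v] zopen_subset[OF that(1)] by (cases "v \<in> U") auto
  qed
  have val: "\<psi> U (\<eta> U (m, n)) = (\<lambda>v. s1 v * m v + s2 v * n v, \<lambda>v. c1 * m v + c2 * n v)"
    if U: "zopen U" and m: "m \<in> Lsec U" and n: "n \<in> Lsec U" for U m n
  proof -
    have x: "(m, \<lambda>_. 0) \<in> secs ?S U" "(\<lambda>_. 0, n) \<in> secs ?S U" using m n regular_0[OF U] by auto
    have "(m, n) = (m, \<lambda>_. 0) \<oplus>\<^bsub>sec ?S U\<^esub> (\<lambda>_. 0, n)" by simp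
    then have "\<psi> U (\<eta> U (m, n)) = \<psi> U (\<eta> U (m, \<lambda>_. 0)) \<oplus>\<^bsub>sec ?A U\<^esub> \<psi> U (\<eta> U (\<lambda>_. 0, n))"
      using o_hom_add[OF h U x] by simp
    then show ?thesis using 1(3)[OF U m] 2(3)[OF U n] kc[OF U m c1] kc[OF U n c2] by simp
  qed
  have inj0: "m = (\<lambda>_. 0) \<and> n = (\<lambda>_. 0)"
    if U: "zopen U" and m: "m \<in> Lsec U" and n: "n \<in> Lsec U" and z: "\<psi> U (\<eta> U (m, n)) = (\<lambda>_. 0, \<lambda>_. 0)" for U m n
  proof -
    have x: "(m, n) \<in> secs ?S U" "(\<lambda>_. 0, \<lambda>_. 0) \<in> secs ?S U" using m n regular_0[OF U] by auto
    have "\<psi> U (\<eta> U (m, n)) = \<psi> U (\<eta> U (\<lambda>_. 0, \<lambda>_. 0))"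
      unfolding z val[OF U regular_0[OF U] regular_0[OF U]] by simp
    then have "\<eta> U (m, n) = \<eta> U (\<lambda>_. 0, \<lambda>_. 0)"
      by (rule inj_onD[OF inj[OF U]]) (rule o_hom_closed[OF \<eta>(1) U x(1)] o_hom_closed[OF \<eta>(1) U x(2)])+
    then have "\<theta> U (\<eta> U (m, n)) = \<theta> U (\<eta> U (\<lambda>_. 0, \<lambda>_. 0))" by (rule arg_cong)
    then show ?thesis using \<eta>(3)[OF U x(1)] \<eta>(3)[OF U x(2)] by simp
  qed
  have rep: "\<exists>m\<in>Lsec U. \<exists>n\<in>Lsec U. x = \<eta> U (m, n)" if U: "zopen U" and x: "x \<in> secs M U" for U x
  proof -
    have "\<theta> U x \<in> secs ?S U" by (rule o_hom_closed[OF \<theta>(1) U x])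
    then obtain m n where "\<theta> U x = (m, n)" "m \<in> Lsec U" "n \<in> Lsec U" by auto
    then show ?thesis using \<eta>(2)[OF U x] by metis
  qed
  have cl: "\<eta> U (m, n) \<in> secs M U" if "zopen U" "m \<in> Lsec U" "n \<in> Lsec U" for U m n
    using o_hom_closed[OF \<eta>(1) that(1), of "(m, n)"] that by simp
  have "c1 \<noteq> 0 \<or> c2 \<noteq> 0"
  proof (rule ccontr)
    assume "\<not> (c1 \<noteq> 0 \<or> c2 \<noteq> 0)"
    then have c0: "c1 = 0" "c2 = 0" by auto
    let ?v = "(vec2 1 0, vec2 1 0) :: 'k pt"
    have v: "?v \<in> ycone" by (simp add: ycone_def vec2_zero_iff)
    obtain V and e :: "'k fn" where V: "zopen V" "?v \<in> V" "V \<subseteq> ycone" "e \<in> regular (-2) (-2) V" "\<And>w. w \<in> V \<Longrightarrow> e w \<noteq> 0"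
      using local_unit[OF zopen_ycone v, of "-2" "-2"] by metis
    obtain W and k :: "'k fn" where W: "zopen W" "?v \<in> W" "W \<subseteq> V" "k \<in> Lsec W" "\<And>w. w \<in> W \<Longrightarrow> k w \<noteq> 0"
      using local_unit[OF V(1,2), of "-1" "-1"] by metis
    have WY: "W \<subseteq> ycone" using W V by blast
    have se: "(\<lambda>v. rst W s v * rst W e v) \<in> Lsec W" if "s \<in> regular 1 1 ycone" for s
      by (rule regular_mult[OF regular_rst[OF that W(1) WY] regular_rst[OF V(4) W(1,3)]]) auto
    let ?m = "\<lambda>v. rst W s2 v * rst W e v" and ?n = "\<lambda>v. - (rst W s1 v * rst W e v)"
    have mn: "?m \<in> Lsec W" "?n \<in> Lsec W" using se[OF s(2)] regular_uminus[OF se[OF s(1)] W(1)] by auto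
    have "\<psi> W (\<eta> W (?m, ?n)) = (\<lambda>_. 0, \<lambda>_. 0)"
      unfolding val[OF W(1) mn] c0 by (auto simp: rst_def)
    then have n0: "?n = (\<lambda>_. 0)" by (rule inj0[OF W(1) mn, THEN conjunct2])
    have "s1 v = 0" if v: "v \<in> W" for v
    proof -
      have "e v \<noteq> 0" using V(5) W(3) v by blast
      then show ?thesis using fun_cong[OF n0, of v] v by (simp add: rst_def)
    qed
    then have "s1 v * k v = 0" for v using regular_outside[OF W(4), of v] by (cases "v \<in> W") auto
    then have "(\<lambda>v. s1 v * k v) = (\<lambda>_. 0)" by (rule ext)
    then have "\<psi> W (\<eta> W (k, \<lambda>_. 0)) = (\<lambda>_. 0, \<lambda>_. 0)" unfolding val[OF W(1,4) regular_0[OF W(1)]] c0 by simp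
    then have "k = (\<lambda>_. 0)" using inj0[OF W(1,4) regular_0[OF W(1)]] by blast
    then show False using W(5)[OF W(2)] by simp
  qed
  then show ?thesis
  proof
    assume c2: "c2 \<noteq> 0"
    show ?thesis
    proof (rule cokernel_elimination[where \<Theta> = "\<lambda>U m n. \<eta> U (m, n)", OF Q \<rho> surj ker s c2])
      show "\<psi> U (\<eta> U (m, n)) = (\<lambda>v. s1 v * m v + s2 v * n v, \<lambda>v. c1 * m v + c2 * n v)"
        if "zopen U" "m \<in> Lsec U" "n \<in> Lsec U" for U m n by (rule val[OF that])
    qed (use rep cl inj0 in blast)+
  next
    assume c1: "c1 \<noteq> 0"
    show ?thesis
    proof (rule cokernel_elimination[where \<Theta> = "\<lambda>U m n. \<eta> U (n, m)", OF Q \<rho> surj ker s(2,1) c1])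
      show "\<psi> U (\<eta> U (n, m)) = (\<lambda>v. s2 v * m v + s1 v * n v, \<lambda>v. c2 * m v + c1 * n v)"
        if "zopen U" "m \<in> Lsec U" "n \<in> Lsec U" for U m n
        unfolding val[OF that(1,3,2)] by (simp add: add.commute)
    qed (use rep cl inj0 in blast)+
  qed
qed

theorem theorem3p15:
  fixes E E' :: "'k::{alg_closed_field, field_char_0}^3 \<Rightarrow> 'k"
    and p :: "'k pt \<Rightarrow> 'k^3"
    and \<phi> :: "'k phi_map"
    and M :: "('k, 'm) amod"
    and \<psi> :: "'k pt set \<Rightarrow> 'm \<Rightarrow> 'k fn \<times> 'k fn"
  assumes "smooth_conic E" and "double_cover p E"
    and "smooth_conic E'" and "meet_in 4 E E'"
    and "phi_iso (zero_divisor 2 2 (E' \<circ> p)) \<phi>"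
    and "A_line_bundle \<phi> M"
    and "has_chern (osheaf.truncate M) (-2, -2) 2"
    and "a_hom M (Aalg \<phi>) \<psi>"
    and "\<exists>U x. zopen U \<and> x \<in> secs M U \<and> \<psi> U x \<noteq> \<zero>\<^bsub>sec (Aalg \<phi>) U\<^esub>"
  shows "\<exists>(Q :: ('k, ('k, ('k fn \<times> 'k fn) set) shf) amod) \<rho>.
    A_module Q \<phi> \<and> a_hom (Aalg \<phi>) Q \<rho> \<and> short_exact M \<psi> (Aalg \<phi>) \<rho> Q \<and>
    (M \<cong>\<^sub>A A_tensor \<phi> (Osh (-1) 0) \<longrightarrow>
       (\<exists>F. is_divisor 1 0 F \<and> Q \<cong>\<^sub>A A_tensor \<phi> (structure_sheaf F))) \<and>
    (M \<cong>\<^sub>A A_tensor \<phi> (Osh 0 (-1)) \<longrightarrow>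
       (\<exists>F. is_divisor 0 1 F \<and> Q \<cong>\<^sub>A A_tensor \<phi> (structure_sheaf F))) \<and>
    (M \<cong>\<^sub>O osum (Osh (-1) (-1) :: ('k, 'k fn) osheaf) (Osh (-1) (-1) :: ('k, 'k fn) osheaf) \<longrightarrow>
       (\<exists>C. is_divisor 1 1 C \<and> Q \<cong>\<^sub>O structure_sheaf C))"
proof -
  let ?h = "E' \<circ> p"
  obtain \<rho>0 a0 where \<rho>0: "\<And>t. E' (p (vec2 t 1, vec2 t 1)) = poly \<rho>0 t" "\<rho>0 \<noteq> 0" "odd (Polynomial.order a0 \<rho>0)"
    by (rule odd_zero_on_diagonal[OF assms(1-4)]) blast
  have hb: "bihom 2 2 ?h" by (rule bihom_conic[OF assms(3) double_coverD(1)[OF assms(2)]])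
  have h0: "\<exists>v\<in>ycone. ?h v \<noteq> 0"
  proof -
    obtain t where "poly \<rho>0 t \<noteq> 0" using \<rho>0(2) poly_all_0_iff_0 by blast
    then show ?thesis using \<rho>0(1)[of t] by (intro bexI[of _ "(vec2 t 1, vec2 t 1)"]) (auto simp: ycone_def vec2_zero_iff)
  qed
  obtain c where c: "c \<noteq> 0" "\<And>U l l'. zopen U \<Longrightarrow> l \<in> Lsec U \<Longrightarrow> l' \<in> Lsec (sig U) \<Longrightarrow>
    \<phi> U (Lsig_pure Lbd U l l') = (\<lambda>v. c * ?h v * l v * l' (prod.swap v))"
    by (rule phi_form[OF assms(5) hb h0]) blast
  interpret division_form \<phi> "\<lambda>v. c * ?h v"
  proof
    show "bihom 2 2 (\<lambda>v. c * ?h v)" by (rule bihom_cmult[OF hb])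
    show "c * ?h (prod.swap v) = c * ?h v" if "v \<in> ycone" for v using double_cover_symmetric[OF assms(2) that] by simp
    show "\<exists>\<rho> a. (\<forall>t. c * ?h (vec2 t 1, vec2 t 1) = poly \<rho> t) \<and> \<rho> \<noteq> 0 \<and> odd (Polynomial.order a \<rho>)"
      using \<rho>0 c(1) by (intro exI[of _ "Polynomial.smult c \<rho>0"] exI[of _ a0]) (simp add: order_smult)
  qed (rule c(2))
  have M: "A_module M \<phi>" using assms(6) unfolding A_line_bundle_def by blast
  then interpret M: A_module M \<phi> .
  obtain U0 x0 where nz: "zopen U0" "x0 \<in> secs M U0" "\<psi> U0 x0 \<noteq> \<zero>\<^bsub>sec (Aalg \<phi>) U0\<^esub>" using assms(9) by blast
  have inj: "inj_on (\<psi> U) (secs M U)" if "zopen U" for U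
    by (rule line_bundle_hom_injective[OF assms(6,8) nz that])
  have \<psi>o: "o_hom M (Aalg \<phi>) \<psi>" using assms(8) unfolding a_hom_on_def by blast
  obtain Q :: "('k, ('k, ('k fn \<times> 'k fn) set) shf) amod" and \<rho>
    where Q: "A_module Q \<phi>" and \<rho>: "a_hom (Aalg \<phi>) Q \<rho>" and surj: "\<And>U z. zopen U \<Longrightarrow> z \<in> secs Q U \<Longrightarrow> in_image (Aalg \<phi>) \<rho> Q U z"
      and ker: "\<And>U y. zopen U \<Longrightarrow> y \<in> secs (Aalg \<phi>) U \<Longrightarrow> \<rho> U y = \<zero>\<^bsub>sec Q U\<^esub> \<longleftrightarrow> in_image M \<psi> (Aalg \<phi>) U y"
    by (rule cokernel[OF M assms(8)]) blast
  interpret Q: A_module Q \<phi> by (rule Q)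
  have \<rho>o: "o_hom (Aalg \<phi>) Q \<rho>" using \<rho> unfolding a_hom_on_def by blast
  have "short_exact M \<psi> (Aalg \<phi>) \<rho> Q"
    unfolding short_exact_def using \<psi>o \<rho>o inj ker surj by blast
  moreover have "\<exists>F. is_divisor 1 0 F \<and> Q \<cong>\<^sub>A A_tensor \<phi> (structure_sheaf F)" if iso: "M \<cong>\<^sub>A A_tensor \<phi> (Osh (-1) 0)"
  proof (rule cokernel_of_induced[where a = 1 and b = 0, OF M assms(8) nz _ _ Q \<rho> surj ker])
    show "g = (\<lambda>_. 0)" if "g \<in> regular (1 - 1) (0 - 1) ycone" for g :: "'k fn"
      by (rule global_section_zero_snd[OF that]) simp
    show "M \<cong>\<^sub>A A_tensor \<phi> (Osh (- 1) (- 0))" using iso by simp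
  qed
  moreover have "\<exists>F. is_divisor 0 1 F \<and> Q \<cong>\<^sub>A A_tensor \<phi> (structure_sheaf F)" if iso: "M \<cong>\<^sub>A A_tensor \<phi> (Osh 0 (-1))"
  proof (rule cokernel_of_induced[where a = 0 and b = 1, OF M assms(8) nz _ _ Q \<rho> surj ker])
    show "g = (\<lambda>_. 0)" if "g \<in> regular (0 - 1) (1 - 1) ycone" for g :: "'k fn"
      by (rule global_section_zero_fst[OF that]) simp
    show "M \<cong>\<^sub>A A_tensor \<phi> (Osh (- 0) (- 1))" using iso by simp
  qed
  moreover have "\<exists>C. is_divisor 1 1 C \<and> Q \<cong>\<^sub>O structure_sheaf C"
    if "M \<cong>\<^sub>O osum (Osh (-1) (-1) :: ('k, 'k fn) osheaf) (Osh (-1) (-1) :: ('k, 'k fn) osheaf)"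
    by (rule cokernel_of_split[OF M.O_module_axioms \<psi>o inj that Q.O_module_axioms \<rho>o surj ker])
  ultimately show ?thesis using Q \<rho> by blast
qed

end
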